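(* Let $T>0$, $\mu_x,\mu_y\in\mathbb{R}$, $0\le\rho_x,\rho_y<1$, $-1\le\rho_{xy}\le 1$ satisfy $$2\rho_x^2(1+2|\rho_{xy}|)\le 1,\qquad 2\rho_y^2(1+2|\rho_{xy}|)\le 1,\qquad 2\rho_x\rho_y(3\rho_{xy}^2+2|\rho_{xy}|+1)\le 1 .$$ Let $h_0,k_0>0$ be such that $T/k_0$ is a positive integer, and let $x_0,y_0\in\mathbb{R}$ be such that $x_0/h_0$ and $y_0/h_0$ are integers. Let $P=P_T$ be the exact functional, and for $l\in\mathbb{N}_0$ let $k_l=k_02^{-2l}$, $N_l=T/k_l$, $P_l=P_l^{N_l}$ (the sparse combination approximation defined in the context), $P_{-1}=0$ and $\delta P_l=P_l-P_{l-1}$, where $P_l$ and $P_{l-1}$ in $\delta P_l$ are computed from the same Brownian path. For $l^\ast\in\mathbb{N}_0$ and positive integers $M_0,\dots,M_{l^\ast}$ define the sparse combination multilevel Monte Carlo estimator $$\widehat P_{l^\ast}=\sum_{l=0}^{l^\ast}\frac1{M_l}\sum_{m=1}^{M_l}\delta\widehat P_l^{(m)},$$ where $\delta\widehat P_l^{(m)}$, $m=1,\dots,M_l$, $l=0,\dots,l^\ast$, are mutually independent and each $\delta\widehat P_l^{(m)}$ is distributed as $\delta P_l$. Then there is a constant $C$ such that for all sufficiently small $\varepsilon>0$ one can choose $l^\ast$ and $M_0,\dots,M_{l^\ast}$ with root-mean-square error $$\sqrt{\mathbb{E}\big[|\widehat P_{l^\ast}-\mathbb{E}[P]|^2\big]}\le\varepsilon$$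 and total computational cost at most $C\varepsilon^{-2}$, i.e. the complexity is $O(\varepsilon^{-2})$.
   Context: Random inputs. $W=(W^x,W^y)$ is a two-dimensional Brownian motion whose components are standard Brownian motions with correlation $\rho_{xy}$. For a time step $k=T/N$ the normalised increments are $Z_{n,x}=k^{-1/2}(W^x_{(n+1)k}-W^x_{nk})$ and $\widetilde Z_{n,y}=k^{-1/2}(W^y_{(n+1)k}-W^y_{nk})$, $n=0,\dots,N-1$. Exact solution and functional. $v$ solves the SPDE $\mathrm{d}v=\big[-\mu_xv_x-\mu_yv_y+\tfrac12(v_{xx}+2\sqrt{\rho_x\rho_y}\rho_{xy}v_{xy}+v_{yy})\big]\mathrm{d}t-\sqrt{\rho_x}v_x\,\mathrm{d}W^x_t-\sqrt{\rho_y}v_y\,\mathrm{d}W^y_t$ with $v(0)=\delta_{x_0}\otimes\delta_{y_0}$; explicitly $$v(T,x,y)=\frac{1}{2\pi\sqrt{(1-\rho_x)(1-\rho_y)}\,T}\exp\Big(-\frac{(x-x_0-\mu_xT-\sqrt{\rho_x}W^x_T)^2}{2(1-\rho_x)T}-\frac{(y-y_0-\mu_yT-\sqrt{\rho_y}W^y_T)^2}{2(1-\rho_y)T}\Big),$$ and $P=P_T=\int_0^\infty\int_0^\infty v(T,x,y)\,\mathrm{d}x\,\mathrm{d}y$. Scheme (semi-implicit Milstein finite differences). Given mesh sizes $h_x,h_y>0$ with $i_0=x_0/h_x$, $j_0=y_0/h_y$ integers, $V^n=(V^n_{i,j})_{i,j\in\mathbb{Z}}$, $n=0,\dots,N$,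 is the sequence of elements of $\ell^2(\mathbb{Z}^2)$ given by $V^0_{i,j}=h_x^{-1}h_y^{-1}$ if $(i,j)=(i_0,j_0)$, $V^0_{i,j}=0$ otherwise, and $$\Big(I+\tfrac{\mu_xk}{2h_x}D_x+\tfrac{\mu_yk}{2h_y}D_y-\tfrac{k}{2h_x^2}D_{xx}-\tfrac{k}{2h_y^2}D_{yy}\Big)V^{n+1}=\Big(I-\tfrac{\sqrt{\rho_xk}Z_{n,x}}{2h_x}D_x-\tfrac{\sqrt{\rho_yk}\widetilde Z_{n,y}}{2h_y}D_y+\tfrac{\rho_xk(Z_{n,x}^2-1)}{8h_x^2}D_x^2+\tfrac{\rho_yk(\widetilde Z_{n,y}^2-1)}{8h_y^2}D_y^2+\tfrac{\sqrt{\rho_x\rho_y}kZ_{n,x}\widetilde Z_{n,y}}{4h_xh_y}D_{xy}\Big)V^n,$$ where $(D_xV)_{i,j}=V_{i+1,j}-V_{i-1,j}$, $(D_yV)_{i,j}=V_{i,j+1}-V_{i,j-1}$, $(D_{xx}V)_{i,j}=V_{i+1,j}-2V_{i,j}+V_{i-1,j}$, $(D_{yy}V)_{i,j}=V_{i,j+1}-2V_{i,j}+V_{i,j-1}$, $(D_{xy}V)_{i,j}=V_{i+1,j+1}-V_{i-1,j+1}-V_{i+1,j-1}+V_{i-1,j-1}$, and $D_x^2=D_x\circ D_x$, $D_y^2=D_y\circ D_y$. Discrete functional and sparse combination. For $(l_1,l_2)\in\mathbb{N}_0^2$, with $V^N$ computed with mesh sizes $h_x=h_02^{-l_1}$, $h_y=h_02^{-l_2}$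 and time step $k=T/N$, $$P^N_{(l_1,l_2)}=h_xh_y\Big(\sum_{i=1}^\infty\sum_{j=1}^\infty V^N_{i,j}+\tfrac12\sum_{j=1}^\infty V^N_{0,j}+\tfrac12\sum_{i=1}^\infty V^N_{i,0}+\tfrac14V^N_{0,0}\Big).$$ For $\bm{l}=(l_1,l_2)$ and $i=1,2$: $\Delta_iP^N_{\bm{l}}=P^N_{\bm{l}}-P^N_{\bm{l}-\bm{e}_i}$ if $l_i>0$ and $\Delta_iP^N_{\bm{l}}=P^N_{\bm{l}}$ if $l_i=0$, where $\bm{e}_1=(1,0)$, $\bm{e}_2=(0,1)$; and $\Delta=\Delta_1\Delta_2$. The sparse combination approximation is $P^N_l=\sum_{(l_1,l_2)\in\mathbb{N}_0^2,\ l_1+l_2\le l+1}\Delta P^N_{(l_1,l_2)}$, with the same time step and Brownian path in all terms. Cost model. Computing one sample of $P^N_{(l_1,l_2)}$ costs (up to a fixed constant factor) $2^{l_1+l_2}N$ operations, i.e. is proportional to the number of mesh points times the number of time steps; the cost of one sample of $P^N_l$ is then $\sum_{l_1+l_2\le l+1}2^{l_1+l_2}N$ up to a constant factor, the cost of one sample of $\delta P_l$ is the sum of the costs of $P_l$ and $P_{l-1}$, and the total cost of the estimator is $\sum_{l=0}^{l^\ast}M_l\,\mathrm{Cost}[\delta P_l]$. *)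

theory Defs
  imports "HOL-Probability.Probability"
begin

section \<open>Correlated Brownian motion\<close>

definition centred_normal :: "real \<Rightarrow> real measure" where
  "centred_normal \<sigma> =
     (if \<sigma> = 0 then return borel 0 else density lborel (\<lambda>x. ennreal (normal_density 0 \<sigma> x)))"

text \<open>
  Joint normality of an increment is expressed through the laws of all its linear combinations,
  so that the degenerate correlations \<open>\<rho> = 1\<close> and \<open>\<rho> = -1\<close> are covered. The choices
  \<open>(a, b) = (1, 0)\<close> and \<open>(a, b) = (0, 1)\<close> say that both components are standard Brownian motions.
\<close>

locale correlated_brownian_motion = prob_space M for M :: "'a measure" +
  fixes \<rho> :: real and W :: "real \<Rightarrow> 'a \<Rightarrow> real \<times> real"
  assumes measurable_W: "\<And>t. 0 \<le> t \<Longrightarrow> W t \<in> borel_measurable M"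
    and start: "AE \<omega> in M. W 0 \<omega> = (0, 0)"
    and continuous_paths: "AE \<omega> in M. continuous_on {0..} (\<lambda>t. W t \<omega>)"
    and independent_increments:
      "\<And>(t :: nat \<Rightarrow> real) n. 0 \<le> t 0 \<Longrightarrow> (\<And>i. i < n \<Longrightarrow> t i < t (Suc i)) \<Longrightarrow>
         indep_vars (\<lambda>_. borel) (\<lambda>i \<omega>. W (t (Suc i)) \<omega> - W (t i) \<omega>) {..<n}"
    and gaussian_increments:
      "\<And>s t a b. 0 \<le> s \<Longrightarrow> s < t \<Longrightarrow>
         distr M borel (\<lambda>\<omega>. a * fst (W t \<omega> - W s \<omega>) + b * snd (W t \<omega> - W s \<omega>))
           = centred_normal (sqrt ((t - s) * (a\<^sup>2 + 2 * \<rho> * a * b + b\<^sup>2)))"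

text \<open>Below, \<open>w\<close> denotes a single two-dimensional path.\<close>

type_synonym path = "real \<Rightarrow> real \<times> real"

definition increment_x :: "real \<Rightarrow> path \<Rightarrow> nat \<Rightarrow> real" where
  "increment_x k w n = (fst (w (real (n + 1) * k)) - fst (w (real n * k))) / sqrt k"

definition increment_y :: "real \<Rightarrow> path \<Rightarrow> nat \<Rightarrow> real" where
  "increment_y k w n = (snd (w (real (n + 1) * k)) - snd (w (real n * k))) / sqrt k"


section \<open>Exact solution and functional\<close>

definition exact_solution ::
  "real \<Rightarrow> real \<Rightarrow> real \<Rightarrow> real \<Rightarrow> real \<Rightarrow> real \<Rightarrow> path \<Rightarrow> real \<Rightarrow> real \<Rightarrow> real \<Rightarrow> real" where
  "exact_solution \<mu>x \<mu>y \<rho>x \<rho>y x0 y0 w T x y =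
     1 / (2 * pi * sqrt ((1 - \<rho>x) * (1 - \<rho>y)) * T) *
     exp (- (x - x0 - \<mu>x * T - sqrt \<rho>x * fst (w T))\<^sup>2 / (2 * (1 - \<rho>x) * T)
          - (y - y0 - \<mu>y * T - sqrt \<rho>y * snd (w T))\<^sup>2 / (2 * (1 - \<rho>y) * T))"

definition exact_functional ::
  "real \<Rightarrow> real \<Rightarrow> real \<Rightarrow> real \<Rightarrow> real \<Rightarrow> real \<Rightarrow> real \<Rightarrow> path \<Rightarrow> real" where
  "exact_functional T \<mu>x \<mu>y \<rho>x \<rho>y x0 y0 w =
     (LINT x:{0..}|lborel. LINT y:{0..}|lborel. exact_solution \<mu>x \<mu>y \<rho>x \<rho>y x0 y0 w T x y)"


section \<open>Semi-implicit Milstein finite difference scheme\<close>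

type_synonym grid = "int \<times> int \<Rightarrow> real"

definition square_summable :: "grid \<Rightarrow> bool" where
  "square_summable V \<longleftrightarrow> (\<lambda>p. (V p)\<^sup>2) summable_on UNIV"

definition Dx :: "grid \<Rightarrow> grid" where
  "Dx V = (\<lambda>(i, j). V (i + 1, j) - V (i - 1, j))"

definition Dy :: "grid \<Rightarrow> grid" where
  "Dy V = (\<lambda>(i, j). V (i, j + 1) - V (i, j - 1))"

definition Dxx :: "grid \<Rightarrow> grid" where
  "Dxx V = (\<lambda>(i, j). V (i + 1, j) - 2 * V (i, j) + V (i - 1, j))"

definition Dyy :: "grid \<Rightarrow> grid" where
  "Dyy V = (\<lambda>(i, j). V (i, j + 1) - 2 * V (i, j) + V (i, j - 1))"

definition Dxy :: "grid \<Rightarrow> grid" where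
  "Dxy V = (\<lambda>(i, j). V (i + 1, j + 1) - V (i - 1, j + 1) - V (i + 1, j - 1) + V (i - 1, j - 1))"

definition implicit_op :: "real \<Rightarrow> real \<Rightarrow> real \<Rightarrow> real \<Rightarrow> real \<Rightarrow> grid \<Rightarrow> grid" where
  "implicit_op \<mu>x \<mu>y hx hy k U = (\<lambda>p. U p
     + \<mu>x * k / (2 * hx) * Dx U p + \<mu>y * k / (2 * hy) * Dy U p
     - k / (2 * hx\<^sup>2) * Dxx U p - k / (2 * hy\<^sup>2) * Dyy U p)"

definition explicit_op ::
  "real \<Rightarrow> real \<Rightarrow> real \<Rightarrow> real \<Rightarrow> real \<Rightarrow> real \<Rightarrow> real \<Rightarrow> grid \<Rightarrow> grid" where
  "explicit_op \<rho>x \<rho>y hx hy k zx zy V = (\<lambda>p. V p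
     - sqrt (\<rho>x * k) * zx / (2 * hx) * Dx V p
     - sqrt (\<rho>y * k) * zy / (2 * hy) * Dy V p
     + \<rho>x * k * (zx\<^sup>2 - 1) / (8 * hx\<^sup>2) * Dx (Dx V) p
     + \<rho>y * k * (zy\<^sup>2 - 1) / (8 * hy\<^sup>2) * Dy (Dy V) p
     + sqrt (\<rho>x * \<rho>y) * k * zx * zy / (4 * hx * hy) * Dxy V p)"

text \<open>
  The description operator is well defined: the Fourier symbol of the implicit operator has real
  part at least 1, so each step has exactly one square-summable solution.
\<close>

primrec milstein_scheme ::
  "real \<Rightarrow> real \<Rightarrow> real \<Rightarrow> real \<Rightarrow> real \<Rightarrow> real \<Rightarrow> real \<Rightarrow> real \<Rightarrow> real \<Rightarrow> path \<Rightarrow> nat \<Rightarrow> grid" where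
  "milstein_scheme \<mu>x \<mu>y \<rho>x \<rho>y x0 y0 hx hy k w 0 =
     (\<lambda>(i, j). if of_int i = x0 / hx \<and> of_int j = y0 / hy then 1 / (hx * hy) else 0)"
| "milstein_scheme \<mu>x \<mu>y \<rho>x \<rho>y x0 y0 hx hy k w (Suc n) =
     (THE U. square_summable U \<and>
        implicit_op \<mu>x \<mu>y hx hy k U =
        explicit_op \<rho>x \<rho>y hx hy k (increment_x k w n) (increment_y k w n)
          (milstein_scheme \<mu>x \<mu>y \<rho>x \<rho>y x0 y0 hx hy k w n))"


section \<open>Discrete functional and sparse combination\<close>

definition trapezoidal_sum :: "real \<Rightarrow> real \<Rightarrow> grid \<Rightarrow> real" where
  "trapezoidal_sum hx hy V = hx * hy *
     ((\<Sum>\<^sub>\<infinity>i\<in>{1..}. \<Sum>\<^sub>\<infinity>j\<in>{1..}. V (i, j))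
      + 1 / 2 * (\<Sum>\<^sub>\<infinity>j\<in>{1..}. V (0, j))
      + 1 / 2 * (\<Sum>\<^sub>\<infinity>i\<in>{1..}. V (i, 0))
      + 1 / 4 * V (0, 0))"

definition grid_functional ::
  "real \<Rightarrow> real \<Rightarrow> real \<Rightarrow> real \<Rightarrow> real \<Rightarrow> real \<Rightarrow> real \<Rightarrow> real \<Rightarrow> path \<Rightarrow> nat \<Rightarrow> nat \<Rightarrow> nat \<Rightarrow> real" where
  "grid_functional T \<mu>x \<mu>y \<rho>x \<rho>y x0 y0 h0 w N l1 l2 =
     (let hx = h0 / 2 ^ l1; hy = h0 / 2 ^ l2; k = T / real N
      in trapezoidal_sum hx hy (milstein_scheme \<mu>x \<mu>y \<rho>x \<rho>y x0 y0 hx hy k w N))"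

definition delta1 :: "(nat \<Rightarrow> nat \<Rightarrow> real) \<Rightarrow> nat \<Rightarrow> nat \<Rightarrow> real" where
  "delta1 F l1 l2 = (if l1 > 0 then F l1 l2 - F (l1 - 1) l2 else F l1 l2)"

definition delta2 :: "(nat \<Rightarrow> nat \<Rightarrow> real) \<Rightarrow> nat \<Rightarrow> nat \<Rightarrow> real" where
  "delta2 F l1 l2 = (if l2 > 0 then F l1 l2 - F l1 (l2 - 1) else F l1 l2)"

definition sparse_indices :: "nat \<Rightarrow> (nat \<times> nat) set" where
  "sparse_indices l = {(l1, l2). l1 + l2 \<le> l + 1}"

definition sparse_functional ::
  "real \<Rightarrow> real \<Rightarrow> real \<Rightarrow> real \<Rightarrow> real \<Rightarrow> real \<Rightarrow> real \<Rightarrow> real \<Rightarrow> path \<Rightarrow> nat \<Rightarrow> nat \<Rightarrow> real" where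
  "sparse_functional T \<mu>x \<mu>y \<rho>x \<rho>y x0 y0 h0 w N l =
     (\<Sum>(l1, l2)\<in>sparse_indices l.
        delta1 (delta2 (grid_functional T \<mu>x \<mu>y \<rho>x \<rho>y x0 y0 h0 w N)) l1 l2)"


section \<open>Multilevel Monte Carlo estimator and its cost\<close>

text \<open>The floor is exact whenever \<open>T / k0\<close> is a natural number.\<close>

definition num_steps :: "real \<Rightarrow> real \<Rightarrow> nat \<Rightarrow> nat" where
  "num_steps T k0 l = nat \<lfloor>T / (k0 / 2 ^ (2 * l))\<rfloor>"

definition level_functional ::
  "real \<Rightarrow> real \<Rightarrow> real \<Rightarrow> real \<Rightarrow> real \<Rightarrow> real \<Rightarrow> real \<Rightarrow> real \<Rightarrow> real \<Rightarrow> nat \<Rightarrow> path \<Rightarrow> real" where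
  "level_functional T \<mu>x \<mu>y \<rho>x \<rho>y x0 y0 h0 k0 l w =
     sparse_functional T \<mu>x \<mu>y \<rho>x \<rho>y x0 y0 h0 w (num_steps T k0 l) l"

definition level_difference ::
  "real \<Rightarrow> real \<Rightarrow> real \<Rightarrow> real \<Rightarrow> real \<Rightarrow> real \<Rightarrow> real \<Rightarrow> real \<Rightarrow> real \<Rightarrow> nat \<Rightarrow> path \<Rightarrow> real" where
  "level_difference T \<mu>x \<mu>y \<rho>x \<rho>y x0 y0 h0 k0 l w =
     level_functional T \<mu>x \<mu>y \<rho>x \<rho>y x0 y0 h0 k0 l w
     - (if l = 0 then 0 else level_functional T \<mu>x \<mu>y \<rho>x \<rho>y x0 y0 h0 k0 (l - 1) w)"

definition sample_indices :: "nat \<Rightarrow> (nat \<Rightarrow> nat) \<Rightarrow> (nat \<times> nat) set" where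
  "sample_indices L Ms = {(l, m). l \<le> L \<and> 1 \<le> m \<and> m \<le> Ms l}"

definition mlmc_estimator ::
  "nat \<Rightarrow> (nat \<Rightarrow> nat) \<Rightarrow> (nat \<Rightarrow> nat \<Rightarrow> 'b \<Rightarrow> real) \<Rightarrow> 'b \<Rightarrow> real" where
  "mlmc_estimator L Ms X \<omega> = (\<Sum>l\<le>L. 1 / real (Ms l) * (\<Sum>m = 1..Ms l. X l m \<omega>))"

text \<open>\<open>\<kappa>\<close> is the cost of one mesh point and time step.\<close>

definition sparse_cost :: "real \<Rightarrow> nat \<Rightarrow> nat \<Rightarrow> real" where
  "sparse_cost \<kappa> N l = (\<Sum>(l1, l2)\<in>sparse_indices l. \<kappa> * 2 ^ (l1 + l2) * real N)"

definition level_cost :: "real \<Rightarrow> real \<Rightarrow> real \<Rightarrow> nat \<Rightarrow> real" where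
  "level_cost \<kappa> T k0 l = sparse_cost \<kappa> (num_steps T k0 l) l
     + (if l = 0 then 0 else sparse_cost \<kappa> (num_steps T k0 (l - 1)) (l - 1))"

definition total_cost :: "real \<Rightarrow> real \<Rightarrow> real \<Rightarrow> nat \<Rightarrow> (nat \<Rightarrow> nat) \<Rightarrow> real" where
  "total_cost \<kappa> T k0 L Ms = (\<Sum>l\<le>L. real (Ms l) * level_cost \<kappa> T k0 l)"

end

theory Submission
  imports Defs "HOL-Complex_Analysis.Complex_Analysis"
begin

text \<open>
  In Fourier variables with a fixed small positive imaginary part the scheme is diagonal, and the
  discrete functional is the integral over the mesh band of
  \<open>gsym \<xi> hx * gsym \<eta> hy * exp (- \<i> (\<xi> x0 + \<eta> y0))\<close> times the product of the amplification factors of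
  all time steps; shifting the contour off the real axis removes the poles of the symbol of the
  quadrant. The conditions on the correlations give the bound
  \<open>exp (- c k (x^2 + y^2) + k)\<close> for the second moment of each factor, not only on the mesh band but also
  for complex mesh sizes \<open>z\<close> as long as \<open>\<xi> z\<close> is small. The integrand is even and holomorphic in each
  mesh size, so Cauchy's formula bounds its mixed differences in mean square by \<open>hx^2 hy^2\<close>. On the
  diagonal the scheme is compared with the exact propagator: the leading local error is odd in the
  Gaussian increments, so it has mean zero and the global error is of order \<open>k\<close>. Writing the sparse
  combination as the finest diagonal value minus the mixed differences outside the sparse index set
  shows that level \<open>l\<close> has mean square error of order \<open>l^4 16^(-l)\<close>, while a sample costs
  \<open>l^2 8^l\<close> at most, and the multilevel sum converges.
\<close>

text \<open>Stability is decided by the quadratic terms. At real frequencies the second moment of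
  the numerator of one step is \<open>1 + s + (3 * w^2 - 2 * s * w + s^2) / 4\<close>, where
  \<open>w\<close> is the variance of the noise exponent and \<open>s\<close> the same without
  correlation, while the squared denominator is at least
  \<open>(1 + y / 2)^2 = 1 + y + y^2 / 4\<close>. The three conditions bound the quadratic part of
  the numerator by \<open>y^2\<close>; the strict gain comes from the linear terms, since
  \<open>s\<close> is at most \<open>max \<rho>x \<rho>y * y\<close>. This gap leaves room for a
  relative perturbation \<epsilon> of the symbols, which is spent twice: on the imaginary shift
  \<alpha> of the contour and on the complex mesh sizes. Complex mesh sizes are used because the
  integrand is a product of a growing number of random factors: Cauchy's formula needs only its
  mean-square bound on a circle, not derivatives of the product. Since \<open>k\<close> and the
  square of the finest mesh size stay proportional, \<open>sqrt k\<close> times a frequency of the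
  mesh band is bounded by one \<open>K\<close> on all levels, which makes the constants uniform in
  the level.\<close>

abbreviation (input) plane :: "(real \<times> real) measure" where
  "plane \<equiv> lborel \<Otimes>\<^sub>M lborel"

section \<open>Gaussian moments\<close>

lemma sets_centred_normal [simp, measurable_cong]: "sets (centred_normal \<sigma>) = sets borel"
  by (simp add: centred_normal_def)

text \<open>The point mass \<sigma> = 0 is a separate case: linear combinations of the two
  increments degenerate when the correlation is 1 or -1, and the moment formulas must still hold
  then.\<close>

lemma has_bochner_integral_centred_normal:
  assumes [measurable]: "f \<in> borel_measurable borel"
    and "\<sigma> > 0 \<Longrightarrow> has_bochner_integral lborel (\<lambda>x. normal_density 0 \<sigma> x * f x) (v :: real)"
    and "\<sigma> = 0 \<Longrightarrow> f 0 = v" and "\<sigma> \<ge> 0"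
  shows "has_bochner_integral (centred_normal \<sigma>) f v"
proof (cases "\<sigma> = 0")
  case True
  interpret prob_space "return borel (0::real)"
    by (rule prob_space_return) simp
  have "integrable (return borel (0::real)) f"
    by (rule integrable_cong_AE[THEN iffD2, OF _ _ _ integrable_const[of "f 0"]])
      (auto simp: AE_return)
  moreover have "integral\<^sup>L (return borel (0::real)) f = f 0"
    by (rule integral_return) auto
  ultimately show ?thesis
    using True assms(3) by (simp add: centred_normal_def has_bochner_integral_iff)
next
  case False
  then have "\<sigma> > 0" using assms(4) by simp
  from assms(2)[OF this] False show ?thesis
    by (simp add: centred_normal_def has_bochner_integral_iff integrable_density integral_density)
qed

lemma centred_normal_moments:
  assumes "\<sigma> \<ge> 0"
  shows "has_bochner_integral (centred_normal \<sigma>) (\<lambda>x. x) 0"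
    and "has_bochner_integral (centred_normal \<sigma>) (\<lambda>x. x ^ 2) (\<sigma>^2)"
    and "has_bochner_integral (centred_normal \<sigma>) (\<lambda>x. x ^ 3) 0"
    and "has_bochner_integral (centred_normal \<sigma>) (\<lambda>x. x ^ 4) (3 * \<sigma> ^ 4)"
proof -
  show "has_bochner_integral (centred_normal \<sigma>) (\<lambda>x. x) 0"
    using assms normal_moment_odd[of \<sigma> 0 0]
    by (intro has_bochner_integral_centred_normal) auto
  show "has_bochner_integral (centred_normal \<sigma>) (\<lambda>x. x ^ 2) (\<sigma>^2)"
    using assms normal_moment_even[of \<sigma> 0 1]
    by (intro has_bochner_integral_centred_normal) (auto simp: field_simps eval_nat_numeral)
  show "has_bochner_integral (centred_normal \<sigma>) (\<lambda>x. x ^ 3) 0"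
    using assms normal_moment_odd[of \<sigma> 0 1]
    by (intro has_bochner_integral_centred_normal) (auto simp: eval_nat_numeral)
  have "(24::real) / (8 / (\<sigma>^2)^2) = 3 * \<sigma> ^ 4"
    by (simp add: field_simps flip: power_mult)
  then show "has_bochner_integral (centred_normal \<sigma>) (\<lambda>x. x ^ 4) (3 * \<sigma> ^ 4)"
    using assms normal_moment_even[of \<sigma> 0 2]
    by (intro has_bochner_integral_centred_normal)
      (auto simp: power_divide fact_numeral)
qed

lemma centred_normal_exp:
  assumes "\<sigma> \<ge> 0"
  shows "has_bochner_integral (centred_normal \<sigma>) (\<lambda>x. exp (c * x)) (exp (c^2 * \<sigma>^2 / 2))"
proof (rule has_bochner_integral_centred_normal)
  assume s: "\<sigma> > 0"
  \<comment> \<open>Completing the square: the exponential weight moves the mean to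
    \<open>c * \<sigma>^2\<close>.\<close>
  have eq: "normal_density 0 \<sigma> x * exp (c * x)
      = exp (c^2 * \<sigma>^2 / 2) * normal_density (c * \<sigma>^2) \<sigma> x" for x
  proof -
    have "- (x - 0)\<^sup>2 / (2 * \<sigma>^2) + c * x = c^2 * \<sigma>^2 / 2 + - (x - c * \<sigma>^2)\<^sup>2 / (2 * \<sigma>^2)"
      using s by (simp add: field_simps power2_eq_square)
    then show ?thesis
      by (simp add: normal_density_def exp_add[symmetric] del: exp_add) 
  qed
  have "has_bochner_integral lborel (normal_density (c * \<sigma>^2) \<sigma>) 1"
    using s by (simp add: has_bochner_integral_iff)
  then show "has_bochner_integral lborel (\<lambda>x. normal_density 0 \<sigma> x * exp (c * x)) (exp (c^2 * \<sigma>^2 / 2))"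
    unfolding eq using has_bochner_integral_mult_right[of "exp (c^2 * \<sigma>^2 / 2)" lborel _ 1] by auto
qed (use assms in auto)

text \<open>The normalised increments of one time step. Only the laws of linear combinations are
  recorded, so joint moments have to be derived by polarisation or estimated through single
  combinations.\<close>

locale gauss_pair = prob_space M for M :: "'a measure" +
  fixes \<rho> :: real and U V :: "'a \<Rightarrow> real"
  assumes measurable_U [measurable]: "U \<in> borel_measurable M"
    and measurable_V [measurable]: "V \<in> borel_measurable M"
    and distr_lin: "\<And>a b. distr M borel (\<lambda>w. a * U w + b * V w)
        = centred_normal (sqrt (a^2 + 2 * \<rho> * a * b + b^2))"
    and abs_rho: "\<bar>\<rho>\<bar> \<le> 1"
begin

lemma lin_var_nonneg: "a^2 + 2 * \<rho> * a * b + b^2 \<ge> (0::real)"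
proof -
  have "\<bar>2 * \<rho> * a * b\<bar> \<le> 1 * (2 * \<bar>a\<bar> * \<bar>b\<bar>)"
    using mult_right_mono[OF abs_rho, of "2 * \<bar>a\<bar> * \<bar>b\<bar>"] by (simp add: abs_mult mult_ac)
  also have "... \<le> a^2 + b^2"
    using sum_squares_bound[of "\<bar>a\<bar>" "\<bar>b\<bar>"] by simp
  finally show ?thesis by linarith
qed

lemma has_bochner_integral_lin:
  assumes "has_bochner_integral (centred_normal (sqrt (a^2 + 2 * \<rho> * a * b + b^2))) f (v :: real)"
  shows "has_bochner_integral M (\<lambda>w. f (a * U w + b * V w)) v"
proof -
  have [measurable]: "f \<in> borel_measurable borel"
    using borel_measurable_has_bochner_integral[OF assms] by simp
  from assms show ?thesis
    unfolding distr_lin[symmetric]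
    by (simp add: has_bochner_integral_iff integrable_distr_eq integral_distr)
qed

lemma lin_moments:
  shows "has_bochner_integral M (\<lambda>w. a * U w + b * V w) 0"
    and "has_bochner_integral M (\<lambda>w. (a * U w + b * V w) ^ 2) (a^2 + 2 * \<rho> * a * b + b^2)"
    and "has_bochner_integral M (\<lambda>w. (a * U w + b * V w) ^ 3) 0"
    and "has_bochner_integral M (\<lambda>w. (a * U w + b * V w) ^ 4) (3 * (a^2 + 2 * \<rho> * a * b + b^2)^2)"
    and "has_bochner_integral M (\<lambda>w. exp (c * (a * U w + b * V w))) (exp (c^2 * (a^2 + 2 * \<rho> * a * b + b^2) / 2))"
proof -
  let ?s = "sqrt (a^2 + 2 * \<rho> * a * b + b^2)"
  have s: "?s \<ge> 0" "?s^2 = a^2 + 2 * \<rho> * a * b + b^2" using lin_var_nonneg by auto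
  have s4: "?s ^ 4 = (?s^2)^2" by (simp flip: power_mult)
  note * = has_bochner_integral_lin[OF centred_normal_moments(1)[OF s(1)]]
    has_bochner_integral_lin[OF centred_normal_moments(2)[OF s(1)]]
    has_bochner_integral_lin[OF centred_normal_moments(3)[OF s(1)]]
    has_bochner_integral_lin[OF centred_normal_moments(4)[OF s(1)]]
    has_bochner_integral_lin[OF centred_normal_exp[OF s(1), of c]]
  show "has_bochner_integral M (\<lambda>w. a * U w + b * V w) 0" by (rule *)
  show "has_bochner_integral M (\<lambda>w. (a * U w + b * V w) ^ 2) (a^2 + 2 * \<rho> * a * b + b^2)"
    using *(2) s(2) by simp
  show "has_bochner_integral M (\<lambda>w. (a * U w + b * V w) ^ 3) 0" by (rule *)
  show "has_bochner_integral M (\<lambda>w. (a * U w + b * V w) ^ 4) (3 * (a^2 + 2 * \<rho> * a * b + b^2)^2)"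
    using *(4) s(2) s4 by simp
  show "has_bochner_integral M (\<lambda>w. exp (c * (a * U w + b * V w))) (exp (c^2 * (a^2 + 2 * \<rho> * a * b + b^2) / 2))"
    using *(5) s(2) by simp
qed

text \<open>Size of the noise of one step. Pointwise error estimates are reduced to a multiple of
  \<open>exp (c * G w)\<close>, whose mean is finite for each \<open>c\<close>.\<close>

definition "G w = \<bar>U w\<bar> + \<bar>V w\<bar>"

lemma measurable_G [measurable]: "G \<in> borel_measurable M"
  unfolding G_def by measurable

lemma G_nonneg [simp]: "0 \<le> G w" by (simp add: G_def)

text \<open>The product \<open>exp (c * \<bar>U\<bar>) * exp (c * \<bar>V\<bar>)\<close> is at most
  the sum of the squares of its factors; that removes the joint law and leaves four one-dimensional
  exponential moments with rate \<open>2 * c\<close>.\<close>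

lemma exp_G:
  assumes "c \<ge> 0"
  shows "integrable M (\<lambda>w. exp (c * G w))" and "(\<integral>w. exp (c * G w) \<partial>M) \<le> 4 * exp (2 * c^2)"
proof -
  let ?h = "\<lambda>w. exp (2 * c * U w) + exp (-(2 * c) * U w) + exp (2 * c * V w) + exp (-(2 * c) * V w)"
  have *: "has_bochner_integral M ?h (exp (2 * c^2) + exp (2 * c^2) + exp (2 * c^2) + exp (2 * c^2))"
    using lin_moments(5)[of "2 * c" 1 0] lin_moments(5)[of "- (2 * c)" 1 0]
      lin_moments(5)[of "2 * c" 0 1] lin_moments(5)[of "- (2 * c)" 0 1]
    by (intro has_bochner_integral_add) (auto simp: power2_eq_square)
  have bnd: "exp (c * G w) \<le> ?h w" for w
  proof -
    have e1: "exp (2 * c * \<bar>x\<bar>) \<le> exp (2 * c * x) + exp (-(2 * c) * x)" for x :: real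
      by (cases "x \<ge> 0") (auto simp: abs_if add_increasing add_increasing2)
    have "exp (c * G w) = exp (c * \<bar>U w\<bar>) * exp (c * \<bar>V w\<bar>)"
      by (simp add: G_def exp_add[symmetric] distrib_left)
    also have "... \<le> (exp (c * \<bar>U w\<bar>))^2 + (exp (c * \<bar>V w\<bar>))^2"
    proof -
      have "a * b \<le> a^2 + b^2" if "0 \<le> a" "0 \<le> b" for a b :: real
        using sum_squares_bound[of a b] mult_nonneg_nonneg[OF that] by linarith
      then show ?thesis by simp
    qed
    also have "... = exp (2 * c * \<bar>U w\<bar>) + exp (2 * c * \<bar>V w\<bar>)"
      by (simp add: exp_double[symmetric] mult_ac)
    also have "... \<le> ?h w"
      using e1[of "U w"] e1[of "V w"] by linarith
    finally show ?thesis .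
  qed
  have i: "integrable M ?h" "integral\<^sup>L M ?h = 4 * exp (2 * c^2)"
    using * by (auto simp: has_bochner_integral_iff)
  show I: "integrable M (\<lambda>w. exp (c * G w))"
    by (rule Bochner_Integration.integrable_bound[OF i(1)]) (use bnd in \<open>auto intro!: AE_I2 order_trans[OF _ abs_ge_self]\<close>)
  show "(\<integral>w. exp (c * G w) \<partial>M) \<le> 4 * exp (2 * c^2)"
    using integral_mono[OF I i(1)] bnd i(2) by simp
qed

lemma integrable_exp_G_bound:
  fixes f :: "'a \<Rightarrow> 'b :: {banach, second_countable_topology}"
  assumes "f \<in> borel_measurable M" and "\<And>w. norm (f w) \<le> B * exp (c * G w)" and "c \<ge> 0"
  shows "integrable M f" and "norm (\<integral>w. f w \<partial>M) \<le> B * (4 * exp (2 * c^2))"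
proof -
  have B: "B \<ge> 0"
    using order_trans[OF norm_ge_zero assms(2)] by (simp add: zero_le_mult_iff)
  have i: "integrable M (\<lambda>w. B * exp (c * G w))"
    using exp_G(1)[OF assms(3)] by simp
  show I: "integrable M f"
    by (rule Bochner_Integration.integrable_bound[OF i assms(1)])
      (use assms(2) in \<open>auto intro!: AE_I2 order_trans[OF _ abs_ge_self]\<close>)
  have "norm (\<integral>w. f w \<partial>M) \<le> (\<integral>w. norm (f w) \<partial>M)" by simp
  also have "... \<le> (\<integral>w. B * exp (c * G w) \<partial>M)"
    by (rule integral_mono[OF _ i]) (use I assms(2) in auto)
  also have "... \<le> B * (4 * exp (2 * c^2))"
    using exp_G(2)[OF assms(3)] B by (simp add: mult_left_mono)
  finally show "norm (\<integral>w. f w \<partial>M) \<le> B * (4 * exp (2 * c^2))" .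
qed

lemma one_plus_G_power: "(1 + G w) ^ n \<le> exp (real n * G w)"
proof -
  have "(1 + G w) ^ n \<le> exp (G w) ^ n"
    by (intro power_mono) (auto simp: exp_ge_add_one_self)
  then show ?thesis by (simp add: exp_of_nat_mult)
qed

text \<open>The mixed moments of \<open>U^2 * V\<close> and \<open>U * V^2\<close> vanish by
  polarisation: both products are combinations of the cubes of \<open>U\<close>, \<open>V\<close>,
  \<open>U + V\<close> and \<open>U - V\<close>, which are centred normal. The leading local error
  averages out for this reason.\<close>

lemma third_moment_complex:
  fixes p q :: complex
  defines "X \<equiv> \<lambda>w. p * U w + q * V w"
  shows "has_bochner_integral M X 0" and "has_bochner_integral M (\<lambda>w. X w ^ 3) 0"
proof -
  note ofr = has_bochner_integral_of_real
  have u: "has_bochner_integral M (\<lambda>w. complex_of_real (U w)) 0"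
    using ofr[OF lin_moments(1)[of 1 0]] by simp
  have v: "has_bochner_integral M (\<lambda>w. complex_of_real (V w)) 0"
    using ofr[OF lin_moments(1)[of 0 1]] by simp
  show "has_bochner_integral M X 0"
    unfolding X_def
    using has_bochner_integral_add[OF has_bochner_integral_mult_right[of p, OF u]
        has_bochner_integral_mult_right[of q, OF v]] by simp
  have u3: "has_bochner_integral M (\<lambda>w. U w ^ 3) 0" using lin_moments(3)[of 1 0] by simp
  have v3: "has_bochner_integral M (\<lambda>w. V w ^ 3) 0" using lin_moments(3)[of 0 1] by simp
  have s3: "has_bochner_integral M (\<lambda>w. (U w + V w) ^ 3) 0" using lin_moments(3)[of 1 1] by simp
  have d3: "has_bochner_integral M (\<lambda>w. (U w - V w) ^ 3) 0" using lin_moments(3)[of 1 "-1"] by simp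
  have uuv: "has_bochner_integral M (\<lambda>w. U w ^ 2 * V w) 0"
  proof -
    have "has_bochner_integral M (\<lambda>w. (1/6) * ((U w + V w) ^ 3 - (U w - V w) ^ 3 - 2 * V w ^ 3)) ((1/6) * (0 - 0 - 2 * 0))"
      by (intro has_bochner_integral_mult_right has_bochner_integral_diff s3 d3 v3)
    moreover have "(\<lambda>w. (1/6) * ((U w + V w) ^ 3 - (U w - V w) ^ 3 - 2 * V w ^ 3)) = (\<lambda>w. U w ^ 2 * V w)"
      by (auto simp: power3_eq_cube power2_eq_square algebra_simps)
    ultimately show ?thesis by (simp only: mult_zero_right diff_self)
  qed
  have uvv: "has_bochner_integral M (\<lambda>w. U w * V w ^ 2) 0"
  proof -
    have "has_bochner_integral M (\<lambda>w. (1/6) * ((U w + V w) ^ 3 + (U w - V w) ^ 3 - 2 * U w ^ 3)) ((1/6) * (0 + 0 - 2 * 0))"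
      by (intro has_bochner_integral_mult_right has_bochner_integral_diff has_bochner_integral_add s3 d3 u3)
    moreover have "(\<lambda>w. (1/6) * ((U w + V w) ^ 3 + (U w - V w) ^ 3 - 2 * U w ^ 3)) = (\<lambda>w. U w * V w ^ 2)"
      by (auto simp: power3_eq_cube power2_eq_square algebra_simps)
    ultimately show ?thesis by (simp only: mult_zero_right diff_self add_0)
  qed
  have "has_bochner_integral M (\<lambda>w. p ^ 3 * complex_of_real (U w ^ 3) + 3 * p^2 * q * complex_of_real (U w ^ 2 * V w)
      + 3 * p * q^2 * complex_of_real (U w * V w ^ 2) + q ^ 3 * complex_of_real (V w ^ 3))
      (p ^ 3 * complex_of_real 0 + 3 * p^2 * q * complex_of_real 0
      + 3 * p * q^2 * complex_of_real 0 + q ^ 3 * complex_of_real 0)"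
    by (rule has_bochner_integral_add[OF has_bochner_integral_add[OF has_bochner_integral_add[OF
          has_bochner_integral_mult_right[OF ofr[OF u3]] has_bochner_integral_mult_right[OF ofr[OF uuv]]]
          has_bochner_integral_mult_right[OF ofr[OF uvv]]] has_bochner_integral_mult_right[OF ofr[OF v3]]])
  moreover have "(\<lambda>w. p ^ 3 * complex_of_real (U w ^ 3) + 3 * p^2 * q * complex_of_real (U w ^ 2 * V w)
      + 3 * p * q^2 * complex_of_real (U w * V w ^ 2) + q ^ 3 * complex_of_real (V w ^ 3)) = (\<lambda>w. X w ^ 3)"
    by (auto simp: X_def power3_eq_cube power2_eq_square algebra_simps)
  ultimately show "has_bochner_integral M (\<lambda>w. X w ^ 3) 0"
    by (simp only: of_real_0 mult_zero_right add_0)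
qed

end

section \<open>Mean-square stability of one step\<close>

text \<open>Symbol of the explicit operator, with \<open>p\<close> and \<open>q\<close> the symbols
  of the central differences times \<open>sqrt (k * \<rho>x)\<close> and
  \<open>sqrt (k * \<rho>y)\<close>. The square is centred by \<open>p^2 + q^2\<close> and not by
  the variance of \<open>p * u + q * v\<close>: in the Milstein term for the mixed derivative the
  correlation cancels against the mixed derivative in the drift.\<close>

definition step_num :: "complex \<Rightarrow> complex \<Rightarrow> real \<Rightarrow> real \<Rightarrow> complex" where
  "step_num p q u v = 1 - \<i> * (p * u + q * v) - ((p * u + q * v)^2 - (p^2 + q^2)) / 2"

text \<open>For real \<open>a\<close> and \<open>b\<close> the squared imaginary part
  \<open>X^2\<close> cancels the linear part of the squared real part, so that the randomness enters
  only at fourth order in \<open>a\<close> and \<open>b\<close>.\<close>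

lemma step_num_real:
  fixes a b u v :: real
  shows "(cmod (step_num a b u v))^2
    = 1 + (a^2 + b^2) + ((a * u + b * v)^2 - (a^2 + b^2))^2 / 4"
proof -
  define X s where "X = a * u + b * v" and "s = a^2 + b^2"
  have "step_num a b u v = Complex (1 - (X^2 - s) / 2) (- X)"
    by (simp add: step_num_def X_def s_def complex_eq_iff power2_eq_square)
  then have "(cmod (step_num a b u v))^2 = (1 - (X^2 - s) / 2)^2 + X^2"
    by (simp add: cmod_power2)
  also have "... = 1 + s + (X^2 - s)^2 / 4"
    by (simp add: power2_eq_square field_simps)
  finally show ?thesis by (simp add: X_def s_def)
qed

text \<open>Passing to complex \<open>p\<close> and \<open>q\<close> changes the squared modulus by
  a term linear in the increments, of order \<open>\<epsilon> * \<tau>\<close>, and by terms of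
  order \<open>\<epsilon> * \<tau>^2\<close>. Only the latter can be absorbed by the damping; the
  linear term is therefore kept exactly, to be removed later by its zero mean.\<close>

lemma step_num_perturb_pointwise:
  fixes a b u v \<epsilon> \<tau> K :: real
  assumes "cmod (p - of_real a) \<le> \<epsilon> * \<tau>" "cmod (q - of_real b) \<le> \<epsilon> * \<tau>" "\<bar>a\<bar> \<le> \<tau>" "\<bar>b\<bar> \<le> \<tau>"
    and "0 \<le> \<epsilon>" "\<epsilon> \<le> 1" "0 \<le> \<tau>" "\<tau> \<le> K"
  defines "g \<equiv> 1 + (\<bar>u\<bar> + \<bar>v\<bar>)"
  shows "(cmod (step_num p q u v))^2 \<le> (cmod (step_num a b u v))^2
      + 2 * Re (- \<i> * ((p - a) * u + (q - b) * v))
      + \<epsilon> * \<tau>^2 * (10 + 2 * (1 + 2 * K) * (1 + 5 * K) + (1 + 5 * K)^2) * g ^ 4"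
proof -
  define dX where "dX = (p - a) * u + (q - b) * v"
  define X0 where "X0 = complex_of_real (a * u + b * v)"
  define X where "X = p * u + q * v"
  define ds where "ds = p^2 + q^2 - ((complex_of_real a)^2 + (complex_of_real b)^2)"
  define d2 where "d2 = - (dX * (X + X0) - ds) / 2"
  define r where "r = step_num a b u v - 1"
  have g1: "g \<ge> 1" "\<bar>u\<bar> + \<bar>v\<bar> \<le> g" by (auto simp: g_def)
  have K0: "K \<ge> 0" using assms by linarith
  have e0: "0 \<le> \<epsilon> * \<tau>" "\<epsilon> * \<tau> \<le> \<tau>"
    using assms mult_right_mono[of \<epsilon> 1 \<tau>] by auto
  have lin: "cmod (x * of_real u + y * of_real v) \<le> c * g" if "cmod x \<le> c" "cmod y \<le> c" "c \<ge> 0" for x y c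
  proof -
    have "cmod (x * of_real u + y * of_real v) \<le> cmod x * \<bar>u\<bar> + cmod y * \<bar>v\<bar>"
      by (rule order_trans[OF norm_triangle_ineq]) (simp add: norm_mult)
    also have "... \<le> c * \<bar>u\<bar> + c * \<bar>v\<bar>"
      using that by (intro add_mono mult_right_mono) auto
    also have "... \<le> c * g" using that g1 by (simp add: distrib_left[symmetric] mult_left_mono)
    finally show ?thesis .
  qed
  have bdX: "cmod dX \<le> \<epsilon> * \<tau> * g"
    unfolding dX_def by (rule lin) (use assms e0 in auto)
  have bX0: "cmod X0 \<le> \<tau> * g"
    using lin[of a \<tau> b] assms by (simp add: X0_def)
  have XX: "X = X0 + dX" by (simp add: X_def X0_def dX_def algebra_simps)
  have bX: "cmod (X + X0) \<le> 3 * \<tau> * g"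
  proof -
    have "cmod (X + X0) = cmod (X0 + X0 + dX)" by (simp add: XX add_ac)
    also have "... \<le> cmod X0 + cmod X0 + cmod dX" 
      by (rule norm_triangle_le[OF add_right_mono[OF norm_triangle_ineq]])
    also have "... \<le> \<tau> * g + \<tau> * g + \<tau> * g"
      using bX0 bdX mult_right_mono[OF e0(2), of g] g1 by linarith
    finally show ?thesis by simp
  qed
  have sq: "cmod (p'^2 - (complex_of_real a')\<^sup>2) \<le> 3 * (\<epsilon> * \<tau>^2)" if "cmod (p' - of_real a') \<le> \<epsilon> * \<tau>" "\<bar>a'\<bar> \<le> \<tau>" for p' a'
  proof -
    have "p'^2 - (complex_of_real a')\<^sup>2 = (p' - of_real a') * ((p' - of_real a') + 2 * of_real a')"
      by (simp add: power2_eq_square algebra_simps)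
    then have "cmod (p'^2 - (complex_of_real a')\<^sup>2) = cmod (p' - of_real a') * cmod ((p' - of_real a') + 2 * of_real a')"
      by (simp add: norm_mult)
    also have "... \<le> (\<epsilon> * \<tau>) * (\<tau> + 2 * \<tau>)"
    proof (intro mult_mono)
      show "cmod ((p' - of_real a') + 2 * of_real a') \<le> \<tau> + 2 * \<tau>"
        by (rule norm_triangle_le) (use that e0 in \<open>simp add: norm_mult\<close>)
    qed (use that e0 in auto)
    finally show ?thesis by (simp add: power2_eq_square)
  qed
  have bds: "cmod ds \<le> 6 * (\<epsilon> * \<tau>^2)"
  proof -
    have "ds = (p^2 - (complex_of_real a)\<^sup>2) + (q^2 - (complex_of_real b)\<^sup>2)"
      by (simp add: ds_def)
    then show ?thesis
      using norm_triangle_ineq[of "p^2 - (complex_of_real a)\<^sup>2" "q^2 - (complex_of_real b)\<^sup>2"]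
        sq[OF assms(1,3)] sq[OF assms(2,4)] by simp
  qed
  have et: "\<epsilon> * \<tau>^2 \<ge> 0" using assms by simp
  have g2: "g^2 \<ge> 1" "g ^ 4 \<ge> 1" "g^2 \<le> g ^ 4" "g \<le> g^2" "g ^ 3 \<le> g ^ 4"
    using g1 by (auto simp: power_increasing self_le_power one_le_power)
  have bd2: "cmod d2 \<le> 5 * (\<epsilon> * \<tau>^2) * g^2"
  proof -
    have "cmod d2 \<le> (cmod dX * cmod (X + X0) + cmod ds) / 2"
      unfolding d2_def using norm_triangle_ineq4[of "dX * (X + X0)" ds]
      by (simp add: norm_divide norm_mult norm_minus_commute)
    also have "... \<le> ((\<epsilon> * \<tau> * g) * (3 * \<tau> * g) + 6 * (\<epsilon> * \<tau>^2) * g^2) / 2"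
      using mult_mono[OF bdX bX] bds e0 g1 mult_left_mono[OF g2(1), of "6 * (\<epsilon> * \<tau>^2)"] et
      by (auto intro!: divide_right_mono add_mono)
    also have "... \<le> 5 * (\<epsilon> * \<tau>^2) * g^2"
      using mult_nonneg_nonneg[OF et, of "g^2"] by (simp add: power2_eq_square algebra_simps)
    finally show ?thesis .
  qed
  have N: "step_num p q u v = step_num a b u v + (- \<i> * dX + d2)"
  proof -
    have "X^2 - X0\<^sup>2 = dX * (X + X0)" by (simp add: XX power2_eq_square algebra_simps)
    then have d2': "d2 = - (X^2 - X0\<^sup>2 - ds) / 2" by (simp add: d2_def)
    have 1: "step_num p q u v = 1 - \<i> * X - (X^2 - (p^2 + q^2)) / 2"
      by (simp add: step_num_def X_def)
    have 2: "step_num a b u v = 1 - \<i> * X0 - (X0^2 - (p^2 + q^2 - ds)) / 2"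
      by (simp add: step_num_def X0_def ds_def)
    have 3: "dX = X - X0" by (simp add: XX)
    show ?thesis unfolding 1 2 d2' 3
      by (simp add: diff_divide_distrib add_divide_distrib algebra_simps del: power2_diff)
  qed
  have br: "cmod r \<le> (1 + 2 * K) * \<tau> * g^2"
  proof -
    have "step_num a b u v = 1 - \<i> * X0 - (X0^2 - complex_of_real (a^2 + b^2)) / 2"
      by (simp only: step_num_def X0_def of_real_add of_real_mult of_real_power)
    then have req: "r = - \<i> * X0 - (X0^2 - complex_of_real (a^2 + b^2)) / 2"
      by (simp add: r_def del: of_real_add)
    have "cmod (X0^2 - complex_of_real (a^2 + b^2)) \<le> (cmod X0)^2 + (a^2 + b^2)"
      by (rule order_trans[OF norm_triangle_ineq4])
        (simp add: norm_power norm_of_real del: of_real_add of_real_power)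
    moreover have "(cmod X0)^2 \<le> K * \<tau> * g^2"
    proof -
      have "(cmod X0)^2 \<le> (\<tau> * g)^2" by (rule power_mono[OF bX0]) simp
      also have "... = \<tau> * (\<tau> * g^2)" by (simp add: power2_eq_square)
      also have "... \<le> K * (\<tau> * g^2)" using assms by (intro mult_right_mono) auto
      finally show ?thesis by (simp add: mult_ac)
    qed
    moreover have "a^2 + b^2 \<le> 2 * (K * \<tau> * g^2)"
    proof -
      have "a^2 \<le> \<tau>^2" "b^2 \<le> \<tau>^2"
        using power_mono[OF assms(3) abs_ge_zero, of 2] power_mono[OF assms(4) abs_ge_zero, of 2]
        by (simp_all only: power2_abs)
      moreover have "\<tau>^2 \<le> K * \<tau>" using mult_right_mono[OF assms(8,7)] by (simp only: power2_eq_square)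
      moreover have "K * \<tau> \<le> K * \<tau> * g^2"
        using mult_left_mono[OF g2(1) mult_nonneg_nonneg[OF K0 assms(7)]] by (simp only: mult_1_right)
      ultimately show ?thesis by argo
    qed
    moreover have "cmod r \<le> cmod X0 + cmod (X0^2 - complex_of_real (a^2 + b^2)) / 2"
    proof -
      have n1: "cmod (- \<i> * X0) = cmod X0" by (simp add: norm_mult)
      have n2: "cmod (Y / 2) = cmod Y / 2" for Y by (simp add: norm_divide)
      show ?thesis
        unfolding req using norm_triangle_ineq4[of "- \<i> * X0" "(X0^2 - complex_of_real (a^2 + b^2)) / 2"]
        by (simp only: n1 n2)
    qed
    moreover have "\<tau> * g \<le> \<tau> * g^2"
      by (rule mult_left_mono[OF g2(4) assms(7)])
    moreover define z where "z = cmod (X0^2 - complex_of_real (a^2 + b^2))"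
    moreover define y where "y = K * \<tau> * g^2"
    ultimately have "z \<le> y + 2 * y" "cmod r \<le> \<tau> * g^2 + z / 2" using bX0 by argo+
    then have "cmod r \<le> \<tau> * g^2 + (y + 2 * y) / 2"
      by argo
    then have "cmod r \<le> \<tau> * g^2 + (K * \<tau> * g^2 + 2 * (K * \<tau> * g^2)) / 2"
      by (simp only: y_def)
    also have "... \<le> (1 + 2 * K) * \<tau> * g^2"
      using mult_nonneg_nonneg[OF mult_nonneg_nonneg[OF K0 assms(7)], of "g^2"] by (simp add: algebra_simps)
    finally show ?thesis .
  qed
  define B where "B = - \<i> * dX + d2"
  have bB: "cmod B \<le> (1 + 5 * K) * (\<epsilon> * \<tau>) * g^2"
  proof -
    have "cmod B \<le> cmod dX + cmod d2"
      unfolding B_def using norm_triangle_ineq[of "- \<i> * dX" d2] by (simp add: norm_mult)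
    also have "... \<le> \<epsilon> * \<tau> * g^2 + 5 * (K * (\<epsilon> * \<tau>)) * g^2"
    proof (rule add_mono)
      have "\<epsilon> * \<tau> * g \<le> \<epsilon> * \<tau> * g^2" using g2 e0 by (intro mult_left_mono) auto
      with bdX show "cmod dX \<le> \<epsilon> * \<tau> * g^2" by linarith
      have "\<epsilon> * \<tau>^2 \<le> K * (\<epsilon> * \<tau>)"
        using mult_right_mono[OF assms(8) e0(1)] by (simp add: power2_eq_square mult_ac)
      then have "5 * (\<epsilon> * \<tau>^2) * g^2 \<le> 5 * (K * (\<epsilon> * \<tau>)) * g^2"
        by (intro mult_right_mono) auto
      with bd2 show "cmod d2 \<le> 5 * (K * (\<epsilon> * \<tau>)) * g^2" by linarith
    qed
    also have "... = (1 + 5 * K) * (\<epsilon> * \<tau>) * g^2" by (simp add: algebra_simps)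
    finally show ?thesis .
  qed
  \<comment> \<open>With \<open>step_num a b u v = 1 + r\<close> the cross term is
    \<open>Re B\<close> plus a product with \<open>r\<close>. As \<open>r\<close> is of order \<tau>
    and \<open>B\<close> of order \<open>\<epsilon> * \<tau>\<close>, only \<open>Re B\<close> needs
    care.\<close>
  have sq_add: "(cmod (1 + r + B))^2 = (cmod (1 + r))^2 + 2 * Re B + 2 * Re (cnj r * B) + (cmod B)^2"
    unfolding cmod_power2 by (simp add: power2_eq_square algebra_simps)
  have e1: "(cmod (step_num p q u v))^2
      = (cmod (step_num a b u v))^2 + 2 * (Re (- \<i> * dX) + Re d2) + 2 * Re (cnj r * B) + (cmod B)^2"
    using sq_add by (simp add: N B_def r_def)
  have e2: "Re d2 \<le> 5 * (\<epsilon> * \<tau>^2) * g ^ 4"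
    using complex_Re_le_cmod[of d2] bd2 mult_left_mono[OF g2(3), of "5 * (\<epsilon> * \<tau>^2)"] et by linarith
  have e3: "Re (cnj r * B) \<le> (1 + 2 * K) * (1 + 5 * K) * (\<epsilon> * \<tau>^2) * g ^ 4"
  proof -
    have "Re (cnj r * B) \<le> cmod r * cmod B"
      using complex_Re_le_cmod[of "cnj r * B"] by (simp add: norm_mult)
    also have "... \<le> ((1 + 2 * K) * \<tau> * g^2) * ((1 + 5 * K) * (\<epsilon> * \<tau>) * g^2)"
      using K0 assms by (intro mult_mono br bB) auto
    also have "... = (1 + 2 * K) * (1 + 5 * K) * (\<epsilon> * \<tau>^2) * g ^ 4"
      by (simp only: power2_eq_square power4_eq_xxxx mult_ac)
    finally show ?thesis .
  qed
  have e4: "(cmod B)^2 \<le> (1 + 5 * K)^2 * (\<epsilon> * \<tau>^2) * g ^ 4"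
  proof -
    have "(cmod B)^2 \<le> ((1 + 5 * K) * (\<epsilon> * \<tau>) * g^2)^2" by (rule power_mono[OF bB]) simp
    also have "... = \<epsilon> * ((1 + 5 * K)^2 * (\<epsilon> * \<tau>^2) * g ^ 4)"
      by (simp only: power2_eq_square power4_eq_xxxx mult_ac)
    also have "... \<le> 1 * ((1 + 5 * K)^2 * (\<epsilon> * \<tau>^2) * g ^ 4)"
      using assms et g2 by (intro mult_right_mono) auto
    finally show ?thesis by simp
  qed
  have "2 * (5 * (\<epsilon> * \<tau>^2) * g ^ 4) + 2 * ((1 + 2 * K) * (1 + 5 * K) * (\<epsilon> * \<tau>^2) * g ^ 4)
      + (1 + 5 * K)^2 * (\<epsilon> * \<tau>^2) * g ^ 4
      = \<epsilon> * \<tau>^2 * (10 + 2 * (1 + 2 * K) * (1 + 5 * K) + (1 + 5 * K)^2) * g ^ 4"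
    by (simp add: algebra_simps)
  then show ?thesis
    unfolding e1 dX_def[symmetric]
  proof -
    have gen: "A + 2 * (B + D) + 2 * E + F \<le> A + 2 * B + Z"
      if "D \<le> D'" "E \<le> E'" "F \<le> F'" "2 * D' + 2 * E' + F' = Z" for A B D E F D' E' F' Z :: real
      using that by argo
    assume eq: "2 * (5 * (\<epsilon> * \<tau>^2) * g ^ 4) + 2 * ((1 + 2 * K) * (1 + 5 * K) * (\<epsilon> * \<tau>^2) * g ^ 4)
      + (1 + 5 * K)^2 * (\<epsilon> * \<tau>^2) * g ^ 4
      = \<epsilon> * \<tau>^2 * (10 + 2 * (1 + 2 * K) * (1 + 5 * K) + (1 + 5 * K)^2) * g ^ 4"
    show "(cmod (step_num a b u v))^2 + 2 * (Re (- \<i> * dX) + Re d2) + 2 * Re (cnj r * B) + (cmod B)^2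
      \<le> (cmod (step_num a b u v))^2 + 2 * Re (- \<i> * dX)
        + \<epsilon> * \<tau>^2 * (10 + 2 * (1 + 2 * K) * (1 + 5 * K) + (1 + 5 * K)^2) * g ^ 4"
      by (rule gen[OF e2 e3 e4 eq])
  qed
qed

text \<open>\<open>w\<close> is the variance of \<open>a * U + b * V\<close>, so the fourth moment
  contributes \<open>3 * w^2\<close>; \<open>s\<close> stems from the centring in
  \<open>step_num\<close>.\<close>

lemma (in gauss_pair) integral_step_num_real:
  fixes a b :: real
  defines "s \<equiv> a^2 + b^2" and "w \<equiv> a^2 + 2 * \<rho> * a * b + b^2"
  shows "has_bochner_integral M (\<lambda>\<omega>. (cmod (step_num a b (U \<omega>) (V \<omega>)))^2)
    (1 + s + (3 * w^2 - 2 * s * w + s^2) / 4)"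
proof -
  have c: "has_bochner_integral M (\<lambda>\<omega>. 1 + s + s^2 / 4) (1 + s + s^2 / 4)"
    by (simp add: has_bochner_integral_iff prob_space)
  note 4 = has_bochner_integral_mult_right[of "1 / 4", OF lin_moments(4)[of a b]]
  note 2 = has_bochner_integral_mult_right[of "s / 2", OF lin_moments(2)[of a b]]
  have eq: "(\<lambda>\<omega>. (cmod (step_num a b (U \<omega>) (V \<omega>)))^2)
      = (\<lambda>\<omega>. (1 + s + s^2 / 4) + 1 / 4 * (a * U \<omega> + b * V \<omega>) ^ 4 - s / 2 * (a * U \<omega> + b * V \<omega>) ^ 2)"
  proof (rule ext)
    fix \<omega>
    define X where "X = a * U \<omega> + b * V \<omega>"
    show "(cmod (step_num a b (U \<omega>) (V \<omega>)))^2
      = (1 + s + s^2 / 4) + 1 / 4 * (a * U \<omega> + b * V \<omega>) ^ 4 - s / 2 * (a * U \<omega> + b * V \<omega>) ^ 2"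
      unfolding step_num_real X_def[symmetric] s_def[symmetric]
      by (simp add: power2_eq_square power4_eq_xxxx field_simps)
  qed
  have val: "1 + s + s^2 / 4 + 1 / 4 * (3 * w^2) - s / 2 * w = 1 + s + (3 * w^2 - 2 * s * w + s^2) / 4"
    by (simp add: field_simps)
  show ?thesis
    unfolding eq val[symmetric]
    using has_bochner_integral_diff[OF has_bochner_integral_add[OF c 4] 2] by (simp only: w_def)
qed

lemma (in gauss_pair) integral_step_num_perturb:
  fixes a b \<epsilon> \<tau> K :: real
  assumes "cmod (p - of_real a) \<le> \<epsilon> * \<tau>" "cmod (q - of_real b) \<le> \<epsilon> * \<tau>" "\<bar>a\<bar> \<le> \<tau>" "\<bar>b\<bar> \<le> \<tau>"
    and "0 \<le> \<epsilon>" "\<epsilon> \<le> 1" "0 \<le> \<tau>" "\<tau> \<le> K"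
  defines "s \<equiv> a^2 + b^2" and "w \<equiv> a^2 + 2 * \<rho> * a * b + b^2"
  shows "integrable M (\<lambda>\<omega>. (cmod (step_num p q (U \<omega>) (V \<omega>)))^2)"
    and "(\<integral>\<omega>. (cmod (step_num p q (U \<omega>) (V \<omega>)))^2 \<partial>M) \<le> 1 + s + (3 * w^2 - 2 * s * w + s^2) / 4
      + \<epsilon> * \<tau>^2 * ((10 + 2 * (1 + 2 * K) * (1 + 5 * K) + (1 + 5 * K)^2) * (4 * exp 32))"
proof -
  define C where "C = 10 + 2 * (1 + 2 * K) * (1 + 5 * K) + (1 + 5 * K)^2"
  have C0: "C \<ge> 0" using assms by (auto simp: C_def intro!: add_nonneg_nonneg mult_nonneg_nonneg)
  \<comment> \<open>The linear term of the pointwise bound is a real linear form in the increments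
    with the imaginary parts as coefficients; its mean is 0.\<close>
  define m where "m = (\<lambda>\<omega>. (cmod (step_num a b (U \<omega>) (V \<omega>)))^2
      + 2 * (Im (p - a) * U \<omega> + Im (q - b) * V \<omega>) + \<epsilon> * \<tau>^2 * C * exp (4 * G \<omega>))"
  have le: "(cmod (step_num p q (U \<omega>) (V \<omega>)))^2 \<le> m \<omega>" for \<omega>
  proof -
    have "\<epsilon> * \<tau>^2 * C * (1 + (\<bar>U \<omega>\<bar> + \<bar>V \<omega>\<bar>)) ^ 4 \<le> \<epsilon> * \<tau>^2 * C * exp (4 * G \<omega>)"
      using one_plus_G_power[of \<omega> 4] assms C0 by (intro mult_left_mono) (auto simp: G_def)
    then show ?thesis
      using step_num_perturb_pointwise[OF assms(1-8), of "U \<omega>" "V \<omega>"]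
      by (simp add: m_def C_def)
  qed
  \<comment> \<open>The fourth power of \<open>1 + G\<close> leads to \<open>exp (4 * G)\<close>,
    and \<open>32 = 2 * 4^2\<close>.\<close>
  have exp4: "integrable M (\<lambda>\<omega>. exp (4 * G \<omega>))" "(\<integral>\<omega>. exp (4 * G \<omega>) \<partial>M) \<le> 4 * exp 32"
    using exp_G[of 4] by auto
  have "has_bochner_integral M (\<lambda>\<omega>. exp (4 * G \<omega>)) (\<integral>\<omega>. exp (4 * G \<omega>) \<partial>M)"
    using exp4 by (simp add: has_bochner_integral_iff)
  note h3 = has_bochner_integral_mult_right[of "\<epsilon> * \<tau>^2 * C", OF this]
  note h2 = has_bochner_integral_mult_right[of 2, OF lin_moments(1)[of "Im (p - a)" "Im (q - b)"]]
  note h1 = integral_step_num_real[of a b, folded s_def w_def]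
  have val: "1 + s + (3 * w^2 - 2 * s * w + s^2) / 4 + \<epsilon> * \<tau>^2 * C * (\<integral>\<omega>. exp (4 * G \<omega>) \<partial>M)
    = 1 + s + (3 * w^2 - 2 * s * w + s^2) / 4 + 2 * 0 + \<epsilon> * \<tau>^2 * C * (\<integral>\<omega>. exp (4 * G \<omega>) \<partial>M)"
    by simp
  have m: "has_bochner_integral M m (1 + s + (3 * w^2 - 2 * s * w + s^2) / 4 + \<epsilon> * \<tau>^2 * C * (\<integral>\<omega>. exp (4 * G \<omega>) \<partial>M))"
    unfolding m_def val by (rule has_bochner_integral_add[OF has_bochner_integral_add[OF h1 h2] h3])
  have meas: "(\<lambda>\<omega>. (cmod (step_num p q (U \<omega>) (V \<omega>)))^2) \<in> borel_measurable M"
    unfolding step_num_def by measurable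
  have im: "integrable M m" using m by (simp add: has_bochner_integral_iff)
  show i: "integrable M (\<lambda>\<omega>. (cmod (step_num p q (U \<omega>) (V \<omega>)))^2)"
    by (rule Bochner_Integration.integrable_bound[OF im meas])
      (use le in \<open>auto intro!: AE_I2 order_trans[OF _ abs_ge_self]\<close>)
  have "(\<integral>\<omega>. (cmod (step_num p q (U \<omega>) (V \<omega>)))^2 \<partial>M) \<le> integral\<^sup>L M m"
    by (rule integral_mono[OF i im le])
  also have "... = 1 + s + (3 * w^2 - 2 * s * w + s^2) / 4 + \<epsilon> * \<tau>^2 * C * (\<integral>\<omega>. exp (4 * G \<omega>) \<partial>M)"
    using m by (simp add: has_bochner_integral_iff)
  also have "... \<le> 1 + s + (3 * w^2 - 2 * s * w + s^2) / 4 + \<epsilon> * \<tau>^2 * C * (4 * exp 32)"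
    using exp4(2) assms C0 by (intro add_left_mono mult_left_mono) auto
  finally show "(\<integral>\<omega>. (cmod (step_num p q (U \<omega>) (V \<omega>)))^2 \<partial>M) \<le> 1 + s + (3 * w^2 - 2 * s * w + s^2) / 4
      + \<epsilon> * \<tau>^2 * ((10 + 2 * (1 + 2 * K) * (1 + 5 * K) + (1 + 5 * K)^2) * (4 * exp 32))"
    by (simp add: C_def mult.assoc)
qed

section \<open>Mean-square bounds\<close>

text \<open>A bound of the norm in mean square. The non-negative integral makes integrability a
  consequence of the bound instead of a side condition.\<close>

definition L2le :: "'a measure \<Rightarrow> ('a \<Rightarrow> 'b::{real_normed_vector, second_countable_topology}) \<Rightarrow> real \<Rightarrow> bool" where
  "L2le M f B \<longleftrightarrow> f \<in> borel_measurable M \<and> 0 \<le> B \<and> (\<integral>\<^sup>+w. ennreal ((norm (f w))^2) \<partial>M) \<le> ennreal (B^2)"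

lemma L2leD:
  assumes "L2le M f B"
  shows "f \<in> borel_measurable M" "0 \<le> B" "(\<integral>\<^sup>+w. ennreal ((norm (f w))^2) \<partial>M) \<le> ennreal (B^2)"
  using assms by (auto simp: L2le_def)

lemma L2le_mono:
  assumes "L2le M f B" "B \<le> B'"
  shows "L2le M f B'"
  using assms order_trans[OF L2leD(3)[OF assms(1)], of "ennreal (B'^2)"]
  by (auto simp: L2le_def intro!: ennreal_leI power_mono)

lemma L2le_bound:
  fixes g :: "'a \<Rightarrow> 'c::{real_normed_vector, second_countable_topology}"
  assumes "L2le M f B" "g \<in> borel_measurable M" "c \<ge> 0" "\<And>w. norm (g w) \<le> c * norm (f w)"
  shows "L2le M g (c * B)"
proof -
  have [measurable]: "f \<in> borel_measurable M" using assms(1) by (simp add: L2le_def)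
  have "(\<integral>\<^sup>+w. ennreal ((norm (g w))^2) \<partial>M) \<le> (\<integral>\<^sup>+w. ennreal (c^2) * ennreal ((norm (f w))^2) \<partial>M)"
  proof (rule nn_integral_mono)
    fix w
    have "(norm (g w))^2 \<le> (c * norm (f w))^2"
      using assms(4) by (intro power_mono) auto
    then show "ennreal ((norm (g w))^2) \<le> ennreal (c^2) * ennreal ((norm (f w))^2)"
      by (simp add: ennreal_mult[symmetric] power_mult_distrib ennreal_leI)
  qed
  also have "... = ennreal (c^2) * (\<integral>\<^sup>+w. ennreal ((norm (f w))^2) \<partial>M)"
    by (rule nn_integral_cmult) measurable
  also have "... \<le> ennreal (c^2) * ennreal (B^2)"
    by (rule mult_left_mono[OF L2leD(3)[OF assms(1)]]) simp
  also have "... = ennreal ((c * B)^2)"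
    by (simp add: ennreal_mult[symmetric] power_mult_distrib)
  finally show ?thesis
    using assms by (auto simp: L2le_def)
qed

lemma L2le_cmult:
  fixes f :: "'a \<Rightarrow> complex"
  assumes "L2le M f B"
  shows "L2le M (\<lambda>w. c * f w) (norm c * B)"
  using assms by (intro L2le_bound[OF assms]) (auto simp: norm_mult L2le_def)

lemma L2le_0: "L2le M (\<lambda>w. 0) 0"
  by (simp add: L2le_def)

text \<open>Minkowski's inequality from Young's inequality with the weights \<open>B' / A'\<close>
  and \<open>A' / B'\<close>, which are optimal when \<open>A'\<close> and \<open>B'\<close> are the
  two norms. They must be positive, so the bounds \<open>A\<close> and \<open>B\<close> are
  approached from above.\<close>

lemma L2le_add:
  fixes f g :: "'a \<Rightarrow> 'b::{real_normed_vector, second_countable_topology}"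
  assumes f: "L2le M f A" and g: "L2le M g B"
  shows "L2le M (\<lambda>w. f w + g w) (A + B)"
proof -
  have [measurable]: "f \<in> borel_measurable M" "g \<in> borel_measurable M"
    using assms by (auto simp: L2le_def)
  have AB: "A \<ge> 0" "B \<ge> 0" using assms by (auto simp: L2le_def)
  have main: "(\<integral>\<^sup>+w. ennreal ((norm (f w + g w))^2) \<partial>M) \<le> ennreal ((A' + B')^2)"
    if "A' > 0" "B' > 0" "A \<le> A'" "B \<le> B'" for A' B'
  proof -
    note pos = that(1,2) and le = that(3,4)
    have "(\<integral>\<^sup>+w. ennreal ((norm (f w + g w))^2) \<partial>M)
       \<le> (\<integral>\<^sup>+w. ennreal (1 + B' / A') * ennreal ((norm (f w))^2) + ennreal (1 + A' / B') * ennreal ((norm (g w))^2) \<partial>M)"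
    proof (rule nn_integral_mono)
      fix w
      let ?x = "norm (f w)" and ?y = "norm (g w)"
      have "(norm (f w + g w))^2 \<le> (?x + ?y)^2"
        by (intro power_mono norm_triangle_ineq) auto
      also have "... \<le> (1 + B' / A') * ?x^2 + (1 + A' / B') * ?y^2"
      proof -
        have "0 \<le> (B' * ?x - A' * ?y)^2 / (A' * B')" using pos by simp
        also have "... = (1 + B' / A') * ?x^2 + (1 + A' / B') * ?y^2 - (?x + ?y)\<^sup>2"
          using pos by (simp add: field_simps power2_eq_square)
        finally show ?thesis by simp
      qed
      finally show "ennreal ((norm (f w + g w))^2)
          \<le> ennreal (1 + B' / A') * ennreal (?x^2) + ennreal (1 + A' / B') * ennreal (?y^2)"
        using pos by (simp add: ennreal_mult[symmetric] ennreal_plus[symmetric] ennreal_leI del: ennreal_plus)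
    qed
    also have "... = ennreal (1 + B' / A') * (\<integral>\<^sup>+w. ennreal ((norm (f w))^2) \<partial>M)
        + ennreal (1 + A' / B') * (\<integral>\<^sup>+w. ennreal ((norm (g w))^2) \<partial>M)"
      by (subst nn_integral_add) (auto simp: nn_integral_cmult)
    also have "... \<le> ennreal (1 + B' / A') * ennreal (A'^2) + ennreal (1 + A' / B') * ennreal (B'^2)"
      by (intro add_mono mult_left_mono L2leD(3)[OF L2le_mono[OF f le(1)]] L2leD(3)[OF L2le_mono[OF g le(2)]]) auto
    also have "... = ennreal ((1 + B' / A') * A'^2 + (1 + A' / B') * B'^2)"
      using pos by (simp add: ennreal_mult[symmetric] ennreal_plus[symmetric] del: ennreal_plus)
    also have "(1 + B' / A') * A'^2 + (1 + A' / B') * B'^2 = (A' + B')^2"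
      using pos by (simp add: field_simps power2_eq_square)
    finally show ?thesis .
  qed
  have lim: "((\<lambda>e. ennreal ((A + e + (B + e))^2)) \<longlongrightarrow> ennreal ((A + 0 + (B + 0))^2)) (at_right 0)"
    by (intro tendsto_intros tendsto_ennrealI)
  have "(\<integral>\<^sup>+w. ennreal ((norm (f w + g w))^2) \<partial>M) \<le> ennreal ((A + 0 + (B + 0))^2)"
    by (rule tendsto_lowerbound[OF lim])
      (rule eventually_at_rightI[of 0 1], rule main, use AB in auto)
  then show ?thesis using AB by (auto simp: L2le_def)
qed

lemma L2le_sum:
  fixes f :: "'i \<Rightarrow> 'a \<Rightarrow> 'b::{real_normed_vector, second_countable_topology}"
  assumes "finite I" "\<And>i. i \<in> I \<Longrightarrow> L2le M (f i) (B i)"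
  shows "L2le M (\<lambda>w. \<Sum>i\<in>I. f i w) (\<Sum>i\<in>I. B i)"
  using assms by (induction I rule: finite_induct) (auto intro: L2le_0 L2le_add)

lemma L2le_uminus:
  assumes "L2le M f B"
  shows "L2le M (\<lambda>w. - f w) B"
  using assms by (auto simp: L2le_def)

lemma L2le_diff:
  assumes "L2le M f A" "L2le M g B"
  shows "L2le M (\<lambda>w. f w - g w) (A + B)"
  using L2le_add[OF assms(1) L2le_uminus[OF assms(2)]] by simp

text \<open>Minkowski's inequality for integrals, via the Cauchy--Schwarz inequality with weight \<open>w\<close>.\<close>

lemma L2le_integral:
  fixes f :: "'x \<Rightarrow> 'a \<Rightarrow> complex"
  assumes N: "sigma_finite_measure N" and M: "sigma_finite_measure M"
    and [measurable]: "(\<lambda>(x, \<omega>). f x \<omega>) \<in> borel_measurable (N \<Otimes>\<^sub>M M)"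
    and w: "integrable N w" and wpos: "\<And>x. x \<in> space N \<Longrightarrow> w x > (0::real)"
    and bnd: "\<And>x. x \<in> space N \<Longrightarrow> (\<integral>\<^sup>+\<omega>. ennreal ((norm (f x \<omega>))^2) \<partial>M) \<le> ennreal ((w x)^2)"
  shows "L2le M (\<lambda>\<omega>. \<integral>x. f x \<omega> \<partial>N) (\<integral>x. w x \<partial>N)"
proof -
  interpret N: sigma_finite_measure N by fact
  interpret M: sigma_finite_measure M by fact
  interpret pair_sigma_finite N M ..
  define W where "W = (\<integral>x. w x \<partial>N)"
  have [measurable]: "w \<in> borel_measurable N" using w by auto
  have W0: "W \<ge> 0" unfolding W_def by (rule integral_nonneg_AE) (use wpos in \<open>auto intro!: AE_I2 less_imp_le\<close>)
  have Wnn: "(\<integral>\<^sup>+x. ennreal (w x) \<partial>N) = ennreal W"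
    unfolding W_def by (rule nn_integral_eq_integral[OF w]) (use wpos in \<open>auto intro!: AE_I2 less_imp_le\<close>)
  have mf: "(\<lambda>\<omega>. \<integral>x. f x \<omega> \<partial>N) \<in> borel_measurable M"
    by measurable
  have path: "ennreal ((norm (\<integral>x. f x \<omega> \<partial>N))^2)
      \<le> ennreal W * (\<integral>\<^sup>+x. ennreal ((norm (f x \<omega>))^2 / w x) \<partial>N)" if [simp]: "\<omega> \<in> space M" for \<omega>
  proof (cases "integrable N (\<lambda>x. f x \<omega>)")
    case True
    have [measurable]: "(\<lambda>x. f x \<omega>) \<in> borel_measurable N" using True by auto
    have "ennreal ((norm (\<integral>x. f x \<omega> \<partial>N))^2) = (ennreal (norm (\<integral>x. f x \<omega> \<partial>N)))^2"
      by (simp add: ennreal_power)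
    also have "... \<le> (\<integral>\<^sup>+x. ennreal (norm (f x \<omega>)) \<partial>N)^2"
      by (intro power_mono integral_norm_bound_ennreal True) auto
    also have "(\<integral>\<^sup>+x. ennreal (norm (f x \<omega>)) \<partial>N)
        = (\<integral>\<^sup>+x. ennreal (sqrt (w x)) * ennreal (norm (f x \<omega>) / sqrt (w x)) \<partial>N)"
      by (intro nn_integral_cong) (use wpos in \<open>force simp: ennreal_mult[symmetric] less_imp_le\<close>)
    also have "...^2 \<le> (\<integral>\<^sup>+x. (ennreal (sqrt (w x)))^2 \<partial>N) * (\<integral>\<^sup>+x. (ennreal (norm (f x \<omega>) / sqrt (w x)))^2 \<partial>N)"
      by (rule Cauchy_Schwarz_nn_integral) measurable
    also have "(\<integral>\<^sup>+x. (ennreal (sqrt (w x)))^2 \<partial>N) = (\<integral>\<^sup>+x. ennreal (w x) \<partial>N)"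
      by (intro nn_integral_cong) (use wpos in \<open>force simp: ennreal_power less_imp_le\<close>)
    also have "(\<integral>\<^sup>+x. (ennreal (norm (f x \<omega>) / sqrt (w x)))^2 \<partial>N) = (\<integral>\<^sup>+x. ennreal ((norm (f x \<omega>))^2 / w x) \<partial>N)"
    proof (intro nn_integral_cong)
      fix x assume "x \<in> space N"
      then have "w x > 0" by (rule wpos)
      then show "(ennreal (norm (f x \<omega>) / sqrt (w x)))^2 = ennreal ((norm (f x \<omega>))^2 / w x)"
        by (simp add: ennreal_power power_divide)
    qed
    finally show ?thesis by (simp add: Wnn)
  next
    \<comment> \<open>A divergent integral has the value 0 by convention, so the bound is trivial
      there.\<close>
    case False
    then show ?thesis by (simp add: not_integrable_integral_eq)
  qed
  have "(\<integral>\<^sup>+\<omega>. ennreal ((norm (\<integral>x. f x \<omega> \<partial>N))^2) \<partial>M)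
     \<le> (\<integral>\<^sup>+\<omega>. ennreal W * (\<integral>\<^sup>+x. ennreal ((norm (f x \<omega>))^2 / w x) \<partial>N) \<partial>M)"
    by (intro nn_integral_mono path)
  also have "... = ennreal W * (\<integral>\<^sup>+\<omega>. (\<integral>\<^sup>+x. ennreal ((norm (f x \<omega>))^2 / w x) \<partial>N) \<partial>M)"
    by (rule nn_integral_cmult) measurable
  also have "(\<integral>\<^sup>+\<omega>. (\<integral>\<^sup>+x. ennreal ((norm (f x \<omega>))^2 / w x) \<partial>N) \<partial>M)
      = (\<integral>\<^sup>+x. (\<integral>\<^sup>+\<omega>. ennreal ((norm (f x \<omega>))^2 / w x) \<partial>M) \<partial>N)"
    by (rule Fubini') measurable
  also have "... \<le> (\<integral>\<^sup>+x. ennreal (w x) \<partial>N)"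
  proof (intro nn_integral_mono)
    fix x assume x: "x \<in> space N"
    then have wx: "w x > 0" by (rule wpos)
    have [measurable]: "f x \<in> borel_measurable M" using x by measurable
    have "(\<integral>\<^sup>+\<omega>. ennreal ((norm (f x \<omega>))^2 / w x) \<partial>M) = (\<integral>\<^sup>+\<omega>. ennreal (1 / w x) * ennreal ((norm (f x \<omega>))^2) \<partial>M)"
      using wx by (intro nn_integral_cong) (simp add: ennreal_mult[symmetric] less_imp_le)
    also have "... = ennreal (1 / w x) * (\<integral>\<^sup>+\<omega>. ennreal ((norm (f x \<omega>))^2) \<partial>M)"
      by (rule nn_integral_cmult) measurable
    also have "... \<le> ennreal (1 / w x) * ennreal ((w x)^2)"
      by (intro mult_left_mono bnd x) auto
    also have "... = ennreal (w x)"
      using wx by (simp add: ennreal_mult[symmetric] power2_eq_square)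
    finally show "(\<integral>\<^sup>+\<omega>. ennreal ((norm (f x \<omega>))^2 / w x) \<partial>M) \<le> ennreal (w x)" .
  qed
  finally have "(\<integral>\<^sup>+\<omega>. ennreal ((norm (\<integral>x. f x \<omega> \<partial>N))^2) \<partial>M) \<le> ennreal W * ennreal W"
    unfolding Wnn by (simp add: mult_left_mono)
  then show ?thesis
    using mf W0 by (simp add: L2le_def ennreal_mult[symmetric] power2_eq_square flip: W_def)
qed

section \<open>Amplification of one step under perturbed symbols\<close>

definition step_den :: "real \<Rightarrow> real \<Rightarrow> real \<Rightarrow> complex \<Rightarrow> complex \<Rightarrow> complex \<Rightarrow> complex \<Rightarrow> complex" where
  "step_den k \<mu>x \<mu>y S1 P1 S2 P2 = 1 + \<i> * k * (\<mu>x * S1 + \<mu>y * S2) + k / 2 * (P1^2 + P2^2)"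

text \<open>\<open>s\<close> and \<open>g\<close> are real reference values for the symbols of the
  first and of the second difference. The first difference may vanish at the edge of the mesh band,
  so \<open>s\<close> is only bounded from above, by \<open>g\<close>; decay in \<open>x\<close> has
  to come from \<open>g\<close>, which stays comparable to \<open>x\<close>. The numerator of a step
  sees \<open>s\<close>, the damping in the denominator sees \<open>g\<close>.\<close>

definition near :: "real \<Rightarrow> real \<Rightarrow> complex \<Rightarrow> complex \<Rightarrow> real \<Rightarrow> real \<Rightarrow> bool" where
  "near \<epsilon> x S P s g \<longleftrightarrow> cmod (S - of_real s) \<le> \<epsilon> * (1 + \<bar>x\<bar>) \<and> cmod (P - of_real g) \<le> \<epsilon> * (1 + \<bar>x\<bar>)
     \<and> \<bar>s\<bar> \<le> \<bar>g\<bar> \<and> \<bar>g\<bar> \<le> \<bar>x\<bar> \<and> \<bar>x\<bar> \<le> 2 * \<bar>g\<bar>"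

text \<open>The conditions on the correlations are bounds of three coefficients. With
  \<open>w = s + 2 * r * c\<close> the left side is
  \<open>2 * s^2 + 8 * s * r * c + 12 * r^2 * c^2\<close>; the middle term is controlled by
  \<open>2 * \<bar>c\<bar> \<le> s\<close>, the inequality of the means, and the outcome is a
  quadratic form whose coefficients at \<open>A^2\<close>, \<open>A * B\<close> and
  \<open>B^2\<close> are at most 1, 2 and 1.\<close>

lemma variance_quadratic_bound:
  fixes A B rx ry r t :: real
  assumes A: "A \<ge> 0" and B: "B \<ge> 0" and rx: "rx \<ge> 0" and ry: "ry \<ge> 0"
    and c: "c^2 = rx * ry * A * B"
    and cx: "2 * rx^2 * (1 + 2 * \<bar>r\<bar>) \<le> 1" and cy: "2 * ry^2 * (1 + 2 * \<bar>r\<bar>) \<le> 1"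
    and cxy: "2 * rx * ry * (3 * r^2 + 2 * \<bar>r\<bar> + 1) \<le> 1"
  defines "s \<equiv> rx * A + ry * B" and "w \<equiv> rx * A + 2 * r * c + ry * B"
  shows "3 * w^2 - 2 * s * w + s^2 \<le> (A + B)^2"
proof -
  have s0: "s \<ge> 0" using assms by (simp add: s_def)
  have "(2 * \<bar>c\<bar>)^2 \<le> s^2"
  proof -
    have "s^2 - (2 * \<bar>c\<bar>)\<^sup>2 = (rx * A - ry * B)^2"
      unfolding power_mult_distrib power2_abs c s_def by (simp add: power2_eq_square algebra_simps)
    then show ?thesis by (metis diff_ge_0_iff_ge zero_le_power2)
  qed
  then have c2: "2 * \<bar>c\<bar> \<le> s" using s0 by (rule power2_le_imp_le)
  have rc: "r * (2 * c) \<le> \<bar>r\<bar> * s"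
  proof -
    have "r * (2 * c) \<le> \<bar>r * (2 * c)\<bar>" by (rule abs_ge_self)
    also have "... = \<bar>r\<bar> * (2 * \<bar>c\<bar>)" by (simp add: abs_mult)
    also have "... \<le> \<bar>r\<bar> * s" by (rule mult_left_mono[OF c2 abs_ge_zero])
    finally show ?thesis .
  qed
  have w: "w = s + 2 * r * c" by (simp add: w_def s_def)
  have "3 * w^2 - 2 * s * w + s^2 = 2 * s^2 + 4 * s * (r * (2 * c)) + 12 * r^2 * c^2"
    unfolding w by (simp add: power2_eq_square algebra_simps)
  also have "... \<le> 2 * s^2 + 4 * s * (\<bar>r\<bar> * s) + 12 * r^2 * c^2"
    using mult_left_mono[OF rc, of "4 * s"] s0 by simp
  also have "... = (2 * rx^2 * (1 + 2 * \<bar>r\<bar>)) * A^2 + (2 * ry^2 * (1 + 2 * \<bar>r\<bar>)) * B^2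
      + (2 * rx * ry * (3 * r^2 + 2 * \<bar>r\<bar> + 1)) * (2 * A * B)"
    unfolding c s_def by (simp add: power2_eq_square algebra_simps)
  also have "... \<le> 1 * A^2 + 1 * B^2 + 1 * (2 * A * B)"
    using A B by (intro add_mono mult_right_mono cx cy cxy) simp_all
  also have "... = (A + B)^2" by (simp add: power2_eq_square algebra_simps)
  finally show ?thesis .
qed

lemma square_perturb:
  fixes P :: complex and g e R :: real
  assumes "cmod (P - of_real g) \<le> e * R" "\<bar>g\<bar> \<le> R" "0 \<le> e" "e \<le> 1" "0 \<le> R"
  shows "cmod (P^2 - of_real (g^2)) \<le> 3 * e * R^2"
proof -
  have eR: "e * R \<le> R" using mult_right_mono[OF assms(4,5)] by simp
  have "P^2 - of_real (g^2) = (P - of_real g) * ((P - of_real g) + 2 * of_real g)"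
    by (simp add: power2_eq_square algebra_simps)
  then have "cmod (P^2 - of_real (g^2)) = cmod (P - of_real g) * cmod ((P - of_real g) + 2 * of_real g)"
    by (simp add: norm_mult)
  also have "... \<le> (e * R) * (3 * R)"
  proof (rule mult_mono[OF assms(1)])
    have "cmod ((P - of_real g) + 2 * of_real g) \<le> cmod (P - of_real g) + 2 * \<bar>g\<bar>"
      by (rule order_trans[OF norm_triangle_ineq]) (simp add: norm_mult)
    then show "cmod ((P - of_real g) + 2 * of_real g) \<le> 3 * R"
      using assms(1,2) eR by argo
  qed (use assms(3,5) in auto)
  finally show ?thesis by (simp add: power2_eq_square mult_ac)
qed

lemma nearD:
  assumes "near \<epsilon> x S P s g"
  shows "cmod (S - of_real s) \<le> \<epsilon> * (1 + \<bar>x\<bar>)" "cmod (P - of_real g) \<le> \<epsilon> * (1 + \<bar>x\<bar>)"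
    "\<bar>s\<bar> \<le> \<bar>g\<bar>" "\<bar>g\<bar> \<le> \<bar>x\<bar>" "\<bar>x\<bar> \<le> 2 * \<bar>g\<bar>"
  using assms by (auto simp: near_def)

text \<open>The drift enters the real part only through the imaginary parts of \<open>S1\<close> and
  \<open>S2\<close>, and these are small because the reference values are real. Hence \<mu>x and
  \<mu>y are not restricted.\<close>

lemma Re_step_den:
  fixes k \<mu>x \<mu>y :: real
  assumes n1: "near \<epsilon> x S1 P1 s1 g1" and n2: "near \<epsilon> y S2 P2 s2 g2" and k: "k \<ge> 0" and e: "0 \<le> \<epsilon>" "\<epsilon> \<le> 1"
  shows "1 + k * (g1^2 + g2^2) / 2 - (\<bar>\<mu>x\<bar> + \<bar>\<mu>y\<bar> + 3) * \<epsilon> * (k * (1 + \<bar>x\<bar> + \<bar>y\<bar>)^2)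
     \<le> Re (step_den k \<mu>x \<mu>y S1 P1 S2 P2)"
proof -
  define R where "R = 1 + \<bar>x\<bar> + \<bar>y\<bar>"
  have R1: "R \<ge> 1" "1 + \<bar>x\<bar> \<le> R" "1 + \<bar>y\<bar> \<le> R" "0 \<le> R" by (auto simp: R_def)
  have R2: "R \<le> R^2" using R1 by (simp add: self_le_power)
  have eR: "\<epsilon> * (1 + \<bar>x\<bar>) \<le> \<epsilon> * R" "\<epsilon> * (1 + \<bar>y\<bar>) \<le> \<epsilon> * R"
    using R1 e by (auto intro: mult_left_mono)
  have im: "\<bar>\<mu> * Im S\<bar> \<le> \<bar>\<mu>\<bar> * (\<epsilon> * R^2)" if "cmod (S - of_real s) \<le> \<epsilon> * z" "\<epsilon> * z \<le> \<epsilon> * R" for S s z \<mu>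
  proof -
    have "\<bar>Im S\<bar> = \<bar>Im (S - of_real s)\<bar>" by simp
    also have "... \<le> cmod (S - of_real s)" by (rule abs_Im_le_cmod)
    also have "... \<le> \<epsilon> * R^2" using that mult_left_mono[OF R2 e(1)] by linarith
    finally show ?thesis by (simp add: abs_mult mult_left_mono)
  qed
  have re: "Re (P^2) \<ge> g^2 - 3 * \<epsilon> * R^2" if "cmod (P - of_real g) \<le> \<epsilon> * z" "\<epsilon> * z \<le> \<epsilon> * R" "\<bar>g\<bar> \<le> R" for P g z
  proof -
    have "cmod (P^2 - of_real (g^2)) \<le> 3 * \<epsilon> * R^2"
      by (rule square_perturb) (use that e R1 in auto)
    moreover have "\<bar>Re (P^2 - of_real (g^2))\<bar> \<le> cmod (P^2 - of_real (g^2))" by (rule abs_Re_le_cmod)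
    moreover have "Re (P^2 - of_real (g^2)) = Re (P^2) - g\<^sup>2" by simp
    ultimately show ?thesis by linarith
  qed
  have g: "\<bar>g1\<bar> \<le> R" "\<bar>g2\<bar> \<le> R" using nearD(4)[OF n1] nearD(4)[OF n2] by (auto simp: R_def)
  have i: "\<mu>x * Im S1 + \<mu>y * Im S2 \<le> (\<bar>\<mu>x\<bar> + \<bar>\<mu>y\<bar>) * (\<epsilon> * R^2)"
    using im[OF nearD(1)[OF n1] eR(1), of \<mu>x] im[OF nearD(1)[OF n2] eR(2), of \<mu>y]
    unfolding distrib_right by linarith
  have r: "Re (P1^2) + Re (P2^2) \<ge> g1^2 + g2^2 - 6 * (\<epsilon> * R^2)"
    using re[OF nearD(2)[OF n1] eR(1) g(1)] re[OF nearD(2)[OF n2] eR(2) g(2)] by linarith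
  have "Re (step_den k \<mu>x \<mu>y S1 P1 S2 P2)
      = 1 - k * (\<mu>x * Im S1 + \<mu>y * Im S2) + k / 2 * (Re (P1^2) + Re (P2^2))"
    by (simp add: step_den_def del: power2_eq_square)
  also have "... \<ge> 1 - k * ((\<bar>\<mu>x\<bar> + \<bar>\<mu>y\<bar>) * (\<epsilon> * R^2)) + k / 2 * (g1^2 + g2^2 - 6 * (\<epsilon> * R^2))"
    using mult_left_mono[OF i k] mult_left_mono[OF r, of "k / 2"] k by simp
  also have "1 - k * ((\<bar>\<mu>x\<bar> + \<bar>\<mu>y\<bar>) * (\<epsilon> * R^2)) + k / 2 * (g1^2 + g2^2 - 6 * (\<epsilon> * R^2))
      = 1 + k * (g1^2 + g2^2) / 2 - (\<bar>\<mu>x\<bar> + \<bar>\<mu>y\<bar> + 3) * \<epsilon> * (k * R^2)"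
    by (simp add: algebra_simps)
  finally show ?thesis by (simp add: R_def)
qed

text \<open>
  Here \<open>y\<close> is the exponent gained by one implicit step, \<open>t\<close> is the size of the perturbation
  and \<open>L\<close> bounds the modulus of the denominator from below.
\<close>

lemma ratio_bound:
  fixes \<rho>m y k t C1 C2 \<epsilon> K2 L n :: real
  assumes y: "0 \<le> y" "y \<le> K2" and k: "k \<ge> 0" and t: "0 \<le> t" "t \<le> 3 * k + 12 * y" "t \<le> K2"
    and C: "C1 \<ge> 0" "C2 \<ge> 0" and e: "\<epsilon> \<ge> 0" "C2 * \<epsilon> * K2 \<le> 1 / 2"
    and \<rho>: "\<rho>m < 1" and e2: "12 * \<epsilon> * (C1 + 2 * (1 + K2) * C2) \<le> (1 - \<rho>m) / 2"
    and n: "n \<le> 1 + \<rho>m * y + y^2 / 4 + C1 * \<epsilon> * t" "n \<ge> 0"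
    and L: "L \<ge> 1 + y / 2 - C2 * \<epsilon> * t"
  shows "L \<ge> 1 / 2" and "n / L^2 \<le> exp (- ((1 - \<rho>m) / (2 * (1 + K2)^2)) * y + (1 - \<rho>m) / 2 * k)"
proof -
  define l where "l = 1 + y / 2 - C2 * \<epsilon> * t"
  have Ct: "0 \<le> C2 * \<epsilon> * t" "C2 * \<epsilon> * t \<le> C2 * \<epsilon> * K2"
    using C e t by (auto intro: mult_left_mono)
  have l: "1 / 2 \<le> l" "l \<le> 1 + K2" using Ct e y by (auto simp: l_def)
  with L show L12: "L \<ge> 1 / 2" by (simp add: l_def)
  have ll: "1 / 4 \<le> l^2" "l^2 \<le> (1 + K2)^2"
    using power_mono[OF l(1), of 2] power_mono[OF l(2), of 2] l by (auto simp: power2_eq_square)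
  have "n - l\<^sup>2 \<le> (1 + \<rho>m * y + y^2 / 4 + C1 * \<epsilon> * t) - l\<^sup>2" using n by simp
  \<comment> \<open>The quadratic terms \<open>y^2 / 4\<close> cancel; the linear terms leave the
    gap \<open>1 - \<rho>m\<close>.\<close>
  also have "... = - (1 - \<rho>m) * y + C1 * \<epsilon> * t + (2 + y) * (C2 * \<epsilon> * t) - (C2 * \<epsilon> * t)\<^sup>2"
    unfolding l_def by (simp add: power2_eq_square field_simps)
  also have "... \<le> - (1 - \<rho>m) * y + C1 * \<epsilon> * t + (2 * (1 + K2)) * (C2 * \<epsilon> * t)"
  proof -
    have "(2 + y) * (C2 * \<epsilon> * t) \<le> (2 * (1 + K2)) * (C2 * \<epsilon> * t)"
      using y Ct by (intro mult_right_mono) auto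
    then show ?thesis using zero_le_power2[of "C2 * \<epsilon> * t"] by linarith
  qed
  also have "... = - (1 - \<rho>m) * y + \<epsilon> * (C1 + 2 * (1 + K2) * C2) * t"
    by (simp add: algebra_simps)
  also have "... \<le> - (1 - \<rho>m) * y + \<epsilon> * (C1 + 2 * (1 + K2) * C2) * (3 * k + 12 * y)"
    using t C e y by (intro add_left_mono mult_left_mono) auto
  also have "... = - (1 - \<rho>m) * y + (12 * \<epsilon> * (C1 + 2 * (1 + K2) * C2)) * (k / 4 + y)"
    by (simp add: algebra_simps)
  \<comment> \<open>Half of the gap pays for all the terms in \<epsilon>.\<close>
  also have "... \<le> - (1 - \<rho>m) * y + (1 - \<rho>m) / 2 * (k / 4 + y)"
    using k y by (intro add_left_mono mult_right_mono e2) auto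
  also have "... = - ((1 - \<rho>m) / 2 * y) + (1 - \<rho>m) / 8 * k"
    by (simp add: field_simps)
  finally have d: "n - l\<^sup>2 \<le> - ((1 - \<rho>m) / 2 * y) + (1 - \<rho>m) / 8 * k" .
  have "n / L^2 \<le> n / l^2"
    using n(2) L l by (intro divide_left_mono power_mono) (auto simp: l_def)
  also have "... = 1 + (n - l\<^sup>2) / l^2" using l by (simp add: field_simps)
  also have "... \<le> 1 + (- ((1 - \<rho>m) / 2 * y) + (1 - \<rho>m) / 8 * k) / l^2"
    using d by (intro add_left_mono divide_right_mono) auto
  also have "... = 1 - ((1 - \<rho>m) / 2 * y) / l^2 + ((1 - \<rho>m) / 8 * k) / l^2"
    by (simp add: add_divide_distrib diff_divide_distrib)
  also have "... \<le> 1 - ((1 - \<rho>m) / 2 * y) / (1 + K2)^2 + ((1 - \<rho>m) / 8 * k) / (1 / 4)"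
  proof -
    have "((1 - \<rho>m) / 2 * y) / (1 + K2)^2 \<le> ((1 - \<rho>m) / 2 * y) / l^2"
      using ll l y \<rho> by (intro divide_left_mono) auto
    moreover have "((1 - \<rho>m) / 8 * k) / l^2 \<le> ((1 - \<rho>m) / 8 * k) / (1 / 4)"
      using ll l k \<rho> by (intro divide_left_mono) auto
    ultimately show ?thesis by linarith
  qed
  also have "... = 1 + (- ((1 - \<rho>m) / (2 * (1 + K2)^2)) * y + (1 - \<rho>m) / 2 * k)"
    by (simp add: field_simps)
  also have "... \<le> exp (- ((1 - \<rho>m) / (2 * (1 + K2)^2)) * y + (1 - \<rho>m) / 2 * k)"
    by (rule exp_ge_add_one_self)
  finally show "n / L^2 \<le> exp (- ((1 - \<rho>m) / (2 * (1 + K2)^2)) * y + (1 - \<rho>m) / 2 * k)" .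
qed

definition step_factor ::
  "real \<Rightarrow> real \<Rightarrow> real \<Rightarrow> real \<Rightarrow> real \<Rightarrow> complex \<Rightarrow> complex \<Rightarrow> complex \<Rightarrow> complex \<Rightarrow> real \<Rightarrow> real \<Rightarrow> complex" where
  "step_factor k \<mu>x \<mu>y \<rho>x \<rho>y S1 P1 S2 P2 u v
    = step_num (complex_of_real (sqrt (k * \<rho>x)) * S1) (complex_of_real (sqrt (k * \<rho>y)) * S2) u v / step_den k \<mu>x \<mu>y S1 P1 S2 P2"

text \<open>The order of the quantifiers matters: \<epsilon> and \<open>c\<close> depend on the
  coefficients and on \<open>K\<close>, but neither on the time step nor on the frequencies, so that
  one choice serves every level.\<close>

theorem step_stability:
  fixes \<mu>x \<mu>y \<rho>x \<rho>y \<rho>xy K :: real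
  assumes rx: "0 \<le> \<rho>x" "\<rho>x < 1" and ry: "0 \<le> \<rho>y" "\<rho>y < 1"
    and cx: "2 * \<rho>x^2 * (1 + 2 * \<bar>\<rho>xy\<bar>) \<le> 1" and cy: "2 * \<rho>y^2 * (1 + 2 * \<bar>\<rho>xy\<bar>) \<le> 1"
    and cxy: "2 * \<rho>x * \<rho>y * (3 * \<rho>xy^2 + 2 * \<bar>\<rho>xy\<bar> + 1) \<le> 1" and K: "K \<ge> 0"
  obtains \<epsilon> c where "0 < \<epsilon>" "\<epsilon> \<le> 1" "0 < c"
    "\<And>(M :: 'a measure) U V k x y S1 P1 S2 P2 s1 g1 s2 g2.
       gauss_pair M \<rho>xy U V \<Longrightarrow> 0 \<le> k \<Longrightarrow> sqrt k * (1 + \<bar>x\<bar> + \<bar>y\<bar>) \<le> K \<Longrightarrow>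
       near \<epsilon> x S1 P1 s1 g1 \<Longrightarrow> near \<epsilon> y S2 P2 s2 g2 \<Longrightarrow>
       1 / 2 \<le> Re (step_den k \<mu>x \<mu>y S1 P1 S2 P2) \<and>
       integrable M (\<lambda>w. (cmod (step_factor k \<mu>x \<mu>y \<rho>x \<rho>y S1 P1 S2 P2 (U w) (V w)))^2) \<and>
       (\<integral>w. (cmod (step_factor k \<mu>x \<mu>y \<rho>x \<rho>y S1 P1 S2 P2 (U w) (V w)))^2 \<partial>M)
         \<le> exp (- c * (k * (x^2 + y^2)) + k)"
proof -
  define \<rho>m where "\<rho>m = max \<rho>x \<rho>y"
  have \<rho>m: "\<rho>m < 1" "\<rho>x \<le> \<rho>m" "\<rho>y \<le> \<rho>m" "0 \<le> \<rho>m" using rx ry by (auto simp: \<rho>m_def)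
  define C1 where "C1 = (10 + 2 * (1 + 2 * K) * (1 + 5 * K) + (1 + 5 * K)^2) * (4 * exp (32::real))"
  define C2 where "C2 = \<bar>\<mu>x\<bar> + \<bar>\<mu>y\<bar> + 3"
  define K2 where "K2 = K^2"
  have C1: "C1 \<ge> 0" unfolding C1_def using K by (intro mult_nonneg_nonneg add_nonneg_nonneg) auto
  have C2: "C2 \<ge> 0" by (simp add: C2_def)
  have K2: "K2 \<ge> 0" by (simp add: K2_def)
  define C3 where "C3 = 1 + C1 + 2 * (1 + K2) * C2"
  have C3: "C3 > 0" unfolding C3_def using C1 C2 K2 by (intro add_pos_nonneg) auto
  \<comment> \<open>The second bound keeps the denominator above 1/2 for all frequencies with
    \<open>sqrt k * R \<le> K\<close>; the third lets half of the gap \<open>1 - \<rho>m\<close>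
    absorb the perturbations of numerator and denominator.\<close>
  define \<epsilon> where "\<epsilon> = min 1 (min (1 / (2 * (1 + C2 * K2))) ((1 - \<rho>m) / (24 * C3)))"
  have CK: "0 \<le> C2 * K2" using C2 K2 by simp
  have e0: "0 < \<epsilon>" unfolding \<epsilon>_def using \<rho>m C3 CK by auto
  have e1: "\<epsilon> \<le> 1" by (simp add: \<epsilon>_def)
  have e2: "C2 * \<epsilon> * K2 \<le> 1 / 2"
  proof -
    have "\<epsilon> \<le> 1 / (2 * (1 + C2 * K2))" by (simp add: \<epsilon>_def)
    then have "(C2 * K2) * \<epsilon> \<le> (C2 * K2) * (1 / (2 * (1 + C2 * K2)))" using CK by (rule mult_left_mono)
    also have "... \<le> 1 / 2" using CK by (simp add: field_simps)
    finally show ?thesis by (simp add: mult_ac)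
  qed
  have e3: "12 * \<epsilon> * (C1 + 2 * (1 + K2) * C2) \<le> (1 - \<rho>m) / 2"
  proof -
    have "\<epsilon> \<le> (1 - \<rho>m) / (24 * C3)" by (simp add: \<epsilon>_def)
    then have "\<epsilon> * C3 \<le> (1 - \<rho>m) / 24" using C3 by (simp add: field_simps)
    moreover have "\<epsilon> * (C1 + 2 * (1 + K2) * C2) \<le> \<epsilon> * C3"
      using e0 by (intro mult_left_mono) (auto simp: C3_def)
    ultimately have "12 * (\<epsilon> * (C1 + 2 * (1 + K2) * C2)) \<le> (1 - \<rho>m) / 2" by argo
    then show ?thesis by (simp only: mult.assoc)
  qed
  define c0 where "c0 = (1 - \<rho>m) / (2 * (1 + K2)^2)"
  have c0: "c0 > 0" using \<rho>m K2 by (simp add: c0_def)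
  show thesis
  proof (rule that[OF e0 e1, of "c0 / 4"])
    show "c0 / 4 > 0" using c0 by simp
    fix M :: "'a measure" and U V k x y S1 P1 S2 P2 s1 g1 s2 g2
    assume gp: "gauss_pair M \<rho>xy U V" and k: "0 \<le> k" and kK: "sqrt k * (1 + \<bar>x\<bar> + \<bar>y\<bar>) \<le> K"
      and n1: "near \<epsilon> x S1 P1 s1 g1" and n2: "near \<epsilon> y S2 P2 s2 g2"
    interpret gauss_pair M \<rho>xy U V by fact
    define R where "R = 1 + \<bar>x\<bar> + \<bar>y\<bar>"
    define \<tau> where "\<tau> = sqrt k * R"
    have R: "1 \<le> R" "1 + \<bar>x\<bar> \<le> R" "1 + \<bar>y\<bar> \<le> R" "\<bar>x\<bar> \<le> R" "\<bar>y\<bar> \<le> R" "0 \<le> R" by (auto simp: R_def)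
    have \<tau>0: "0 \<le> \<tau>" using k R by (simp add: \<tau>_def)
    have \<tau>K: "\<tau> \<le> K" using kK by (simp add: \<tau>_def R_def)
    have \<tau>2: "\<tau>^2 = k * R^2" using k by (simp add: \<tau>_def power_mult_distrib)
    have \<tau>K2: "\<tau>^2 \<le> K2" unfolding K2_def by (rule power_mono[OF \<tau>K \<tau>0])
    define yy where "yy = k * (g1^2 + g2^2)"
    have sqx: "x^2 \<le> 4 * g1^2" using power_mono[OF nearD(5)[OF n1] abs_ge_zero, of 2] by (simp add: power_mult_distrib)
    have sqy: "y^2 \<le> 4 * g2^2" using power_mono[OF nearD(5)[OF n2] abs_ge_zero, of 2] by (simp add: power_mult_distrib)
    have yy0: "0 \<le> yy" using k by (simp add: yy_def)
    have g12: "g1^2 + g2^2 \<le> R^2"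
    proof -
      have "g1^2 + g2^2 \<le> \<bar>x\<bar>^2 + \<bar>y\<bar>^2"
        using power_mono[OF nearD(4)[OF n1] abs_ge_zero, of 2] power_mono[OF nearD(4)[OF n2] abs_ge_zero, of 2] by simp
      also have "... \<le> (\<bar>x\<bar> + \<bar>y\<bar>)^2" by (simp add: power2_sum)
      also have "... \<le> R^2" by (rule power_mono) (auto simp: R_def)
      finally show ?thesis .
    qed
    have yyK: "yy \<le> K2" using mult_left_mono[OF g12 k] \<tau>2 \<tau>K2 by (simp add: yy_def)
    \<comment> \<open>\<open>(1 + p + q)^2 \<le> 3 * (1 + p^2 + q^2)\<close> together with
      \<open>x^2 \<le> 4 * g1^2\<close>. This compares the perturbation, which is proportional to
      \<open>k * R^2\<close>, with the damping \<open>yy\<close>.\<close>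
    have R2: "R^2 \<le> 3 + 12 * (g1^2 + g2^2)"
    proof -
      have "3 + 3 * \<bar>x\<bar>^2 + 3 * \<bar>y\<bar>^2 - R\<^sup>2 = (1 - \<bar>x\<bar>)^2 + (1 - \<bar>y\<bar>)^2 + (\<bar>x\<bar> - \<bar>y\<bar>)^2"
        unfolding R_def by (simp only: power2_eq_square) (simp add: algebra_simps)
      also have "... \<ge> 0" by simp
      finally have "R^2 \<le> 3 + 3 * x^2 + 3 * y^2" by (simp only: power2_abs diff_ge_0_iff_ge)
      then show ?thesis using sqx sqy by argo
    qed
    have \<tau>y: "\<tau>^2 \<le> 3 * k + 12 * yy"
      using mult_left_mono[OF R2 k] unfolding \<tau>2 yy_def by (simp add: algebra_simps)
    define p q where "p = complex_of_real (sqrt (k * \<rho>x)) * S1" and "q = complex_of_real (sqrt (k * \<rho>y)) * S2"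
    define a b where "a = sqrt (k * \<rho>x) * s1" and "b = sqrt (k * \<rho>y) * s2"
    have pert: "cmod (complex_of_real (sqrt (k * \<rho>)) * S - of_real (sqrt (k * \<rho>) * s)) \<le> \<epsilon> * \<tau> \<and> \<bar>sqrt (k * \<rho>) * s\<bar> \<le> \<tau>"
      if n: "near \<epsilon> z S P s g" and z: "1 + \<bar>z\<bar> \<le> R" "\<bar>z\<bar> \<le> R" and \<rho>: "0 \<le> \<rho>" "\<rho> < 1" for z S P s g \<rho>
    proof
      have sk: "sqrt (k * \<rho>) \<le> sqrt k" using k \<rho> by (simp add: mult_left_le)
      have "cmod (complex_of_real (sqrt (k * \<rho>)) * S - of_real (sqrt (k * \<rho>) * s)) = sqrt (k * \<rho>) * cmod (S - of_real s)"
        using k \<rho> by (simp add: norm_mult flip: right_diff_distrib)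
      also have "... \<le> sqrt k * (\<epsilon> * R)"
      proof (rule mult_mono[OF sk])
        show "cmod (S - of_real s) \<le> \<epsilon> * R"
          using nearD(1)[OF n] mult_left_mono[OF z(1), of \<epsilon>] e0 by linarith
      qed (use k in auto)
      finally show "cmod (complex_of_real (sqrt (k * \<rho>)) * S - of_real (sqrt (k * \<rho>) * s)) \<le> \<epsilon> * \<tau>"
        by (simp add: \<tau>_def mult_ac)
      have "\<bar>sqrt (k * \<rho>) * s\<bar> = sqrt (k * \<rho>) * \<bar>s\<bar>" using k \<rho> by (simp add: abs_mult)
      also have "... \<le> sqrt k * R"
        using nearD(3,4)[OF n] z k \<rho> by (intro mult_mono sk) auto
      finally show "\<bar>sqrt (k * \<rho>) * s\<bar> \<le> \<tau>" by (simp add: \<tau>_def)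
    qed
    note pa = pert[OF n1 R(2,4) rx, folded p_def a_def] and qb = pert[OF n2 R(3,5) ry, folded q_def b_def]
    note num = integral_step_num_perturb[OF conjunct1[OF pa] conjunct1[OF qb] conjunct2[OF pa] conjunct2[OF qb]
        less_imp_le[OF e0] e1 \<tau>0 \<tau>K, folded C1_def]
    define n where "n = (\<integral>w. (cmod (step_num p q (U w) (V w)))^2 \<partial>M)"
    define L where "L = Re (step_den k \<mu>x \<mu>y S1 P1 S2 P2)"
    have n0: "n \<ge> 0" by (simp add: n_def)
    have a2: "a^2 = \<rho>x * (k * s1^2)" "b^2 = \<rho>y * (k * s2^2)"
      using k rx ry by (auto simp: a_def b_def power_mult_distrib)
    have s12: "k * s1^2 \<le> k * g1^2" "k * s2^2 \<le> k * g2^2"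
      using power_mono[OF nearD(3)[OF n1] abs_ge_zero, of 2] power_mono[OF nearD(3)[OF n2] abs_ge_zero, of 2] k
      by (auto intro: mult_left_mono)
    \<comment> \<open>Here the conditions on the correlations enter, with
      \<open>A = k * s1^2\<close> and \<open>B = k * s2^2\<close>.\<close>
    have q: "3 * (a^2 + 2 * \<rho>xy * a * b + b^2)^2 - 2 * (a^2 + b^2) * (a^2 + 2 * \<rho>xy * a * b + b^2) + (a^2 + b^2)^2 \<le> yy^2"
    proof -
      have "(a * b)^2 = \<rho>x * \<rho>y * (k * s1^2) * (k * s2^2)"
        by (simp add: power_mult_distrib a2)
      from variance_quadratic_bound[OF _ _ rx(1) ry(1) this cx cy cxy] k
      have "3 * (a^2 + 2 * \<rho>xy * a * b + b^2)^2 - 2 * (a^2 + b^2) * (a^2 + 2 * \<rho>xy * a * b + b^2) + (a^2 + b^2)^2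
         \<le> (k * s1^2 + k * s2^2)^2"
        by (simp only: a2[symmetric] mult.assoc[of _ a b] mult_nonneg_nonneg zero_le_power2 simp_thms)
      also have "... \<le> yy^2"
        using s12 k by (intro power_mono) (auto simp: yy_def distrib_left)
      finally show ?thesis .
    qed
    have sy: "a^2 + b^2 \<le> \<rho>m * yy"
    proof -
      have "\<rho>x * (k * s1^2) \<le> \<rho>m * (k * g1^2)" by (rule mult_mono[OF \<rho>m(2) s12(1) \<rho>m(4)]) (use k in simp)
      moreover have "\<rho>y * (k * s2^2) \<le> \<rho>m * (k * g2^2)" by (rule mult_mono[OF \<rho>m(3) s12(2) \<rho>m(4)]) (use k in simp)
      ultimately show ?thesis unfolding a2 yy_def by (simp add: distrib_left)
    qed
    have nb: "n \<le> 1 + \<rho>m * yy + yy^2 / 4 + C1 * \<epsilon> * \<tau>^2"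
    proof -
      have "\<epsilon> * \<tau>^2 * C1 = C1 * \<epsilon> * \<tau>^2" by (simp add: mult_ac)
      then show ?thesis using num(2) q sy unfolding n_def by argo
    qed
    have Lb: "L \<ge> 1 + yy / 2 - C2 * \<epsilon> * \<tau>^2"
      using Re_step_den[OF n1 n2 k less_imp_le[OF e0] e1, of \<mu>x \<mu>y]
      by (simp add: L_def yy_def C2_def \<tau>2 R_def)
    note rb = ratio_bound[OF yy0 yyK k zero_le_power2 \<tau>y \<tau>K2 C1 C2 less_imp_le[OF e0] e2 \<rho>m(1) e3 nb n0 Lb]
    have Lle: "L \<le> cmod (step_den k \<mu>x \<mu>y S1 P1 S2 P2)" unfolding L_def by (rule complex_Re_le_cmod)
    have fac: "(cmod (step_factor k \<mu>x \<mu>y \<rho>x \<rho>y S1 P1 S2 P2 (U w) (V w)))^2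
       = (cmod (step_num p q (U w) (V w)))^2 / (cmod (step_den k \<mu>x \<mu>y S1 P1 S2 P2))^2" for w
      by (simp add: step_factor_def p_def q_def norm_divide power_divide)
    have int: "integrable M (\<lambda>w. (cmod (step_factor k \<mu>x \<mu>y \<rho>x \<rho>y S1 P1 S2 P2 (U w) (V w)))^2)"
      unfolding fac by (rule integrable_divide_zero) (use num(1) in auto)
    have "(\<integral>w. (cmod (step_factor k \<mu>x \<mu>y \<rho>x \<rho>y S1 P1 S2 P2 (U w) (V w)))^2 \<partial>M)
        = n / (cmod (step_den k \<mu>x \<mu>y S1 P1 S2 P2))^2"
      unfolding fac n_def by (rule integral_divide_zero)
    also have "... \<le> n / L^2"
    proof -
      have "L^2 \<le> (cmod (step_den k \<mu>x \<mu>y S1 P1 S2 P2))^2"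
        using rb(1) Lle by (intro power_mono) auto
      moreover have "0 < L^2" using rb(1) by simp
      ultimately show ?thesis using n0 by (intro divide_left_mono mult_pos_pos) auto
    qed
    also have "... \<le> exp (- c0 * yy + (1 - \<rho>m) / 2 * k)" using rb(2) by (simp only: c0_def)
    also have "... \<le> exp (- (c0 / 4) * (k * (x^2 + y^2)) + k)"
    proof -
      have "k * (x^2 + y^2) \<le> 4 * yy"
        using mult_left_mono[OF add_mono[OF sqx sqy] k] by (simp add: yy_def algebra_simps)
      then have "c0 / 4 * (k * (x^2 + y^2)) \<le> c0 / 4 * (4 * yy)" using c0 by (intro mult_left_mono) auto
      moreover have "(1 - \<rho>m) / 2 * k \<le> 1 * k" using k \<rho>m by (intro mult_right_mono) auto
      ultimately show ?thesis by simp
    qed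
    finally have "(\<integral>w. (cmod (step_factor k \<mu>x \<mu>y \<rho>x \<rho>y S1 P1 S2 P2 (U w) (V w)))^2 \<partial>M)
         \<le> exp (- (c0 / 4) * (k * (x^2 + y^2)) + k)" .
    with rb(1) int show "1 / 2 \<le> Re (step_den k \<mu>x \<mu>y S1 P1 S2 P2) \<and>
       integrable M (\<lambda>w. (cmod (step_factor k \<mu>x \<mu>y \<rho>x \<rho>y S1 P1 S2 P2 (U w) (V w)))^2) \<and>
       (\<integral>w. (cmod (step_factor k \<mu>x \<mu>y \<rho>x \<rho>y S1 P1 S2 P2 (U w) (V w)))^2 \<partial>M)
         \<le> exp (- (c0 / 4) * (k * (x^2 + y^2)) + k)"
      by (simp add: L_def)
  qed
qed

section \<open>Discrete symbols\<close>

definition csinc :: "complex \<Rightarrow> complex" where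
  "csinc w = (if w = 0 then 1 else sin w / w)"

lemma csinc_mult: "w * csinc w = sin w"
  by (simp add: csinc_def)

lemma csinc_minus [simp]: "csinc (- w) = csinc w"
  by (simp add: csinc_def)

text \<open>The origin is a removable singularity: the difference quotient of \<open>sin\<close>,
  extended by the derivative, is entire.\<close>

lemma holomorphic_csinc_UNIV: "csinc holomorphic_on UNIV"
proof -
  have "(\<lambda>z. if z = 0 then deriv sin 0 else (sin z - sin 0) / (z - 0)) holomorphic_on (UNIV :: complex set)"
    by (rule pole_lemma_open) (auto intro: holomorphic_intros)
  also have "(\<lambda>z. if z = 0 then deriv sin 0 else (sin z - sin 0) / (z - 0)) = csinc"
    by (auto simp: csinc_def fun_eq_iff intro!: DERIV_imp_deriv derivative_eq_intros)
  finally show ?thesis .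
qed

lemma holomorphic_csinc [holomorphic_intros]:
  "f holomorphic_on A \<Longrightarrow> (\<lambda>z. csinc (f z)) holomorphic_on A"
  using holomorphic_on_compose_gen[OF _ holomorphic_csinc_UNIV, of f A] by (simp add: o_def)

lemma continuous_csinc [continuous_intros]:
  "continuous_on A f \<Longrightarrow> continuous_on A (\<lambda>z. csinc (f z))"
  using continuous_on_compose2[OF holomorphic_on_imp_continuous_on[OF holomorphic_csinc_UNIV], of A f] by simp

lemma measurable_csinc [measurable]: "csinc \<in> borel_measurable borel"
  by (intro borel_measurable_continuous_onI continuous_intros)

lemma csinc_bound:
  assumes "cmod w \<le> 1"
  shows "cmod (csinc w - 1) \<le> 2 * (cmod w)^2"
proof (cases "w = 0")
  case True then show ?thesis by (simp add: csinc_def)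
next
  case False
  have sum: "(\<Sum>k\<le>2. complex_of_real (sin_coeff k) * w ^ k) = w"
    by (simp add: numeral_2_eq_2 sin_coeff_def)
  have e: "exp \<bar>Im w\<bar> \<le> 3"
  proof -
    have "exp \<bar>Im w\<bar> \<le> exp 1" using assms abs_Im_le_cmod[of w] by simp
    then show ?thesis using exp_le by linarith
  qed
  have "cmod (sin w - w) \<le> exp \<bar>Im w\<bar> * cmod w ^ 3 / 2"
    using Taylor_sin[of w 2] unfolding sum by (simp add: numeral_3_eq_3 numeral_2_eq_2)
  also have "... \<le> 4 * cmod w ^ 3 / 2"
    using e by (intro divide_right_mono mult_right_mono) auto
  finally have b: "cmod (sin w - w) \<le> 2 * (cmod w)^2 * cmod w" by (simp add: power3_eq_cube power2_eq_square)
  have "csinc w - 1 = (sin w - w) / w" using False by (simp add: csinc_def diff_divide_distrib)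
  then have "cmod (csinc w - 1) = cmod (sin w - w) / cmod w" by (simp add: norm_divide)
  also have "... \<le> 2 * (cmod w)^2" using b False by (simp add: pos_divide_le_eq)
  finally show ?thesis .
qed

lemma cos_minus_1_bound:
  fixes w :: complex
  assumes "cmod w \<le> 1"
  shows "cmod (cos w - 1) \<le> 3 * (cmod w)^2"
proof -
  have sum: "(\<Sum>k\<le>1. complex_of_real (cos_coeff k) * w ^ k) = 1"
    by (simp add: cos_coeff_def)
  have e: "exp \<bar>Im w\<bar> \<le> 3"
  proof -
    have "exp \<bar>Im w\<bar> \<le> exp 1" using assms abs_Im_le_cmod[of w] by simp
    then show ?thesis using exp_le by linarith
  qed
  have "cmod (cos w - 1) \<le> exp \<bar>Im w\<bar> * (cmod w)^2"
    using Taylor_cos[of w 1] unfolding sum by (simp add: numeral_2_eq_2)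
  also have "... \<le> 3 * (cmod w)^2" using e by (intro mult_right_mono) auto
  finally show ?thesis .
qed

text \<open>
  \<open>fsym \<xi> h\<close> is the symbol of the central difference \<open>Dx / (2 \<i> h)\<close>, \<open>(fsym \<xi> (h / 2))^2\<close> that of
  \<open>- Dxx / h^2\<close>, and \<open>gsym \<xi> h\<close> that of the trapezoidal sum over a half line. Written in terms of
  \<open>csinc\<close> they are holomorphic in \<open>h\<close> near \<open>0\<close>.
\<close>

definition fsym :: "complex \<Rightarrow> complex \<Rightarrow> complex" where
  "fsym \<xi> h = \<xi> * csinc (\<xi> * h)"

definition gsym :: "complex \<Rightarrow> complex \<Rightarrow> complex" where
  "gsym \<xi> h = \<i> / \<xi> * cos (\<xi> * h / 2) / csinc (\<xi> * h / 2)"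

lemma fsym_eq: "h \<noteq> 0 \<Longrightarrow> fsym \<xi> h = sin (\<xi> * h) / h"
  using csinc_mult[of "\<xi> * h"] by (simp add: fsym_def field_simps)

lemma fsym_minus [simp]: "fsym \<xi> (- h) = fsym \<xi> h" and gsym_minus [simp]: "gsym \<xi> (- h) = gsym \<xi> h"
  by (simp_all add: fsym_def gsym_def)

text \<open>On the line of height \<open>b\<close> the shift changes the sine by little, and the
  sine stays away from 0 because its modulus is at least \<open>sinh b \<ge> b\<close>. The lower
  bound keeps \<open>gsym\<close> away from its poles on the shifted contour.\<close>

lemma sin_shift_bound:
  fixes a b :: real
  assumes "b \<ge> 0"
  shows "cmod (sin (Complex a b) - of_real (sin a)) \<le> b * exp b" and "b \<le> cmod (sin (Complex a b))"
    and "cmod (cos (Complex a b)) \<le> exp b"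
proof -
  have E: "exp (\<i> * Complex a b) = of_real (exp (- b)) * cis a" "exp (- (\<i> * Complex a b)) = of_real (exp b) * cis (- a)"
    by (simp_all add: exp_eq_polar)
  have s: "sin (Complex a b) = (of_real (exp (- b)) * cis a - of_real (exp b) * cis (- a)) / (2 * \<i>)"
    unfolding sin_exp_eq E ..
  have s0: "complex_of_real (sin a) = (cis a - cis (- a)) / (2 * \<i>)"
    by (simp add: complex_eq_iff)
  have c: "cos (Complex a b) = (of_real (exp (- b)) * cis a + of_real (exp b) * cis (- a)) / 2"
    unfolding cos_exp_eq E ..
  have eb: "exp (- b) \<le> 1" "1 \<le> exp b" "1 - exp (- b) \<le> b" "1 + b \<le> exp b"
    using assms exp_ge_add_one_self[of "- b"] exp_ge_add_one_self[of b] by auto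
  have bexp: "exp b - 1 \<le> b * exp b"
  proof -
    have "exp b * (1 - exp (- b)) \<le> exp b * b" using eb by (intro mult_left_mono) auto
    then show ?thesis by (simp add: right_diff_distrib exp_minus mult_ac)
  qed
  have gen: "(A * c - B * d) / w - (c - d) / w = ((A - 1) * c - (B - 1) * d) / w" for A B c d w :: complex
  proof -
    have "(A * c - B * d) - (c - d) = (A - 1) * c - (B - 1) * d" by (simp add: algebra_simps)
    then show ?thesis by (simp only: diff_divide_distrib[symmetric])
  qed
  have n2: "cmod (2 * \<i>) = 2" by (simp add: norm_mult)
  have "sin (Complex a b) - of_real (sin a) = (of_real (exp (- b) - 1) * cis a - of_real (exp b - 1) * cis (- a)) / (2 * \<i>)"
    unfolding s s0 of_real_diff of_real_1 by (rule gen)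
  then have "cmod (sin (Complex a b) - of_real (sin a)) = cmod (of_real (exp (- b) - 1) * cis a - of_real (exp b - 1) * cis (- a)) / 2"
    by (simp only: norm_divide n2)
  also have "... \<le> (cmod (of_real (exp (- b) - 1) * cis a) + cmod (of_real (exp b - 1) * cis (- a))) / 2"
    by (intro divide_right_mono norm_triangle_ineq4) auto
  also have "... = ((1 - exp (- b)) + (exp b - 1)) / 2"
  proof -
    have "\<bar>exp (- b) - 1\<bar> = 1 - exp (- b)" 
      using abs_of_nonpos[OF iffD2[OF diff_le_0_iff_le eb(1)]] by (simp only: minus_diff_eq)
    moreover have "\<bar>exp b - 1\<bar> = exp b - 1" by (rule abs_of_nonneg[OF iffD2[OF diff_ge_0_iff_ge eb(2)]])
    ultimately show ?thesis by (simp only: norm_mult norm_cis norm_of_real mult_1_right)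
  qed
  also have "... \<le> b * exp b"
  proof -
    have "b * 1 \<le> b * exp b" by (rule mult_left_mono[OF eb(2) assms])
    then have "((1 - exp (- b)) + (exp b - 1)) / 2 \<le> (b * exp b + b * exp b) / 2"
      using order_trans[OF eb(3)] bexp by (intro divide_right_mono add_mono) simp_all
    then show ?thesis by simp
  qed
  finally show "cmod (sin (Complex a b) - of_real (sin a)) \<le> b * exp b" .
  have "2 * cmod (sin (Complex a b)) = cmod (of_real (exp b) * cis (- a) - of_real (exp (- b)) * cis a)"
    unfolding s by (simp add: norm_divide norm_mult norm_minus_commute)
  also have "... \<ge> cmod (of_real (exp b) * cis (- a)) - cmod (of_real (exp (- b)) * cis a)"
    by (rule norm_triangle_ineq2)
  finally have "2 * cmod (sin (Complex a b)) \<ge> exp b - exp (- b)"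
    by (simp only: norm_mult norm_cis norm_of_real) simp
  moreover have "exp b - exp (- b) \<ge> 2 * b"
  proof -
    have "(\<lambda>b. exp b - exp (- b) - 2 * b) 0 \<le> (\<lambda>b. exp b - exp (- b) - 2 * b) (b::real)"
    proof (rule DERIV_nonneg_imp_nondecreasing[OF assms])
      fix x :: real
      have "exp x + exp (- x) - 2 \<ge> 0"
        using exp_ge_add_one_self[of x] exp_ge_add_one_self[of "- x"] by linarith
      moreover have "((\<lambda>b. exp b - exp (- b) - 2 * b) has_real_derivative exp x + exp (- x) - 2) (at x)"
        by (auto intro!: derivative_eq_intros)
      ultimately show "\<exists>y. ((\<lambda>b. exp b - exp (- b) - 2 * b) has_real_derivative y) (at x) \<and> 0 \<le> y" by blast
    qed
    then show ?thesis by simp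
  qed
  ultimately show "b \<le> cmod (sin (Complex a b))" by linarith
  have "cmod (cos (Complex a b)) = cmod (of_real (exp (- b)) * cis a + of_real (exp b) * cis (- a)) / 2"
    unfolding c by (simp add: norm_divide)
  also have "... \<le> (cmod (of_real (exp (- b)) * cis a) + cmod (of_real (exp b) * cis (- a))) / 2"
    by (intro divide_right_mono norm_triangle_ineq) auto
  also have "... \<le> exp b" using eb by (simp only: norm_mult norm_cis norm_of_real) simp
  finally show "cmod (cos (Complex a b)) \<le> exp b" .
qed

text \<open>By concavity the sine lies above its chord on \<open>{0..pi / 2}\<close>, whose slope
  \<open>2 / pi\<close> exceeds \<open>1 / 2\<close>.\<close>

lemma sin_ge_half:
  fixes t :: real
  assumes "0 \<le> t" "t \<le> pi / 2"
  shows "t / 2 \<le> sin t"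
proof -
  have cv: "convex_on {0..pi/2} (\<lambda>x::real. - sin x)"
    by (rule f''_ge0_imp_convex[where f' = "\<lambda>x. - cos x" and f'' = "\<lambda>x. sin x"])
      (auto intro!: derivative_eq_intros sin_ge_zero)
  define u where "u = t / (pi / 2)"
  have u: "0 \<le> u" "u \<le> 1" using assms by (auto simp: u_def field_simps)
  have "- sin ((1 - u) *\<^sub>R 0 + u *\<^sub>R (pi / 2)) \<le> (1 - u) * - sin 0 + u * - sin (pi / 2)"
    by (rule convex_onD[OF cv]) (use u in auto)
  then have "u \<le> sin t" by (simp add: u_def)
  moreover have "t / 2 \<le> u"
  proof -
    have "t / 2 = t / (4 / 2)" by simp
    also have "... \<le> t / (pi / 2)" using assms pi_less_4 by (intro divide_left_mono) auto
    finally show ?thesis by (simp add: u_def)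
  qed
  ultimately show ?thesis by linarith
qed

lemma near_mono: "near \<epsilon> x S P s g \<Longrightarrow> \<epsilon> \<le> \<epsilon>' \<Longrightarrow> near \<epsilon>' x S P s g"
  unfolding near_def by (meson abs_ge_zero add_nonneg_nonneg mult_right_mono order_trans zero_le_one)

text \<open>The reference values are the symbols at the real frequency. The double angle formula
  gives \<open>\<bar>s\<bar> \<le> \<bar>g\<bar>\<close>, and
  \<open>\<bar>x\<bar> \<le> 2 * \<bar>g\<bar>\<close> holds because on the mesh band the half angle
  stays within a quarter turn.\<close>

lemma near_real_mesh:
  fixes h x \<alpha> :: real
  assumes h: "h > 0" and xh: "\<bar>x\<bar> * h \<le> pi" and \<alpha>: "\<alpha> \<ge> 0"
  shows "near (\<alpha> * exp (\<alpha> * h)) x (fsym (Complex x \<alpha>) h) (fsym (Complex x \<alpha>) (h / 2)) (sin (x * h) / h) (sin (x * (h / 2)) / (h / 2))"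
proof -
  have *: "cmod (fsym (Complex x \<alpha>) d - of_real (sin (x * d) / d)) \<le> \<alpha> * exp (\<alpha> * h) * (1 + \<bar>x\<bar>)"
    if d: "d > 0" "d \<le> h" for d :: real
  proof -
    have eq: "Complex x \<alpha> * d = Complex (x * d) (\<alpha> * d)" by (simp add: complex_eq_iff)
    have "fsym (Complex x \<alpha>) d - of_real (sin (x * d) / d) = (sin (Complex (x * d) (\<alpha> * d)) - of_real (sin (x * d))) / d"
      using d by (subst fsym_eq) (simp_all add: eq diff_divide_distrib)
    then have "cmod (fsym (Complex x \<alpha>) d - of_real (sin (x * d) / d)) = cmod (sin (Complex (x * d) (\<alpha> * d)) - of_real (sin (x * d))) / d"
      using d by (simp add: norm_divide)
    also have "... \<le> (\<alpha> * d * exp (\<alpha> * d)) / d"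
      using d \<alpha> by (intro divide_right_mono sin_shift_bound) auto
    also have "... = \<alpha> * exp (\<alpha> * d)" using d by simp
    also have "... \<le> \<alpha> * exp (\<alpha> * h)" using d \<alpha> by (intro mult_left_mono) (auto intro: mult_left_mono)
    also have "... \<le> \<alpha> * exp (\<alpha> * h) * (1 + \<bar>x\<bar>)"
      using mult_left_mono[of 1 "1 + \<bar>x\<bar>" "\<alpha> * exp (\<alpha> * h)"] \<alpha> by simp
    finally show ?thesis .
  qed
  define t where "t = x * (h / 2)"
  have sin2: "sin (x * h) / h = sin t / (h / 2) * cos t"
    using sin_double[of t] by (simp add: t_def field_simps)
  have b1: "\<bar>sin (x * h) / h\<bar> \<le> \<bar>sin t / (h / 2)\<bar>"
    unfolding sin2 abs_mult by (rule mult_left_le) auto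
  have b2: "\<bar>sin t / (h / 2)\<bar> \<le> \<bar>x\<bar>"
  proof -
    have "\<bar>sin t / (h / 2)\<bar> = \<bar>sin t\<bar> / (h / 2)" using h by (simp add: abs_divide)
    also have "... \<le> \<bar>t\<bar> / (h / 2)" using h abs_sin_x_le_abs_x[of t] by (intro divide_right_mono) auto
    also have "... = \<bar>x\<bar>" using h by (simp add: t_def abs_mult)
    finally show ?thesis .
  qed
  have b3: "\<bar>x\<bar> \<le> 2 * \<bar>sin t / (h / 2)\<bar>"
  proof -
    have "\<bar>t\<bar> \<le> pi / 2" using xh h by (simp add: t_def abs_mult)
    then have "\<bar>t\<bar> / 2 \<le> sin \<bar>t\<bar>" by (intro sin_ge_half) auto
    also have "... \<le> \<bar>sin t\<bar>" by (cases "t \<ge> 0") (auto simp: abs_if)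
    finally have "\<bar>t\<bar> / (h / 2) \<le> 2 * \<bar>sin t\<bar> / (h / 2)" using h by (intro divide_right_mono) auto
    moreover have "\<bar>t\<bar> / (h / 2) = \<bar>x\<bar>" using h by (simp add: t_def abs_mult)
    ultimately show ?thesis using h by (simp add: abs_divide)
  qed
  show ?thesis
    unfolding near_def using *[of h] *[of "h / 2"] b1 b2 b3 h by (simp add: t_def)
qed

text \<open>If \<open>\<xi> * z\<close> is small, both symbols are close to the frequency itself, so
  \<open>x\<close> serves as both reference values. The tolerance collects the shift by \<alpha> and
  the deviation of \<open>csinc\<close> from 1, which is quadratic in \<delta>.\<close>

lemma near_complex_mesh:
  fixes x \<alpha> \<delta> :: real and z :: complex
  assumes "cmod (Complex x \<alpha> * z) \<le> \<delta>" "0 \<le> \<delta>" "\<delta> \<le> 1" "0 \<le> \<alpha>"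
  shows "near (3 * \<alpha> + 2 * \<delta>^2) x (fsym (Complex x \<alpha>) z) (fsym (Complex x \<alpha>) (z / 2)) x x"
proof -
  have *: "cmod (fsym (Complex x \<alpha>) d - of_real x) \<le> (3 * \<alpha> + 2 * \<delta>^2) * (1 + \<bar>x\<bar>)" if d: "cmod (Complex x \<alpha> * d) \<le> \<delta>" for d
  proof -
    have cx: "cmod (Complex x \<alpha>) \<le> \<bar>x\<bar> + \<alpha>" using cmod_le[of "Complex x \<alpha>"] assms(4) by simp
    have s: "cmod (csinc (Complex x \<alpha> * d) - 1) \<le> 2 * \<delta>^2"
    proof -
      have "cmod (csinc (Complex x \<alpha> * d) - 1) \<le> 2 * (cmod (Complex x \<alpha> * d))^2"
        by (rule csinc_bound) (use d assms(3) in linarith)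
      also have "... \<le> 2 * \<delta>^2" using d by (intro mult_left_mono power_mono) auto
      finally show ?thesis .
    qed
    have "fsym (Complex x \<alpha>) d - of_real x = \<i> * \<alpha> + Complex x \<alpha> * (csinc (Complex x \<alpha> * d) - 1)"
      by (simp add: fsym_def complex_eq_iff algebra_simps)
    then have "cmod (fsym (Complex x \<alpha>) d - of_real x) \<le> \<alpha> + cmod (Complex x \<alpha>) * cmod (csinc (Complex x \<alpha> * d) - 1)"
      using norm_triangle_ineq[of "\<i> * \<alpha>" "Complex x \<alpha> * (csinc (Complex x \<alpha> * d) - 1)"] assms(4)
      by (simp add: norm_mult)
    also have "... \<le> \<alpha> + (\<bar>x\<bar> + \<alpha>) * (2 * \<delta>^2)"
      using assms(4) by (intro add_left_mono mult_mono cx s) auto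
    also have "... \<le> (3 * \<alpha> + 2 * \<delta>^2) * (1 + \<bar>x\<bar>)"
    proof -
      have "\<alpha> * (2 * \<delta>^2) \<le> \<alpha> * 2" using assms by (intro mult_left_mono) (auto simp: power_le_one)
      moreover have "0 \<le> 3 * \<alpha> * \<bar>x\<bar>" using assms(4) by simp
      moreover have "0 \<le> 2 * \<delta>^2" by simp
      moreover have "(3 * \<alpha> + 2 * \<delta>^2) * (1 + \<bar>x\<bar>) = 3 * \<alpha> + 2 * \<delta>^2 + 3 * \<alpha> * \<bar>x\<bar> + \<bar>x\<bar> * (2 * \<delta>^2)"
        by (simp add: algebra_simps)
      moreover have "(\<bar>x\<bar> + \<alpha>) * (2 * \<delta>^2) = \<bar>x\<bar> * (2 * \<delta>^2) + \<alpha> * (2 * \<delta>^2)"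
        by (simp add: algebra_simps)
      ultimately show ?thesis by argo
    qed
    finally show ?thesis .
  qed
  have h2: "cmod (Complex x \<alpha> * (z / 2)) \<le> \<delta>"
    using assms(1,2) by (simp add: norm_mult norm_divide)
  show ?thesis unfolding near_def using *[OF assms(1)] *[OF h2] by simp
qed

text \<open>The symbol of the half line has its poles on the real axis; on the contour of height
  \<alpha> its denominator has modulus at least \<alpha>, uniformly in the mesh size.\<close>

lemma gsym_real_mesh_bound:
  fixes h x \<alpha> :: real
  assumes "h > 0" "\<alpha> > 0"
  shows "cmod (gsym (Complex x \<alpha>) h) \<le> exp (\<alpha> * h) / \<alpha>"
proof -
  define \<xi> where "\<xi> = Complex x \<alpha>"
  have eq: "\<xi> * h / 2 = Complex (x * (h / 2)) (\<alpha> * (h / 2))" by (simp add: \<xi>_def complex_eq_iff)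
  have s: "\<alpha> \<le> cmod (\<xi> * csinc (\<xi> * h / 2))"
  proof -
    have "\<xi> * csinc (\<xi> * h / 2) = sin (\<xi> * h / 2) / (h / 2)"
      using fsym_eq[of "h / 2" \<xi>] assms by (simp add: fsym_def)
    then have "cmod (\<xi> * csinc (\<xi> * h / 2)) = cmod (sin (Complex (x * (h / 2)) (\<alpha> * (h / 2)))) / (h / 2)"
      using assms unfolding eq by (simp add: norm_divide)
    also have "... \<ge> (\<alpha> * (h / 2)) / (h / 2)"
      using assms by (intro divide_right_mono sin_shift_bound(2)) auto
    finally show ?thesis using assms by simp
  qed
  have c: "cmod (cos (\<xi> * h / 2)) \<le> exp (\<alpha> * h)"
  proof -
    have "cmod (cos (\<xi> * h / 2)) \<le> exp (\<alpha> * (h / 2))"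
      unfolding eq using assms by (intro sin_shift_bound(3)) auto
    also have "... \<le> exp (\<alpha> * h)" using assms by simp
    finally show ?thesis .
  qed
  have "gsym \<xi> h = \<i> * cos (\<xi> * h / 2) / (\<xi> * csinc (\<xi> * h / 2))" by (simp add: gsym_def)
  then have "cmod (gsym \<xi> h) = cmod (cos (\<xi> * h / 2)) / cmod (\<xi> * csinc (\<xi> * h / 2))"
    by (simp add: norm_divide norm_mult)
  also have "... \<le> exp (\<alpha> * h) / \<alpha>"
    using c s assms by (intro frac_le) auto
  finally show ?thesis by (simp add: \<xi>_def)
qed

lemma csinc_ge_half: "cmod w \<le> 1 / 2 \<Longrightarrow> 1 / 2 \<le> cmod (csinc w)"
proof -
  assume w: "cmod w \<le> 1 / 2"
  have "cmod (csinc w - 1) \<le> 2 * (cmod w)^2" using w by (intro csinc_bound) auto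
  also have "... \<le> 2 * (1 / 2)^2" using w by (intro mult_left_mono power_mono) auto
  finally have "cmod (1 - csinc w) \<le> 1 / 2" by (simp add: norm_minus_commute power2_eq_square)
  moreover have "cmod 1 - cmod (csinc w) \<le> cmod (1 - csinc w)" by (rule norm_triangle_ineq2)
  ultimately show ?thesis by simp
qed

text \<open>\<open>\<i> / \<xi>\<close> is the symbol of the exact integral over the half line. The
  second bound is the second order consistency of the trapezoidal sum; the first serves the circles
  of Cauchy's formula.\<close>

lemma gsym_complex_mesh_bound:
  assumes "cmod (\<xi> * z) \<le> 1" "\<xi> \<noteq> 0"
  shows "cmod (gsym \<xi> z) \<le> 4 / cmod \<xi>"
    and "cmod (gsym \<xi> z - \<i> / \<xi>) \<le> 3 * (cmod \<xi>) * (cmod z)^2"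
proof -
  define w where "w = \<xi> * z / 2"
  have w: "cmod w \<le> 1 / 2" using assms by (simp add: w_def norm_divide)
  have w2: "(cmod w)^2 \<le> 1 / 4" using power_mono[OF w, of 2] by (simp add: power2_eq_square)
  have s: "1 / 2 \<le> cmod (csinc w)" by (rule csinc_ge_half[OF w])
  have c: "cmod (cos w - 1) \<le> 3 * (cmod w)^2" using w by (intro cos_minus_1_bound) auto
  have c2: "cmod (cos w) \<le> 2" using norm_triangle_ineq[of "cos w - 1" 1] c w2 by simp
  have g: "gsym \<xi> z = \<i> / \<xi> * (cos w / csinc w)" by (simp add: gsym_def w_def)
  have "cmod (gsym \<xi> z) = 1 / cmod \<xi> * (cmod (cos w) / cmod (csinc w))"
    unfolding g by (simp add: norm_mult norm_divide)
  also have "... \<le> 1 / cmod \<xi> * (2 / (1 / 2))"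
    using s c2 by (intro mult_left_mono frac_le) auto
  finally show "cmod (gsym \<xi> z) \<le> 4 / cmod \<xi>" by simp
  have cs0: "csinc w \<noteq> 0" using s by auto
  have "gsym \<xi> z - \<i> / \<xi> = \<i> / \<xi> * ((cos w - 1) - (csinc w - 1)) / csinc w"
  proof -
    have "cos w / csinc w - 1 = ((cos w - 1) - (csinc w - 1)) / csinc w"
      using cs0 by (simp add: diff_divide_distrib)
    moreover have "gsym \<xi> z - \<i> / \<xi> = \<i> / \<xi> * (cos w / csinc w - 1)"
      unfolding g by (simp add: right_diff_distrib)
    ultimately show ?thesis by (simp only: times_divide_eq_right)
  qed
  then have "cmod (gsym \<xi> z - \<i> / \<xi>) = 1 / cmod \<xi> * cmod ((cos w - 1) - (csinc w - 1)) / cmod (csinc w)"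
    by (simp add: norm_mult norm_divide)
  also have "... \<le> 1 / cmod \<xi> * (5 * (cmod w)^2) / (1 / 2)"
  proof (intro frac_le mult_left_mono s)
    have "cmod (csinc w - 1) \<le> 2 * (cmod w)^2" using w by (intro csinc_bound) auto
    then show "cmod ((cos w - 1) - (csinc w - 1)) \<le> 5 * (cmod w)^2"
      using norm_triangle_ineq4[of "cos w - 1" "csinc w - 1"] c by argo
  qed auto
  also have "... = 10 / 4 * ((cmod \<xi>) * (cmod z)^2)"
    using assms(2) by (simp add: w_def norm_mult norm_divide power2_eq_square)
  also have "... \<le> 3 * ((cmod \<xi>) * (cmod z)^2)" by (intro mult_right_mono) auto
  finally show "cmod (gsym \<xi> z - \<i> / \<xi>) \<le> 3 * (cmod \<xi>) * (cmod z)^2" by simp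
qed

section \<open>Differences of even holomorphic functions\<close>

text \<open>Cauchy's kernel on the circle of radius \<open>R\<close> for
  \<open>f h - f (2 * h)\<close> when \<open>f\<close> is even. Averaging over the points and their
  negatives gives \<open>\<zeta>^2 / (\<zeta>^2 - h^2) - \<zeta>^2 / (\<zeta>^2 - 4 * h^2)\<close>,
  and this difference carries the factor \<open>h^2\<close>.\<close>

definition even_kernel :: "real \<Rightarrow> real \<Rightarrow> real \<Rightarrow> complex" where
  "even_kernel h R t = (let \<zeta> = R * exp (2 * pi * \<i> * t) in
     - 3 * h^2 * \<zeta>^2 / ((\<zeta>^2 - h\<^sup>2) * (\<zeta>^2 - 4 * h^2)))"

lemma norm_even_kernel:
  assumes "h > 0" "4 * h \<le> R"
  shows "cmod (even_kernel h R t) \<le> 5 * h^2 / R^2"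
proof -
  define \<zeta> where "\<zeta> = complex_of_real R * exp (2 * pi * \<i> * t)"
  have R: "R > 0" using assms by linarith
  have e: "exp (2 * pi * \<i> * t) = cis (2 * pi * t)" by (simp add: cis_conv_exp mult_ac)
  have z: "cmod (\<zeta>^2) = R^2" using R by (simp add: \<zeta>_def norm_mult norm_power e)
  have hR: "16 * h^2 \<le> R^2" using power_mono[OF assms(2), of 2] assms(1) by (simp add: power_mult_distrib)
  have 1: "15 / 16 * R^2 \<le> cmod (\<zeta>^2 - h\<^sup>2)"
    using norm_triangle_ineq2[of "\<zeta>^2" "complex_of_real (h^2)"] z hR by (simp del: of_real_power)
  have 2: "3 / 4 * R^2 \<le> cmod (\<zeta>^2 - 4 * h^2)"
    using norm_triangle_ineq2[of "\<zeta>^2" "complex_of_real (4 * h^2)"] z hR by (simp del: of_real_power)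
  have "cmod (even_kernel h R t) = 3 * h^2 * R^2 / (cmod (\<zeta>^2 - h\<^sup>2) * cmod (\<zeta>^2 - 4 * h^2))"
    unfolding even_kernel_def Let_def \<zeta>_def[symmetric] using z by (simp add: norm_mult norm_divide norm_power)
  also have "... \<le> 3 * h^2 * R^2 / ((15 / 16 * R^2) * (3 / 4 * R^2))"
    using R 1 2 by (intro divide_left_mono mult_mono mult_pos_pos) (auto intro: less_le_trans[of 0 "15 / 16 * R^2"] less_le_trans[of 0 "3 / 4 * R^2"])
  also have "... = 64 / 15 * (h^2 / R^2)" using R by (simp add: field_simps)
  also have "... \<le> 5 * (h^2 / R^2)" by (intro mult_right_mono) auto
  finally show ?thesis by simp
qed

lemma even_kernel_denominators:
  assumes "h > 0" "4 * h \<le> R"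
  defines "\<zeta> \<equiv> \<lambda>t. complex_of_real R * exp (2 * pi * \<i> * complex_of_real t)"
  shows "cmod (\<zeta> t) = R" "\<zeta> t - complex_of_real h \<noteq> 0" "\<zeta> t + complex_of_real h \<noteq> 0"
    "\<zeta> t - 2 * complex_of_real h \<noteq> 0" "\<zeta> t + 2 * complex_of_real h \<noteq> 0"
proof -
  have e: "exp (2 * pi * \<i> * complex_of_real t) = cis (2 * pi * t)" by (simp add: cis_conv_exp mult_ac)
  show z: "cmod (\<zeta> t) = R" using assms by (simp add: \<zeta>_def norm_mult e)
  have ne: "\<zeta> t \<noteq> w" if "cmod w < R" for w using that z by auto
  show "\<zeta> t - complex_of_real h \<noteq> 0" using ne[of h] assms by simp
  show "\<zeta> t + complex_of_real h \<noteq> 0" using ne[of "- h"] assms by (simp add: add_eq_0_iff2)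
  show "\<zeta> t - 2 * complex_of_real h \<noteq> 0" using ne[of "2 * complex_of_real h"] assms by (simp add: norm_mult)
  show "\<zeta> t + 2 * complex_of_real h \<noteq> 0" using ne[of "- (2 * complex_of_real h)"] assms by (simp add: add_eq_0_iff2 norm_mult)
qed

text \<open>Averaging the Cauchy formulas at \<open>h\<close> and \<open>- h\<close>, and at
  \<open>2 * h\<close> and \<open>- (2 * h)\<close>, cancels the part of first order in
  \<open>h\<close>. An integral formula is preferred to a bound on derivatives because Minkowski's
  inequality applies to it directly.\<close>

lemma even_difference_integral:
  assumes hol: "f holomorphic_on cball 0 R" and even: "\<And>z. f (- z) = f z"
    and h: "h > 0" and hR: "4 * h \<le> R"
  shows "f (of_real h) - f (of_real (2 * h))
    = (LINT t|restrict_space lborel {0..1}. even_kernel h R t * f (R * exp (2 * pi * \<i> * t)))"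
proof -
  define \<zeta> where "\<zeta> = (\<lambda>t. complex_of_real R * exp (2 * pi * \<i> * complex_of_real t))"
  have den: "cmod (\<zeta> t) = R" "\<zeta> t - complex_of_real h \<noteq> 0" "\<zeta> t + complex_of_real h \<noteq> 0"
    "\<zeta> t - 2 * complex_of_real h \<noteq> 0" "\<zeta> t + 2 * complex_of_real h \<noteq> 0" for t
    unfolding \<zeta>_def by (rule even_kernel_denominators[OF h hR])+
  have R: "R > 0" using h hR by linarith
  have C: "((\<lambda>u. f u / (u - w)) has_contour_integral (2 * of_real pi * \<i> * f w)) (circlepath 0 R)"
    if "cmod w < R" for w
    by (rule Cauchy_integral_circlepath_simple[OF hol]) (use that in simp)
  define H where "H = complex_of_real h"
  have nH: "cmod H < R" "cmod (2 * H) < R" using h hR by (auto simp: H_def norm_mult)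
  define F where "F = (\<lambda>u. f u / (u - H) + f u / (u - - H) - f u / (u - 2 * H) - f u / (u - - (2 * H)))"
  have "(F has_contour_integral
     (2 * of_real pi * \<i> * f H + 2 * of_real pi * \<i> * f (- H) - 2 * of_real pi * \<i> * f (2 * H) - 2 * of_real pi * \<i> * f (- (2 * H)))) (circlepath 0 R)"
    unfolding F_def
    by (rule has_contour_integral_diff[OF has_contour_integral_diff[OF has_contour_integral_add[OF C C] C] C])
      (use nH in simp_all)
  then have hc: "(F has_contour_integral (4 * of_real pi * \<i> * (f H - f (2 * H)))) (circlepath 0 R)"
    unfolding even by (simp add: algebra_simps)
  have "((\<lambda>t. F (\<zeta> t) * (2 * pi * \<i> * \<zeta> t)) has_integral (4 * of_real pi * \<i> * (f H - f (2 * H)))) {0..1}"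
    using hc unfolding has_contour_integral_def
    by (rule has_integral_cong[THEN iffD1, rotated])
      (simp add: vector_derivative_circlepath01, simp add: circlepath \<zeta>_def mult_ac)
  from has_integral_mult_right[OF this, of "1 / (4 * of_real pi * \<i>)"]
  have hi: "((\<lambda>t. 1 / (4 * of_real pi * \<i>) * (F (\<zeta> t) * (2 * pi * \<i> * \<zeta> t))) has_integral (f H - f (2 * H))) {0..1}"
    by simp
  have kern: "1 / (4 * of_real pi * \<i>) * (F (\<zeta> t) * (2 * pi * \<i> * \<zeta> t)) = even_kernel h R t * f (\<zeta> t)" for t :: real
  proof -
    note d = den(2-5)[of t, folded H_def]
    have 1: "(\<zeta> t)^2 - H\<^sup>2 = (\<zeta> t - H) * (\<zeta> t + H)" "(\<zeta> t)^2 - 4 * H^2 = (\<zeta> t - 2 * H) * (\<zeta> t + 2 * H)"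
      by (simp_all add: power2_eq_square algebra_simps)
    have 2: "even_kernel h R t = - 3 * H^2 * (\<zeta> t)^2 / (((\<zeta> t - H) * (\<zeta> t + H)) * ((\<zeta> t - 2 * H) * (\<zeta> t + 2 * H)))"
      unfolding 1[symmetric] by (simp add: even_kernel_def Let_def \<zeta>_def H_def)
    have 3: "F' / (z - a) + F' / (z - - a) - F' / (z - 2 * a) - F' / (z - - (2 * a)) = - 6 * a^2 * z * F' / (((z - a) * (z + a)) * ((z - 2 * a) * (z + 2 * a)))"
      if "z - a \<noteq> 0" "z + a \<noteq> 0" "z - 2 * a \<noteq> 0" "z + 2 * a \<noteq> 0" for F' z a :: complex
    proof -
      have 30: "F' / (z - b) + F' / (z - - b) = F' * (2 * z) / ((z - b) * (z + b))"
        if "z - b \<noteq> 0" "z + b \<noteq> 0" for b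
      proof -
        have "F' / (z - b) + F' / (z + b) = (F' * (z + b) + F' * (z - b)) / ((z - b) * (z + b))"
          by (rule add_frac_eq[OF that])
        also have "F' * (z + b) + F' * (z - b) = F' * (2 * z)" by (simp add: algebra_simps)
        finally show ?thesis by simp
      qed
      note 31 = 30[OF that(1,2)] and 32 = 30[OF that(3,4)]
      have "F' / (z - a) + F' / (z - - a) - F' / (z - 2 * a) - F' / (z - - (2 * a))
         = (F' / (z - a) + F' / (z - - a)) - (F' / (z - 2 * a) + F' / (z - - (2 * a)))" by (simp only: diff_diff_eq)
      also have "... = F' * (2 * z) / ((z - a) * (z + a)) - F' * (2 * z) / ((z - 2 * a) * (z + 2 * a))"
        unfolding 31 32 ..
      also have "... = (F' * (2 * z) * ((z - 2 * a) * (z + 2 * a)) - F' * (2 * z) * ((z - a) * (z + a))) / (((z - a) * (z + a)) * ((z - 2 * a) * (z + 2 * a)))"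
        by (rule diff_frac_eq) (use that in simp_all)
      also have "F' * (2 * z) * ((z - 2 * a) * (z + 2 * a)) - F' * (2 * z) * ((z - a) * (z + a)) = - 6 * a^2 * z * F'"
        by (simp add: power2_eq_square algebra_simps)
      finally show ?thesis .
    qed
    have 4: "F (\<zeta> t) = - 6 * H^2 * \<zeta> t * f (\<zeta> t) / (((\<zeta> t - H) * (\<zeta> t + H)) * ((\<zeta> t - 2 * H) * (\<zeta> t + 2 * H)))"
      unfolding F_def by (rule 3[OF d])
    show ?thesis
      unfolding 4 2 by (simp add: power2_eq_square)
  qed
  have int: "integral {0..1} (\<lambda>t. even_kernel h R t * f (\<zeta> t)) = f H - f (2 * H)"
    using hi unfolding kern by (rule integral_unique)
  have cf: "continuous_on {0..1} (\<lambda>t. even_kernel h R t * f (\<zeta> t))"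
  proof (intro continuous_on_mult)
    have "(\<zeta> t)^2 - H\<^sup>2 \<noteq> 0" "(\<zeta> t)^2 - 4 * H^2 \<noteq> 0" for t
    proof -
      have 1: "(\<zeta> t)^2 - H\<^sup>2 = (\<zeta> t - H) * (\<zeta> t + H)" "(\<zeta> t)^2 - 4 * H^2 = (\<zeta> t - 2 * H) * (\<zeta> t + 2 * H)"
        by (simp_all add: power2_eq_square algebra_simps)
      show "(\<zeta> t)^2 - H\<^sup>2 \<noteq> 0" "(\<zeta> t)^2 - 4 * H^2 \<noteq> 0" unfolding 1 using den(2-5)[of t, folded H_def] by auto
    qed
    then show "continuous_on {0..1} (even_kernel h R)"
      unfolding even_kernel_def[abs_def] Let_def \<zeta>_def H_def by (intro continuous_intros) auto
    show "continuous_on {0..1} (\<lambda>t. f (\<zeta> t))"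
      by (rule continuous_on_compose2[OF holomorphic_on_imp_continuous_on[OF hol]])
        (use den(1) in \<open>auto simp: \<zeta>_def intro!: continuous_intros\<close>)
  qed
  have "set_integrable lborel {0..1} (\<lambda>t. even_kernel h R t * f (\<zeta> t))"
    by (rule borel_integrable_atLeastAtMost') (rule cf)
  from set_borel_integral_eq_integral(2)[OF this] int
  have "(LINT t:{0..1}|lborel. even_kernel h R t * f (\<zeta> t)) = f (of_real h) - f (of_real (2 * h))" by (simp add: H_def)
  then show ?thesis
    by (simp add: integral_restrict_space set_lebesgue_integral_def \<zeta>_def)
qed

text \<open>The integral formula holds for every \<open>w\<close>; Minkowski's inequality in the
  circle parameter then asks for the mean square of \<open>f z\<close> on the circle only.\<close>

lemma L2le_even_difference:
  fixes f :: "complex \<Rightarrow> 'a \<Rightarrow> complex"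
  assumes M: "prob_space M"
    and hol: "\<And>w. (\<lambda>z. f z w) holomorphic_on cball 0 R" and even: "\<And>z w. f (- z) w = f z w"
    and h: "h > 0" and hR: "4 * h \<le> R"
    and meas [measurable]: "(\<lambda>(z, w). f z w) \<in> borel_measurable (borel \<Otimes>\<^sub>M M)"
    and B: "B > 0" "\<And>z. cmod z = R \<Longrightarrow> L2le M (f z) B"
  shows "L2le M (\<lambda>w. f (of_real h) w - f (of_real (2 * h)) w) (5 * h^2 / R^2 * B)"
proof -
  interpret prob_space M by fact
  have R: "R > 0" using h hR by linarith
  have [measurable]: "even_kernel h R \<in> borel_measurable lborel"
  proof -
    have "(\<lambda>t. complex_of_real R * exp (2 * complex_of_real pi * \<i> * complex_of_real t)) \<in> borel_measurable borel"
      by (intro borel_measurable_continuous_onI continuous_intros)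
    then show ?thesis unfolding even_kernel_def Let_def by measurable
  qed
  have mz [measurable]: "(\<lambda>t. complex_of_real R * exp (2 * complex_of_real pi * \<i> * complex_of_real t)) \<in> borel_measurable lborel"
    using borel_measurable_continuous_onI[of "\<lambda>t. complex_of_real R * exp (2 * complex_of_real pi * \<i> * complex_of_real t)"]
    by (auto intro!: continuous_intros)
  define c where "c = 5 * h^2 / R^2"
  have c: "c > 0" using h R by (simp add: c_def)
  let ?N = "restrict_space lborel {0..1::real}"
  have sf: "sigma_finite_measure ?N"
    by (rule finite_measure.sigma_finite_measure) (auto intro!: finite_measureI simp: emeasure_restrict_space space_restrict_space)
  have mj: "(\<lambda>(t, w). even_kernel h R t * f (R * exp (2 * pi * \<i> * t)) w) \<in> borel_measurable (?N \<Otimes>\<^sub>M M)"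
  proof -
    have [measurable]: "(\<lambda>t. t) \<in> measurable ?N lborel" by (simp add: measurable_restrict_space1)
    have 1: "(\<lambda>x. complex_of_real R * exp (2 * complex_of_real pi * \<i> * complex_of_real (fst x))) \<in> measurable (?N \<Otimes>\<^sub>M M) borel"
      using measurable_compose[OF measurable_fst, OF measurable_restrict_space1[OF mz]] by simp
    have 2: "(\<lambda>x. even_kernel h R (fst x)) \<in> measurable (?N \<Otimes>\<^sub>M M) borel"
      using measurable_compose[OF measurable_fst, OF measurable_restrict_space1[of "even_kernel h R" lborel borel "{0..1}"]] by simp
    have 3: "(\<lambda>x. f (complex_of_real R * exp (2 * complex_of_real pi * \<i> * complex_of_real (fst x))) (snd x)) \<in> measurable (?N \<Otimes>\<^sub>M M) borel"
      using measurable_compose[OF measurable_Pair[OF 1 measurable_snd] meas] by simp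
    show ?thesis unfolding split_beta using borel_measurable_times[OF 2 3] by simp
  qed
  have "L2le M (\<lambda>w. LINT t|?N. even_kernel h R t * f (R * exp (2 * pi * \<i> * t)) w) (LINT t|?N. c * B)"
  proof (rule L2le_integral[OF sf sigma_finite_measure_axioms mj])
    show "integrable ?N (\<lambda>t. c * B)"
      by (rule finite_measure.integrable_const) (auto intro!: finite_measureI simp: emeasure_restrict_space space_restrict_space)
    show "c * B > 0" using c B by simp
    fix t
    have "L2le M (\<lambda>w. even_kernel h R t * f (R * exp (2 * pi * \<i> * t)) w) (c * B)"
    proof (rule L2le_mono[OF L2le_cmult[OF B(2)]])
      show "cmod (R * exp (2 * pi * \<i> * t)) = R" by (rule even_kernel_denominators(1)[OF h hR])
      show "cmod (even_kernel h R t) * B \<le> c * B"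
        unfolding c_def by (rule mult_right_mono[OF norm_even_kernel[OF h hR]]) (use B(1) in simp)
    qed
    then show "(\<integral>\<^sup>+w. ennreal ((norm (even_kernel h R t * f (R * exp (2 * pi * \<i> * t)) w))^2) \<partial>M) \<le> ennreal ((c * B)^2)"
      by (rule L2leD(3))
  qed
  also have "(LINT t|?N. c * B) = c * B"
    by (simp add: measure_restrict_space space_restrict_space)
  also have "(\<lambda>w. LINT t|?N. even_kernel h R t * f (R * exp (2 * pi * \<i> * t)) w) = (\<lambda>w. f (of_real h) w - f (of_real (2 * h)) w)"
    using even_difference_integral[OF hol even h hR] by auto
  finally show ?thesis by (simp add: c_def)
qed

section \<open>Uniqueness of the implicit step\<close>

lemma bij_shift: "bij (\<lambda>(i, j). (i + a, j + b) :: int \<times> int)"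
  by (rule o_bij[where g = "\<lambda>(i, j). (i - a, j - b)"]) (auto simp: fun_eq_iff)

lemma has_sum_shift:
  fixes f :: "int \<times> int \<Rightarrow> real"
  assumes "(f has_sum s) UNIV"
  shows "((\<lambda>(i, j). f (i + a, j + b)) has_sum s) UNIV"
  using has_sum_reindex_bij_betw[OF bij_shift[of a b], of f s] assms
  by (simp add: case_prod_unfold)

lemma has_sum_diff_real:
  fixes f g :: "'b \<Rightarrow> real"
  assumes "(f has_sum a) A" "(g has_sum b) A"
  shows "((\<lambda>x. f x - g x) has_sum (a - b)) A"
  using has_sum_add[OF assms(1) has_sum_cmult_right[OF assms(2), of "- 1"]] by simp

lemma square_summable_diff:
  assumes "square_summable U" "square_summable V"
  shows "square_summable (\<lambda>p. U p - V p)"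
proof -
  have "(\<lambda>p. 2 * (U p)^2 + 2 * (V p)^2) summable_on UNIV"
    using assms unfolding square_summable_def by (intro summable_on_add summable_on_cmult_right)
  then have "(\<lambda>p. norm ((U p - V p)^2)) summable_on UNIV"
  proof (rule Infinite_Sum.abs_summable_on_comparison_test')
    fix p
    have "(U p - V p)^2 + (U p + V p)^2 = 2 * (U p)^2 + 2 * (V p)^2"
      by (simp add: power2_eq_square algebra_simps)
    moreover have "0 \<le> (U p + V p)^2" by simp
    moreover have "norm ((U p - V p)^2) = (U p - V p)^2" by simp
    ultimately show "norm ((U p - V p)^2) \<le> 2 * (U p)^2 + 2 * (V p)^2"
      by linarith
  qed
  then show ?thesis unfolding square_summable_def by simp
qed

lemma summable_on_shift_product:
  fixes U :: "int \<times> int \<Rightarrow> real"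
  assumes "square_summable U"
  shows "(\<lambda>(i, j). U (i, j) * U (i + a, j + b)) summable_on UNIV"
proof -
  have 1: "(\<lambda>p. (U p)^2) summable_on UNIV" using assms by (simp add: square_summable_def)
  then obtain s where "((\<lambda>p. (U p)^2) has_sum s) UNIV" by (auto simp: summable_on_def)
  from has_sum_shift[OF this, of a b]
  have 2: "(\<lambda>(i, j). (U (i + a, j + b))^2) summable_on UNIV" by (auto simp: summable_on_def)
  have "(\<lambda>p. (U p)^2 + (case p of (i, j) \<Rightarrow> (U (i + a, j + b))^2)) summable_on UNIV"
    by (rule summable_on_add[OF 1 2])
  then have "(\<lambda>p. norm (case p of (i, j) \<Rightarrow> U (i, j) * U (i + a, j + b))) summable_on UNIV"
  proof (rule Infinite_Sum.abs_summable_on_comparison_test')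
    fix p :: "int \<times> int"
    obtain i j where p: "p = (i, j)" by (cases p)
    have gen: "\<bar>x * y\<bar> \<le> x^2 + y^2" for x y :: real
    proof -
      have "2 * (\<bar>x\<bar> * \<bar>y\<bar>) \<le> x^2 + y^2" using sum_squares_bound[of "\<bar>x\<bar>" "\<bar>y\<bar>"] by simp
      moreover have "0 \<le> \<bar>x\<bar> * \<bar>y\<bar>" by simp
      ultimately show ?thesis unfolding abs_mult by linarith
    qed
    show "norm (case p of (i, j) \<Rightarrow> U (i, j) * U (i + a, j + b)) \<le> (U p)^2 + (case p of (i, j) \<Rightarrow> (U (i + a, j + b))^2)"
      using gen by (simp add: p)
  qed
  then show ?thesis by (rule abs_summable_summable)
qed

text \<open>
  Testing the equation with \<open>U\<close>, the first order terms telescope and the second order terms are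
  non-negative up to telescoping sums.
\<close>

lemma implicit_op_kernel:
  assumes U: "square_summable U" and k: "k \<ge> 0" and eq: "\<And>p. implicit_op \<mu>x \<mu>y hx hy k U p = 0"
  shows "U p = 0"
proof -
  define cx cy dx dy where "cx = \<mu>x * k / (2 * hx)" and "cy = \<mu>y * k / (2 * hy)"
    and "dx = k / (2 * hx^2)" and "dy = k / (2 * hy^2)"
  have d: "dx \<ge> 0" "dy \<ge> 0" using k by (simp_all add: dx_def dy_def)
  define q where "q = (\<lambda>p. (U p)^2)"
  have qs: "q summable_on UNIV" using U by (simp add: q_def square_summable_def)
  obtain s where s: "(q has_sum s) UNIV" using qs by (auto simp: summable_on_def)
  define a1 a2 where "a1 = (\<lambda>(i, j). U (i, j) * U (i + 1, j))" and "a2 = (\<lambda>(i, j). U (i, j) * U (i, j + 1))"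
  obtain s1 where s1: "(a1 has_sum s1) UNIV"
    using summable_on_shift_product[OF U, of 1 0] by (auto simp: a1_def summable_on_def)
  obtain s2 where s2: "(a2 has_sum s2) UNIV"
    using summable_on_shift_product[OF U, of 0 1] by (auto simp: a2_def summable_on_def)
  \<comment> \<open>\<open>r\<close> is the part that telescopes: by shift invariance its sum over
    the grid is 0. Since \<open>r p\<close> equals \<open>q p\<close> plus squares of differences,
    \<open>q\<close> is dominated pointwise and its sum vanishes too.\<close>
  define r where "r = (\<lambda>p. - cx * (a1 p - (case p of (i, j) \<Rightarrow> a1 (i + - 1, j + 0)))
      - cy * (a2 p - (case p of (i, j) \<Rightarrow> a2 (i + 0, j + - 1)))
      + dx / 2 * ((case p of (i, j) \<Rightarrow> q (i + 1, j + 0)) - 2 * q p + (case p of (i, j) \<Rightarrow> q (i + - 1, j + 0)))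
      + dy / 2 * ((case p of (i, j) \<Rightarrow> q (i + 0, j + 1)) - 2 * q p + (case p of (i, j) \<Rightarrow> q (i + 0, j + - 1))))"
  have "(r has_sum (- cx * (s1 - s1) - cy * (s2 - s2) + dx / 2 * (s - 2 * s + s) + dy / 2 * (s - 2 * s + s))) UNIV"
    unfolding r_def
    by (intro has_sum_add has_sum_diff_real has_sum_cmult_right has_sum_shift s s1 s2)
  then have rs: "(r has_sum 0) UNIV" by simp
  have le: "q p \<le> r p" for p
  proof -
    obtain i j where p: "p = (i, j)" by (cases p)
    have "0 = U (i, j) * implicit_op \<mu>x \<mu>y hx hy k U (i, j)" using eq by simp
    also have "... = q p - r p + dx / 2 * ((U (i + 1, j) - U (i, j))^2 + (U (i - 1, j) - U (i, j))^2)
       + dy / 2 * ((U (i, j + 1) - U (i, j))^2 + (U (i, j - 1) - U (i, j))^2)"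
      unfolding implicit_op_def Dx_def Dy_def Dxx_def Dyy_def r_def a1_def a2_def q_def p
        cx_def[symmetric] cy_def[symmetric] dx_def[symmetric] dy_def[symmetric]
      by (simp add: power2_eq_square algebra_simps)
    finally have "r p = q p + dx / 2 * ((U (i + 1, j) - U (i, j))^2 + (U (i - 1, j) - U (i, j))^2)
       + dy / 2 * ((U (i, j + 1) - U (i, j))^2 + (U (i, j - 1) - U (i, j))^2)" by simp
    then show ?thesis using d by simp
  qed
  have "s \<le> 0" by (rule has_sum_mono[OF s rs]) (rule le)
  then have "infsum q UNIV \<le> 0" using infsumI[OF s] by simp
  from nonneg_infsum_le_0D[OF this qs, of p] show ?thesis by (simp add: q_def)
qed

lemma implicit_op_diff:
  "implicit_op \<mu>x \<mu>y hx hy k (\<lambda>p. U p - V p) p = implicit_op \<mu>x \<mu>y hx hy k U p - implicit_op \<mu>x \<mu>y hx hy k V p"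
proof -
  obtain i j where p: "p = (i, j)" by (cases p)
  define c1 c2 c3 c4 where c: "c1 = \<mu>x * k / (2 * hx)" "c2 = \<mu>y * k / (2 * hy)"
    "c3 = k / (2 * hx^2)" "c4 = k / (2 * hy^2)"
  show ?thesis
    unfolding implicit_op_def Dx_def Dy_def Dxx_def Dyy_def p c[symmetric] by (simp add: algebra_simps)
qed

lemma implicit_op_unique:
  assumes "square_summable U" "square_summable V" "k \<ge> 0"
    and "implicit_op \<mu>x \<mu>y hx hy k U = implicit_op \<mu>x \<mu>y hx hy k V"
  shows "U = V"
proof
  fix p
  have "(\<lambda>p. U p - V p) p = 0"
    by (rule implicit_op_kernel[OF square_summable_diff[OF assms(1,2)] assms(3), of \<mu>x \<mu>y hx hy])
      (simp add: implicit_op_diff assms(4))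
  then show "U p = V p" by simp
qed

section \<open>Fourier representation of the scheme\<close>

text \<open>On the convex strip \<open>f\<close> has a primitive. By periodicity of \<open>f\<close>
  the increment of the primitive over one period has derivative 0, so it is the same at every
  height; this replaces the rectangle with cancelling vertical sides.\<close>

lemma periodic_strip_integral:
  assumes hol: "f holomorphic_on {z. \<bar>Im z\<bar> \<le> \<alpha>}" and per: "\<And>z. f (z + of_real (2 * L)) = f z"
    and L: "L \<ge> 0" and a: "\<bar>a\<bar> \<le> \<alpha>" and b: "\<bar>b\<bar> \<le> \<alpha>"
  shows "integral {- L..L} (\<lambda>x. f (Complex x a)) = integral {- L..L} (\<lambda>x. f (Complex x b))"
proof -
  let ?S = "{z. \<bar>Im z\<bar> \<le> \<alpha>}"
  have S: "?S = {z. Im z \<le> \<alpha>} \<inter> {z. Im z \<ge> - \<alpha>}" by auto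
  have cS: "convex ?S"
    unfolding S by (intro convex_Int) (auto simp: convex_halfspace_Im_le convex_halfspace_Im_ge)
  obtain F where F: "\<And>z. z \<in> ?S \<Longrightarrow> (F has_field_derivative f z) (at z within ?S)"
  proof (rule holomorphic_convex_primitive[OF cS, of "{}" f])
    show "finite ({} :: complex set)" by simp
    show "continuous_on ?S f" by (rule holomorphic_on_imp_continuous_on[OF hol])
    show "f field_differentiable at x" if "x \<in> interior ?S - {}" for x
      by (rule holomorphic_on_imp_differentiable_at[of f "interior ?S" x])
        (use that in \<open>auto intro: holomorphic_on_subset[OF hol interior_subset]\<close>)
  qed (use that in blast)
  have shift: "z + of_real (2 * L) \<in> ?S" if "z \<in> ?S" for z using that by simp
  have D: "((\<lambda>z. F (z + of_real (2 * L)) - F z) has_field_derivative 0) (at z within ?S)" if z: "z \<in> ?S" for z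
  proof -
    have 1: "((\<lambda>z. F (z + of_real (2 * L))) has_field_derivative f (z + of_real (2 * L)) * 1) (at z within ?S)"
    proof -
      have g: "((\<lambda>z. z + of_real (2 * L)) has_field_derivative 1) (at z within ?S)"
        by (auto intro!: derivative_eq_intros)
      have "(F has_field_derivative f (z + of_real (2 * L))) (at (z + of_real (2 * L)) within (\<lambda>z. z + of_real (2 * L)) ` ?S)"
        by (rule DERIV_subset[OF F[OF shift[OF z]]]) auto
      from DERIV_image_chain[OF this g] show ?thesis by (simp add: o_def)
    qed
    from DERIV_diff[OF 1 F[OF z]] show ?thesis using per[of z] by simp
  qed
  obtain c where c: "\<And>z. z \<in> ?S \<Longrightarrow> F (z + of_real (2 * L)) - F z = c"
    using has_field_derivative_zero_constant[OF cS D] by blast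
  have "integral {- L..L} (\<lambda>x. f (Complex x e)) = c" if e: "\<bar>e\<bar> \<le> \<alpha>" for e
  proof -
    have "((\<lambda>x. f (Complex x e)) has_integral (F (Complex L e) - F (Complex (- L) e))) {- L..L}"
    proof (rule fundamental_theorem_of_calculus)
      show "- L \<le> L" using L by simp
      fix x assume "x \<in> {- L..L}"
      have 1: "((\<lambda>x. Complex x e) has_vector_derivative 1) (at x within {- L..L})"
        by (auto simp: has_vector_derivative_complex_iff intro!: derivative_eq_intros)
      have 2: "(F has_field_derivative f (Complex x e)) (at (Complex x e) within (\<lambda>x. Complex x e) ` {- L..L})"
        by (rule DERIV_subset[OF F]) (use e in auto)
      from field_vector_diff_chain_within[OF 1 2]
      show "((\<lambda>x. F (Complex x e)) has_vector_derivative f (Complex x e)) (at x within {- L..L})"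
        by (simp add: o_def)
    qed
    moreover have "Complex L e = Complex (- L) e + of_real (2 * L)" by (simp add: complex_eq_iff)
    ultimately show ?thesis using c[of "Complex (- L) e"] e integral_unique by force
  qed
  from this[OF a] this[OF b] show ?thesis by simp
qed

text \<open>At half the mesh size one period is a half turn, which reverses the sign of the sine.
  The denominator of a step contains this symbol only squared.\<close>

lemma fsym_periodic:
  fixes h :: real
  assumes "h \<noteq> 0"
  shows "fsym (\<xi> + of_real (2 * (pi / h))) h = fsym \<xi> h"
    and "(fsym (\<xi> + of_real (2 * (pi / h))) (of_real (h / 2)))^2 = (fsym \<xi> (of_real (h / 2)))^2"
proof -
  have hz: "complex_of_real h \<noteq> 0" "complex_of_real (h / 2) \<noteq> 0" using assms by auto
  have eq: "(\<xi> + of_real (2 * (pi / h))) * of_real h = \<xi> * of_real h + of_real (2 * pi)" using assms by (simp add: field_simps)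
  have per: "sin (w + of_real (2 * pi)) = sin w" for w :: complex
    unfolding sin_add sin_of_real cos_of_real by simp
  show "fsym (\<xi> + of_real (2 * (pi / h))) h = fsym \<xi> h"
    unfolding fsym_eq[OF hz(1)] eq per ..
  have eq2: "(\<xi> + of_real (2 * (pi / h))) * of_real (h / 2) = \<xi> * of_real (h / 2) + of_real pi" using assms by (simp add: field_simps)
  have per2: "sin (w + of_real pi) = - sin w" for w :: complex
    unfolding sin_add sin_of_real cos_of_real by simp
  show "(fsym (\<xi> + of_real (2 * (pi / h))) (of_real (h / 2)))^2 = (fsym \<xi> (of_real (h / 2)))^2"
    unfolding fsym_eq[OF hz(2)] eq2 per2 by (simp only: minus_divide_left[symmetric] power2_minus)
qed

text \<open>One realisation of the increments, with values \<open>zx\<close> and \<open>zy\<close>.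
  The denominator must not vanish on the whole closed strip: the scheme is represented on real
  frequencies, the quadrant is summed at height \<alpha>, and decay of the solution in all
  directions uses the heights \<alpha> and -\<alpha>.\<close>

locale fourier_scheme =
  fixes hx hy k \<alpha> \<mu>x \<mu>y \<rho>x \<rho>y :: real and i0 j0 :: int and zx zy :: "nat \<Rightarrow> real"
  assumes hx: "hx > 0" and hy: "hy > 0" and k: "k \<ge> 0" and \<alpha>: "\<alpha> > 0" and rx: "\<rho>x \<ge> 0" and ry: "\<rho>y \<ge> 0"
    and den: "\<And>\<xi> \<eta>. \<bar>Im \<xi>\<bar> \<le> \<alpha> \<Longrightarrow> \<bar>Im \<eta>\<bar> \<le> \<alpha> \<Longrightarrow>
      step_den k \<mu>x \<mu>y (fsym \<xi> (of_real hx)) (fsym \<xi> (of_real (hx / 2))) (fsym \<eta> (of_real hy)) (fsym \<eta> (of_real (hy / 2))) \<noteq> 0"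
begin

abbreviation "S \<equiv> {z. \<bar>Im z\<bar> \<le> \<alpha>}"

definition "Den \<xi> \<eta> = step_den k \<mu>x \<mu>y (fsym \<xi> (of_real hx)) (fsym \<xi> (of_real (hx / 2))) (fsym \<eta> (of_real hy)) (fsym \<eta> (of_real (hy / 2)))"
definition "Num n \<xi> \<eta> = step_num (of_real (sqrt (k * \<rho>x)) * fsym \<xi> (of_real hx)) (of_real (sqrt (k * \<rho>y)) * fsym \<eta> (of_real hy)) (zx n) (zy n)"
definition "Fac n \<xi> \<eta> = step_factor k \<mu>x \<mu>y \<rho>x \<rho>y (fsym \<xi> (of_real hx)) (fsym \<xi> (of_real (hx / 2))) (fsym \<eta> (of_real hy)) (fsym \<eta> (of_real (hy / 2))) (zx n) (zy n)"
definition "Amp n \<xi> \<eta> = (\<Prod>m<n. Fac m \<xi> \<eta>)"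
definition Ex :: "int \<Rightarrow> int \<Rightarrow> complex \<Rightarrow> complex \<Rightarrow> complex" where
  "Ex i j \<xi> \<eta> = exp (\<i> * (\<xi> * of_real (of_int (i - i0) * hx) + \<eta> * of_real (of_int (j - j0) * hy)))"

definition "fbox = cbox (- (pi / hx), - (pi / hy)) (pi / hx, pi / hy)"
text \<open>Continuity along one pair of horizontal lines, enough for integrating there. It also
  covers the sums of geometric series of modes, which have poles elsewhere in the strip.\<close>

definition lcont :: "real \<Rightarrow> real \<Rightarrow> (complex \<Rightarrow> complex \<Rightarrow> complex) \<Rightarrow> bool" where
  "lcont a b H \<longleftrightarrow> continuous_on fbox (\<lambda>(x, y). H (Complex x a) (Complex y b))"
definition J :: "real \<Rightarrow> real \<Rightarrow> (complex \<Rightarrow> complex \<Rightarrow> complex) \<Rightarrow> complex" where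
  "J a b H = integral fbox (\<lambda>(x, y). H (Complex x a) (Complex y b))"
text \<open>What is required to move both contours: joint continuity for interchanging the
  integrals, and in each variable holomorphy and the period of the mesh.\<close>

definition reg :: "(complex \<Rightarrow> complex \<Rightarrow> complex) \<Rightarrow> bool" where
  "reg H \<longleftrightarrow> continuous_on (S \<times> S) (\<lambda>(\<xi>, \<eta>). H \<xi> \<eta>) \<and> (\<forall>\<eta>\<in>S. (\<lambda>\<xi>. H \<xi> \<eta>) holomorphic_on S)
     \<and> (\<forall>\<xi>\<in>S. H \<xi> holomorphic_on S) \<and> (\<forall>\<xi> \<eta>. H (\<xi> + of_real (2 * (pi / hx))) \<eta> = H \<xi> \<eta>)
     \<and> (\<forall>\<xi> \<eta>. H \<xi> (\<eta> + of_real (2 * (pi / hy))) = H \<xi> \<eta>)"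

lemma Den_nz: "\<xi> \<in> S \<Longrightarrow> \<eta> \<in> S \<Longrightarrow> Den \<xi> \<eta> \<noteq> 0"
  using den by (simp add: Den_def)

lemma Fac_eq: "Fac n \<xi> \<eta> = Num n \<xi> \<eta> / Den \<xi> \<eta>"
  by (simp add: Fac_def Num_def Den_def step_factor_def)

lemma reg_cont:
  assumes "reg H" "\<bar>a\<bar> \<le> \<alpha>" "\<bar>b\<bar> \<le> \<alpha>"
  shows "lcont a b H"
proof -
  have 1: "continuous_on fbox (\<lambda>(x, y). (Complex x a, Complex y b))"
    unfolding Complex_eq by (auto simp: case_prod_unfold intro!: continuous_intros)
  have 2: "continuous_on (S \<times> S) (\<lambda>(\<xi>, \<eta>). H \<xi> \<eta>)" using assms(1) by (simp add: reg_def)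
  have 3: "(\<lambda>(x, y). (Complex x a, Complex y b)) ` fbox \<subseteq> S \<times> S" using assms(2,3) by auto
  from continuous_on_compose2[OF 2 1 3] show ?thesis
    by (simp add: lcont_def case_prod_unfold)
qed

lemma reg_mult: "reg H \<Longrightarrow> reg H' \<Longrightarrow> reg (\<lambda>\<xi> \<eta>. H \<xi> \<eta> * H' \<xi> \<eta>)"
  unfolding reg_def by (auto simp: case_prod_unfold intro!: continuous_intros holomorphic_intros)

lemma reg_Ex: "reg (Ex i j)"
proof -
  have per: "exp (\<i> * of_real (2 * pi * of_int m)) = 1" for m :: int
    using exp_integer_2pi[of "of_int m"] by (simp add: mult_ac)
  have 1: "Ex i j (\<xi> + of_real (2 * (pi / hx))) \<eta> = Ex i j \<xi> \<eta>" for \<xi> \<eta>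
  proof -
    have "\<i> * ((\<xi> + of_real (2 * (pi / hx))) * of_real (of_int (i - i0) * hx) + \<eta> * of_real (of_int (j - j0) * hy))
      = \<i> * (\<xi> * of_real (of_int (i - i0) * hx) + \<eta> * of_real (of_int (j - j0) * hy)) + \<i> * of_real (2 * pi * of_int (i - i0))"
      using hx by (simp add: field_simps)
    then show ?thesis unfolding Ex_def by (simp only: exp_add per mult_1_right)
  qed
  have 2: "Ex i j \<xi> (\<eta> + of_real (2 * (pi / hy))) = Ex i j \<xi> \<eta>" for \<xi> \<eta>
  proof -
    have "\<i> * (\<xi> * of_real (of_int (i - i0) * hx) + (\<eta> + of_real (2 * (pi / hy))) * of_real (of_int (j - j0) * hy))
      = \<i> * (\<xi> * of_real (of_int (i - i0) * hx) + \<eta> * of_real (of_int (j - j0) * hy)) + \<i> * of_real (2 * pi * of_int (j - j0))"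
      using hy by (simp add: field_simps)
    then show ?thesis unfolding Ex_def by (simp only: exp_add per mult_1_right)
  qed
  show ?thesis
    unfolding reg_def using 1 2
    by (auto simp: case_prod_unfold Ex_def[abs_def] intro!: continuous_intros holomorphic_intros)
qed

lemma reg_Fac: "reg (Fac n)"
  unfolding reg_def
proof (intro conjI ballI allI)
  have D: "Den (fst p) (snd p) \<noteq> 0" if "p \<in> S \<times> S" for p using that Den_nz by auto
  show "continuous_on (S \<times> S) (\<lambda>(\<xi>, \<eta>). Fac n \<xi> \<eta>)"
    unfolding Fac_eq case_prod_unfold using D
    by (intro continuous_on_divide ballI; (assumption | simp add: Num_def[abs_def] Den_def[abs_def] step_num_def step_den_def fsym_def)?)
      (auto intro!: continuous_intros)
  show "(\<lambda>\<xi>. Fac n \<xi> \<eta>) holomorphic_on S" if "\<eta> \<in> S" for \<eta>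
    unfolding Fac_eq using Den_nz[OF _ that]
    by (intro holomorphic_on_divide; (assumption | simp add: Num_def[abs_def] Den_def[abs_def] step_num_def step_den_def fsym_def)?)
      (auto intro!: holomorphic_intros)
  show "Fac n \<xi> holomorphic_on S" if "\<xi> \<in> S" for \<xi>
    unfolding Fac_eq[abs_def] using Den_nz[OF that]
    by (intro holomorphic_on_divide; (assumption | simp add: Num_def[abs_def] Den_def[abs_def] step_num_def step_den_def fsym_def)?)
      (auto intro!: holomorphic_intros)
  show "Fac n (\<xi> + of_real (2 * (pi / hx))) \<eta> = Fac n \<xi> \<eta>" for \<xi> \<eta>
    using fsym_periodic[of hx \<xi>] hx by (simp only: Fac_def step_factor_def step_den_def)
  show "Fac n \<xi> (\<eta> + of_real (2 * (pi / hy))) = Fac n \<xi> \<eta>" for \<xi> \<eta>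
    using fsym_periodic[of hy \<eta>] hy by (simp only: Fac_def step_factor_def step_den_def)
qed

lemma reg_1: "reg (\<lambda>\<xi> \<eta>. 1)"
  by (auto simp: reg_def case_prod_unfold)

lemma reg_Amp: "reg (Amp n)"
proof (induction n)
  case 0 then show ?case using reg_1 by (simp add: Amp_def[abs_def])
next
  case (Suc n)
  have "Amp (Suc n) = (\<lambda>\<xi> \<eta>. Amp n \<xi> \<eta> * Fac n \<xi> \<eta>)" by (auto simp: Amp_def fun_eq_iff)
  then show ?case using reg_mult[OF Suc reg_Fac] by simp
qed

lemma lcont_add: "lcont a b H \<Longrightarrow> lcont a b H' \<Longrightarrow> lcont a b (\<lambda>\<xi> \<eta>. H \<xi> \<eta> + H' \<xi> \<eta>)"
  and lcont_mult: "lcont a b H \<Longrightarrow> lcont a b H' \<Longrightarrow> lcont a b (\<lambda>\<xi> \<eta>. H \<xi> \<eta> * H' \<xi> \<eta>)"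
  and lcont_const: "lcont a b (\<lambda>\<xi> \<eta>. c)"
  by (auto simp: lcont_def case_prod_unfold intro!: continuous_intros)

lemma J_integrable: "lcont a b H \<Longrightarrow> (\<lambda>(x, y). H (Complex x a) (Complex y b)) integrable_on fbox"
  unfolding lcont_def fbox_def by (rule integrable_continuous)

lemma J_add:
  assumes "lcont a b H" "lcont a b H'"
  shows "J a b (\<lambda>\<xi> \<eta>. H \<xi> \<eta> + H' \<xi> \<eta>) = J a b H + J a b H'"
  using integral_add[OF J_integrable[OF assms(1)] J_integrable[OF assms(2)]]
  by (simp add: J_def case_prod_unfold)

lemma J_cmult: "J a b (\<lambda>\<xi> \<eta>. c * H \<xi> \<eta>) = c * J a b H"
  using integral_mult_right[of fbox c "\<lambda>(x, y). H (Complex x a) (Complex y b)"]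
  by (simp add: J_def case_prod_unfold)

lemma J_bound:
  assumes c: "lcont a b H" and B: "\<And>x y. (x, y) \<in> fbox \<Longrightarrow> cmod (H (Complex x a) (Complex y b)) \<le> B"
  shows "cmod (J a b H) \<le> B * measure lborel fbox"
proof -
  have "(0, 0) \<in> fbox" using hx hy by (simp add: fbox_def cbox_Pair_eq)
  then have "B \<ge> 0" using B order_trans[OF norm_ge_zero] by blast
  then show ?thesis
    unfolding J_def fbox_def
    by (rule has_integral_bound[OF _ integrable_integral[OF J_integrable[OF c, unfolded fbox_def]]])
      (use B in \<open>auto simp: fbox_def\<close>)
qed

lemma J_shift:
  assumes H: "reg H" and ab: "\<bar>a\<bar> \<le> \<alpha>" "\<bar>b\<bar> \<le> \<alpha>" "\<bar>a'\<bar> \<le> \<alpha>" "\<bar>b'\<bar> \<le> \<alpha>"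
  shows "J a b H = J a' b' H"
proof -
  let ?Lx = "pi / hx" and ?Ly = "pi / hy"
  have L: "?Lx \<ge> 0" "?Ly \<ge> 0" using hx hy by auto
  have it: "J a b H = integral {- ?Lx..?Lx} (\<lambda>x. integral {- ?Ly..?Ly} (\<lambda>y. H (Complex x a) (Complex y b)))"
    if "\<bar>a\<bar> \<le> \<alpha>" "\<bar>b\<bar> \<le> \<alpha>" for a b
    using integral_prod_continuous[OF reg_cont[OF H that, unfolded lcont_def fbox_def]]
    by (simp add: J_def fbox_def)
  have sw: "integral {- ?Lx..?Lx} (\<lambda>x. integral {- ?Ly..?Ly} (\<lambda>y. H (Complex x a) (Complex y b)))
     = integral {- ?Ly..?Ly} (\<lambda>y. integral {- ?Lx..?Lx} (\<lambda>x. H (Complex x a) (Complex y b)))"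
    if "\<bar>a\<bar> \<le> \<alpha>" "\<bar>b\<bar> \<le> \<alpha>" for a b
    using integral_swap_continuous[OF reg_cont[OF H that, unfolded lcont_def fbox_def]] by simp
  have hol: "(\<lambda>\<xi>. H \<xi> \<eta>) holomorphic_on S" if "\<eta> \<in> S" for \<eta> using H that by (auto simp: reg_def)
  have hol': "H \<xi> holomorphic_on S" if "\<xi> \<in> S" for \<xi> using H that by (auto simp: reg_def)
  have per: "H (\<xi> + of_real (2 * ?Lx)) \<eta> = H \<xi> \<eta>" "H \<xi> (\<eta> + of_real (2 * ?Ly)) = H \<xi> \<eta>" for \<xi> \<eta>
    using H by (auto simp: reg_def)
  have "J a b H = integral {- ?Lx..?Lx} (\<lambda>x. integral {- ?Ly..?Ly} (\<lambda>y. H (Complex x a) (Complex y b)))"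
    by (rule it[OF ab(1,2)])
  also have "... = integral {- ?Lx..?Lx} (\<lambda>x. integral {- ?Ly..?Ly} (\<lambda>y. H (Complex x a) (Complex y b')))"
    by (rule integral_cong) (rule periodic_strip_integral[OF hol' per(2) L(2) ab(2,4)], use ab in simp)
  also have "... = integral {- ?Ly..?Ly} (\<lambda>y. integral {- ?Lx..?Lx} (\<lambda>x. H (Complex x a) (Complex y b')))"
    by (rule sw[OF ab(1,4)])
  also have "... = integral {- ?Ly..?Ly} (\<lambda>y. integral {- ?Lx..?Lx} (\<lambda>x. H (Complex x a') (Complex y b')))"
    by (rule integral_cong) (rule periodic_strip_integral[OF hol per(1) L(1) ab(1,3)], use ab in simp)
  also have "... = J a' b' H" using it[OF ab(3,4)] sw[OF ab(3,4)] by simp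
  finally show ?thesis .
qed

subsection \<open>The scheme in Fourier variables\<close>

text \<open>The difference operators have real coefficients, so taking the real part commutes with
  them and the recursion for the Fourier symbols passes to real grids.\<close>

definition Rep :: "(complex \<Rightarrow> complex \<Rightarrow> complex) \<Rightarrow> grid" where
  "Rep H = (\<lambda>(i, j). Re (J 0 0 (\<lambda>\<xi> \<eta>. Ex i j \<xi> \<eta> * H \<xi> \<eta>)))"

lemma zero_alpha: "\<bar>0\<bar> \<le> \<alpha>" using \<alpha> by simp

abbreviation "cont0 \<equiv> lcont 0 0"

lemma cont_Ex: "cont0 (Ex i j)"
  using reg_cont[OF reg_Ex zero_alpha zero_alpha] .

lemma Rep_add: "cont0 H \<Longrightarrow> cont0 H' \<Longrightarrow> Rep (\<lambda>\<xi> \<eta>. H \<xi> \<eta> + H' \<xi> \<eta>) p = Rep H p + Rep H' p"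
  by (cases p) (simp add: Rep_def distrib_left J_add lcont_mult cont_Ex)

lemma Rep_cmult: "Rep (\<lambda>\<xi> \<eta>. of_real c * H \<xi> \<eta>) p = c * Rep H p"
proof -
  obtain i j where p: "p = (i, j)" by (cases p)
  have "(\<lambda>\<xi> \<eta>. Ex i j \<xi> \<eta> * (of_real c * H \<xi> \<eta>)) = (\<lambda>\<xi> \<eta>. of_real c * (Ex i j \<xi> \<eta> * H \<xi> \<eta>))"
    by (simp add: mult_ac)
  then show ?thesis by (simp add: Rep_def p J_cmult)
qed

lemma Rep_diff: "cont0 H \<Longrightarrow> cont0 H' \<Longrightarrow> Rep (\<lambda>\<xi> \<eta>. H \<xi> \<eta> - H' \<xi> \<eta>) p = Rep H p - Rep H' p"
  using Rep_add[of H "\<lambda>\<xi> \<eta>. of_real (- 1) * H' \<xi> \<eta>" p] Rep_cmult[of "- 1" H' p]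
    lcont_mult[OF lcont_const[of 0 0 "of_real (- 1)"], of H']
  by simp

definition sh :: "int \<Rightarrow> int \<Rightarrow> complex \<Rightarrow> complex \<Rightarrow> complex" where
  "sh s t \<xi> \<eta> = exp (\<i> * (\<xi> * of_real (of_int s * hx) + \<eta> * of_real (of_int t * hy)))"

lemma cont_sh: "cont0 (sh s t)"
  unfolding lcont_def sh_def Complex_eq case_prod_unfold by (intro continuous_intros)

lemma Ex_shift: "Ex (i + s) (j + t) \<xi> \<eta> = sh s t \<xi> \<eta> * Ex i j \<xi> \<eta>"
proof -
  have "\<i> * (\<xi> * of_real (of_int (i + s - i0) * hx) + \<eta> * of_real (of_int (j + t - j0) * hy))
    = \<i> * (\<xi> * of_real (of_int s * hx) + \<eta> * of_real (of_int t * hy)) + \<i> * (\<xi> * of_real (of_int (i - i0) * hx) + \<eta> * of_real (of_int (j - j0) * hy))"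
    by (simp add: algebra_simps)
  then show ?thesis by (simp only: Ex_def sh_def exp_add)
qed

lemma Rep_shift: "Rep H (i + s, j + t) = Rep (\<lambda>\<xi> \<eta>. sh s t \<xi> \<eta> * H \<xi> \<eta>) (i, j)"
  by (simp add: Rep_def Ex_shift mult_ac)

lemma sh_values:
  shows "sh 1 0 \<xi> \<eta> - sh (- 1) 0 \<xi> \<eta> = 2 * \<i> * hx * fsym \<xi> hx"
    and "sh 0 1 \<xi> \<eta> - sh 0 (- 1) \<xi> \<eta> = 2 * \<i> * hy * fsym \<eta> hy"
    and "sh 1 0 \<xi> \<eta> - 2 + sh (- 1) 0 \<xi> \<eta> = - (hx^2 * (fsym \<xi> (of_real (hx / 2)))^2)"
    and "sh 0 1 \<xi> \<eta> - 2 + sh 0 (- 1) \<xi> \<eta> = - (hy^2 * (fsym \<eta> (of_real (hy / 2)))^2)"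
    and "sh 1 1 \<xi> \<eta> - sh (- 1) 1 \<xi> \<eta> - sh 1 (- 1) \<xi> \<eta> + sh (- 1) (- 1) \<xi> \<eta> = - 4 * hx * hy * fsym \<xi> hx * fsym \<eta> hy"
proof -
  have e: "exp (\<i> * (z * h)) - exp (- (\<i> * (z * h))) = 2 * \<i> * h * fsym z h" if "h > 0" for z :: complex and h :: real
    using that by (simp add: fsym_eq sin_exp_eq)
  have sq: "exp (\<i> * (z * h)) - 2 + exp (- (\<i> * (z * h))) = - (h^2 * (fsym z (of_real (h / 2)))^2)" if "h > 0" for z :: complex and h :: real
  proof -
    define w where "w = exp (\<i> * (z * of_real (h / 2)))"
    have w0: "w \<noteq> 0" by (simp add: w_def)
    have a: "exp (\<i> * (z * h)) = w^2" unfolding w_def exp_double[symmetric] by (simp add: mult_ac)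
    have b: "exp (- (\<i> * (z * h))) = (inverse w)^2" unfolding power_inverse a[symmetric] by (simp add: exp_minus)
    have "fsym z (of_real (h / 2)) = (w - inverse w) / (2 * \<i>) / of_real (h / 2)"
      using that by (subst fsym_eq) (simp_all add: sin_exp_eq w_def exp_minus)
    moreover have "of_real h * (A / (2 * \<i>) / of_real (h / 2)) = A / \<i>" for A
      using that by (simp add: field_simps)
    ultimately have f: "h * fsym z (of_real (h / 2)) = (w - inverse w) / \<i>" by simp
    have "h^2 * (fsym z (of_real (h / 2)))^2 = ((w - inverse w) / \<i>)^2"
      unfolding f[symmetric] by (simp add: power_mult_distrib)
    also have "... = - (w - inverse w)\<^sup>2" by (simp add: power_divide power_mult_distrib)
    also have "... = - (w^2 - 2 + (inverse w)^2)" using w0 by (simp add: power2_diff)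
    finally show ?thesis unfolding a b by simp
  qed
  show "sh 1 0 \<xi> \<eta> - sh (- 1) 0 \<xi> \<eta> = 2 * \<i> * hx * fsym \<xi> hx"
    using e[OF hx, of \<xi>] by (simp add: sh_def)
  show "sh 0 1 \<xi> \<eta> - sh 0 (- 1) \<xi> \<eta> = 2 * \<i> * hy * fsym \<eta> hy"
    using e[OF hy, of \<eta>] by (simp add: sh_def)
  show "sh 1 0 \<xi> \<eta> - 2 + sh (- 1) 0 \<xi> \<eta> = - (hx^2 * (fsym \<xi> (of_real (hx / 2)))^2)"
    using sq[OF hx, of \<xi>] by (simp add: sh_def)
  show "sh 0 1 \<xi> \<eta> - 2 + sh 0 (- 1) \<xi> \<eta> = - (hy^2 * (fsym \<eta> (of_real (hy / 2)))^2)"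
    using sq[OF hy, of \<eta>] by (simp add: sh_def)
  have prod: "sh s t \<xi> \<eta> = sh s 0 \<xi> \<eta> * sh 0 t \<xi> \<eta>" for s t
    by (simp add: sh_def exp_add[symmetric] distrib_left)
  have "sh 1 1 \<xi> \<eta> - sh (- 1) 1 \<xi> \<eta> - sh 1 (- 1) \<xi> \<eta> + sh (- 1) (- 1) \<xi> \<eta>
    = (sh 1 0 \<xi> \<eta> - sh (- 1) 0 \<xi> \<eta>) * (sh 0 1 \<xi> \<eta> - sh 0 (- 1) \<xi> \<eta>)"
    unfolding prod[of 1 1] prod[of "- 1" 1] prod[of 1 "- 1"] prod[of "- 1" "- 1"] by (simp add: algebra_simps)
  also have "... = - 4 * hx * hy * fsym \<xi> hx * fsym \<eta> hy"
    using e[OF hx, of \<xi>] e[OF hy, of \<eta>] by (simp add: sh_def mult_ac)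
  finally show "sh 1 1 \<xi> \<eta> - sh (- 1) 1 \<xi> \<eta> - sh 1 (- 1) \<xi> \<eta> + sh (- 1) (- 1) \<xi> \<eta> = - 4 * hx * hy * fsym \<xi> hx * fsym \<eta> hy" .
qed

end

section \<open>Exponential decay, orthogonality of the modes and geometric sums\<close>

lemma summable_exp_abs_int:
  fixes c :: real
  assumes "c > 0"
  shows "(\<lambda>i::int. exp (- c * \<bar>of_int i\<bar>)) summable_on UNIV"
proof -
  have geo: "(\<lambda>m::nat. exp (- c * real m)) summable_on UNIV"
  proof (rule norm_summable_imp_summable_on)
    have "(\<lambda>m::nat. norm (exp (- c * real m))) = (\<lambda>m. exp (- c) ^ m)"
      by (auto simp: exp_of_nat_mult[symmetric] mult_ac)
    then show "summable (\<lambda>m::nat. norm (exp (- c * real m)))"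
      using assms by (simp add: summable_geometric)
  qed
  have b1: "bij_betw int UNIV {0..}" by (rule bij_betwI[where g = nat]) auto
  have b2: "bij_betw (\<lambda>m. - int m - 1) UNIV {..<0}" by (rule bij_betwI[where g = "\<lambda>i. nat (- i - 1)"]) auto
  have 1: "(\<lambda>i::int. exp (- c * \<bar>of_int i\<bar>)) summable_on {0..}"
    using summable_on_reindex_bij_betw[OF b1, of "\<lambda>i::int. exp (- c * \<bar>of_int i\<bar>)"] geo by simp
  have 2: "(\<lambda>i::int. exp (- c * \<bar>of_int i\<bar>)) summable_on {..<0}"
  proof -
    have "(\<lambda>m. exp (- c * \<bar>of_int (- int m - 1)\<bar>)) = (\<lambda>m. exp (- c) * exp (- c * real m))"
      by (auto simp: exp_add[symmetric] algebra_simps abs_if)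
    then have "(\<lambda>m. exp (- c * \<bar>of_int (- int m - 1)\<bar>)) summable_on UNIV"
      using summable_on_cmult_right[OF geo, of "exp (- c)"] by simp
    then show ?thesis
      using summable_on_reindex_bij_betw[OF b2, of "\<lambda>i::int. exp (- c * \<bar>of_int i\<bar>)"] by simp
  qed
  have "{0..} \<union> {..<0} = (UNIV :: int set)" "{0..} \<inter> {..<0} = ({} :: int set)" by auto
  then show ?thesis using summable_on_Un_disjoint[OF 1 2] by metis
qed

lemma square_summable_exp_bound:
  fixes U :: grid
  assumes c: "c > 0" and d: "d > 0" and U: "\<And>i j. \<bar>U (i, j)\<bar> \<le> K * (exp (- c * \<bar>of_int i\<bar>) * exp (- d * \<bar>of_int j\<bar>))"
  shows "square_summable U"
proof -
  define f where "f = (\<lambda>i::int. exp (- (2 * c) * \<bar>of_int i\<bar>))"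
  define g where "g = (\<lambda>i::int. exp (- (2 * d) * \<bar>of_int i\<bar>))"
  have f: "f summable_on UNIV" and g: "g summable_on UNIV"
    unfolding f_def g_def by (rule summable_exp_abs_int, use c d in simp)+
  obtain s where s: "(g has_sum s) UNIV" using g by (auto simp: summable_on_def)
  have "(\<lambda>(i, j). f i * g j) summable_on Sigma UNIV (\<lambda>_. UNIV)"
  proof (rule summable_on_SigmaI)
    show "((\<lambda>y. case (x, y) of (i, j) \<Rightarrow> f i * g j) has_sum f x * s) UNIV" for x
      using has_sum_cmult_right[OF s, of "f x"] by simp
    show "(\<lambda>x. f x * s) summable_on UNIV" using summable_on_cmult_left[OF f] .
  qed (simp add: f_def g_def)
  then have fg: "(\<lambda>p. K^2 * (case p of (i, j) \<Rightarrow> f i * g j)) summable_on UNIV"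
    by (intro summable_on_cmult_right) simp
  have "(\<lambda>p. norm ((U p)^2)) summable_on UNIV"
  proof (rule Infinite_Sum.abs_summable_on_comparison_test'[OF fg])
    fix p :: "int \<times> int"
    obtain i j where p: "p = (i, j)" by (cases p)
    have "norm ((U p)^2) = \<bar>U (i, j)\<bar>^2" by (simp add: p)
    also have "... \<le> (K * (exp (- c * \<bar>of_int i\<bar>) * exp (- d * \<bar>of_int j\<bar>)))^2"
      by (rule power_mono[OF U]) simp
    also have "... = K^2 * (f i * g j)"
      by (simp add: f_def g_def power_mult_distrib exp_double[symmetric] mult_ac)
    finally show "norm ((U p)^2) \<le> K^2 * (case p of (i, j) \<Rightarrow> f i * g j)" by (simp add: p)
  qed
  then show ?thesis by (simp add: square_summable_def)
qed

lemma integral_exp_mode: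
  fixes m :: int and h :: real
  assumes h: "h > 0"
  shows "integral {- (pi / h)..pi / h} (\<lambda>x. exp (\<i> * (of_real x * of_real (of_int m * h)))) = (if m = 0 then of_real (2 * (pi / h)) else 0)"
proof (cases "m = 0")
  case True
  then show ?thesis using h by (simp add: content_real scaleR_conv_of_real)
next
  case False
  define c where "c = \<i> * of_real (of_int m * h)"
  have c: "c \<noteq> 0" using False h by (simp add: c_def)
  define F where "F = (\<lambda>x::real. exp (c * of_real x) / c)"
  have "((\<lambda>x. exp (c * of_real x)) has_integral (F (pi / h) - F (- (pi / h)))) {- (pi / h)..pi / h}"
  proof (rule fundamental_theorem_of_calculus)
    show "- (pi / h) \<le> pi / h" using h by simp
    fix x assume "x \<in> {- (pi / h)..pi / h}"
    have "((\<lambda>z. exp (c * z) / c) has_field_derivative exp (c * of_real x)) (at (of_real x))"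
      using c by (auto intro!: derivative_eq_intros)
    from has_vector_derivative_real_field[OF this]
    show "(F has_vector_derivative exp (c * of_real x)) (at x within {- (pi / h)..pi / h})"
      unfolding F_def by (rule has_vector_derivative_at_within)
  qed
  moreover have "F (pi / h) = F (- (pi / h))"
  proof -
    have a: "c * of_real (pi / h) = \<i> * of_real (pi * of_int m)" "c * of_real (- (pi / h)) = - (\<i> * of_real (pi * of_int m))"
      using h by (simp_all add: c_def field_simps)
    have "exp (\<i> * of_real (pi * of_int m)) = exp (- (\<i> * of_real (pi * of_int m))) * exp (\<i> * of_real (2 * pi * of_int m))"
      unfolding exp_add[symmetric] by (simp add: algebra_simps)
    also have "exp (\<i> * of_real (2 * pi * of_int m)) = 1"
      using exp_integer_2pi[of "of_int m"] by (simp add: mult_ac)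
    finally show ?thesis unfolding F_def a by simp
  qed
  ultimately have "integral {- (pi / h)..pi / h} (\<lambda>x. exp (c * of_real x)) = 0"
    by (simp add: integral_unique)
  then show ?thesis using False by (simp add: c_def mult_ac)
qed

text \<open>The origin has weight one half and the points to its right form a geometric series in
  \<open>exp (\<i> * \<xi> * h)\<close>; both sides are \<open>\<i> * h / 2\<close> times the
  cotangent of \<open>\<xi> * h / 2\<close>.\<close>

lemma gsym_geometric:
  fixes h :: real
  assumes h: "h > 0" and q: "exp (\<i> * (\<xi> * of_real h)) \<noteq> 1"
  shows "of_real h * (1 / 2 + exp (\<i> * (\<xi> * of_real h)) / (1 - exp (\<i> * (\<xi> * of_real h)))) = gsym \<xi> (of_real h)"
proof -
  define e where "e = exp (\<i> * (\<xi> * of_real h / 2))"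
  have e2: "exp (\<i> * (\<xi> * of_real h)) = e^2" unfolding e_def exp_double[symmetric] by simp
  have e0: "e \<noteq> 0" by (simp add: e_def)
  have q': "1 - e\<^sup>2 \<noteq> 0" using q unfolding e2 by auto
  have \<xi>0: "\<xi> \<noteq> 0" using q by auto
  define w where "w = \<xi> * of_real h / 2"
  have w0: "w \<noteq> 0" using \<xi>0 h by (simp add: w_def)
  have s: "sin w = (e - inverse e) / (2 * \<i>)" and c: "cos w = (e + inverse e) / 2"
    by (simp_all add: sin_exp_eq cos_exp_eq e_def w_def exp_minus)
  have "gsym \<xi> (of_real h) = \<i> / \<xi> * cos w / (sin w / w)"
    using w0 by (simp add: gsym_def csinc_def w_def)
  also have "... = of_real h / 2 * (\<i> * cos w / sin w)"
    using \<xi>0 by (simp add: w_def mult_ac)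
  also have "\<i> * cos w / sin w = (1 + e^2) / (1 - e\<^sup>2)"
  proof -
    have "e - inverse e = - (1 - e\<^sup>2) / e" "e + inverse e = (1 + e^2) / e"
      using e0 by (simp_all add: field_simps power2_eq_square)
    then show ?thesis unfolding s c using e0 q' by (simp add: field_simps)
  qed
  also have "of_real h / 2 * ((1 + e^2) / (1 - e\<^sup>2)) = of_real h * (1 / 2 + e^2 / (1 - e\<^sup>2))"
    using q' by (simp add: field_simps)
  finally show ?thesis unfolding e2 by simp
qed

lemma infsum_int_from_1: "infsum f {1..} = infsum (\<lambda>m. f (int m + 1)) (UNIV :: nat set)"
proof -
  have "bij_betw (\<lambda>m. int m + 1) UNIV {1..}" by (rule bij_betwI[where g = "\<lambda>i. nat (i - 1)"]) auto
  from infsum_reindex_bij_betw[OF this] show ?thesis by metis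
qed

section \<open>Action of the scheme on Fourier representations\<close>

context fourier_scheme
begin

lemma lcont_symbols:
  "cont0 (\<lambda>\<xi> \<eta>. fsym \<xi> (of_real c))" "cont0 (\<lambda>\<xi> \<eta>. fsym \<eta> (of_real c))"
  "cont0 (\<lambda>\<xi> \<eta>. (fsym \<xi> (of_real c))^2)" "cont0 (\<lambda>\<xi> \<eta>. (fsym \<eta> (of_real c))^2)"
  unfolding lcont_def fsym_def Complex_eq case_prod_unfold by (auto intro!: continuous_intros)

lemma Rep_Dx: "cont0 H \<Longrightarrow> Dx (Rep H) p = Rep (\<lambda>\<xi> \<eta>. 2 * \<i> * hx * fsym \<xi> hx * H \<xi> \<eta>) p"
  and Rep_Dy: "cont0 H \<Longrightarrow> Dy (Rep H) p = Rep (\<lambda>\<xi> \<eta>. 2 * \<i> * hy * fsym \<eta> hy * H \<xi> \<eta>) p"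
  and Rep_Dxx: "cont0 H \<Longrightarrow> Dxx (Rep H) p = Rep (\<lambda>\<xi> \<eta>. - (hx^2 * (fsym \<xi> (of_real (hx / 2)))^2) * H \<xi> \<eta>) p"
  and Rep_Dyy: "cont0 H \<Longrightarrow> Dyy (Rep H) p = Rep (\<lambda>\<xi> \<eta>. - (hy^2 * (fsym \<eta> (of_real (hy / 2)))^2) * H \<xi> \<eta>) p"
  and Rep_Dxy: "cont0 H \<Longrightarrow> Dxy (Rep H) p = Rep (\<lambda>\<xi> \<eta>. - 4 * hx * hy * fsym \<xi> hx * fsym \<eta> hy * H \<xi> \<eta>) p"
proof -
  assume H: "cont0 H"
  obtain i j where p: "p = (i, j)" by (cases p)
  have cs: "cont0 (\<lambda>\<xi> \<eta>. sh s t \<xi> \<eta> * H \<xi> \<eta>)" for s t by (rule lcont_mult[OF cont_sh H])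
  have c2: "cont0 (\<lambda>\<xi> \<eta>. of_real 2 * H \<xi> \<eta>)" by (rule lcont_mult[OF lcont_const H])
  have d0: "cont0 (\<lambda>\<xi> \<eta>. sh s t \<xi> \<eta> * H \<xi> \<eta> - of_real 2 * H \<xi> \<eta>)" for s t
    using lcont_add[OF cs[of s t] lcont_mult[OF lcont_const[of 0 0 "- 1"] c2]] by simp
  have R: "Rep H (i + s, j + t) = Rep (\<lambda>\<xi> \<eta>. sh s t \<xi> \<eta> * H \<xi> \<eta>) p" for s t
    unfolding p by (rule Rep_shift)
  have "Dx (Rep H) p = Rep H (i + 1, j + 0) - Rep H (i + - 1, j + 0)" by (simp add: Dx_def p)
  also have "... = Rep (\<lambda>\<xi> \<eta>. sh 1 0 \<xi> \<eta> * H \<xi> \<eta> - sh (- 1) 0 \<xi> \<eta> * H \<xi> \<eta>) p"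
    unfolding R by (rule Rep_diff[OF cs cs, symmetric])
  finally show "Dx (Rep H) p = Rep (\<lambda>\<xi> \<eta>. 2 * \<i> * hx * fsym \<xi> hx * H \<xi> \<eta>) p"
    by (simp only: left_diff_distrib[symmetric] sh_values)
  have "Dy (Rep H) p = Rep H (i + 0, j + 1) - Rep H (i + 0, j + - 1)" by (simp add: Dy_def p)
  also have "... = Rep (\<lambda>\<xi> \<eta>. sh 0 1 \<xi> \<eta> * H \<xi> \<eta> - sh 0 (- 1) \<xi> \<eta> * H \<xi> \<eta>) p"
    unfolding R by (rule Rep_diff[OF cs cs, symmetric])
  finally show "Dy (Rep H) p = Rep (\<lambda>\<xi> \<eta>. 2 * \<i> * hy * fsym \<eta> hy * H \<xi> \<eta>) p"
    by (simp only: left_diff_distrib[symmetric] sh_values)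
  have "Dxx (Rep H) p = Rep H (i + 1, j + 0) - 2 * Rep H p + Rep H (i + - 1, j + 0)" by (simp add: Dxx_def p)
  also have "... = Rep (\<lambda>\<xi> \<eta>. sh 1 0 \<xi> \<eta> * H \<xi> \<eta> - of_real 2 * H \<xi> \<eta> + sh (- 1) 0 \<xi> \<eta> * H \<xi> \<eta>) p"
    unfolding R
    by (simp only: Rep_add[OF d0 cs] Rep_diff[OF cs c2] Rep_cmult)
  finally show "Dxx (Rep H) p = Rep (\<lambda>\<xi> \<eta>. - (hx^2 * (fsym \<xi> (of_real (hx / 2)))^2) * H \<xi> \<eta>) p"
    by (simp only: of_real_numeral left_diff_distrib[symmetric] distrib_right[symmetric] sh_values)
  have "Dyy (Rep H) p = Rep H (i + 0, j + 1) - 2 * Rep H p + Rep H (i + 0, j + - 1)" by (simp add: Dyy_def p)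
  also have "... = Rep (\<lambda>\<xi> \<eta>. sh 0 1 \<xi> \<eta> * H \<xi> \<eta> - of_real 2 * H \<xi> \<eta> + sh 0 (- 1) \<xi> \<eta> * H \<xi> \<eta>) p"
    unfolding R
    by (simp only: Rep_add[OF d0 cs] Rep_diff[OF cs c2] Rep_cmult)
  finally show "Dyy (Rep H) p = Rep (\<lambda>\<xi> \<eta>. - (hy^2 * (fsym \<eta> (of_real (hy / 2)))^2) * H \<xi> \<eta>) p"
    by (simp only: of_real_numeral left_diff_distrib[symmetric] distrib_right[symmetric] sh_values)
  have d1: "cont0 (\<lambda>\<xi> \<eta>. sh 1 1 \<xi> \<eta> * H \<xi> \<eta> - sh (- 1) 1 \<xi> \<eta> * H \<xi> \<eta>)"
    using lcont_add[OF cs[of 1 1] lcont_mult[OF lcont_const[of 0 0 "- 1"] cs[of "- 1" 1]]] by simp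
  have d2: "cont0 (\<lambda>\<xi> \<eta>. sh 1 1 \<xi> \<eta> * H \<xi> \<eta> - sh (- 1) 1 \<xi> \<eta> * H \<xi> \<eta> - sh 1 (- 1) \<xi> \<eta> * H \<xi> \<eta>)"
    using lcont_add[OF d1 lcont_mult[OF lcont_const[of 0 0 "- 1"] cs[of 1 "- 1"]]] by simp
  have "Dxy (Rep H) p = Rep H (i + 1, j + 1) - Rep H (i + - 1, j + 1) - Rep H (i + 1, j + - 1) + Rep H (i + - 1, j + - 1)"
    by (simp add: Dxy_def p)
  also have "... = Rep (\<lambda>\<xi> \<eta>. sh 1 1 \<xi> \<eta> * H \<xi> \<eta> - sh (- 1) 1 \<xi> \<eta> * H \<xi> \<eta> - sh 1 (- 1) \<xi> \<eta> * H \<xi> \<eta> + sh (- 1) (- 1) \<xi> \<eta> * H \<xi> \<eta>) p"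
    unfolding R by (simp only: Rep_add[OF d2 cs] Rep_diff[OF d1 cs] Rep_diff[OF cs cs])
  finally show "Dxy (Rep H) p = Rep (\<lambda>\<xi> \<eta>. - 4 * hx * hy * fsym \<xi> hx * fsym \<eta> hy * H \<xi> \<eta>) p"
    by (simp only: left_diff_distrib[symmetric] distrib_right[symmetric] sh_values)
qed

lemma lcont_lin:
  assumes "cont0 A" "cont0 B"
  shows "cont0 (\<lambda>\<xi> \<eta>. A \<xi> \<eta> + of_real c * B \<xi> \<eta>)"
  by (rule lcont_add[OF assms(1) lcont_mult[OF lcont_const assms(2)]])

lemma Rep_lin:
  assumes "cont0 A" "cont0 B"
  shows "Rep (\<lambda>\<xi> \<eta>. A \<xi> \<eta> + of_real c * B \<xi> \<eta>) p = Rep A p + c * Rep B p"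
  using Rep_add[OF assms(1) lcont_mult[OF lcont_const assms(2)], of "of_real c" p] by (simp add: Rep_cmult)

lemma implicit_Rep:
  assumes H: "cont0 H"
  shows "implicit_op \<mu>x \<mu>y hx hy k (Rep H) p = Rep (\<lambda>\<xi> \<eta>. Den \<xi> \<eta> * H \<xi> \<eta>) p"
proof -
  define m1 m2 m3 m4 where m: "m1 = (\<lambda>\<xi> \<eta>::complex. 2 * \<i> * hx * fsym \<xi> hx * H \<xi> \<eta>)"
    "m2 = (\<lambda>\<xi> \<eta>. 2 * \<i> * hy * fsym \<eta> hy * H \<xi> \<eta>)"
    "m3 = (\<lambda>\<xi> \<eta>::complex. - (hx^2 * (fsym \<xi> (of_real (hx / 2)))^2) * H \<xi> \<eta>)"
    "m4 = (\<lambda>\<xi> \<eta>. - (hy^2 * (fsym \<eta> (of_real (hy / 2)))^2) * H \<xi> \<eta>)"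
  have c: "cont0 m1" "cont0 m2" "cont0 m3" "cont0 m4"
  proof -
    note cc = lcont_mult[OF lcont_mult[OF lcont_const lcont_symbols(1)] H]
      lcont_mult[OF lcont_mult[OF lcont_const lcont_symbols(2)] H]
      lcont_mult[OF lcont_mult[OF lcont_const lcont_symbols(3)] H]
      lcont_mult[OF lcont_mult[OF lcont_const lcont_symbols(4)] H]
    show "cont0 m1" unfolding m using cc(1)[of "2 * \<i> * hx" hx] by simp
    show "cont0 m2" unfolding m using cc(2)[of "2 * \<i> * hy" hy] by simp
    show "cont0 m3" unfolding m using cc(3)[of "- (hx^2)" "hx / 2"] by simp
    show "cont0 m4" unfolding m using cc(4)[of "- (hy^2)" "hy / 2"] by simp
  qed
  have "implicit_op \<mu>x \<mu>y hx hy k (Rep H) p = Rep H p + (\<mu>x * k / (2 * hx)) * Rep m1 p + (\<mu>y * k / (2 * hy)) * Rep m2 p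
     + (- k / (2 * hx^2)) * Rep m3 p + (- k / (2 * hy^2)) * Rep m4 p"
    unfolding implicit_op_def Rep_Dx[OF H] Rep_Dy[OF H] Rep_Dxx[OF H] Rep_Dyy[OF H] m by simp
  also have "... = Rep (\<lambda>\<xi> \<eta>. H \<xi> \<eta> + of_real (\<mu>x * k / (2 * hx)) * m1 \<xi> \<eta> + of_real (\<mu>y * k / (2 * hy)) * m2 \<xi> \<eta>
     + of_real (- k / (2 * hx^2)) * m3 \<xi> \<eta> + of_real (- k / (2 * hy^2)) * m4 \<xi> \<eta>) p"
    by (simp only: Rep_lin lcont_lin H c)
  also have "(\<lambda>\<xi> \<eta>. H \<xi> \<eta> + of_real (\<mu>x * k / (2 * hx)) * m1 \<xi> \<eta> + of_real (\<mu>y * k / (2 * hy)) * m2 \<xi> \<eta>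
     + of_real (- k / (2 * hx^2)) * m3 \<xi> \<eta> + of_real (- k / (2 * hy^2)) * m4 \<xi> \<eta>) = (\<lambda>\<xi> \<eta>. Den \<xi> \<eta> * H \<xi> \<eta>)"
  proof (intro ext)
    fix \<xi> \<eta>
    have 1: "of_real (\<mu>x * k / (2 * hx)) * m1 \<xi> \<eta> = \<i> * k * \<mu>x * fsym \<xi> hx * H \<xi> \<eta>"
      "of_real (\<mu>y * k / (2 * hy)) * m2 \<xi> \<eta> = \<i> * k * \<mu>y * fsym \<eta> hy * H \<xi> \<eta>"
      "of_real (- k / (2 * hx^2)) * m3 \<xi> \<eta> = k / 2 * (fsym \<xi> (of_real (hx / 2)))^2 * H \<xi> \<eta>"
      "of_real (- k / (2 * hy^2)) * m4 \<xi> \<eta> = k / 2 * (fsym \<eta> (of_real (hy / 2)))^2 * H \<xi> \<eta>"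
      using hx hy by (simp_all add: m)
    show "H \<xi> \<eta> + of_real (\<mu>x * k / (2 * hx)) * m1 \<xi> \<eta> + of_real (\<mu>y * k / (2 * hy)) * m2 \<xi> \<eta>
     + of_real (- k / (2 * hx^2)) * m3 \<xi> \<eta> + of_real (- k / (2 * hy^2)) * m4 \<xi> \<eta> = Den \<xi> \<eta> * H \<xi> \<eta>"
      unfolding 1 Den_def step_den_def by (simp add: algebra_simps)
  qed
  finally show ?thesis .
qed

text \<open>The second order terms are products of central differences, \<open>Dx\<close> with
  \<open>Dx\<close>, \<open>Dy\<close> with \<open>Dy\<close> and \<open>Dx\<close> with
  \<open>Dy\<close>; hence they assemble to the completed square
  \<open>(p * u + q * v)^2 - (p^2 + q^2)\<close> of \<open>step_num\<close>.\<close>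

lemma explicit_Rep:
  assumes H: "cont0 H"
  shows "explicit_op \<rho>x \<rho>y hx hy k (zx n) (zy n) (Rep H) p = Rep (\<lambda>\<xi> \<eta>. Num n \<xi> \<eta> * H \<xi> \<eta>) p"
proof -
  define m1 m2 m3 m4 m5 where m: "m1 = (\<lambda>\<xi> \<eta>::complex. 2 * \<i> * hx * fsym \<xi> hx * H \<xi> \<eta>)"
    "m2 = (\<lambda>\<xi> \<eta>. 2 * \<i> * hy * fsym \<eta> hy * H \<xi> \<eta>)"
    "m3 = (\<lambda>\<xi> \<eta>::complex. 2 * \<i> * hx * fsym \<xi> hx * (2 * \<i> * hx * fsym \<xi> hx * H \<xi> \<eta>))"
    "m4 = (\<lambda>\<xi> \<eta>. 2 * \<i> * hy * fsym \<eta> hy * (2 * \<i> * hy * fsym \<eta> hy * H \<xi> \<eta>))"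
    "m5 = (\<lambda>\<xi> \<eta>. - 4 * hx * hy * fsym \<xi> hx * fsym \<eta> hy * H \<xi> \<eta>)"
  have c12: "cont0 (\<lambda>\<xi> \<eta>. 2 * \<i> * hx * fsym \<xi> hx * H' \<xi> \<eta>)" "cont0 (\<lambda>\<xi> \<eta>. 2 * \<i> * hy * fsym \<eta> hy * H' \<xi> \<eta>)" if "cont0 H'" for H'
    using lcont_mult[OF lcont_mult[OF lcont_const lcont_symbols(1)] that, of "2 * \<i> * hx" hx]
      lcont_mult[OF lcont_mult[OF lcont_const lcont_symbols(2)] that, of "2 * \<i> * hy" hy] by simp_all
  have c: "cont0 m1" "cont0 m2" "cont0 m3" "cont0 m4" "cont0 m5"
    unfolding m using c12[OF c12(1)[OF H]] c12[OF c12(2)[OF H]] c12[OF H]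
      lcont_mult[OF lcont_mult[OF lcont_mult[OF lcont_const lcont_symbols(1)] lcont_symbols(2)] H, of "- 4 * hx * hy" hx hy] by simp_all
  have dd: "Dx (Dx (Rep H)) p = Rep m3 p" "Dy (Dy (Rep H)) p = Rep m4 p"
  proof -
    have "Dx (Rep H) = Rep m1" "Dy (Rep H) = Rep m2" using Rep_Dx[OF H] Rep_Dy[OF H] by (auto simp: m)
    then show "Dx (Dx (Rep H)) p = Rep m3 p" "Dy (Dy (Rep H)) p = Rep m4 p"
      using Rep_Dx[OF c(1)] Rep_Dy[OF c(2)] by (simp_all add: m)
  qed
  define c1 c2 c3 c4 c5 where cd: "c1 = - (sqrt (\<rho>x * k) * zx n / (2 * hx))" "c2 = - (sqrt (\<rho>y * k) * zy n / (2 * hy))"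
    "c3 = \<rho>x * k * ((zx n)^2 - 1) / (8 * hx^2)" "c4 = \<rho>y * k * ((zy n)^2 - 1) / (8 * hy^2)"
    "c5 = sqrt (\<rho>x * \<rho>y) * k * zx n * zy n / (4 * hx * hy)"
  have "explicit_op \<rho>x \<rho>y hx hy k (zx n) (zy n) (Rep H) p = Rep H p + c1 * Rep m1 p + c2 * Rep m2 p
     + c3 * Rep m3 p + c4 * Rep m4 p + c5 * Rep m5 p"
    unfolding explicit_op_def dd Rep_Dx[OF H] Rep_Dy[OF H] Rep_Dxy[OF H] m[symmetric] cd by simp
  also have "... = Rep (\<lambda>\<xi> \<eta>. H \<xi> \<eta> + of_real c1 * m1 \<xi> \<eta> + of_real c2 * m2 \<xi> \<eta>
     + of_real c3 * m3 \<xi> \<eta> + of_real c4 * m4 \<xi> \<eta> + of_real c5 * m5 \<xi> \<eta>) p"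
    by (simp only: Rep_lin lcont_lin H c)
  also have "(\<lambda>\<xi> \<eta>. H \<xi> \<eta> + of_real c1 * m1 \<xi> \<eta> + of_real c2 * m2 \<xi> \<eta>
     + of_real c3 * m3 \<xi> \<eta> + of_real c4 * m4 \<xi> \<eta> + of_real c5 * m5 \<xi> \<eta>) = (\<lambda>\<xi> \<eta>. Num n \<xi> \<eta> * H \<xi> \<eta>)"
  proof (intro ext)
    fix \<xi> \<eta>
    define a b u v where "a = complex_of_real (sqrt (k * \<rho>x))" and "b = complex_of_real (sqrt (k * \<rho>y))"
      and "u = complex_of_real (zx n)" and "v = complex_of_real (zy n)"
    define s t h where "s = fsym \<xi> hx" and "t = fsym \<eta> hy" and "h = H \<xi> \<eta>"
    have ab: "a^2 = of_real (\<rho>x * k)" "b^2 = of_real (\<rho>y * k)" "a * b = of_real (sqrt (\<rho>x * \<rho>y) * k)"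
    proof -
      have "sqrt (k * \<rho>x) * sqrt (k * \<rho>y) = sqrt (\<rho>x * \<rho>y) * k"
        using k by (simp add: real_sqrt_mult)
      then show "a * b = of_real (sqrt (\<rho>x * \<rho>y) * k)" unfolding a_def b_def by (metis of_real_mult)
      show "a^2 = of_real (\<rho>x * k)" "b^2 = of_real (\<rho>y * k)"
        using k rx ry by (simp_all add: a_def b_def flip: of_real_power)
    qed
    have hz: "hx \<noteq> 0" "hy \<noteq> 0" using hx hy by auto
    have 1: "of_real c1 * m1 \<xi> \<eta> = - \<i> * (a * s * u) * h" "of_real c2 * m2 \<xi> \<eta> = - \<i> * (b * t * v) * h"
      using hz by (simp_all add: cd m a_def b_def u_def v_def s_def t_def h_def mult_ac)
    have 2: "of_real c3 * m3 \<xi> \<eta> = - (a^2 * (u^2 - 1) * s^2 / 2) * h" "of_real c4 * m4 \<xi> \<eta> = - (b^2 * (v^2 - 1) * t^2 / 2) * h"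
      using hz unfolding ab by (simp_all add: cd m u_def v_def s_def t_def h_def power2_eq_square)
    have 3: "of_real c5 * m5 \<xi> \<eta> = - ((a * b) * u * v * s * t) * h"
      using hz unfolding ab by (simp add: cd m u_def v_def s_def t_def h_def)
    have N: "Num n \<xi> \<eta> = 1 - \<i> * (a * s * u + b * t * v) - ((a * s * u + b * t * v)^2 - ((a * s)^2 + (b * t)^2)) / 2"
      by (simp add: Num_def step_num_def a_def b_def u_def v_def s_def t_def)
    show "H \<xi> \<eta> + of_real c1 * m1 \<xi> \<eta> + of_real c2 * m2 \<xi> \<eta>
     + of_real c3 * m3 \<xi> \<eta> + of_real c4 * m4 \<xi> \<eta> + of_real c5 * m5 \<xi> \<eta> = Num n \<xi> \<eta> * H \<xi> \<eta>"
      unfolding 1 2 3 N h_def[symmetric] by (simp add: power2_eq_square diff_divide_distrib add_divide_distrib algebra_simps)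
  qed
  finally show ?thesis .
qed

lemma Rep_initial: "Rep (\<lambda>\<xi> \<eta>. 1) (i, j) = (if i = i0 \<and> j = j0 then (2 * (pi / hx)) * (2 * (pi / hy)) else 0)"
proof -
  have "J 0 0 (Ex i j) = integral {- (pi / hx)..pi / hx} (\<lambda>x. integral {- (pi / hy)..pi / hy} (\<lambda>y. Ex i j (Complex x 0) (Complex y 0)))"
    using integral_prod_continuous[OF cont_Ex[unfolded lcont_def fbox_def]] by (simp add: J_def fbox_def)
  also have "... = integral {- (pi / hx)..pi / hx} (\<lambda>x. exp (\<i> * (of_real x * of_real (of_int (i - i0) * hx)))
      * (if j - j0 = 0 then of_real (2 * (pi / hy)) else 0))"
  proof (rule integral_cong)
    fix x
    have "Ex i j (Complex x 0) (Complex y 0) = exp (\<i> * (of_real x * of_real (of_int (i - i0) * hx))) * exp (\<i> * (of_real y * of_real (of_int (j - j0) * hy)))" for y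
      unfolding Ex_def exp_add[symmetric] by (simp add: complex_of_real_def distrib_left)
    then show "integral {- (pi / hy)..pi / hy} (\<lambda>y. Ex i j (Complex x 0) (Complex y 0)) = exp (\<i> * (of_real x * of_real (of_int (i - i0) * hx)))
      * (if j - j0 = 0 then of_real (2 * (pi / hy)) else 0)"
      by (simp only: integral_mult_right integral_exp_mode[OF hy])
  qed
  also have "... = (if i - i0 = 0 then of_real (2 * (pi / hx)) else 0) * (if j - j0 = 0 then of_real (2 * (pi / hy)) else 0)"
    by (simp only: integral_mult_left integral_exp_mode[OF hx])
  finally show ?thesis by (auto simp: Rep_def simp flip: of_real_mult)
qed

text \<open>The factor matches the initial grid: before the first step the mode integral at the
  source point is \<open>(2 * (pi / hx)) * (2 * (pi / hy))\<close>, which has to become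
  \<open>1 / (hx * hy)\<close>.\<close>

definition "V n = (\<lambda>p. 1 / (4 * pi^2) * Rep (Amp n) p)"

lemma Amp_cont: "cont0 (Amp n)"
  by (rule reg_cont[OF reg_Amp zero_alpha zero_alpha])

lemma V_eq:
  assumes "\<bar>a\<bar> \<le> \<alpha>" "\<bar>b\<bar> \<le> \<alpha>"
  shows "V n (i, j) = 1 / (4 * pi^2) * Re (J a b (\<lambda>\<xi> \<eta>. Ex i j \<xi> \<eta> * Amp n \<xi> \<eta>))"
  using J_shift[OF reg_mult[OF reg_Ex reg_Amp] zero_alpha zero_alpha assms] by (simp add: V_def Rep_def)

lemma norm_Ex: "cmod (Ex i j (Complex x a) (Complex y b)) = exp (- (a * (of_int (i - i0) * hx)) - b * (of_int (j - j0) * hy))"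
  by (simp add: Ex_def norm_exp_eq_Re)

text \<open>Exponential decay in the grid indices: in each quadrant of indices the contours are
  moved to height \<alpha> or -\<alpha> so that the mode itself decays there, while the amplitude is
  bounded on the compact set of all these contours. Square summability singles out the solution of
  the implicit step.\<close>

lemma V_square_summable: "square_summable (V n)"
proof -
  have "compact ((\<lambda>((x, a), (y, b)). Amp n (Complex x a) (Complex y b)) ` (({- (pi / hx)..pi / hx} \<times> {- \<alpha>..\<alpha>}) \<times> ({- (pi / hy)..pi / hy} \<times> {- \<alpha>..\<alpha>})))"
  proof (rule compact_continuous_image)
    have 1: "continuous_on (({- (pi / hx)..pi / hx} \<times> {- \<alpha>..\<alpha>}) \<times> ({- (pi / hy)..pi / hy} \<times> {- \<alpha>..\<alpha>})) (\<lambda>((x, a), (y, b)). (Complex x a, Complex y b))"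
      unfolding Complex_eq by (auto simp: case_prod_unfold intro!: continuous_intros)
    have 2: "continuous_on (S \<times> S) (\<lambda>(\<xi>, \<eta>). Amp n \<xi> \<eta>)" using reg_Amp[of n] by (simp add: reg_def)
    have 3: "(\<lambda>((x, a), (y, b)). (Complex x a, Complex y b)) ` (({- (pi / hx)..pi / hx} \<times> {- \<alpha>..\<alpha>}) \<times> ({- (pi / hy)..pi / hy} \<times> {- \<alpha>..\<alpha>})) \<subseteq> S \<times> S"
      by auto
    show "continuous_on (({- (pi / hx)..pi / hx} \<times> {- \<alpha>..\<alpha>}) \<times> ({- (pi / hy)..pi / hy} \<times> {- \<alpha>..\<alpha>})) (\<lambda>((x, a), (y, b)). Amp n (Complex x a) (Complex y b))"
      using continuous_on_compose2[OF 2 1 3] by (simp add: case_prod_unfold)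
  qed (intro compact_Times compact_Icc)
  then obtain B where B: "\<And>z. z \<in> (\<lambda>((x, a), (y, b)). Amp n (Complex x a) (Complex y b)) ` (({- (pi / hx)..pi / hx} \<times> {- \<alpha>..\<alpha>}) \<times> ({- (pi / hy)..pi / hy} \<times> {- \<alpha>..\<alpha>})) \<Longrightarrow> cmod z \<le> B"
    using compact_imp_bounded bounded_iff by metis
  have B': "cmod (Amp n (Complex x a) (Complex y b)) \<le> B" if "(x, y) \<in> fbox" "\<bar>a\<bar> \<le> \<alpha>" "\<bar>b\<bar> \<le> \<alpha>" for x a y b
    by (rule B, rule image_eqI[of _ _ "((x, a), (y, b))"]) (use that in \<open>auto simp: fbox_def cbox_Pair_eq\<close>)
  define K where "K = 1 / (4 * pi^2) * (exp (\<alpha> * hx * \<bar>i0\<bar>) * exp (\<alpha> * hy * \<bar>j0\<bar>) * B * measure lborel fbox)"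
  show ?thesis
  proof (rule square_summable_exp_bound[of "\<alpha> * hx" "\<alpha> * hy"])
    show "\<alpha> * hx > 0" "\<alpha> * hy > 0" using hx hy \<alpha> by auto
    fix i j :: int
    define a b where "a = (if i \<ge> 0 then \<alpha> else - \<alpha>)" and "b = (if j \<ge> 0 then \<alpha> else - \<alpha>)"
    have ab: "\<bar>a\<bar> \<le> \<alpha>" "\<bar>b\<bar> \<le> \<alpha>" using \<alpha> by (auto simp: a_def b_def)
    have e: "- (c * (of_int (m - m0) * h)) \<le> - (\<alpha> * h) * \<bar>of_int m\<bar> + \<alpha> * h * \<bar>of_int m0\<bar>"
      if "c = (if m \<ge> 0 then \<alpha> else - \<alpha>)" "h > 0" for c h :: real and m m0 :: int
    proof -
      have "- (c * (of_int (m - m0) * h)) = - (\<alpha> * h) * \<bar>of_int m\<bar> + c * h * of_int m0"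
        using that by (auto simp: algebra_simps)
      moreover have "c * h * of_int m0 \<le> \<bar>c * h * of_int m0\<bar>" by (rule abs_ge_self)
      moreover have "\<bar>c * h * of_int m0\<bar> = \<alpha> * h * \<bar>of_int m0\<bar>" using that \<alpha> by (auto simp: abs_mult)
      ultimately show ?thesis by linarith
    qed
    have "cmod (J a b (\<lambda>\<xi> \<eta>. Ex i j \<xi> \<eta> * Amp n \<xi> \<eta>))
       \<le> (exp (- (\<alpha> * hx) * \<bar>of_int i\<bar> + \<alpha> * hx * \<bar>of_int i0\<bar>) * exp (- (\<alpha> * hy) * \<bar>of_int j\<bar> + \<alpha> * hy * \<bar>of_int j0\<bar>) * B) * measure lborel fbox"
    proof (rule J_bound)
      show "lcont a b (\<lambda>\<xi> \<eta>. Ex i j \<xi> \<eta> * Amp n \<xi> \<eta>)" by (rule reg_cont[OF reg_mult[OF reg_Ex reg_Amp] ab])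
      fix x y assume xy: "(x, y) \<in> fbox"
      have "cmod (Ex i j (Complex x a) (Complex y b)) \<le> exp (- (\<alpha> * hx) * \<bar>of_int i\<bar> + \<alpha> * hx * \<bar>of_int i0\<bar>) * exp (- (\<alpha> * hy) * \<bar>of_int j\<bar> + \<alpha> * hy * \<bar>of_int j0\<bar>)"
        unfolding norm_Ex exp_add[symmetric] using e[OF a_def hx, of i0] e[OF b_def hy, of j0] by simp
      then show "cmod (Ex i j (Complex x a) (Complex y b) * Amp n (Complex x a) (Complex y b))
         \<le> exp (- (\<alpha> * hx) * \<bar>of_int i\<bar> + \<alpha> * hx * \<bar>of_int i0\<bar>) * exp (- (\<alpha> * hy) * \<bar>of_int j\<bar> + \<alpha> * hy * \<bar>of_int j0\<bar>) * B"
        unfolding norm_mult by (intro mult_mono B'[OF xy ab]) auto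
    qed
    then have "\<bar>V n (i, j)\<bar> \<le> 1 / (4 * pi^2) * ((exp (- (\<alpha> * hx) * \<bar>of_int i\<bar> + \<alpha> * hx * \<bar>of_int i0\<bar>) * exp (- (\<alpha> * hy) * \<bar>of_int j\<bar> + \<alpha> * hy * \<bar>of_int j0\<bar>) * B) * measure lborel fbox)"
      unfolding V_eq[OF ab] abs_mult using abs_Re_le_cmod order_trans by (intro mult_mono) (fastforce+)
    then show "\<bar>V n (i, j)\<bar> \<le> K * (exp (- (\<alpha> * hx) * \<bar>of_int i\<bar>) * exp (- (\<alpha> * hy) * \<bar>of_int j\<bar>))"
      by (simp only: K_def exp_add mult_ac of_int_abs)
  qed
qed

text \<open>The description operator is resolved by exhibiting \<open>V\<close> as a solution and by
  uniqueness of the implicit step. In Fourier variables the recursion for \<open>V\<close> amounts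
  to cancelling the denominator.\<close>

lemma milstein_scheme_eq_V:
  assumes w: "\<And>n. increment_x k w n = zx n" "\<And>n. increment_y k w n = zy n"
    and x0: "x0 = of_int i0 * hx" and y0: "y0 = of_int j0 * hy"
  shows "milstein_scheme \<mu>x \<mu>y \<rho>x \<rho>y x0 y0 hx hy k w n = V n"
proof (induction n)
  case 0
  have "Amp 0 = (\<lambda>\<xi> \<eta>. 1)" by (simp add: Amp_def fun_eq_iff)
  then have "V 0 (i, j) = (if i = i0 \<and> j = j0 then 1 / (hx * hy) else 0)" for i j
    using hx hy by (simp add: V_def Rep_initial power2_eq_square)
  then show ?case using hx hy by (auto simp: x0 y0)
next
  case (Suc n)
  have lin: "implicit_op \<mu>x \<mu>y hx hy k (\<lambda>p. c * U p) p = c * implicit_op \<mu>x \<mu>y hx hy k U p" for c U p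
    by (cases p) (simp add: implicit_op_def Dx_def Dy_def Dxx_def Dyy_def algebra_simps)
  have lin2: "explicit_op \<rho>x \<rho>y hx hy k a b (\<lambda>p. c * U p) p = c * explicit_op \<rho>x \<rho>y hx hy k a b U p" for a b c U p
    by (cases p) (simp add: explicit_op_def Dx_def Dy_def Dxy_def algebra_simps)
  have am: "Rep (\<lambda>\<xi> \<eta>. Den \<xi> \<eta> * Amp (Suc n) \<xi> \<eta>) = Rep (\<lambda>\<xi> \<eta>. Num n \<xi> \<eta> * Amp n \<xi> \<eta>)"
  proof -
    have "J 0 0 (\<lambda>\<xi> \<eta>. Ex i j \<xi> \<eta> * (Den \<xi> \<eta> * Amp (Suc n) \<xi> \<eta>)) = J 0 0 (\<lambda>\<xi> \<eta>. Ex i j \<xi> \<eta> * (Num n \<xi> \<eta> * Amp n \<xi> \<eta>))" for i j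
      unfolding J_def using Den_nz \<alpha>
      by (intro integral_cong) (auto simp: Amp_def Fac_eq)
    then show ?thesis by (simp add: Rep_def)
  qed
  have eq: "implicit_op \<mu>x \<mu>y hx hy k (V (Suc n)) = explicit_op \<rho>x \<rho>y hx hy k (zx n) (zy n) (V n)"
    unfolding V_def lin[abs_def] fun_eq_iff lin lin2 implicit_Rep[OF Amp_cont] explicit_Rep[OF Amp_cont] am by simp
  show ?case
    unfolding milstein_scheme.simps Suc w
  proof (rule the_equality)
    show "square_summable (V (Suc n)) \<and> implicit_op \<mu>x \<mu>y hx hy k (V (Suc n)) = explicit_op \<rho>x \<rho>y hx hy k (zx n) (zy n) (V n)"
      using V_square_summable eq by simp
    fix U assume U: "square_summable U \<and> implicit_op \<mu>x \<mu>y hx hy k U = explicit_op \<rho>x \<rho>y hx hy k (zx n) (zy n) (V n)"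
    show "U = V (Suc n)"
      by (rule implicit_op_unique[of _ _ k \<mu>x \<mu>y hx hy]) (use U V_square_summable eq k in auto)
  qed
qed

text \<open>At height \<alpha> the modulus of \<open>Q\<close> is a constant below 1. The partial
  sums are evaluated exactly, with a remainder of geometric size, so the series may be taken inside
  the integral.\<close>

lemma J_geometric:
  assumes H: "lcont \<alpha> \<alpha> H" and Q: "lcont \<alpha> \<alpha> Q" and r: "r < 1"
    and Qr: "\<And>x y. cmod (Q (Complex x \<alpha>) (Complex y \<alpha>)) = r"
  shows "((\<lambda>m. J \<alpha> \<alpha> (\<lambda>\<xi> \<eta>. Q \<xi> \<eta> ^ Suc m * H \<xi> \<eta>)) has_sum J \<alpha> \<alpha> (\<lambda>\<xi> \<eta>. Q \<xi> \<eta> / (1 - Q \<xi> \<eta>) * H \<xi> \<eta>)) UNIV"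
proof -
  have r0: "r \<ge> 0" using Qr[of 0 0] by (metis norm_ge_zero)
  have Q1: "Q (Complex x \<alpha>) (Complex y \<alpha>) \<noteq> 1" for x y using Qr[of x y] r by auto
  have cp: "lcont \<alpha> \<alpha> (\<lambda>\<xi> \<eta>. Q \<xi> \<eta> ^ m)" for m
    using Q unfolding lcont_def case_prod_unfold by (intro continuous_intros)
  have cd: "lcont \<alpha> \<alpha> (\<lambda>\<xi> \<eta>. 1 / (1 - Q \<xi> \<eta>))"
    using Q Q1 unfolding lcont_def case_prod_unfold by (intro continuous_intros) auto
  define G where "G = (\<lambda>\<xi> \<eta>. 1 / (1 - Q \<xi> \<eta>) * H \<xi> \<eta>)"
  have cG: "lcont \<alpha> \<alpha> G" unfolding G_def by (rule lcont_mult[OF cd H])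
  have cmp: "\<exists>B. \<forall>x y. (x, y) \<in> fbox \<longrightarrow> cmod (F (Complex x \<alpha>) (Complex y \<alpha>)) \<le> B" if F: "lcont \<alpha> \<alpha> F" for F
  proof -
    have "compact ((\<lambda>(x, y). F (Complex x \<alpha>) (Complex y \<alpha>)) ` fbox)"
      by (rule compact_continuous_image[OF F[unfolded lcont_def]]) (simp add: fbox_def)
    then obtain B where "\<forall>z\<in>(\<lambda>(x, y). F (Complex x \<alpha>) (Complex y \<alpha>)) ` fbox. cmod z \<le> B"
      using compact_imp_bounded bounded_iff by metis
    then show ?thesis by (intro exI[of _ B]) force
  qed
  obtain B where B: "\<And>x y. (x, y) \<in> fbox \<Longrightarrow> cmod (H (Complex x \<alpha>) (Complex y \<alpha>)) \<le> B" using cmp[OF H] by blast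
  obtain B' where B': "\<And>x y. (x, y) \<in> fbox \<Longrightarrow> cmod (G (Complex x \<alpha>) (Complex y \<alpha>)) \<le> B'" using cmp[OF cG] by blast
  have bnd: "cmod (J \<alpha> \<alpha> (\<lambda>\<xi> \<eta>. Q \<xi> \<eta> ^ m * F \<xi> \<eta>)) \<le> (B * measure lborel fbox) * r ^ m"
    if "lcont \<alpha> \<alpha> F" "\<And>x y. (x, y) \<in> fbox \<Longrightarrow> cmod (F (Complex x \<alpha>) (Complex y \<alpha>)) \<le> B" for F B m
  proof -
    have "cmod (J \<alpha> \<alpha> (\<lambda>\<xi> \<eta>. Q \<xi> \<eta> ^ m * F \<xi> \<eta>)) \<le> (r ^ m * B) * measure lborel fbox"
      by (rule J_bound[OF lcont_mult[OF cp that(1)]])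
        (use that(2) r0 in \<open>auto simp: norm_mult norm_power Qr intro: mult_left_mono\<close>)
    then show ?thesis by (simp only: mult_ac)
  qed
  have sm: "summable (\<lambda>m. norm (J \<alpha> \<alpha> (\<lambda>\<xi> \<eta>. Q \<xi> \<eta> ^ Suc m * H \<xi> \<eta>)))"
  proof (rule summable_comparison_test'[of "\<lambda>m. (B * measure lborel fbox) * r ^ Suc m"])
    show "summable (\<lambda>m. (B * measure lborel fbox) * r ^ Suc m)"
      using r r0 by (intro summable_mult summable_Suc_iff[THEN iffD2] summable_geometric) auto
    show "norm (norm (J \<alpha> \<alpha> (\<lambda>\<xi> \<eta>. Q \<xi> \<eta> ^ Suc m * H \<xi> \<eta>))) \<le> (B * measure lborel fbox) * r ^ Suc m" for m
      using bnd[OF H B, of "Suc m"] by simp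
  qed
  have part: "(\<Sum>m<n. J \<alpha> \<alpha> (\<lambda>\<xi> \<eta>. Q \<xi> \<eta> ^ Suc m * H \<xi> \<eta>)) = J \<alpha> \<alpha> (\<lambda>\<xi> \<eta>. Q \<xi> \<eta> / (1 - Q \<xi> \<eta>) * H \<xi> \<eta>) - J \<alpha> \<alpha> (\<lambda>\<xi> \<eta>. Q \<xi> \<eta> ^ Suc n * G \<xi> \<eta>)" for n
  proof (induction n)
    case 0 then show ?case by (simp add: G_def)
  next
    case (Suc n)
    have "J \<alpha> \<alpha> (\<lambda>\<xi> \<eta>. Q \<xi> \<eta> ^ Suc n * G \<xi> \<eta>) = J \<alpha> \<alpha> (\<lambda>\<xi> \<eta>. Q \<xi> \<eta> ^ Suc (Suc n) * G \<xi> \<eta> + Q \<xi> \<eta> ^ Suc n * H \<xi> \<eta>)"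
      unfolding J_def
    proof (intro integral_cong, clarify)
      fix x y
      have "1 - Q (Complex x \<alpha>) (Complex y \<alpha>) \<noteq> 0" using Q1 by simp
      then show "Q (Complex x \<alpha>) (Complex y \<alpha>) ^ Suc n * G (Complex x \<alpha>) (Complex y \<alpha>)
        = Q (Complex x \<alpha>) (Complex y \<alpha>) ^ Suc (Suc n) * G (Complex x \<alpha>) (Complex y \<alpha>) + Q (Complex x \<alpha>) (Complex y \<alpha>) ^ Suc n * H (Complex x \<alpha>) (Complex y \<alpha>)"
        unfolding G_def by (simp add: divide_simps) (simp add: algebra_simps)
    qed
    also have "... = J \<alpha> \<alpha> (\<lambda>\<xi> \<eta>. Q \<xi> \<eta> ^ Suc (Suc n) * G \<xi> \<eta>) + J \<alpha> \<alpha> (\<lambda>\<xi> \<eta>. Q \<xi> \<eta> ^ Suc n * H \<xi> \<eta>)"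
      by (rule J_add[OF lcont_mult[OF cp cG] lcont_mult[OF cp H]])
    finally show ?case using Suc by simp
  qed
  have lim0: "(\<lambda>n. J \<alpha> \<alpha> (\<lambda>\<xi> \<eta>. Q \<xi> \<eta> ^ Suc n * G \<xi> \<eta>)) \<longlonglongrightarrow> 0"
  proof (rule Lim_null_comparison)
    show "\<forall>\<^sub>F n in sequentially. norm (J \<alpha> \<alpha> (\<lambda>\<xi> \<eta>. Q \<xi> \<eta> ^ Suc n * G \<xi> \<eta>)) \<le> (B' * measure lborel fbox) * r ^ Suc n"
      by (rule always_eventually, rule allI, rule bnd[OF cG B'])
    have "(\<lambda>n. r ^ Suc n) \<longlonglongrightarrow> 0" using LIMSEQ_Suc[OF LIMSEQ_realpow_zero[OF r0 r]] .
    then show "(\<lambda>n. (B' * measure lborel fbox) * r ^ Suc n) \<longlonglongrightarrow> 0" by (rule tendsto_mult_right_zero)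
  qed
  have "(\<lambda>m. J \<alpha> \<alpha> (\<lambda>\<xi> \<eta>. Q \<xi> \<eta> ^ Suc m * H \<xi> \<eta>)) sums J \<alpha> \<alpha> (\<lambda>\<xi> \<eta>. Q \<xi> \<eta> / (1 - Q \<xi> \<eta>) * H \<xi> \<eta>)"
    unfolding sums_def part using tendsto_diff[OF tendsto_const lim0] by simp
  from norm_summable_imp_has_sum[OF sm this] show ?thesis .
qed

text \<open>Only at height \<alpha> in both variables are the sums over the quadrant convergent
  geometric series. Their values combine with the boundary weights as
  \<open>(1 / 2 + A) * (1 / 2 + B)\<close>, whose four terms are the interior, the two axes and the
  corner.\<close>

theorem trapezoidal_V:
  "trapezoidal_sum hx hy (V n) = 1 / (4 * pi^2) *
     Re (J \<alpha> \<alpha> (\<lambda>\<xi> \<eta>. gsym \<xi> hx * gsym \<eta> hy * (Ex 0 0 \<xi> \<eta> * Amp n \<xi> \<eta>)))"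
proof -
  define Q R where "Q = (\<lambda>\<xi> \<eta>::complex. exp (\<i> * (\<xi> * of_real hx)))" and "R = (\<lambda>\<xi>::complex. \<lambda>\<eta>. exp (\<i> * (\<eta> * of_real hy)))"
  define G where "G = (\<lambda>\<xi> \<eta>. Ex 0 0 \<xi> \<eta> * Amp n \<xi> \<eta>)"
  define RV where "RV = (\<lambda>H. 1 / (4 * pi^2) * Re (J \<alpha> \<alpha> H))"
  have a: "\<bar>\<alpha>\<bar> \<le> \<alpha>" using \<alpha> by simp
  have cG: "lcont \<alpha> \<alpha> G" unfolding G_def by (rule reg_cont[OF reg_mult[OF reg_Ex reg_Amp] a a])
  have cQ: "lcont \<alpha> \<alpha> Q" and cR: "lcont \<alpha> \<alpha> R"
    unfolding Q_def R_def lcont_def Complex_eq case_prod_unfold by (auto intro!: continuous_intros)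
  have nQ: "cmod (Q (Complex x \<alpha>) (Complex y \<alpha>)) = exp (- (\<alpha> * hx))" and nR: "cmod (R (Complex x \<alpha>) (Complex y \<alpha>)) = exp (- (\<alpha> * hy))" for x y
    by (simp_all add: Q_def R_def norm_exp_eq_Re)
  have e1: "exp (- (\<alpha> * hx)) < 1" "exp (- (\<alpha> * hy)) < 1" using \<alpha> hx hy by auto
  have Q1: "Q (Complex x \<alpha>) (Complex y \<alpha>) \<noteq> 1" "R (Complex x \<alpha>) (Complex y \<alpha>) \<noteq> 1" for x y
    using nQ[of x y] nR[of x y] e1 by auto
  have cqd: "lcont \<alpha> \<alpha> (\<lambda>\<xi> \<eta>. Q \<xi> \<eta> / (1 - Q \<xi> \<eta>))" "lcont \<alpha> \<alpha> (\<lambda>\<xi> \<eta>. R \<xi> \<eta> / (1 - R \<xi> \<eta>))"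
    using cQ cR Q1 unfolding lcont_def case_prod_unfold by (auto intro!: continuous_intros)
  have cp: "lcont \<alpha> \<alpha> (\<lambda>\<xi> \<eta>. Q \<xi> \<eta> ^ m)" for m
    using cQ unfolding lcont_def case_prod_unfold by (intro continuous_intros)
  have ExQ: "Ex (int i) (int j) \<xi> \<eta> = Q \<xi> \<eta> ^ i * (R \<xi> \<eta> ^ j * Ex 0 0 \<xi> \<eta>)" for i j \<xi> \<eta>
  proof -
    have "Ex (0 + int i) (0 + int j) \<xi> \<eta> = sh (int i) (int j) \<xi> \<eta> * Ex 0 0 \<xi> \<eta>" by (rule Ex_shift)
    moreover have "sh (int i) (int j) \<xi> \<eta> = Q \<xi> \<eta> ^ i * R \<xi> \<eta> ^ j"
      unfolding sh_def Q_def R_def exp_of_nat_mult[symmetric] exp_add[symmetric] by (simp add: algebra_simps)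
    ultimately show ?thesis by simp
  qed
  have VQ: "V n (int i, int j) = RV (\<lambda>\<xi> \<eta>. Q \<xi> \<eta> ^ i * (R \<xi> \<eta> ^ j * G \<xi> \<eta>))" for i j
    unfolding V_eq[OF a a] RV_def G_def ExQ by (simp add: mult_ac)
  have hs: "infsum (\<lambda>m. RV (\<lambda>\<xi> \<eta>. Q' \<xi> \<eta> ^ Suc m * H \<xi> \<eta>)) UNIV = RV (\<lambda>\<xi> \<eta>. Q' \<xi> \<eta> / (1 - Q' \<xi> \<eta>) * H \<xi> \<eta>)"
    if "lcont \<alpha> \<alpha> H" "lcont \<alpha> \<alpha> Q'" "r < 1" "\<And>x y. cmod (Q' (Complex x \<alpha>) (Complex y \<alpha>)) = r" for H Q' r
    unfolding RV_def
    by (rule infsumI[OF has_sum_cmult_right[OF has_sum_Re[OF J_geometric[OF that]]]])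
  have sR: "infsum (\<lambda>m. RV (\<lambda>\<xi> \<eta>. R \<xi> \<eta> ^ Suc m * H \<xi> \<eta>)) UNIV = RV (\<lambda>\<xi> \<eta>. R \<xi> \<eta> / (1 - R \<xi> \<eta>) * H \<xi> \<eta>)" if "lcont \<alpha> \<alpha> H" for H
    by (rule hs[OF that cR e1(2) nR])
  have sQ: "infsum (\<lambda>m. RV (\<lambda>\<xi> \<eta>. Q \<xi> \<eta> ^ Suc m * H \<xi> \<eta>)) UNIV = RV (\<lambda>\<xi> \<eta>. Q \<xi> \<eta> / (1 - Q \<xi> \<eta>) * H \<xi> \<eta>)" if "lcont \<alpha> \<alpha> H" for H
    by (rule hs[OF that cQ e1(1) nQ])
  have n0: "(0::int) = int 0" "int m + 1 = int (Suc m)" for m by auto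
  have V00: "V n (0, 0) = RV G" using VQ[of 0 0] by simp
  have Vi: "infsum (\<lambda>i. V n (i, 0)) {1..} = RV (\<lambda>\<xi> \<eta>. Q \<xi> \<eta> / (1 - Q \<xi> \<eta>) * G \<xi> \<eta>)"
    unfolding infsum_int_from_1 n0 VQ using sQ[OF cG] by simp
  have Vj: "infsum (\<lambda>j. V n (0, j)) {1..} = RV (\<lambda>\<xi> \<eta>. R \<xi> \<eta> / (1 - R \<xi> \<eta>) * G \<xi> \<eta>)"
    unfolding infsum_int_from_1 n0 VQ using sR[OF cG] by simp
  have Vij: "infsum (\<lambda>i. infsum (\<lambda>j. V n (i, j)) {1..}) {1..} = RV (\<lambda>\<xi> \<eta>. Q \<xi> \<eta> / (1 - Q \<xi> \<eta>) * (R \<xi> \<eta> / (1 - R \<xi> \<eta>) * G \<xi> \<eta>))"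
  proof -
    have "infsum (\<lambda>j. RV (\<lambda>\<xi> \<eta>. Q \<xi> \<eta> ^ Suc i * (R \<xi> \<eta> ^ Suc j * G \<xi> \<eta>))) UNIV = RV (\<lambda>\<xi> \<eta>. Q \<xi> \<eta> ^ Suc i * (R \<xi> \<eta> / (1 - R \<xi> \<eta>) * G \<xi> \<eta>))" for i
      using sR[OF lcont_mult[OF cp[of "Suc i"] cG]] by (simp only: mult_ac)
    then show ?thesis
      unfolding infsum_int_from_1 n0 VQ using sQ[OF lcont_mult[OF cqd(2) cG]] by simp
  qed
  have RVadd: "RV (\<lambda>\<xi> \<eta>. H \<xi> \<eta> + H' \<xi> \<eta>) = RV H + RV H'" if "lcont \<alpha> \<alpha> H" "lcont \<alpha> \<alpha> H'" for H H'
    unfolding RV_def J_add[OF that] by (simp add: distrib_left add_divide_distrib)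
  have RVc: "RV (\<lambda>\<xi> \<eta>. of_real c * H \<xi> \<eta>) = c * RV H" for c H unfolding RV_def J_cmult by simp
  define A B where "A = (\<lambda>\<xi> \<eta>. Q \<xi> \<eta> / (1 - Q \<xi> \<eta>))" and "B = (\<lambda>\<xi> \<eta>. R \<xi> \<eta> / (1 - R \<xi> \<eta>))"
  have cAB: "lcont \<alpha> \<alpha> A" "lcont \<alpha> \<alpha> B" using cqd by (auto simp: A_def B_def)
  note cs = lcont_mult[OF cAB(1) lcont_mult[OF cAB(2) cG]] lcont_mult[OF cAB(2) cG] lcont_mult[OF cAB(1) cG] cG
  have "trapezoidal_sum hx hy (V n) = hx * hy * (RV (\<lambda>\<xi> \<eta>. A \<xi> \<eta> * (B \<xi> \<eta> * G \<xi> \<eta>)) + 1 / 2 * RV (\<lambda>\<xi> \<eta>. B \<xi> \<eta> * G \<xi> \<eta>)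
      + 1 / 2 * RV (\<lambda>\<xi> \<eta>. A \<xi> \<eta> * G \<xi> \<eta>) + 1 / 4 * RV G)"
    unfolding trapezoidal_sum_def Vij Vi Vj V00 A_def B_def ..
  also have "... = RV (\<lambda>\<xi> \<eta>. of_real (hx * hy) * (A \<xi> \<eta> * (B \<xi> \<eta> * G \<xi> \<eta>) + of_real (1 / 2) * (B \<xi> \<eta> * G \<xi> \<eta>)
      + of_real (1 / 2) * (A \<xi> \<eta> * G \<xi> \<eta>) + of_real (1 / 4) * G \<xi> \<eta>))"
    by (simp only: RVc RVadd cs lcont_add lcont_mult lcont_const)
  also have "... = RV (\<lambda>\<xi> \<eta>. gsym \<xi> hx * gsym \<eta> hy * G \<xi> \<eta>)"
  proof -
    have "of_real (hx * hy) * (A \<xi> \<eta> * (B \<xi> \<eta> * G \<xi> \<eta>) + of_real (1 / 2) * (B \<xi> \<eta> * G \<xi> \<eta>)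
      + of_real (1 / 2) * (A \<xi> \<eta> * G \<xi> \<eta>) + of_real (1 / 4) * G \<xi> \<eta>) = gsym \<xi> hx * gsym \<eta> hy * G \<xi> \<eta>"
      if "Q \<xi> \<eta> \<noteq> 1" "R \<xi> \<eta> \<noteq> 1" for \<xi> \<eta>
    proof -
      have 1: "gsym \<xi> hx = of_real hx * (1 / 2 + A \<xi> \<eta>)" "gsym \<eta> hy = of_real hy * (1 / 2 + B \<xi> \<eta>)"
        using gsym_geometric[OF hx, of \<xi>] gsym_geometric[OF hy, of \<eta>] that by (simp_all add: A_def B_def Q_def R_def)
      show ?thesis unfolding 1 by (simp add: algebra_simps)
    qed
    then show ?thesis unfolding RV_def J_def using Q1
      by (intro arg_cong[where f = "\<lambda>z. 1 / (4 * pi^2) * Re z"] integral_cong) (auto simp del: of_real_mult)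
  qed
  finally show ?thesis by (simp add: RV_def G_def)
qed

end

section \<open>Local error of one Milstein step\<close>

text \<open>
  Third order comparison of one step of the scheme with the exact propagator \<open>exp (- \<i> X - D)\<close>.
  The cubic term on the left is odd in the Gaussian increments.
\<close>

lemma local_expansion:
  fixes X X' D E E0 s s' :: complex and t g c :: real
  assumes t: "0 \<le> t" "t \<le> 1" and g: "1 \<le> g" and c: "2 \<le> c"
    and X: "cmod X \<le> t * g" and dX: "cmod (X' - X) \<le> c * t ^ 3 * g"
    and D: "cmod D \<le> c * t^2" and E0: "cmod E0 \<le> c * t^2" and dE: "cmod (E - E0) \<le> c * t ^ 4"
    and s: "cmod s \<le> c * t^2" and ds: "cmod (s' - s) \<le> c * t ^ 4"
    and ED: "E0 - D = s / 2" and E: "cmod E \<le> 1 / 2"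
  shows "cmod ((1 - \<i> * X' - (X'^2 - s') / 2) / (1 + E) - exp (- \<i> * X - D)
      - (- \<i> * (X' - X) + \<i> * X * s / 2 - \<i> * X ^ 3 / 6)) \<le> 200 * c ^ 4 * t ^ 4 * g ^ 4 * exp (2 * c * g)"
proof -
  \<comment> \<open>Every remainder is bounded by a monomial \<open>c ^ i * t ^ j * g ^ m\<close>.
    As \<open>c\<close> and \<open>g\<close> are at least 1 and \<open>t\<close> is at most 1, it is
    below \<open>Q\<close> as soon as \<open>i\<close> and \<open>m\<close> are at most 4 and
    \<open>j\<close> is at least 4.\<close>
  define Q where "Q = c ^ 4 * t ^ 4 * g ^ 4"
  have c1: "1 \<le> c" "0 \<le> c" using c by auto
  have g0: "0 \<le> g" using g by simp
  have mon': "c ^ i * t ^ j * g ^ l \<le> c ^ i' * t ^ j' * g ^ l'" if "i \<le> i'" "j' \<le> j" "l \<le> l'" for i j l i' j' l'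
    using that t c1 g by (intro mult_mono power_increasing power_decreasing) auto
  have Q0: "Q \<ge> 0" unfolding Q_def using t c1 g by auto
  have bX: "cmod X \<le> c ^ 0 * t ^ 1 * g ^ 1" using X by simp
  have bdX: "cmod (X' - X) \<le> c ^ 1 * t ^ 3 * g ^ 1" using dX by simp
  have bX': "cmod X' \<le> 2 * (c ^ 1 * t ^ 1 * g ^ 1)"
    using norm_triangle_ineq[of "X' - X" X] bdX bX mon'[of 1 1 1 3 1 1] mon'[of 0 1 1 1 1 1] by simp
  have bE: "cmod E \<le> 2 * (c ^ 1 * t ^ 2 * g ^ 0)"
    using norm_triangle_ineq[of "E - E0" E0] dE E0 mon'[of 1 1 2 4 0 0] by simp
  have bs': "cmod s' \<le> 2 * (c ^ 1 * t ^ 2 * g ^ 0)"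
    using norm_triangle_ineq[of "s' - s" s] ds s mon'[of 1 1 2 4 0 0] by simp
  have pm: "cmod (a * b) \<le> (k * l) * (c ^ (i + i') * t ^ (j + j') * g ^ (m + m'))"
    if "cmod a \<le> k * (c ^ i * t ^ j * g ^ m)" "cmod b \<le> l * (c ^ i' * t ^ j' * g ^ m')" "0 \<le> k"
    for a b k l i i' j j' m m'
  proof -
    have "cmod (a * b) \<le> (k * (c ^ i * t ^ j * g ^ m)) * (l * (c ^ i' * t ^ j' * g ^ m'))"
      unfolding norm_mult by (rule mult_mono[OF that(1,2)]) (use that(3) t c1 g0 in auto)
    then show ?thesis by (simp add: power_add mult_ac)
  qed
  have pmx: "cmod (a * b) \<le> kl * (c ^ I * t ^ J * g ^ L)"
    if "cmod a \<le> k * (c ^ i * t ^ j * g ^ m)" "cmod b \<le> l * (c ^ i' * t ^ j' * g ^ m')" "0 \<le> k"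
      "kl = k * l" "I = i + i'" "J = j + j'" "L = m + m'"
    for a b k l i i' j j' m m' kl I J L
    unfolding that(4-7) by (rule pm[OF that(1-3)])
  have fin: "cmod a \<le> k * Q" if "cmod a \<le> k * (c ^ i * t ^ j * g ^ m)" "i \<le> 4" "j \<ge> 4" "m \<le> 4" "0 \<le> k" for a k i j m
  proof -
    have "c ^ i * t ^ j * g ^ m \<le> Q" unfolding Q_def by (rule mon'[OF that(2,3,4)])
    then show ?thesis using that(1) mult_left_mono[OF _ that(5)] order_trans by blast
  qed
  have one: "cmod X \<le> 1 * (c ^ 0 * t ^ 1 * g ^ 1)" "cmod (X' - X) \<le> 1 * (c ^ 1 * t ^ 3 * g ^ 1)" "cmod D \<le> 1 * (c ^ 1 * t ^ 2 * g ^ 0)"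
    "cmod E0 \<le> 1 * (c ^ 1 * t ^ 2 * g ^ 0)" "cmod (E - E0) \<le> 1 * (c ^ 1 * t ^ 4 * g ^ 0)" "cmod (s' - s) \<le> 1 * (c ^ 1 * t ^ 4 * g ^ 0)"
    using X dX D E0 dE ds by simp_all
  define N where "N = 1 - \<i> * X' - (X'^2 - s') / 2"
  have bN: "cmod N \<le> 6 * (c ^ 2 * t ^ 0 * g ^ 2)"
  proof -
    have "cmod N \<le> 1 + cmod X' + (cmod (X' * X') + cmod s') / 2"
    proof -
      have "cmod N \<le> cmod (1 - \<i> * X') + cmod ((X'^2 - s') / 2)" unfolding N_def by (rule norm_triangle_ineq4)
      moreover have "cmod (1 - \<i> * X') \<le> 1 + cmod X'" using norm_triangle_ineq4[of 1 "\<i> * X'"] by (simp add: norm_mult)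
      moreover have "cmod ((X'^2 - s') / 2) \<le> (cmod (X' * X') + cmod s') / 2"
        using norm_triangle_ineq4[of "X'^2" s'] by (simp add: norm_divide power2_eq_square)
      ultimately show ?thesis by linarith
    qed
    moreover have "cmod X' \<le> 2 * (c ^ 2 * t ^ 0 * g ^ 2)" using bX' mon'[of 1 2 0 1 1 2] by linarith
    moreover have "cmod (X' * X') \<le> 4 * (c ^ 2 * t ^ 0 * g ^ 2)" using pmx[OF bX' bX', of 4 2 2 2] mon'[of 2 2 0 2 2 2] by simp
    moreover have "cmod s' \<le> 2 * (c ^ 2 * t ^ 0 * g ^ 2)" using bs' mon'[of 1 2 0 2 0 2] by linarith
    moreover have "1 \<le> c ^ 2 * t ^ 0 * g ^ 2" using mon'[of 0 2 0 0 0 2] by simp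
    ultimately show ?thesis by argo
  qed
  have E1: "1 + E \<noteq> 0" "1 / 2 \<le> cmod (1 + E)"
  proof -
    show "1 / 2 \<le> cmod (1 + E)" using norm_triangle_ineq2[of 1 "- E"] E by simp
    then show "1 + E \<noteq> 0" by auto
  qed
  define ta where "ta = N * (E * E) / (1 + E)"
  have bta: "cmod ta \<le> 48 * Q"
  proof -
    have "cmod (N * (E * E)) \<le> 24 * Q" by (rule fin[OF pm[OF bN pm[OF bE bE]], simplified]) 
    moreover have "cmod ta \<le> cmod (N * (E * E)) / (1 / 2)"
      unfolding ta_def norm_divide using E1(2) by (intro divide_left_mono) (auto intro: mult_pos_pos)
    ultimately show ?thesis by simp
  qed
  define tb1 tb2 tb3 tb4 tb5 where "tb1 = (X' - X) * (X' - X + 2 * X)" and "tb2 = s' - s" and "tb3 = (X' - X) * E"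
    and "tb4 = X * (E - E0)" and "tb5 = (X' * X' - s') * E"
  have b1: "cmod tb1 \<le> 3 * Q"
  proof -
    have "cmod (X' - X + 2 * X) \<le> cmod (X' - X) + 2 * cmod X"
      using norm_triangle_ineq[of "X' - X" "2 * X"] by (simp add: norm_mult)
    also have "... \<le> 3 * (c ^ 1 * t ^ 1 * g ^ 1)" using bdX bX mon'[of 1 1 1 3 1 1] mon'[of 0 1 1 1 1 1] by linarith
    finally have "cmod (X' - X + 2 * X) \<le> 3 * (c ^ 1 * t ^ 1 * g ^ 1)" .
    from fin[OF pm[OF one(2) this]] show ?thesis unfolding tb1_def by simp
  qed
  have b2: "cmod tb2 \<le> 1 * Q" unfolding tb2_def by (rule fin[OF one(6)]) auto
  have b2': "cmod (E - E0) \<le> 1 * Q" by (rule fin[OF one(5)]) auto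
  have b3: "cmod tb3 \<le> 2 * Q" unfolding tb3_def using fin[OF pm[OF one(2) bE]] by simp
  have b4: "cmod tb4 \<le> 1 * Q" unfolding tb4_def using fin[OF pm[OF one(1) one(5)]] by simp
  have b5: "cmod tb5 \<le> 12 * Q"
  proof -
    have "cmod (X' * X' - s') \<le> cmod (X' * X') + cmod s'" by (rule norm_triangle_ineq4)
    also have "... \<le> 6 * (c ^ 2 * t ^ 2 * g ^ 2)" using pmx[OF bX' bX', of 4 2 2 2] bs' mon'[of 1 2 2 2 0 2] by simp
    finally have "cmod (X' * X' - s') \<le> 6 * (c ^ 2 * t ^ 2 * g ^ 2)" .
    from fin[OF pm[OF this bE]] show ?thesis unfolding tb5_def by simp
  qed
  define w where "w = - \<i> * X - D"
  have bw: "cmod w \<le> 2 * (c ^ 1 * t ^ 1 * g ^ 1)"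
  proof -
    have "cmod w \<le> cmod X + cmod D" unfolding w_def using norm_triangle_ineq4[of "- \<i> * X" D] by (simp add: norm_mult)
    then show ?thesis using one(1,3) mon'[of 0 1 1 1 1 1] mon'[of 1 1 1 2 0 1] by linarith
  qed
  define tc1 where "tc1 = exp w - (1 + w + w^2 / 2 + w ^ 3 / 6)"
  have b6: "cmod tc1 \<le> 16 * Q * exp (2 * c * g)"
  proof -
    have sum: "(\<Sum>k\<le>3. w ^ k / fact k) = 1 + w + w^2 / 2 + w ^ 3 / 6"
      by (simp add: eval_nat_numeral fact_numeral)
    have "cmod tc1 \<le> exp \<bar>Re w\<bar> * cmod w ^ 4 / 6"
      using Taylor_exp[of w 3] unfolding sum tc1_def by (simp add: eval_nat_numeral fact_numeral)
    also have "... \<le> exp (2 * c * g) * (16 * Q) / 1"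
    proof (intro frac_le mult_mono)
      have "\<bar>Re w\<bar> \<le> 2 * (c * t * g)" using abs_Re_le_cmod[of w] bw by simp
      also have "... \<le> 2 * (c * 1 * g)" using t c1 g0 by (intro mult_left_mono mult_right_mono) auto
      finally show "exp \<bar>Re w\<bar> \<le> exp (2 * c * g)" by simp
      have "cmod w ^ 4 \<le> (2 * (c ^ 1 * t ^ 1 * g ^ 1)) ^ 4" by (rule power_mono[OF bw]) simp
      then show "cmod w ^ 4 \<le> 16 * Q" by (simp add: Q_def power_mult_distrib)
    qed (use Q0 in auto)
    finally show ?thesis by (simp add: mult_ac)
  qed
  define tc2 tc3 where "tc2 = D * D" and "tc3 = w ^ 3 - (- \<i> * X) ^ 3"
  have b7: "cmod tc2 \<le> 1 * Q" unfolding tc2_def using fin[OF pm[OF one(3) one(3)]] by simp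
  have b8: "cmod tc3 \<le> 7 * Q"
  proof -
    have tc3: "tc3 = - D * (w * w + w * (- \<i> * X) + (- \<i> * X) * (- \<i> * X))"
      unfolding tc3_def w_def by (simp add: power3_eq_cube algebra_simps)
    have b: "cmod (w * w + w * (- \<i> * X) + (- \<i> * X) * (- \<i> * X)) \<le> 7 * (c ^ 2 * t ^ 2 * g ^ 2)"
    proof -
      have iX: "cmod (- \<i> * X) \<le> 1 * (c ^ 0 * t ^ 1 * g ^ 1)" using one(1) by (simp add: norm_mult)
      have "cmod (w * w + w * (- \<i> * X) + (- \<i> * X) * (- \<i> * X)) \<le> cmod (w * w) + cmod (w * (- \<i> * X)) + cmod ((- \<i> * X) * (- \<i> * X))"
        by (intro order_trans[OF norm_triangle_ineq] add_right_mono norm_triangle_ineq)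
      moreover have "cmod (w * w) \<le> 4 * (c ^ 2 * t ^ 2 * g ^ 2)" by (rule pmx[OF bw bw]) simp_all
      moreover have "cmod (w * (- \<i> * X)) \<le> 2 * (c ^ 2 * t ^ 2 * g ^ 2)" using pmx[OF bw iX, of 2 1 2 2] mon'[of 1 2 2 2 2 2] by simp
      moreover have "cmod ((- \<i> * X) * (- \<i> * X)) \<le> 1 * (c ^ 2 * t ^ 2 * g ^ 2)" using pmx[OF iX iX, of 1 0 2 2] mon'[of 0 2 2 2 2 2] by simp
      ultimately show ?thesis by linarith
    qed
    have a: "cmod (- D) \<le> 1 * (c ^ 1 * t ^ 2 * g ^ 0)" using one(3) by simp
    have "cmod tc3 \<le> 7 * (c ^ 3 * t ^ 4 * g ^ 2)" unfolding tc3 by (rule pmx[OF a b]) simp_all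
    then show ?thesis by (rule fin) simp_all
  qed
  have Nq: "N / (1 + E) = N * (1 - E) + ta"
  proof -
    have "N * (1 - E) * (1 + E) + N * (E * E) = N" by (simp add: algebra_simps)
    then have "N / (1 + E) = (N * (1 - E) * (1 + E) + N * (E * E)) / (1 + E)" by simp
    also have "... = N * (1 - E) + ta" unfolding add_divide_distrib ta_def using E1(1) by simp
    finally show ?thesis .
  qed
  \<comment> \<open>Consistency: the implicit part \<open>E0\<close> and the centring
    \<open>s / 2\<close> together reproduce the exponent \<open>D\<close>; with this all terms of
    order below 3 cancel.\<close>
  have Dd: "D = E0 - s / 2" by (simp add: ED[symmetric])
  \<comment> \<open>\<open>ta\<close> is the remainder of the geometric series of
    \<open>1 / (1 + E)\<close>; the \<open>tb\<close> terms are the errors of the symbols and the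
    products of high order in the numerator; the \<open>tc\<close> terms are those of the
    exponential series.\<close>
  have "N / (1 + E) - exp w - (- \<i> * (X' - X) + \<i> * X * s / 2 - \<i> * X ^ 3 / 6)
     = ta - (tb1 - tb2) / 2 - (E - E0) + \<i> * (tb3 + tb4) + tb5 / 2 - tc1 - tc2 / 2 - tc3 / 6"
  proof -
    have a: "N * (1 - E) = 1 - \<i> * X' - (X' * X' - s') / 2 - E + \<i> * X' * E + (X' * X' - s') * E / 2"
      unfolding N_def by (simp add: power2_eq_square diff_divide_distrib algebra_simps)
    have b: "exp w = tc1 + (1 + w + w^2 / 2 + w ^ 3 / 6)" by (simp add: tc1_def)
    have "(- \<i>) ^ 3 = \<i>" by (simp add: power3_eq_cube)
    then have i3: "(- \<i> * X) ^ 3 = \<i> * X ^ 3" by (simp only: power_mult_distrib)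
    have c: "w ^ 3 = tc3 + \<i> * X ^ 3" unfolding tc3_def i3 by simp
    have d: "w^2 = - X * X + 2 * \<i> * X * D + tc2" unfolding w_def tc2_def by (simp add: power2_eq_square algebra_simps)
    show ?thesis unfolding Nq a b c d unfolding w_def tb1_def tb2_def tb3_def tb4_def tb5_def Dd
      by (simp add: diff_divide_distrib add_divide_distrib algebra_simps)
  qed
  also have "cmod ... \<le> cmod ta + (cmod tb1 + cmod tb2) / 2 + cmod (E - E0) + (cmod tb3 + cmod tb4) + cmod tb5 / 2 + cmod tc1 + cmod tc2 / 2 + cmod tc3 / 6"
  proof -
    have n1: "cmod ((tb1 - tb2) / 2) \<le> (cmod tb1 + cmod tb2) / 2" using norm_triangle_ineq4[of tb1 tb2] by (simp add: norm_divide)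
    have n2: "cmod (\<i> * (tb3 + tb4)) \<le> cmod tb3 + cmod tb4" using norm_triangle_ineq[of tb3 tb4] by (simp add: norm_mult)
    have n3: "cmod (z / 2) = cmod z / 2" "cmod (z / 6) = cmod z / 6" for z by (simp_all add: norm_divide)
    have d: "cmod (a - b) \<le> p + q" if "cmod a \<le> p" "cmod b \<le> q" for a b p q using norm_triangle_ineq4[of a b] that by linarith
    have e: "cmod (a + b) \<le> p + q" if "cmod a \<le> p" "cmod b \<le> q" for a b p q using norm_triangle_ineq[of a b] that by linarith
    show ?thesis by (intro d e n1 n2 order_refl eq_refl n3)
  qed
  also have "... \<le> 200 * Q * exp (2 * c * g)"
  proof -
    have "1 \<le> exp (2 * c * g)" using c1 g0 by simp
    from mult_left_mono[OF this Q0] have q: "Q \<le> Q * exp (2 * c * g)" by (simp only: mult_1_right)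
    define Z where "Z = Q * exp (2 * c * g)"
    have "cmod tc1 \<le> 16 * Z" using b6 by (simp add: Z_def mult_ac)
    moreover have "200 * Q * exp (2 * c * g) = 200 * Z" by (simp add: Z_def)
    ultimately show ?thesis using bta b1 b2 b2' b3 b4 b5 b7 b8 q[folded Z_def] Q0 by argo
  qed
  finally show ?thesis unfolding w_def N_def Q_def by (simp add: mult_ac)
qed

section \<open>Products of independent factors\<close>

text \<open>
  With \<open>a = \<E>|C|^2\<close>, \<open>b = \<E>[C cnj D]\<close>, \<open>c = \<E>|D|^2\<close> the mean square distance of two products of
  independent factors is \<open>\<Prod>a - 2 Re \<Prod>b + \<Prod>c\<close>; here \<open>d = b - c\<close> is the weak and
  \<open>e = a - 2 Re b + c\<close> the strong one-step error.
\<close>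

lemma product_distance:
  fixes a c e :: "nat \<Rightarrow> real" and b d :: "nat \<Rightarrow> complex"
  assumes a: "\<And>n. n < N \<Longrightarrow> 0 \<le> a n \<and> a n \<le> r" and c: "\<And>n. n < N \<Longrightarrow> 0 \<le> c n \<and> c n \<le> r"
    and b: "\<And>n. n < N \<Longrightarrow> cmod (b n) \<le> r" and r: "r > 0"
    and bd: "\<And>n. n < N \<Longrightarrow> b n = of_real (c n) + d n" and ad: "\<And>n. n < N \<Longrightarrow> a n = c n + 2 * Re (d n) + e n"
    and d: "\<And>n. n < N \<Longrightarrow> cmod (d n) \<le> dd" and e: "\<And>n. n < N \<Longrightarrow> 0 \<le> e n \<and> e n \<le> ee" and dd: "0 \<le> dd" and ee: "0 \<le> ee"
  shows "r^2 * ((\<Prod>n<N. a n) - 2 * Re (\<Prod>n<N. b n) + (\<Prod>n<N. c n)) \<le> r ^ N * (real N * r * ee + (real N)^2 * (dd + ee) * dd)"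
proof -
  define A B C where "A = (\<lambda>n. \<Prod>m<n. a m)" and "B = (\<lambda>n. \<Prod>m<n. b m)" and "C = (\<lambda>n. \<Prod>m<n. c m)"
  have C0: "0 \<le> C n \<and> C n \<le> r ^ n" if "n \<le> N" for n
    using that c r unfolding C_def by (induction n) (auto intro!: mult_mono simp: mult.commute[of r])
  \<comment> \<open>The factor \<open>r\<close> on the left avoids the power
    \<open>r ^ (n - 1)\<close>, which truncated subtraction spoils at \<open>n = 0\<close>. The
    factor \<open>r^2\<close> in the claim has the same origin.\<close>
  have BC: "r * cmod (B n - of_real (C n)) \<le> real n * r ^ n * dd" if "n \<le> N" for n
    using that
  proof (induction n)
    case 0 then show ?case by (simp add: B_def C_def)
  next
    case (Suc n)
    then have n: "n < N" "n \<le> N" by auto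
    have "B (Suc n) - of_real (C (Suc n)) = b n * (B n - of_real (C n)) + d n * of_real (C n)"
      using bd[OF n(1)] by (simp add: B_def C_def algebra_simps)
    then have "cmod (B (Suc n) - of_real (C (Suc n))) \<le> cmod (b n) * cmod (B n - of_real (C n)) + cmod (d n) * \<bar>C n\<bar>"
      using norm_triangle_ineq[of "b n * (B n - of_real (C n))" "d n * of_real (C n)"] by (simp add: norm_mult)
    also have "... \<le> r * cmod (B n - of_real (C n)) + dd * r ^ n"
      using b[OF n(1)] d[OF n(1)] C0[OF n(2)] dd r by (intro add_mono mult_mono) auto
    finally have "r * cmod (B (Suc n) - of_real (C (Suc n))) \<le> r * (r * cmod (B n - of_real (C n)) + dd * r ^ n)"
      using r by (intro mult_left_mono) auto
    also have "... \<le> r * (real n * r ^ n * dd + dd * r ^ n)"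
      using Suc.IH[OF n(2)] r by (intro mult_left_mono add_right_mono) auto
    also have "... = real (Suc n) * r ^ Suc n * dd" by (simp add: algebra_simps)
    finally show ?case .
  qed
  have "r^2 * (A n - 2 * Re (B n) + C n) \<le> r ^ n * (real n * r * ee + (real n)^2 * (dd + ee) * dd)" if "n \<le> N" for n
    using that
  proof (induction n)
    case 0 then show ?case by (simp add: A_def B_def C_def)
  next
    case (Suc n)
    then have n: "n < N" "n \<le> N" by auto
    define X where "X = A n - 2 * Re (B n) + C n"
    define F where "F = B n - of_real (C n)"
    have IH: "r^2 * X \<le> r ^ n * (real n * r * ee + (real n)^2 * (dd + ee) * dd)" using Suc.IH[OF n(2)] by (simp add: X_def)
    have "A (Suc n) - 2 * Re (B (Suc n)) + C (Suc n) = a n * A n - 2 * Re (b n * B n) + c n * C n"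
      by (simp add: A_def B_def C_def mult_ac)
    \<comment> \<open>The accumulated error is amplified by \<open>a n\<close>. The weak error
      \<open>d n\<close> meets only the bias \<open>F\<close>, which is itself of the size of
      \<open>n\<close> weak errors; therefore weak errors enter as a square.\<close>
    also have "... = a n * X + 2 * Re (cnj (d n) * F) + 2 * e n * Re F + e n * C n"
      unfolding X_def F_def ad[OF n(1)] bd[OF n(1)] by (simp add: algebra_simps)
    also have "... \<le> a n * X + 2 * (dd * cmod F) + 2 * (ee * cmod F) + ee * r ^ n"
    proof -
      have "Re (cnj (d n) * F) \<le> dd * cmod F"
        using complex_Re_le_cmod[of "cnj (d n) * F"] mult_right_mono[OF d[OF n(1)], of "cmod F"] by (simp add: norm_mult)
      moreover have "e n * Re F \<le> ee * cmod F"
        using e[OF n(1)] complex_Re_le_cmod[of F] by (meson abs_Re_le_cmod abs_le_D1 mult_mono norm_ge_zero order_trans mult_left_mono mult_right_mono)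
      moreover have "e n * C n \<le> ee * r ^ n" using e[OF n(1)] C0[OF n(2)] by (intro mult_mono) auto
      ultimately show ?thesis by linarith
    qed
    finally have "r^2 * (A (Suc n) - 2 * Re (B (Suc n)) + C (Suc n)) \<le> r^2 * (a n * X + 2 * (dd * cmod F) + 2 * (ee * cmod F) + ee * r ^ n)"
      by (intro mult_left_mono) auto
    also have "... = a n * (r^2 * X) + 2 * (dd + ee) * r * (r * cmod F) + ee * r ^ n * r^2"
      by (simp add: power2_eq_square algebra_simps)
    also have "... \<le> r * (r ^ n * (real n * r * ee + (real n)^2 * (dd + ee) * dd)) + 2 * (dd + ee) * r * (real n * r ^ n * dd) + ee * r ^ n * r^2"
    proof -
      define Y where "Y = r ^ n * (real n * r * ee + (real n)^2 * (dd + ee) * dd)"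
      have Y0: "Y \<ge> 0" unfolding Y_def using r dd ee by simp
      have "a n * (r^2 * X) \<le> a n * Y" using a[OF n(1)] IH by (intro mult_left_mono) (auto simp: Y_def)
      also have "... \<le> r * Y" using a[OF n(1)] Y0 by (intro mult_right_mono) auto
      finally have "a n * (r^2 * X) \<le> r * Y" .
      moreover have "2 * (dd + ee) * r * (r * cmod F) \<le> 2 * (dd + ee) * r * (real n * r ^ n * dd)"
        using BC[OF n(2)] dd ee r by (intro mult_left_mono) (auto simp: F_def)
      ultimately show ?thesis unfolding Y_def by linarith
    qed
    also have "... \<le> r ^ Suc n * (real (Suc n) * r * ee + (real (Suc n))^2 * (dd + ee) * dd)"
    proof -
      have "0 \<le> r ^ Suc n * ((dd + ee) * dd)" using r dd ee by simp
      then show ?thesis by (simp add: power2_eq_square algebra_simps)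
    qed
    finally show ?case .
  qed
  from this[of N] show ?thesis by (simp add: A_def B_def C_def)
qed

lemma borel_measurable_cnj [measurable]: "cnj \<in> borel_measurable borel"
  by (intro borel_measurable_continuous_onI continuous_intros)

context prob_space
begin

lemma indep_product_norm_square:
  fixes C :: "nat \<Rightarrow> 'a \<Rightarrow> complex"
  assumes ind: "indep_vars (\<lambda>_. borel) C {..<N}" and i: "\<And>n. n < N \<Longrightarrow> integrable M (\<lambda>w. (cmod (C n w))^2)"
  shows "integrable M (\<lambda>w. (cmod (\<Prod>n<N. C n w))^2)"
    and "(\<integral>w. (cmod (\<Prod>n<N. C n w))^2 \<partial>M) = (\<Prod>n<N. \<integral>w. (cmod (C n w))^2 \<partial>M)"
proof -
  have ind': "indep_vars (\<lambda>_. borel) (\<lambda>n w. (cmod (C n w))^2) {..<N}"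
    by (rule indep_vars_compose2[OF ind]) auto
  have eq: "(\<lambda>w. (cmod (\<Prod>n<N. C n w))^2) = (\<lambda>w. \<Prod>n<N. (cmod (C n w))^2)"
    by (simp add: prod_norm[symmetric] prod_power_distrib)
  show "integrable M (\<lambda>w. (cmod (\<Prod>n<N. C n w))^2)"
    unfolding eq by (rule indep_vars_integrable[OF _ ind']) (use i in auto)
  show "(\<integral>w. (cmod (\<Prod>n<N. C n w))^2 \<partial>M) = (\<Prod>n<N. \<integral>w. (cmod (C n w))^2 \<partial>M)"
    unfolding eq by (rule indep_vars_lebesgue_integral[OF _ ind']) (use i in auto)
qed

lemma L2le_I_integral:
  fixes f :: "'a \<Rightarrow> complex"
  assumes "f \<in> borel_measurable M" "integrable M (\<lambda>w. (cmod (f w))^2)" "(\<integral>w. (cmod (f w))^2 \<partial>M) \<le> B^2" "0 \<le> B"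
  shows "L2le M f B"
  using assms nn_integral_eq_integral[OF assms(2)] by (simp add: L2le_def ennreal_leI)

lemma integrable_cnj_product:
  fixes C D :: "'a \<Rightarrow> complex"
  assumes [measurable]: "C \<in> borel_measurable M" "D \<in> borel_measurable M"
    and i: "integrable M (\<lambda>w. (cmod (C w))^2)" "integrable M (\<lambda>w. (cmod (D w))^2)"
  shows "integrable M (\<lambda>w. C w * cnj (D w))"
    and "cmod (\<integral>w. C w * cnj (D w) \<partial>M) \<le> ((\<integral>w. (cmod (C w))^2 \<partial>M) + (\<integral>w. (cmod (D w))^2 \<partial>M)) / 2"
proof -
  have b: "cmod (C w * cnj (D w)) \<le> ((cmod (C w))^2 + (cmod (D w))^2) / 2" for w
    using sum_squares_bound[of "cmod (C w)" "cmod (D w)"] by (simp add: norm_mult)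
  have ii: "integrable M (\<lambda>w. ((cmod (C w))^2 + (cmod (D w))^2) / 2)" using i by simp
  show I: "integrable M (\<lambda>w. C w * cnj (D w))"
    by (rule Bochner_Integration.integrable_bound[OF ii]) (measurable, use b in \<open>auto intro!: AE_I2 order_trans[OF _ abs_ge_self]\<close>)
  have "cmod (\<integral>w. C w * cnj (D w) \<partial>M) \<le> (\<integral>w. cmod (C w * cnj (D w)) \<partial>M)" by simp
  also have "... \<le> (\<integral>w. ((cmod (C w))^2 + (cmod (D w))^2) / 2 \<partial>M)"
    by (rule integral_mono[OF _ ii b]) (use I in simp)
  finally show "cmod (\<integral>w. C w * cnj (D w) \<partial>M) \<le> ((\<integral>w. (cmod (C w))^2 \<partial>M) + (\<integral>w. (cmod (D w))^2 \<partial>M)) / 2"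
    using i by simp
qed

text \<open>The pairs are independent in \<open>n\<close>, while \<open>C n\<close> and
  \<open>D n\<close> share their increments. In the application strong errors \<open>ee\<close> of
  order \<open>k^3\<close> and weak errors \<open>dd\<close> of order \<open>k^2\<close>, over
  \<open>N\<close> steps with \<open>N * k\<close> fixed, both give a mean square distance of order
  \<open>k^2\<close>.\<close>

lemma indep_product_distance:
  fixes C D :: "nat \<Rightarrow> 'a \<Rightarrow> complex"
  assumes ind: "indep_vars (\<lambda>_. borel) (\<lambda>n w. (C n w, D n w)) {..<N}"
    and iC: "\<And>n. n < N \<Longrightarrow> integrable M (\<lambda>w. (cmod (C n w))^2)" and iD: "\<And>n. n < N \<Longrightarrow> integrable M (\<lambda>w. (cmod (D n w))^2)"
    and rC: "\<And>n. n < N \<Longrightarrow> (\<integral>w. (cmod (C n w))^2 \<partial>M) \<le> r" and rD: "\<And>n. n < N \<Longrightarrow> (\<integral>w. (cmod (D n w))^2 \<partial>M) \<le> r"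
    and r: "r > 0"
    and e: "\<And>n. n < N \<Longrightarrow> (\<integral>w. (cmod (C n w - D n w))^2 \<partial>M) \<le> ee"
    and d: "\<And>n. n < N \<Longrightarrow> cmod (\<integral>w. (C n w - D n w) * cnj (D n w) \<partial>M) \<le> dd" and dd: "0 \<le> dd" and ee: "0 \<le> ee"
    and B: "B \<ge> 0" "r ^ N * (real N * r * ee + (real N)^2 * (dd + ee) * dd) \<le> r^2 * B^2"
  shows "L2le M (\<lambda>w. (\<Prod>n<N. C n w) - (\<Prod>n<N. D n w)) B"
proof -
  have rv: "random_variable borel (\<lambda>w. (C n w, D n w))" if "n < N" for n
    using ind that by (auto simp: indep_vars_def)
  have mC: "C n \<in> borel_measurable M" and mD: "D n \<in> borel_measurable M" if "n < N" for n
    using measurable_compose[OF rv[OF that] borel_measurable_continuous_onI[OF continuous_on_fst[OF continuous_on_id]]]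
      measurable_compose[OF rv[OF that] borel_measurable_continuous_onI[OF continuous_on_snd[OF continuous_on_id]]]
    by simp_all
  have indC: "indep_vars (\<lambda>_. borel) C {..<N}" and indD: "indep_vars (\<lambda>_. borel) D {..<N}"
    using indep_vars_compose2[OF ind, of "\<lambda>_. fst" "\<lambda>_. borel"] indep_vars_compose2[OF ind, of "\<lambda>_. snd" "\<lambda>_. borel"]
    by (simp_all add: borel_measurable_continuous_onI continuous_on_fst continuous_on_snd)
  have indCD: "indep_vars (\<lambda>_. borel) (\<lambda>n w. C n w * cnj (D n w)) {..<N}"
    using indep_vars_compose2[OF ind, of "\<lambda>_ p. fst p * cnj (snd p)" "\<lambda>_. borel"]
    by (simp add: borel_measurable_continuous_onI continuous_intros)
  have iCD: "integrable M (\<lambda>w. C n w * cnj (D n w))" if "n < N" for n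
    by (rule integrable_cnj_product(1)[OF mC[OF that] mD[OF that] iC[OF that] iD[OF that]])
  define a b c where "a = (\<lambda>n. \<integral>w. (cmod (C n w))^2 \<partial>M)" and "b = (\<lambda>n. \<integral>w. C n w * cnj (D n w) \<partial>M)" and "c = (\<lambda>n. \<integral>w. (cmod (D n w))^2 \<partial>M)"
  define dn en where "dn = (\<lambda>n. \<integral>w. (C n w - D n w) * cnj (D n w) \<partial>M)" and "en = (\<lambda>n. \<integral>w. (cmod (C n w - D n w))^2 \<partial>M)"
  have sq: "(cmod (x - y))^2 = (cmod x)^2 - 2 * Re (x * cnj y) + (cmod y)^2" for x y
    unfolding cmod_power2 by (simp add: power2_eq_square algebra_simps)
  have cc: "x * cnj x = of_real ((cmod x)^2)" for x by (rule complex_norm_square[symmetric])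
  have bd: "b n = of_real (c n) + dn n" if "n < N" for n
  proof -
    have "dn n = (\<integral>w. C n w * cnj (D n w) - of_real ((cmod (D n w))^2) \<partial>M)"
      unfolding dn_def left_diff_distrib cc ..
    also have "... = b n - of_real (c n)"
      unfolding b_def c_def using iCD[OF that] iD[OF that] by (subst Bochner_Integration.integral_diff) (auto simp del: of_real_power)
    finally show ?thesis by simp
  qed
  have ad: "a n = c n + 2 * Re (dn n) + en n" if "n < N" for n
  proof -
    have "en n = (\<integral>w. (cmod (C n w))^2 - 2 * Re (C n w * cnj (D n w)) + (cmod (D n w))^2 \<partial>M)"
      unfolding en_def sq ..
    also have "... = a n - 2 * Re (b n) + c n"
      unfolding a_def b_def c_def using iC[OF that] iD[OF that] iCD[OF that]
      by (subst Bochner_Integration.integral_add) (auto simp: integrable_Re simp del: times_complex.sel)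
    finally show ?thesis using bd[OF that] by simp
  qed
  have pa: "integrable M (\<lambda>w. (cmod (\<Prod>n<N. C n w))^2)" "(\<integral>w. (cmod (\<Prod>n<N. C n w))^2 \<partial>M) = (\<Prod>n<N. a n)"
    using indep_product_norm_square[OF indC iC] by (simp_all add: a_def)
  have pc: "integrable M (\<lambda>w. (cmod (\<Prod>n<N. D n w))^2)" "(\<integral>w. (cmod (\<Prod>n<N. D n w))^2 \<partial>M) = (\<Prod>n<N. c n)"
    using indep_product_norm_square[OF indD iD] by (simp_all add: c_def)
  have pb: "integrable M (\<lambda>w. \<Prod>n<N. C n w * cnj (D n w))" "(\<integral>w. (\<Prod>n<N. C n w * cnj (D n w)) \<partial>M) = (\<Prod>n<N. b n)"
    using indep_vars_integrable[OF _ indCD] indep_vars_lebesgue_integral[OF _ indCD] iCD by (auto simp: b_def)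
  have eq: "(\<lambda>w. (cmod ((\<Prod>n<N. C n w) - (\<Prod>n<N. D n w)))^2)
     = (\<lambda>w. (cmod (\<Prod>n<N. C n w))^2 - 2 * Re (\<Prod>n<N. C n w * cnj (D n w)) + (cmod (\<Prod>n<N. D n w))^2)"
    unfolding sq by (simp add: prod.distrib)
  have int: "integrable M (\<lambda>w. (cmod ((\<Prod>n<N. C n w) - (\<Prod>n<N. D n w)))^2)"
    unfolding eq using pa pb pc integrable_Re[OF pb(1)] by simp
  have val: "(\<integral>w. (cmod ((\<Prod>n<N. C n w) - (\<Prod>n<N. D n w)))^2 \<partial>M) = (\<Prod>n<N. a n) - 2 * Re (\<Prod>n<N. b n) + (\<Prod>n<N. c n)"
  proof -
    have "(\<integral>w. Re (\<Prod>n<N. C n w * cnj (D n w)) \<partial>M) = Re (\<Prod>n<N. b n)" using integral_Re[OF pb(1)] pb(2) by simp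
    then show ?thesis
      unfolding eq using pa pc integrable_Re[OF pb(1)]
      by (subst Bochner_Integration.integral_add) simp_all
  qed
  have bb: "cmod (b n) \<le> r" if "n < N" for n
    using integrable_cnj_product(2)[OF mC[OF that] mD[OF that] iC[OF that] iD[OF that]] rC[OF that] rD[OF that] unfolding b_def by argo
  have "r^2 * ((\<Prod>n<N. a n) - 2 * Re (\<Prod>n<N. b n) + (\<Prod>n<N. c n)) \<le> r ^ N * (real N * r * ee + (real N)^2 * (dd + ee) * dd)"
    by (rule product_distance[OF _ _ bb r bd ad _ _ dd ee])
      (use rC rD d e in \<open>auto simp: a_def c_def dn_def en_def\<close>)
  also note B(2)
  finally have "(\<Prod>n<N. a n) - 2 * Re (\<Prod>n<N. b n) + (\<Prod>n<N. c n) \<le> B^2" using r by simp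
  then show ?thesis
    using int val B mC mD by (intro L2le_I_integral borel_measurable_diff borel_measurable_prod) auto
qed

end

text \<open>Fourier multiplier of the equation over one time step: given the increments, the
  solution is translated by drift and noise and smoothed by a heat flow with coefficients
  \<open>1 - \<rho>x\<close> and \<open>1 - \<rho>y\<close>.\<close>

definition exact_step :: "real \<Rightarrow> real \<Rightarrow> real \<Rightarrow> real \<Rightarrow> real \<Rightarrow> complex \<Rightarrow> complex \<Rightarrow> real \<Rightarrow> real \<Rightarrow> complex" where
  "exact_step k \<mu>x \<mu>y \<rho>x \<rho>y \<xi> \<eta> u v = exp (- \<i> * (of_real (sqrt (k * \<rho>x)) * \<xi> * u + of_real (sqrt (k * \<rho>y)) * \<eta> * v)
     - of_real k * (\<i> * (\<mu>x * \<xi> + \<mu>y * \<eta>) + ((1 - \<rho>x) * \<xi>^2 + (1 - \<rho>y) * \<eta>^2) / 2))"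

text \<open>The first summand bounds the strong and the second the weak one-step error. Each is the
  prefactor of a pointwise bound in \<open>exp (b * G)\<close> times the moment bound
  \<open>4 * exp (2 * b^2)\<close>, with \<open>b\<close> equal to \<open>2 * (4 + 2 * c)\<close>
  and to \<open>4 + 4 * c\<close>.\<close>

definition local_constant :: "real \<Rightarrow> real" where
  "local_constant c = (200 * c ^ 4 * exp (2 * c) + 2 * c)^2 * (4 * exp (2 * (2 * (4 + 2 * c))^2))
     + (200 * c ^ 4 * exp (4 * c) + 4 * c^2 * exp (2 * c)) * (4 * exp (2 * (4 + 4 * c)^2))"

lemma square_diff_bound:
  fixes S \<xi> :: complex and R \<kappa> k :: real
  assumes "cmod (S - \<xi>) \<le> \<kappa> * R ^ 3 * k" "cmod \<xi> \<le> R" "1 \<le> R" "0 \<le> k" "k * R^2 \<le> 1" "1 \<le> \<kappa>"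
  shows "cmod (S^2 - \<xi>^2) \<le> \<kappa> * (2 + \<kappa>) * (k * R ^ 4)"
proof -
  have "\<kappa> * R ^ 3 * k = \<kappa> * R * (k * R^2)" by (simp add: power3_eq_cube power2_eq_square)
  also have "... \<le> \<kappa> * R * 1" using assms by (intro mult_left_mono) auto
  finally have l: "\<kappa> * R ^ 3 * k \<le> \<kappa> * R" by simp
  have "S^2 - \<xi>^2 = (S - \<xi>) * ((S - \<xi>) + 2 * \<xi>)" by (simp add: power2_eq_square algebra_simps)
  then have "cmod (S^2 - \<xi>^2) = cmod (S - \<xi>) * cmod ((S - \<xi>) + 2 * \<xi>)" by (simp add: norm_mult)
  also have "... \<le> (\<kappa> * R ^ 3 * k) * ((2 + \<kappa>) * R)"
  proof (rule mult_mono[OF assms(1)])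
    have "cmod ((S - \<xi>) + 2 * \<xi>) \<le> cmod (S - \<xi>) + 2 * cmod \<xi>"
      by (rule order_trans[OF norm_triangle_ineq]) (simp add: norm_mult)
    then show "cmod ((S - \<xi>) + 2 * \<xi>) \<le> (2 + \<kappa>) * R" using assms(1,2) l by (simp add: distrib_right)
  qed (use assms in auto)
  also have "... = \<kappa> * (2 + \<kappa>) * (k * R ^ 4)" by (simp add: power3_eq_cube power4_eq_xxxx)
  finally show ?thesis .
qed

text \<open>The local error is \<open>T3\<close> plus a remainder of order
  \<open>\<tau> ^ 4\<close>. \<open>T3\<close> has order \<open>\<tau> ^ 3\<close>, which gives the
  strong bound, and mean zero, being odd in the increments, which raises the weak bound by one
  order. \<open>\<kappa> * R ^ 3 * k\<close> is the second order error of the symbols when the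
  squared mesh size is of order \<open>k\<close>.\<close>

lemma (in gauss_pair) one_step_error:
  fixes k R \<kappa> \<mu>x \<mu>y \<rho>x \<rho>y :: real
  defines "\<tau> \<equiv> sqrt k * R" and "c \<equiv> 2 * \<kappa> * (\<bar>\<mu>x\<bar> + \<bar>\<mu>y\<bar> + 2 + \<kappa>)"
  assumes k: "0 \<le> k" and R: "1 \<le> R" and \<xi>: "cmod \<xi> \<le> R" and \<eta>: "cmod \<eta> \<le> R" and lam: "1 \<le> \<kappa>"
    and rx: "0 \<le> \<rho>x" "\<rho>x \<le> 1" and ry: "0 \<le> \<rho>y" "\<rho>y \<le> 1"
    and S1: "cmod (S1 - \<xi>) \<le> \<kappa> * R ^ 3 * k" and P1: "cmod (P1 - \<xi>) \<le> \<kappa> * R ^ 3 * k"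
    and S2: "cmod (S2 - \<eta>) \<le> \<kappa> * R ^ 3 * k" and P2: "cmod (P2 - \<eta>) \<le> \<kappa> * R ^ 3 * k"
    and \<tau>: "4 * c * \<tau>^2 \<le> 1"
  defines "C \<equiv> \<lambda>w. step_factor k \<mu>x \<mu>y \<rho>x \<rho>y S1 P1 S2 P2 (U w) (V w)"
    and "X0 \<equiv> \<lambda>w. exact_step k \<mu>x \<mu>y \<rho>x \<rho>y \<xi> \<eta> (U w) (V w)"
  shows "(\<integral>w. (cmod (C w - X0 w))^2 \<partial>M) \<le> local_constant c * \<tau> ^ 6"
    and "cmod (\<integral>w. (C w - X0 w) * cnj (X0 w) \<partial>M) \<le> local_constant c * \<tau> ^ 4"
proof -
  define m where "m = \<bar>\<mu>x\<bar> + \<bar>\<mu>y\<bar>"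
  have m0: "m \<ge> 0" by (simp add: m_def)
  have c_eq: "c = 2 * \<kappa> * (m + 2 + \<kappa>)" by (simp add: c_def m_def)
  have lm: "m \<le> \<kappa> * m" "1 \<le> \<kappa> * \<kappa>" using lam m0 mult_right_mono[of 1 \<kappa> m] mult_mono[of 1 \<kappa> 1 \<kappa>] by auto
  have c_exp: "c = 2 * (\<kappa> * m) + 4 * \<kappa> + 2 * (\<kappa> * \<kappa>)" by (simp add: c_eq algebra_simps)
  have c2: "2 \<le> c" "\<kappa> \<le> c" "m + 1 \<le> c" "2 * (\<kappa> * (2 + \<kappa>)) \<le> c" "m * \<kappa> + \<kappa> * (2 + \<kappa>) \<le> c"
    unfolding c_exp using lam lm m0 by (auto simp: algebra_simps)
  have c0: "0 \<le> c" using c2 by linarith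
  have \<tau>0: "0 \<le> \<tau>" using k R by (simp add: \<tau>_def)
  have \<tau>2: "\<tau>^2 = k * R^2" using k by (simp add: \<tau>_def power_mult_distrib)
  have \<tau>4: "\<tau> ^ 4 = k * (k * R ^ 4)"
  proof -
    have "\<tau> ^ 4 = \<tau>^2 * \<tau>^2" by (simp add: power4_eq_xxxx power2_eq_square)
    then show ?thesis unfolding \<tau>2 by (simp add: power4_eq_xxxx power2_eq_square)
  qed
  have \<tau>3: "\<tau> ^ 3 = sqrt k * (R ^ 3 * k)"
  proof -
    have "\<tau> ^ 3 = \<tau> * \<tau>^2" by (simp add: power3_eq_cube power2_eq_square)
    then show ?thesis unfolding \<tau>2 by (simp add: \<tau>_def power3_eq_cube power2_eq_square)
  qed
  have kR: "k * R^2 \<le> 1"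
  proof -
    have "\<tau>^2 \<le> 4 * c * \<tau>^2" using c2 mult_right_mono[of 1 "4 * c" "\<tau>^2"] by simp
    then show ?thesis using \<tau> \<tau>2 by linarith
  qed
  have \<tau>1: "\<tau> \<le> 1" using kR \<tau>2 \<tau>0 by (metis abs_of_nonneg abs_square_le_1)
  define X where "X = (\<lambda>w. of_real (sqrt (k * \<rho>x)) * \<xi> * U w + of_real (sqrt (k * \<rho>y)) * \<eta> * V w)"
  define X' where "X' = (\<lambda>w. of_real (sqrt (k * \<rho>x)) * S1 * U w + of_real (sqrt (k * \<rho>y)) * S2 * V w)"
  define D where "D = of_real k * (\<i> * (\<mu>x * \<xi> + \<mu>y * \<eta>) + ((1 - \<rho>x) * \<xi>^2 + (1 - \<rho>y) * \<eta>^2) / 2)"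
  define E0 where "E0 = \<i> * k * (\<mu>x * \<xi> + \<mu>y * \<eta>) + k / 2 * (\<xi>^2 + \<eta>^2)"
  define E where "E = \<i> * k * (\<mu>x * S1 + \<mu>y * S2) + k / 2 * (P1^2 + P2^2)"
  define s where "s = of_real k * (\<rho>x * \<xi>^2 + \<rho>y * \<eta>^2)"
  define s' where "s' = (of_real (sqrt (k * \<rho>x)) * S1)^2 + (of_real (sqrt (k * \<rho>y)) * S2)^2"
  define g where "g = (\<lambda>w. 1 + G w)"
  have g1: "1 \<le> g w" for w by (simp add: g_def)
  have sk: "sqrt (k * \<rho>x) \<le> sqrt k" "sqrt (k * \<rho>y) \<le> sqrt k" using k rx ry by (auto simp: mult_left_le)
  have sk0: "0 \<le> sqrt (k * \<rho>x)" "0 \<le> sqrt (k * \<rho>y)" using k rx ry by auto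
  have lin: "cmod (of_real (sqrt (k * \<rho>x)) * a * U w + of_real (sqrt (k * \<rho>y)) * b * V w) \<le> sqrt k * B * g w"
    if "cmod a \<le> B" "cmod b \<le> B" for a b B w
  proof -
    have B: "0 \<le> B" using that(1) norm_ge_zero order_trans by blast
    have "cmod (of_real (sqrt (k * \<rho>x)) * a * U w + of_real (sqrt (k * \<rho>y)) * b * V w)
      \<le> sqrt (k * \<rho>x) * cmod a * \<bar>U w\<bar> + sqrt (k * \<rho>y) * cmod b * \<bar>V w\<bar>"
      by (rule order_trans[OF norm_triangle_ineq]) (use sk0 in \<open>simp add: norm_mult\<close>)
    also have "... \<le> sqrt k * B * \<bar>U w\<bar> + sqrt k * B * \<bar>V w\<bar>"
      using that sk sk0 B k by (intro add_mono mult_right_mono mult_mono) auto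
    also have "... = sqrt k * B * G w" by (simp add: G_def algebra_simps)
    also have "... \<le> sqrt k * B * g w" using B k by (intro mult_left_mono) (auto simp: g_def)
    finally show ?thesis .
  qed
  have bX: "cmod (X w) \<le> \<tau> * g w" for w unfolding X_def \<tau>_def by (rule lin[OF \<xi> \<eta>])
  have bdX: "cmod (X' w - X w) \<le> c * \<tau> ^ 3 * g w" for w
  proof -
    have "X' w - X w = of_real (sqrt (k * \<rho>x)) * (S1 - \<xi>) * U w + of_real (sqrt (k * \<rho>y)) * (S2 - \<eta>) * V w"
      by (simp add: X_def X'_def algebra_simps)
    then have "cmod (X' w - X w) \<le> sqrt k * (\<kappa> * R ^ 3 * k) * g w" using lin[OF S1 S2] by simp
    also have "... = \<kappa> * \<tau> ^ 3 * g w" unfolding \<tau>3 by simp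
    also have "... \<le> c * \<tau> ^ 3 * g w" using c2 \<tau>0 g1[of w] by (intro mult_right_mono) auto
    finally show ?thesis .
  qed
  have sqb: "cmod (\<xi>^2) \<le> R^2" "cmod (\<eta>^2) \<le> R^2" using \<xi> \<eta> by (auto simp: norm_power intro: power_mono)
  have RR: "R \<le> R^2" "R ^ 3 \<le> R ^ 4" using R by (auto simp: self_le_power intro: power_increasing)
  have tri: "cmod (a + b) \<le> p + q" if "cmod a \<le> p" "cmod b \<le> q" for a b p q using norm_triangle_ineq[of a b] that by linarith
  have bmu: "cmod (\<mu>x * a + \<mu>y * b) \<le> m * B" if "cmod a \<le> B" "cmod b \<le> B" for a b :: complex and B
  proof -
    have "cmod (\<mu>x * a) \<le> \<bar>\<mu>x\<bar> * B" "cmod (\<mu>y * b) \<le> \<bar>\<mu>y\<bar> * B" using that by (auto simp: norm_mult intro: mult_left_mono)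
    from tri[OF this] show ?thesis by (simp add: m_def distrib_right)
  qed
  have bq: "cmod (a * \<xi>^2 + b * \<eta>^2) \<le> 2 * R^2" if "0 \<le> a" "a \<le> 1" "0 \<le> b" "b \<le> 1" for a b :: real
  proof -
    have "cmod (a * \<xi>^2) \<le> 1 * R^2" "cmod (b * \<eta>^2) \<le> 1 * R^2"
      using that sqb mult_mono[of a 1 "cmod (\<xi>^2)" "R^2"] mult_mono[of b 1 "cmod (\<eta>^2)" "R^2"]
      by (simp_all add: norm_mult)
    from tri[OF this] show ?thesis by simp
  qed
  have mR: "m * R \<le> m * R^2" using RR m0 by (intro mult_left_mono)
  have DD: "cmod (of_real k * (\<i> * (\<mu>x * \<xi> + \<mu>y * \<eta>) + q / 2)) \<le> c * \<tau>^2" if q: "cmod q \<le> 2 * R^2" for q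
  proof -
    have "cmod (\<i> * (\<mu>x * \<xi> + \<mu>y * \<eta>)) \<le> m * R^2" using bmu[OF \<xi> \<eta>] mR by (simp add: norm_mult)
    moreover have "cmod (q / 2) \<le> R^2" using q by (simp add: norm_divide)
    ultimately have "cmod (\<i> * (\<mu>x * \<xi> + \<mu>y * \<eta>) + q / 2) \<le> m * R^2 + R^2" by (rule tri)
    then have "k * cmod (\<i> * (\<mu>x * \<xi> + \<mu>y * \<eta>) + q / 2) \<le> k * ((m + 1) * R^2)"
      using k by (intro mult_left_mono) (auto simp: distrib_right)
    also have "... = (m + 1) * \<tau>^2" by (simp add: \<tau>2)
    also have "... \<le> c * \<tau>^2" using c2 by (intro mult_right_mono) auto
    finally show ?thesis using k by (simp add: norm_mult)
  qed
  have bD: "cmod D \<le> c * \<tau>^2"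
  proof -
    have "cmod ((1 - \<rho>x) * \<xi>^2 + (1 - \<rho>y) * \<eta>^2) \<le> 2 * R^2" using bq[of "1 - \<rho>x" "1 - \<rho>y"] rx ry by simp
    from DD[OF this] show ?thesis by (simp add: D_def)
  qed
  have bE0: "cmod E0 \<le> c * \<tau>^2"
  proof -
    have "cmod (\<xi>^2 + \<eta>^2) \<le> 2 * R^2" using bq[of 1 1] by simp
    moreover have "E0 = of_real k * (\<i> * (\<mu>x * \<xi> + \<mu>y * \<eta>) + (\<xi>^2 + \<eta>^2) / 2)" by (simp add: E0_def algebra_simps)
    ultimately show ?thesis using DD by simp
  qed
  note sd = square_diff_bound[OF _ _ R k kR lam]
  have bdE: "cmod (E - E0) \<le> c * \<tau> ^ 4"
  proof -
    have "E - E0 = of_real k * (\<i> * (\<mu>x * (S1 - \<xi>) + \<mu>y * (S2 - \<eta>)) + ((P1^2 - \<xi>^2) + (P2^2 - \<eta>^2)) / 2)"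
      by (simp add: E_def E0_def algebra_simps add_divide_distrib diff_divide_distrib)
    moreover have "cmod (\<i> * (\<mu>x * (S1 - \<xi>) + \<mu>y * (S2 - \<eta>)) + ((P1^2 - \<xi>^2) + (P2^2 - \<eta>^2)) / 2)
        \<le> m * \<kappa> * (k * R ^ 4) + \<kappa> * (2 + \<kappa>) * (k * R ^ 4)"
    proof (rule tri)
      have "m * (\<kappa> * R ^ 3 * k) \<le> m * (\<kappa> * R ^ 4 * k)"
        using RR m0 lam k by (intro mult_left_mono mult_right_mono) auto
      then show "cmod (\<i> * (\<mu>x * (S1 - \<xi>) + \<mu>y * (S2 - \<eta>))) \<le> m * \<kappa> * (k * R ^ 4)"
        using bmu[OF S1 S2] by (simp add: norm_mult mult_ac)
      show "cmod (((P1^2 - \<xi>^2) + (P2^2 - \<eta>^2)) / 2) \<le> \<kappa> * (2 + \<kappa>) * (k * R ^ 4)"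
        using tri[OF sd[OF P1 \<xi>] sd[OF P2 \<eta>]] unfolding norm_divide by (simp add: mult_ac)
    qed
    ultimately have "cmod (E - E0) \<le> k * (m * \<kappa> * (k * R ^ 4) + \<kappa> * (2 + \<kappa>) * (k * R ^ 4))"
      using k by (simp add: norm_mult mult_left_mono)
    also have "... = (m * \<kappa> + \<kappa> * (2 + \<kappa>)) * \<tau> ^ 4" unfolding \<tau>4 by (simp add: algebra_simps)
    also have "... \<le> c * \<tau> ^ 4" using c2 \<tau>0 by (intro mult_right_mono) auto
    finally show ?thesis .
  qed
  have bs: "cmod s \<le> c * \<tau>^2"
  proof -
    have "cmod s \<le> k * (2 * R^2)" unfolding s_def using bq[of \<rho>x \<rho>y] rx ry k by (simp add: norm_mult mult_left_mono)
    also have "... = 2 * \<tau>^2" by (simp add: \<tau>2)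
    also have "... \<le> c * \<tau>^2" using c2 by (intro mult_right_mono) auto
    finally show ?thesis .
  qed
  have s'_eq: "s' = of_real k * (\<rho>x * S1^2 + \<rho>y * S2^2)"
  proof -
    have "(complex_of_real (sqrt (k * \<rho>)))^2 = of_real (k * \<rho>)" if "0 \<le> \<rho>" for \<rho>
      using k that by (simp flip: of_real_power)
    then show ?thesis unfolding s'_def power_mult_distrib using rx ry by (simp add: algebra_simps)
  qed
  have bds: "cmod (s' - s) \<le> c * \<tau> ^ 4"
  proof -
    have "s' - s = of_real k * (\<rho>x * (S1^2 - \<xi>^2) + \<rho>y * (S2^2 - \<eta>^2))" by (simp add: s'_eq s_def algebra_simps)
    moreover have "cmod (\<rho>x * (S1^2 - \<xi>^2) + \<rho>y * (S2^2 - \<eta>^2)) \<le> 1 * (\<kappa> * (2 + \<kappa>) * (k * R ^ 4)) + 1 * (\<kappa> * (2 + \<kappa>) * (k * R ^ 4))"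
      by (rule tri; unfold norm_mult; rule mult_mono) (use rx ry sd[OF S1 \<xi>] sd[OF S2 \<eta>] lam k in auto)
    ultimately have "cmod (s' - s) \<le> k * (1 * (\<kappa> * (2 + \<kappa>) * (k * R ^ 4)) + 1 * (\<kappa> * (2 + \<kappa>) * (k * R ^ 4)))"
      using k by (simp add: norm_mult mult_left_mono)
    also have "... = (2 * (\<kappa> * (2 + \<kappa>))) * \<tau> ^ 4" unfolding \<tau>4 by (simp add: algebra_simps)
    also have "... \<le> c * \<tau> ^ 4" using c2 \<tau>0 by (intro mult_right_mono) auto
    finally show ?thesis .
  qed
  have ED: "E0 - D = s / 2" by (simp add: E0_def D_def s_def algebra_simps add_divide_distrib diff_divide_distrib)
  \<comment> \<open>The assumption \<open>4 * c * \<tau>^2 \<le> 1\<close> is calibrated for this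
    bound: \<open>E\<close> has two parts of size at most \<open>c * \<tau>^2\<close>.\<close>
  have bE: "cmod E \<le> 1 / 2"
  proof -
    have "cmod E \<le> c * \<tau> ^ 4 + c * \<tau>^2" using tri[OF bdE bE0] by simp
    also have "c * \<tau> ^ 4 \<le> c * \<tau>^2" using power_decreasing[of 2 4 \<tau>] \<tau>0 \<tau>1 c0 by (intro mult_left_mono) auto
    finally show ?thesis using \<tau> by linarith
  qed
  define T3 where "T3 = (\<lambda>w. - \<i> * (X' w - X w) + \<i> * X w * s / 2 - \<i> * X w ^ 3 / 6)"
  have Ceq: "C w = (1 - \<i> * X' w - ((X' w)^2 - s') / 2) / (1 + E)" for w
    by (simp add: C_def step_factor_def step_num_def step_den_def X'_def s'_def E_def add_ac)
  have X0eq: "X0 w = exp (- \<i> * X w - D)" for w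
    by (simp add: X0_def exact_step_def X_def D_def)
  have rem: "cmod (C w - X0 w - T3 w) \<le> 200 * c ^ 4 * \<tau> ^ 4 * g w ^ 4 * exp (2 * c * g w)" for w
    unfolding Ceq X0eq T3_def by (rule local_expansion[OF \<tau>0 \<tau>1 g1 c2(1) bX bdX bD bE0 bdE bs bds ED bE])
  have gn: "g w ^ n \<le> exp (real n * G w)" for w n unfolding g_def by (rule one_plus_G_power)
  have eg: "exp (2 * c * g w) = exp (2 * c) * exp (2 * c * G w)" for w by (simp add: g_def exp_add[symmetric] algebra_simps)
  have rem': "cmod (C w - X0 w - T3 w) \<le> 200 * c ^ 4 * exp (2 * c) * \<tau> ^ 4 * exp ((4 + 2 * c) * G w)" for w
  proof -
    have "200 * c ^ 4 * \<tau> ^ 4 * g w ^ 4 * exp (2 * c * g w) \<le> 200 * c ^ 4 * \<tau> ^ 4 * exp (real 4 * G w) * exp (2 * c * g w)"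
      using gn[of w 4] c0 \<tau>0 by (intro mult_right_mono mult_left_mono) auto
    also have "... = 200 * c ^ 4 * exp (2 * c) * \<tau> ^ 4 * exp ((4 + 2 * c) * G w)"
      unfolding eg by (simp add: exp_add distrib_right)
    finally show ?thesis using rem[of w] by linarith
  qed
  have bT: "cmod (T3 w) \<le> 2 * c * \<tau> ^ 3 * exp (3 * G w)" for w
  proof -
    have a: "cmod (- \<i> * (X' w - X w)) \<le> c * \<tau> ^ 3 * g w ^ 3"
    proof -
      have "c * \<tau> ^ 3 * g w \<le> c * \<tau> ^ 3 * g w ^ 3" using g1[of w] c0 \<tau>0 by (intro mult_left_mono self_le_power) auto
      then show ?thesis using bdX[of w] by (simp add: norm_mult)
    qed
    have b: "cmod (\<i> * X w * s / 2) \<le> c * \<tau> ^ 3 * g w ^ 3 / 2"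
    proof -
      have "cmod (X w) * cmod s \<le> (\<tau> * g w) * (c * \<tau>^2)" using bX bs \<tau>0 g1[of w] by (intro mult_mono) auto
      also have "... = c * \<tau> ^ 3 * g w" by (simp add: power3_eq_cube power2_eq_square)
      also have "... \<le> c * \<tau> ^ 3 * g w ^ 3" using g1[of w] c0 \<tau>0 by (intro mult_left_mono self_le_power) auto
      finally show ?thesis by (simp add: norm_mult norm_divide)
    qed
    have d: "cmod (\<i> * X w ^ 3 / 6) \<le> c * \<tau> ^ 3 * g w ^ 3 / 6"
    proof -
      have "cmod (X w) ^ 3 \<le> 1 * (\<tau> * g w) ^ 3" using power_mono[OF bX norm_ge_zero, of w 3] by simp
      also have "... \<le> c * (\<tau> * g w) ^ 3" using c2 \<tau>0 g1[of w] by (intro mult_right_mono) auto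
      finally show ?thesis by (simp add: norm_mult norm_divide norm_power power_mult_distrib)
    qed
    have "cmod (T3 w) \<le> c * \<tau> ^ 3 * g w ^ 3 + c * \<tau> ^ 3 * g w ^ 3 / 2 + c * \<tau> ^ 3 * g w ^ 3 / 6"
      unfolding T3_def using norm_triangle_ineq4[of "- \<i> * (X' w - X w) + \<i> * X w * s / 2" "\<i> * X w ^ 3 / 6"] tri[OF a b] d by linarith
    also have "... \<le> 2 * (c * \<tau> ^ 3 * g w ^ 3)"
    proof -
      have "0 \<le> c * \<tau> ^ 3 * g w ^ 3" using c0 \<tau>0 g1[of w] by auto
      then show ?thesis by argo
    qed
    also have "... \<le> 2 * (c * \<tau> ^ 3 * exp (real 3 * G w))"
      using gn[of w 3] c0 \<tau>0 by (intro mult_left_mono) auto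
    finally show ?thesis by simp
  qed
  have bw: "cmod (- \<i> * X w - D) \<le> 2 * c * \<tau> * g w" for w
  proof -
    have "cmod (- \<i> * X w - D) \<le> \<tau> * g w + c * \<tau>^2"
      using norm_triangle_ineq4[of "- \<i> * X w" D] bX[of w] bD by (simp add: norm_mult)
    moreover have "c * \<tau>^2 \<le> c * (\<tau> * g w)"
    proof -
      have "\<tau> * \<tau> \<le> \<tau> * g w" using \<tau>0 \<tau>1 g1[of w] by (intro mult_left_mono) auto
      then show ?thesis using c0 by (simp add: power2_eq_square mult_left_mono)
    qed
    moreover have "1 * (\<tau> * g w) \<le> c * (\<tau> * g w)" using c2 \<tau>0 g1[of w] by (intro mult_right_mono) auto
    ultimately show ?thesis by (simp add: mult_ac)
  qed
  have eRe: "exp \<bar>Re (- \<i> * X w - D)\<bar> \<le> exp (2 * c) * exp (2 * c * G w)" for w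
  proof -
    have "\<bar>Re (- \<i> * X w - D)\<bar> \<le> 2 * c * \<tau> * g w" using abs_Re_le_cmod[of "- \<i> * X w - D"] bw[of w] by linarith
    also have "... \<le> 2 * c * 1 * g w" using \<tau>1 c0 g1[of w] by (intro mult_right_mono mult_left_mono) auto
    finally have "exp \<bar>Re (- \<i> * X w - D)\<bar> \<le> exp (2 * c * g w)" by simp
    then show ?thesis unfolding eg .
  qed
  have bX0: "cmod (X0 w) \<le> exp (2 * c) * exp (2 * c * G w)" for w
  proof -
    have "cmod (X0 w) \<le> exp \<bar>Re (- \<i> * X w - D)\<bar>" unfolding X0eq norm_exp_eq_Re by simp
    then show ?thesis using eRe[of w] by linarith
  qed
  have bX1: "cmod (X0 w - 1) \<le> 2 * c * \<tau> * exp (2 * c) * exp ((1 + 2 * c) * G w)" for w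
  proof -
    have "cmod (X0 w - 1) \<le> exp \<bar>Re (- \<i> * X w - D)\<bar> * cmod (- \<i> * X w - D)"
      using Taylor_exp[of "- \<i> * X w - D" 0] by (simp add: X0eq)
    also have "... \<le> (exp (2 * c) * exp (2 * c * G w)) * (2 * c * \<tau> * exp (real 1 * G w))"
    proof (intro mult_mono eRe)
      have "2 * c * \<tau> * g w \<le> 2 * c * \<tau> * exp (real 1 * G w)" using gn[of w 1] c0 \<tau>0 by (intro mult_left_mono) auto
      then show "cmod (- \<i> * X w - D) \<le> 2 * c * \<tau> * exp (real 1 * G w)" using bw[of w] by linarith
    qed auto
    also have "... = 2 * c * \<tau> * exp (2 * c) * exp ((1 + 2 * c) * G w)" by (simp add: exp_add distrib_right)
    finally show ?thesis .
  qed
  have mX [measurable]: "X \<in> borel_measurable M" "X' \<in> borel_measurable M" unfolding X_def X'_def by measurable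
  have mC [measurable]: "C \<in> borel_measurable M" unfolding Ceq[abs_def] by measurable
  have mX0 [measurable]: "X0 \<in> borel_measurable M"
    unfolding X0eq[abs_def] by (intro measurable_compose[OF _ borel_measurable_continuous_onI[OF continuous_on_exp[OF continuous_on_id]]]) measurable
  have mT [measurable]: "T3 \<in> borel_measurable M" unfolding T3_def by measurable
  define A1 A2 where "A1 = (200 * c ^ 4 * exp (2 * c) + 2 * c)^2 * (4 * exp (2 * (2 * (4 + 2 * c))^2))"
    and "A2 = (200 * c ^ 4 * exp (4 * c) + 4 * c^2 * exp (2 * c)) * (4 * exp (2 * (4 + 4 * c)^2))"
  have A0: "0 \<le> A1" "0 \<le> A2" unfolding A1_def A2_def using c0 by auto
  have lc: "A1 \<le> local_constant c" "A2 \<le> local_constant c" using A0 by (auto simp: local_constant_def A1_def A2_def)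
  have b1: "norm ((cmod (C w - X0 w))^2) \<le> ((200 * c ^ 4 * exp (2 * c) + 2 * c)^2 * \<tau> ^ 6) * exp ((2 * (4 + 2 * c)) * G w)" for w
  proof -
    have "cmod (C w - X0 w) \<le> cmod (C w - X0 w - T3 w) + cmod (T3 w)"
      using norm_triangle_ineq[of "C w - X0 w - T3 w" "T3 w"] by simp
    also have "... \<le> 200 * c ^ 4 * exp (2 * c) * \<tau> ^ 3 * exp ((4 + 2 * c) * G w) + 2 * c * \<tau> ^ 3 * exp ((4 + 2 * c) * G w)"
    proof (rule add_mono)
      have "200 * c ^ 4 * exp (2 * c) * \<tau> ^ 4 * exp ((4 + 2 * c) * G w) \<le> 200 * c ^ 4 * exp (2 * c) * \<tau> ^ 3 * exp ((4 + 2 * c) * G w)"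
        using \<tau>0 \<tau>1 c0 by (intro mult_right_mono mult_left_mono power_decreasing) auto
      then show "cmod (C w - X0 w - T3 w) \<le> 200 * c ^ 4 * exp (2 * c) * \<tau> ^ 3 * exp ((4 + 2 * c) * G w)" using rem'[of w] by linarith
      have "2 * c * \<tau> ^ 3 * exp (3 * G w) \<le> 2 * c * \<tau> ^ 3 * exp ((4 + 2 * c) * G w)"
        using c0 \<tau>0 by (intro mult_left_mono) (auto intro!: mult_right_mono)
      then show "cmod (T3 w) \<le> 2 * c * \<tau> ^ 3 * exp ((4 + 2 * c) * G w)" using bT[of w] by linarith
    qed
    also have "... = (200 * c ^ 4 * exp (2 * c) + 2 * c) * \<tau> ^ 3 * exp ((4 + 2 * c) * G w)" by (simp add: distrib_right)
    finally have "(cmod (C w - X0 w))^2 \<le> ((200 * c ^ 4 * exp (2 * c) + 2 * c) * \<tau> ^ 3 * exp ((4 + 2 * c) * G w))^2"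
      by (rule power_mono) simp
    also have "... = ((200 * c ^ 4 * exp (2 * c) + 2 * c)^2 * (\<tau> ^ 3)^2) * (exp ((4 + 2 * c) * G w))^2"
      by (simp only: power_mult_distrib)
    also have "(\<tau> ^ 3)^2 = \<tau> ^ 6" by (simp flip: power_mult)
    also have "(exp ((4 + 2 * c) * G w))^2 = exp ((2 * (4 + 2 * c)) * G w)" by (simp add: exp_double[symmetric])
    finally show ?thesis by simp
  qed
  have "norm (\<integral>w. (cmod (C w - X0 w))^2 \<partial>M) \<le> ((200 * c ^ 4 * exp (2 * c) + 2 * c)^2 * \<tau> ^ 6) * (4 * exp (2 * (2 * (4 + 2 * c))^2))"
    by (rule integrable_exp_G_bound(2)[OF _ b1]) (use c0 in \<open>measurable, auto\<close>)
  also have "... = A1 * \<tau> ^ 6" by (simp add: A1_def)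
  also have "... \<le> local_constant c * \<tau> ^ 6" using lc \<tau>0 by (intro mult_right_mono) auto
  finally show "(\<integral>w. (cmod (C w - X0 w))^2 \<partial>M) \<le> local_constant c * \<tau> ^ 6" by simp
  have T3int: "has_bochner_integral M T3 0"
  proof -
    define p q where "p = of_real (sqrt (k * \<rho>x)) * \<xi>" and "q = of_real (sqrt (k * \<rho>y)) * \<eta>"
    define p' q' where "p' = of_real (sqrt (k * \<rho>x)) * (S1 - \<xi>)" and "q' = of_real (sqrt (k * \<rho>y)) * (S2 - \<eta>)"
    note h1 = has_bochner_integral_mult_right[of "- \<i>", OF third_moment_complex(1)[of p' q']]
    note h2 = has_bochner_integral_mult_right[of "\<i> * s / 2", OF third_moment_complex(1)[of p q]]
    note h3 = has_bochner_integral_mult_right[of "\<i> / 6", OF third_moment_complex(2)[of p q]]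
    have "T3 = (\<lambda>w. - \<i> * (p' * U w + q' * V w) + \<i> * s / 2 * (p * U w + q * V w) - \<i> / 6 * (p * U w + q * V w) ^ 3)"
    proof (rule ext)
      fix w
      have 1: "X' w - X w = p' * U w + q' * V w" by (simp add: X_def X'_def p'_def q'_def algebra_simps)
      have 2: "X w = p * U w + q * V w" by (simp add: X_def p_def q_def)
      show "T3 w = - \<i> * (p' * U w + q' * V w) + \<i> * s / 2 * (p * U w + q * V w) - \<i> / 6 * (p * U w + q * V w) ^ 3"
        unfolding T3_def 1 2[symmetric] by simp
    qed
    then show ?thesis using has_bochner_integral_diff[OF has_bochner_integral_add[OF h1 h2] h3] by simp
  qed
  \<comment> \<open>Removing \<open>T3\<close> leaves the remainder times \<open>cnj X0\<close> and
    \<open>T3 * cnj (X0 - 1)\<close>; the latter gains the missing power of \<tau> because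
    \<open>X0 - 1\<close> is of order \<tau>.\<close>
  define Y where "Y = (\<lambda>w. (C w - X0 w) * cnj (X0 w) - T3 w)"
  have mY: "Y \<in> borel_measurable M" unfolding Y_def by measurable
  have b2: "norm (Y w) \<le> ((200 * c ^ 4 * exp (4 * c) + 4 * c^2 * exp (2 * c)) * \<tau> ^ 4) * exp ((4 + 4 * c) * G w)" for w
  proof -
    have "Y w = (C w - X0 w - T3 w) * cnj (X0 w) + T3 w * cnj (X0 w - 1)" by (simp add: Y_def algebra_simps)
    then have "cmod (Y w) \<le> cmod (C w - X0 w - T3 w) * cmod (X0 w) + cmod (T3 w) * cmod (X0 w - 1)"
      using norm_triangle_ineq[of "(C w - X0 w - T3 w) * cnj (X0 w)" "T3 w * cnj (X0 w - 1)"]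
      by (simp only: norm_mult complex_mod_cnj)
    also have "... \<le> (200 * c ^ 4 * exp (2 * c) * \<tau> ^ 4 * exp ((4 + 2 * c) * G w)) * (exp (2 * c) * exp (2 * c * G w))
       + (2 * c * \<tau> ^ 3 * exp (3 * G w)) * (2 * c * \<tau> * exp (2 * c) * exp ((1 + 2 * c) * G w))"
      using c0 \<tau>0 by (intro add_mono mult_mono rem' bX0 bT bX1) auto
    also have "... = 200 * c ^ 4 * exp (4 * c) * \<tau> ^ 4 * exp ((4 + 4 * c) * G w) + 4 * c^2 * exp (2 * c) * \<tau> ^ 4 * exp ((4 + 2 * c) * G w)"
    proof -
      have "exp ((4 + 4 * c) * G w) = exp ((4 + 2 * c) * G w) * exp (2 * c * G w)" "exp (4 * c) = exp (2 * c) * exp (2 * c)"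
        "exp ((4 + 2 * c) * G w) = exp (3 * G w) * exp ((1 + 2 * c) * G w)"
        unfolding exp_add[symmetric] by (simp_all add: algebra_simps)
      note e = this(1,2) and e3 = this(3)
      have "(2 * c * \<tau> ^ 3 * exp (3 * G w)) * (2 * c * \<tau> * exp (2 * c) * exp ((1 + 2 * c) * G w)) = 4 * c^2 * exp (2 * c) * \<tau> ^ 4 * exp ((4 + 2 * c) * G w)"
        unfolding e3 by (simp add: power2_eq_square power3_eq_cube power4_eq_xxxx)
      then show ?thesis unfolding e by simp
    qed
    also have "... \<le> 200 * c ^ 4 * exp (4 * c) * \<tau> ^ 4 * exp ((4 + 4 * c) * G w) + 4 * c^2 * exp (2 * c) * \<tau> ^ 4 * exp ((4 + 4 * c) * G w)"
      using c0 \<tau>0 by (intro add_left_mono mult_left_mono) (auto intro!: mult_right_mono)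
    finally show ?thesis by (simp add: algebra_simps)
  qed
  have iY: "integrable M Y" and nY: "norm (\<integral>w. Y w \<partial>M) \<le> ((200 * c ^ 4 * exp (4 * c) + 4 * c^2 * exp (2 * c)) * \<tau> ^ 4) * (4 * exp (2 * (4 + 4 * c)^2))"
    using integrable_exp_G_bound[OF mY b2] c0 by auto
  have "(\<integral>w. (C w - X0 w) * cnj (X0 w) \<partial>M) = (\<integral>w. Y w + T3 w \<partial>M)" by (simp add: Y_def)
  also have "... = (\<integral>w. Y w \<partial>M)" using iY T3int by (simp add: has_bochner_integral_iff)
  finally have "cmod (\<integral>w. (C w - X0 w) * cnj (X0 w) \<partial>M) \<le> A2 * \<tau> ^ 4" using nY by (simp add: A2_def mult_ac)
  also have "... \<le> local_constant c * \<tau> ^ 4" using lc \<tau>0 by (intro mult_right_mono) auto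
  finally show "cmod (\<integral>w. (C w - X0 w) * cnj (X0 w) \<partial>M) \<le> local_constant c * \<tau> ^ 4" .
qed

text \<open>The squared modulus is the exponential of a real linear form in the increments, so its
  mean is known exactly. Of the constant 10, the part 8 comes from the exponential moment, where the
  variance of \<open>a * U + b * V\<close> is at most \<open>4 * k\<close>, and 2 from the squares
  of the shift in the two variables.\<close>

lemma (in gauss_pair) exact_step_stability:
  fixes k x y \<alpha> \<mu>x \<mu>y \<rho>x \<rho>y r :: real
  assumes k: "0 \<le> k" and \<alpha>: "0 \<le> \<alpha>" "\<alpha> \<le> 1" and rx: "0 \<le> \<rho>x" "\<rho>x \<le> r" and ry: "0 \<le> \<rho>y" "\<rho>y \<le> r" and r: "r \<le> 1"
  defines "F \<equiv> \<lambda>w. (cmod (exact_step k \<mu>x \<mu>y \<rho>x \<rho>y (Complex x \<alpha>) (Complex y \<alpha>) (U w) (V w)))^2"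
  shows "integrable M F" and "(\<integral>w. F w \<partial>M) \<le> exp (- (1 - r) * (k * (x^2 + y^2)) + (10 + 2 * \<bar>\<mu>x\<bar> + 2 * \<bar>\<mu>y\<bar>) * k)"
proof -
  define a b where "a = sqrt (k * \<rho>x)" and "b = sqrt (k * \<rho>y)"
  define e where "e = 2 * k * (\<alpha> * (\<mu>x + \<mu>y)) - k * ((1 - \<rho>x) * (x^2 - \<alpha>^2) + (1 - \<rho>y) * (y^2 - \<alpha>^2))"
  have Feq: "F w = exp e * exp ((2 * \<alpha>) * (a * U w + b * V w))" for w
  proof -
    define z where "z = - \<i> * (of_real (sqrt (k * \<rho>x)) * Complex x \<alpha> * U w + of_real (sqrt (k * \<rho>y)) * Complex y \<alpha> * V w)
     - of_real k * (\<i> * (\<mu>x * Complex x \<alpha> + \<mu>y * Complex y \<alpha>) + ((1 - \<rho>x) * (Complex x \<alpha>)^2 + (1 - \<rho>y) * (Complex y \<alpha>)^2) / 2)"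
    have sq: "Re ((Complex u \<alpha>)^2) = u^2 - \<alpha>^2" for u by (simp add: power2_eq_square)
    have "Re z = \<alpha> * (a * U w + b * V w) + e / 2"
      unfolding z_def e_def a_def b_def by (simp add: sq algebra_simps add_divide_distrib diff_divide_distrib)
    moreover have "exact_step k \<mu>x \<mu>y \<rho>x \<rho>y (Complex x \<alpha>) (Complex y \<alpha>) (U w) (V w) = exp z"
      unfolding exact_step_def z_def by (simp add: algebra_simps)
    then have "F w = exp (2 * Re z)" unfolding F_def by (simp add: exp_double)
    ultimately show ?thesis by (simp add: exp_add[symmetric] algebra_simps)
  qed
  have h: "has_bochner_integral M F (exp e * exp ((2 * \<alpha>)^2 * (a^2 + 2 * \<rho> * a * b + b^2) / 2))"
    unfolding Feq[abs_def] by (rule has_bochner_integral_mult_right) (rule lin_moments(5))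
  then show "integrable M F" by (simp add: has_bochner_integral_iff)
  have a2: "a^2 = k * \<rho>x" "b^2 = k * \<rho>y" using k rx ry by (simp_all add: a_def b_def)
  have v: "a^2 + 2 * \<rho> * a * b + b^2 \<le> 4 * k"
  proof -
    have ab0: "0 \<le> a" "0 \<le> b" using k rx ry by (simp_all add: a_def b_def)
    have "\<rho> * (2 * (a * b)) \<le> 1 * (2 * (a * b))" using abs_rho ab0 by (intro mult_right_mono) auto
    moreover have "2 * (a * b) \<le> a^2 + b^2" using sum_squares_bound[of a b] by simp
    moreover have "a^2 \<le> k" "b^2 \<le> k" unfolding a2 using k rx ry r by (auto intro!: mult_left_le)
    moreover have "a^2 + 2 * \<rho> * a * b + b^2 = a^2 + \<rho> * (2 * (a * b)) + b^2" by simp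
    ultimately show ?thesis by argo
  qed
  have \<alpha>2: "\<alpha>^2 \<le> 1" using \<alpha> by (simp add: power_le_one)
  have "(\<integral>w. F w \<partial>M) = exp (e + (2 * \<alpha>)^2 * (a^2 + 2 * \<rho> * a * b + b^2) / 2)"
    using h by (simp add: has_bochner_integral_iff exp_add)
  also have "... \<le> exp (- (1 - r) * (k * (x^2 + y^2)) + (10 + 2 * \<bar>\<mu>x\<bar> + 2 * \<bar>\<mu>y\<bar>) * k)"
  proof -
    have 1: "(2 * \<alpha>)^2 * (a^2 + 2 * \<rho> * a * b + b^2) / 2 \<le> 8 * k"
    proof -
      have "(2 * \<alpha>)^2 * (a^2 + 2 * \<rho> * a * b + b^2) \<le> 4 * (4 * k)"
        using \<alpha>2 v lin_var_nonneg[of a b] by (intro mult_mono) (auto simp: power_mult_distrib)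
      then show ?thesis by simp
    qed
    have 2: "2 * k * (\<alpha> * (\<mu>x + \<mu>y)) \<le> (2 * \<bar>\<mu>x\<bar> + 2 * \<bar>\<mu>y\<bar>) * k"
    proof -
      have "\<alpha> * (\<mu>x + \<mu>y) \<le> \<alpha> * (\<bar>\<mu>x\<bar> + \<bar>\<mu>y\<bar>)" using \<alpha> by (intro mult_left_mono) auto
      also have "... \<le> 1 * (\<bar>\<mu>x\<bar> + \<bar>\<mu>y\<bar>)" using \<alpha> by (intro mult_right_mono) auto
      finally have "2 * k * (\<alpha> * (\<mu>x + \<mu>y)) \<le> 2 * k * (\<bar>\<mu>x\<bar> + \<bar>\<mu>y\<bar>)" using k by (intro mult_left_mono) auto
      then show ?thesis by (simp add: algebra_simps)
    qed
    have 3: "(1 - r) * x^2 - 1 \<le> (1 - q) * (x^2 - \<alpha>^2)" if "0 \<le> q" "q \<le> r" for q x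
    proof -
      have "(1 - r) * x^2 \<le> (1 - q) * x^2" using that by (intro mult_right_mono) auto
      moreover have "(1 - q) * \<alpha>^2 \<le> 1 * 1" using that r \<alpha>2 by (intro mult_mono) auto
      ultimately show ?thesis by (simp add: right_diff_distrib)
    qed
    have "k * ((1 - \<rho>x) * (x^2 - \<alpha>^2) + (1 - \<rho>y) * (y^2 - \<alpha>^2)) \<ge> k * (((1 - r) * x^2 - 1) + ((1 - r) * y^2 - 1))"
      using 3[OF rx] 3[OF ry] k by (intro mult_left_mono add_mono) auto
    moreover have "k * (((1 - r) * x^2 - 1) + ((1 - r) * y^2 - 1)) = (1 - r) * (k * (x^2 + y^2)) - 2 * k" by (simp add: algebra_simps)
    moreover have "(10 + 2 * \<bar>\<mu>x\<bar> + 2 * \<bar>\<mu>y\<bar>) * k = 10 * k + (2 * \<bar>\<mu>x\<bar> + 2 * \<bar>\<mu>y\<bar>) * k" by (simp add: algebra_simps)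
    ultimately show ?thesis using 1 2 unfolding e_def exp_le_cancel_iff by argo
  qed
  finally show "(\<integral>w. F w \<partial>M) \<le> exp (- (1 - r) * (k * (x^2 + y^2)) + (10 + 2 * \<bar>\<mu>x\<bar> + 2 * \<bar>\<mu>y\<bar>) * k)" .
qed

section \<open>Multilevel Monte Carlo\<close>

text \<open>Decomposition into variance and squared bias. Independence removes the mixed terms of
  the centred variables, and each variance is estimated by the second moment bound
  \<open>v\<close>.\<close>

lemma (in prob_space) weighted_sum_mean_square_error:
  fixes X :: "'i \<Rightarrow> 'a \<Rightarrow> real"
  assumes ind: "indep_vars (\<lambda>_. borel) X I" and fin: "finite I"
    and i2: "\<And>i. i \<in> I \<Longrightarrow> integrable M (\<lambda>w. (X i w)^2)" and v: "\<And>i. i \<in> I \<Longrightarrow> (\<integral>w. (X i w)^2 \<partial>M) \<le> v i"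
  shows "integrable M (\<lambda>w. ((\<Sum>i\<in>I. c i * X i w) - b)^2)"
    and "(\<integral>w. ((\<Sum>i\<in>I. c i * X i w) - b)^2 \<partial>M) \<le> (\<Sum>i\<in>I. (c i)^2 * v i) + ((\<Sum>i\<in>I. c i * expectation (X i)) - b)^2"
proof -
  have m: "X i \<in> borel_measurable M" if "i \<in> I" for i using ind that by (auto simp: indep_vars_def)
  have i1: "integrable M (X i)" if "i \<in> I" for i using square_integrable_imp_integrable[OF m[OF that] i2[OF that]] .
  define Y where "Y = (\<lambda>i w. X i w - expectation (X i))"
  define d where "d = (\<Sum>i\<in>I. c i * expectation (X i)) - b"
  have iY: "integrable M (Y i)" and EY: "expectation (Y i) = 0" if "i \<in> I" for i
    using i1[OF that] by (simp_all add: Y_def prob_space)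
  have indY: "indep_vars (\<lambda>_. borel) Y I"
    unfolding Y_def by (rule indep_vars_compose2[OF ind]) auto
  have Y2: "integrable M (\<lambda>w. (Y i w)^2)" "(\<integral>w. (Y i w)^2 \<partial>M) \<le> v i" if "i \<in> I" for i
  proof -
    have eq: "(Y i w)^2 = (X i w)^2 - 2 * expectation (X i) * X i w + (expectation (X i))^2" for w
      by (simp add: Y_def power2_eq_square algebra_simps)
    show "integrable M (\<lambda>w. (Y i w)^2)" unfolding eq using i1[OF that] i2[OF that] by simp
    have "(\<integral>w. (Y i w)^2 \<partial>M) = (\<integral>w. (X i w)^2 \<partial>M) - (expectation (X i))\<^sup>2"
      unfolding eq using i1[OF that] i2[OF that] by (simp add: prob_space power2_eq_square)
    then show "(\<integral>w. (Y i w)^2 \<partial>M) \<le> v i" using v[OF that] zero_le_power2[of "expectation (X i)"] by linarith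
  qed
  have YY: "integrable M (\<lambda>w. Y i w * Y j w) \<and> (\<integral>w. Y i w * Y j w \<partial>M) = (if i = j then (\<integral>w. (Y i w)^2 \<partial>M) else 0)"
    if "i \<in> I" "j \<in> I" for i j
  proof (cases "i = j")
    case True then show ?thesis using Y2[OF that(1)] by (simp add: power2_eq_square)
  next
    case False
    have ij: "indep_vars (\<lambda>_. borel) Y {i, j}" by (rule indep_vars_subset[OF indY]) (use that in auto)
    have "integrable M (\<lambda>w. \<Prod>l\<in>{i, j}. Y l w)" by (rule indep_vars_integrable[OF _ ij]) (use iY that in auto)
    moreover have "(\<integral>w. (\<Prod>l\<in>{i, j}. Y l w) \<partial>M) = (\<Prod>l\<in>{i, j}. \<integral>w. Y l w \<partial>M)"
      by (rule indep_vars_lebesgue_integral[OF _ ij]) (use iY that in auto)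
    ultimately show ?thesis using False EY[OF that(1)] by simp
  qed
  have eq: "((\<Sum>i\<in>I. c i * X i w) - b)^2
      = (\<Sum>i\<in>I. \<Sum>j\<in>I. c i * c j * (Y i w * Y j w)) + (2 * d * (\<Sum>i\<in>I. c i * Y i w) + d^2)" for w
  proof -
    have "(\<Sum>i\<in>I. c i * X i w) - b = (\<Sum>i\<in>I. c i * Y i w) + d"
      by (simp add: Y_def d_def right_diff_distrib sum_subtractf)
    moreover have "(\<Sum>i\<in>I. c i * Y i w)^2 = (\<Sum>i\<in>I. \<Sum>j\<in>I. c i * c j * (Y i w * Y j w))"
      unfolding power2_eq_square sum_product by (intro sum.cong refl) (simp only: mult_ac)
    ultimately show ?thesis by (simp add: power2_sum)
  qed
  have I1: "integrable M (\<lambda>w. \<Sum>i\<in>I. \<Sum>j\<in>I. c i * c j * (Y i w * Y j w))" using YY by auto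
  have I2: "integrable M (\<lambda>w. 2 * d * (\<Sum>i\<in>I. c i * Y i w) + d^2)" using iY by auto
  show "integrable M (\<lambda>w. ((\<Sum>i\<in>I. c i * X i w) - b)^2)" unfolding eq using I1 I2 by simp
  have "(\<integral>w. (\<Sum>i\<in>I. \<Sum>j\<in>I. c i * c j * (Y i w * Y j w)) \<partial>M)
      = (\<Sum>i\<in>I. \<Sum>j\<in>I. c i * c j * (\<integral>w. Y i w * Y j w \<partial>M))"
    by (simp add: Bochner_Integration.integral_sum YY[THEN conjunct1])
  also have "... = (\<Sum>i\<in>I. (c i)^2 * (\<integral>w. (Y i w)^2 \<partial>M))"
  proof (rule sum.cong[OF refl])
    fix i assume i: "i \<in> I"
    have "(\<Sum>j\<in>I. c i * c j * (\<integral>w. Y i w * Y j w \<partial>M)) = (\<Sum>j\<in>I. if i = j then (c i)^2 * (\<integral>w. (Y i w)^2 \<partial>M) else 0)"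
      by (rule sum.cong[OF refl]) (simp add: YY[THEN conjunct2] i power2_eq_square[of "c _"])
    also have "... = (c i)^2 * (\<integral>w. (Y i w)^2 \<partial>M)" using i fin by simp
    finally show "(\<Sum>j\<in>I. c i * c j * (\<integral>w. Y i w * Y j w \<partial>M)) = (c i)^2 * (\<integral>w. (Y i w)^2 \<partial>M)" .
  qed
  also have "... \<le> (\<Sum>i\<in>I. (c i)^2 * v i)" by (intro sum_mono mult_left_mono Y2) auto
  finally have "(\<integral>w. (\<Sum>i\<in>I. \<Sum>j\<in>I. c i * c j * (Y i w * Y j w)) \<partial>M) \<le> (\<Sum>i\<in>I. (c i)^2 * v i)" .
  moreover have "(\<integral>w. 2 * d * (\<Sum>i\<in>I. c i * Y i w) + d^2 \<partial>M) = d^2" using iY EY by (simp add: prob_space)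
  ultimately show "(\<integral>w. ((\<Sum>i\<in>I. c i * X i w) - b)^2 \<partial>M) \<le> (\<Sum>i\<in>I. (c i)^2 * v i) + ((\<Sum>i\<in>I. c i * expectation (X i)) - b)^2"
    unfolding eq Bochner_Integration.integral_add[OF I1 I2] d_def[symmetric] by linarith
qed

lemma sample_indices_Sigma: "sample_indices L Ms = (SIGMA l:{..L}. {1..Ms l})"
  by (auto simp: sample_indices_def)

text \<open>The samples live on another space than the Brownian path; equality of laws carries their
  moments over to \<open>D\<close> on \<open>N\<close>. The expectations of the level differences
  appear as a sum that is ready to telescope.\<close>

lemma (in prob_space) mlmc_mean_square_error:
  fixes X :: "nat \<Rightarrow> nat \<Rightarrow> 'a \<Rightarrow> real" and D :: "nat \<Rightarrow> 'b \<Rightarrow> real"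
  assumes ind: "indep_vars (\<lambda>_. borel) (\<lambda>(l, m). X l m) (sample_indices L Ms)"
    and dist: "\<forall>(l, m) \<in> sample_indices L Ms. distr M borel (X l m) = distr N borel (D l)"
    and D: "\<And>l. D l \<in> borel_measurable N" and D2: "\<And>l. integrable N (\<lambda>w. (D l w)^2)" "\<And>l. (\<integral>w. (D l w)^2 \<partial>N) \<le> v l"
    and Ms: "\<And>l. l \<le> L \<Longrightarrow> 0 < Ms l"
  shows "integrable M (\<lambda>w. (mlmc_estimator L Ms X w - b)^2)"
    and "(\<integral>w. (mlmc_estimator L Ms X w - b)^2 \<partial>M) \<le> (\<Sum>l\<le>L. v l / Ms l) + ((\<Sum>l\<le>L. \<integral>w. D l w \<partial>N) - b)^2"
proof -
  let ?I = "sample_indices L Ms" and ?X = "\<lambda>(l, m). X l m"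
  define c where "c = (\<lambda>(l, m :: nat). 1 / real (Ms l))"
  have fin: "finite ?I" by (simp add: sample_indices_Sigma)
  have mX: "?X p \<in> borel_measurable M" if "p \<in> ?I" for p using ind that by (auto simp: indep_vars_def)
  have tr: "distr M borel (?X p) = distr N borel (D (fst p))" if "p \<in> ?I" for p using dist that by (cases p) auto
  have tI: "integrable M (\<lambda>w. f (?X p w)) \<longleftrightarrow> integrable N (\<lambda>w. f (D (fst p) w))"
    and tE: "(\<integral>w. f (?X p w) \<partial>M) = (\<integral>w. f (D (fst p) w) \<partial>N)"
    if "p \<in> ?I" and [measurable]: "f \<in> borel_measurable borel" for p and f :: "real \<Rightarrow> real"
  proof -
    show "integrable M (\<lambda>w. f (?X p w)) \<longleftrightarrow> integrable N (\<lambda>w. f (D (fst p) w))"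
      by (subst integrable_distr_eq[OF mX[OF that(1)] that(2), symmetric], subst integrable_distr_eq[OF D that(2), symmetric])
        (simp only: tr[OF that(1)])
    show "(\<integral>w. f (?X p w) \<partial>M) = (\<integral>w. f (D (fst p) w) \<partial>N)"
      by (subst integral_distr[OF mX[OF that(1)] that(2), symmetric], subst integral_distr[OF D that(2), symmetric])
        (simp only: tr[OF that(1)])
  qed
  have i2: "integrable M (\<lambda>w. (?X p w)^2)" and v: "(\<integral>w. (?X p w)^2 \<partial>M) \<le> v (fst p)" if "p \<in> ?I" for p
    using tI[OF that, of "\<lambda>x. x^2"] tE[OF that, of "\<lambda>x. x^2"] D2[of "fst p"] by simp_all
  have sum1: "(\<Sum>p\<in>?I. c p * f p) = (\<Sum>l\<le>L. 1 / real (Ms l) * (\<Sum>m = 1..Ms l. f (l, m)))" for f :: "nat \<times> nat \<Rightarrow> real"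
  proof -
    have "(\<Sum>l\<le>L. \<Sum>m = 1..Ms l. c (l, m) * f (l, m)) = (\<Sum>(l, m)\<in>(SIGMA l:{..L}. {1..Ms l}). c (l, m) * f (l, m))"
      by (rule sum.Sigma) auto
    then show ?thesis unfolding sample_indices_Sigma by (simp add: c_def sum_distrib_left case_prod_unfold)
  qed
  have est: "mlmc_estimator L Ms X w = (\<Sum>p\<in>?I. c p * ?X p w)" for w
    unfolding sum1 by (simp add: mlmc_estimator_def)
  note W = weighted_sum_mean_square_error[OF ind fin i2 v, of c b]
  show "integrable M (\<lambda>w. (mlmc_estimator L Ms X w - b)^2)" unfolding est by (rule W(1))
  have "(\<Sum>p\<in>?I. (c p)^2 * v (fst p)) = (\<Sum>p\<in>?I. c p * (c p * v (fst p)))" by (simp add: power2_eq_square mult.assoc)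
  also have "... = (\<Sum>l\<le>L. v l / Ms l)"
    unfolding sum1 by (rule sum.cong[OF refl]) (use Ms in \<open>auto simp: c_def\<close>)
  finally have A: "(\<Sum>p\<in>?I. (c p)^2 * v (fst p)) = (\<Sum>l\<le>L. v l / Ms l)" .
  have "(\<Sum>p\<in>?I. c p * expectation (?X p)) = (\<Sum>p\<in>?I. c p * (\<integral>w. D (fst p) w \<partial>N))"
    by (rule sum.cong[OF refl]) (use tE[of _ "\<lambda>x. x"] in simp)
  also have "... = (\<Sum>l\<le>L. \<integral>w. D l w \<partial>N)"
    unfolding sum1 by (rule sum.cong[OF refl]) (use Ms in auto)
  finally show "(\<integral>w. (mlmc_estimator L Ms X w - b)^2 \<partial>M) \<le> (\<Sum>l\<le>L. v l / Ms l) + ((\<Sum>l\<le>L. \<integral>w. D l w \<partial>N) - b)^2"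
    using W(2) unfolding est A by metis
qed

section \<open>Cost of a level and choice of the parameters\<close>

lemma square_le_geometric: "(real l + 2)^2 * 8 ^ l \<le> 4096 * 9 ^ l"
proof -
  \<comment> \<open>By Bernoulli's inequality growth by \<open>1 + 1 / 32\<close> per level
    dominates the linear factor, and it is slow enough for its square to stay below
    \<open>9 / 8\<close>.\<close>
  have "(real l + 2) / 64 \<le> 1 + real l * (1 / 32)" by simp
  also have "... \<le> (1 + 1 / 32) ^ l" by (rule Bernoulli_inequality) simp
  finally have "((real l + 2) / 64)^2 \<le> ((33 / 32) ^ l)^2" by (intro power_mono) auto
  also have "... = ((33 / 32)^2) ^ l" by (simp only: power_mult[symmetric] mult.commute)
  also have "... \<le> (9 / 8) ^ l" by (intro power_mono) (auto simp: power2_eq_square)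
  finally have "(real l + 2)^2 \<le> 4096 * (9 / 8) ^ l" by (simp add: power_divide mult_ac)
  then have "(real l + 2)^2 * 8 ^ l \<le> 4096 * (9 / 8) ^ l * 8 ^ l" by (intro mult_right_mono) auto
  then show ?thesis by (simp add: power_divide mult_ac)
qed

lemma num_steps_eq:
  assumes "T / k0 = real n0" shows "num_steps T k0 l = n0 * 4 ^ l"
proof -
  have "T / (k0 / 2 ^ (2 * l)) = real_of_int (int (n0 * 4 ^ l))" using assms by (simp add: power_mult divide_simps)
  then show ?thesis unfolding num_steps_def by (metis floor_of_int nat_int)
qed

text \<open>At most \<open>(l + 2)^2\<close> index pairs cost at most
  \<open>\<kappa> * 2 ^ (l + 1)\<close> times \<open>n0 * 4 ^ l\<close> each. In
  \<open>16384 = 2 * 2 * 4096\<close> one factor 2 is that of \<open>2 ^ (l + 1)\<close>, the other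
  pays for the coarser level of the difference.\<close>

lemma level_cost_le:
  assumes n0: "T / k0 = real n0" and \<kappa>: "\<kappa> > 0"
  shows "level_cost \<kappa> T k0 l \<le> 16384 * \<kappa> * real n0 * 9 ^ l"
proof -
  have sc: "0 \<le> sparse_cost \<kappa> (num_steps T k0 l) l \<and> sparse_cost \<kappa> (num_steps T k0 l) l \<le> 8192 * \<kappa> * real n0 * 9 ^ l" for l
  proof
    have sub: "sparse_indices l \<subseteq> {..l + 1} \<times> {..l + 1}" by (auto simp: sparse_indices_def)
    show "0 \<le> sparse_cost \<kappa> (num_steps T k0 l) l" unfolding sparse_cost_def using \<kappa> by (intro sum_nonneg) auto
    have "sparse_cost \<kappa> (num_steps T k0 l) l \<le> (\<Sum>p\<in>sparse_indices l. \<kappa> * 2 ^ (l + 1) * real (n0 * 4 ^ l))"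
      unfolding sparse_cost_def num_steps_eq[OF n0]
    proof (rule sum_mono, clarify)
      fix a b assume "(a, b) \<in> sparse_indices l"
      then have "(2 :: real) ^ (a + b) \<le> 2 ^ (l + 1)" by (intro power_increasing) (auto simp: sparse_indices_def)
      then show "\<kappa> * 2 ^ (a + b) * real (n0 * 4 ^ l) \<le> \<kappa> * 2 ^ (l + 1) * real (n0 * 4 ^ l)"
        using \<kappa> by (intro mult_right_mono mult_left_mono) auto
    qed
    also have "... = real (card (sparse_indices l)) * (\<kappa> * 2 ^ (l + 1) * real (n0 * 4 ^ l))" by simp
    also have "... \<le> (real l + 2)^2 * (\<kappa> * 2 ^ (l + 1) * real (n0 * 4 ^ l))"
    proof (rule mult_right_mono)
      have "card (sparse_indices l) \<le> (l + 2) * (l + 2)" using card_mono[OF _ sub] by simp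
      then have "real (card (sparse_indices l)) \<le> real ((l + 2) * (l + 2))" by (rule of_nat_mono)
      then show "real (card (sparse_indices l)) \<le> (real l + 2)^2" by (simp add: power2_eq_square algebra_simps)
    qed (use \<kappa> in simp)
    also have "... = (2 * \<kappa> * real n0) * ((real l + 2)^2 * 8 ^ l)"
      using power_mult_distrib[of "2 :: real" 4 l] by (simp add: mult_ac)
    also have "... \<le> (2 * \<kappa> * real n0) * (4096 * 9 ^ l)"
      by (rule mult_left_mono[OF square_le_geometric]) (use \<kappa> in simp)
    finally show "sparse_cost \<kappa> (num_steps T k0 l) l \<le> 8192 * \<kappa> * real n0 * 9 ^ l" by simp
  qed
  show ?thesis
  proof (cases l)
    case 0
    then show ?thesis using sc[of 0] by (simp add: level_cost_def)
  next
    case (Suc m)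
    have "8192 * \<kappa> * real n0 * 9 ^ m \<le> 8192 * \<kappa> * real n0 * 9 ^ l"
      using \<kappa> Suc by (intro mult_left_mono) auto
    then show ?thesis using sc[of l] sc[of m] Suc by (simp add: level_cost_def)
  qed
qed

text \<open>The sample numbers decay like \<open>1 / 11 ^ l\<close>. As 11 lies between the growth 9
  of the cost and the rate 14 of the second moments, the variance sum with ratio
  \<open>11 / 14\<close> and the cost sum with ratio \<open>9 / 11\<close> are both geometric, and
  no logarithm appears.\<close>

lemma mlmc_parameters:
  fixes K c Kc :: real
  assumes K: "K > 0" and Kc: "\<And>l. level_cost \<kappa> T k0 l \<le> Kc * 9 ^ l" and Kc0: "0 \<le> Kc"
  obtains C where "\<And>\<epsilon>. 0 < \<epsilon> \<Longrightarrow> \<epsilon> < 1 \<Longrightarrow> \<exists>L Ms. (\<forall>l. 0 < Ms l) \<and> K / 14 ^ L \<le> \<epsilon>^2 / 2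
     \<and> (\<Sum>l\<le>L. (K / 14 ^ l) / Ms l) \<le> \<epsilon>^2 / 2 \<and> total_cost \<kappa> T k0 L Ms \<le> C * \<epsilon> powr (-2)"
proof
  fix \<epsilon> :: real assume e: "0 < \<epsilon>" "\<epsilon> < 1"
  have e2: "0 < \<epsilon>^2" "\<epsilon>^2 < 1" using e by (auto simp: power_less_one_iff abs_less_iff)
  have pw: "\<epsilon> powr (-2) = 1 / \<epsilon>^2" using e by (simp add: powr_minus powr_realpow[of \<epsilon> 2, simplified] divide_inverse)
  obtain n0 where "2 * K / \<epsilon>^2 < 14 ^ n0" using real_arch_pow[of 14] by auto
  then have ex: "2 * K / \<epsilon>^2 \<le> 14 ^ n0" by simp
  define L where "L = (LEAST n. 2 * K / \<epsilon>^2 \<le> 14 ^ n)"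
  have L1: "2 * K / \<epsilon>^2 \<le> 14 ^ L" unfolding L_def by (rule LeastI[of _ n0]) (rule ex)
  \<comment> \<open>Minimality of \<open>L\<close>; the summand 1 covers \<open>L = 0\<close>. This
    bounds the cost of rounding the sample numbers up, which is of order \<open>9 ^ l\<close> on
    level \<open>l\<close> and hence of order \<open>14 ^ L\<close> at most in total.\<close>
  have L2: "14 ^ L \<le> (1 + 28 * K) / \<epsilon>^2"
  proof (cases L)
    case 0 then show ?thesis using e2 K by (simp add: field_simps)
  next
    case (Suc m)
    have "\<not> 2 * K / \<epsilon>^2 \<le> 14 ^ m" by (rule not_less_Least[of m]) (simp add: L_def[symmetric] Suc)
    then have "14 ^ L \<le> 14 * (2 * K / \<epsilon>^2)" using Suc by simp
    also have "... \<le> (1 + 28 * K) / \<epsilon>^2" using e2 by (simp add: divide_right_mono)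
    finally show ?thesis .
  qed
  \<comment> \<open>The factor 10 makes the variance sum at most
    \<open>\<epsilon>^2 / 10 * (14 / 3)\<close>, which is below
    \<open>\<epsilon>^2 / 2\<close>.\<close>
  define Ms where "Ms = (\<lambda>l. nat \<lceil>10 * K / \<epsilon>^2 / 11 ^ l\<rceil>)"
  have mpos: "0 < 10 * K / \<epsilon>^2 / 11 ^ l" for l using K e2 by simp
  have Ms0: "0 < Ms l" for l using mpos[of l] by (simp add: Ms_def)
  have Ms1: "10 * K / \<epsilon>^2 / 11 ^ l \<le> real (Ms l)" for l unfolding Ms_def by (rule real_nat_ceiling_ge)
  have Ms2: "real (Ms l) \<le> 10 * K / \<epsilon>^2 / 11 ^ l + 1" for l using mpos[of l] unfolding Ms_def by linarith
  have g1: "(\<Sum>l\<le>L. (11 / 14 :: real) ^ l) \<le> 14 / 3"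
    by (subst sum_gp0) simp
  have g2: "(\<Sum>l\<le>L. (9 / 11 :: real) ^ l) \<le> 11 / 2"
    by (subst sum_gp0) simp
  have g3: "(\<Sum>l\<le>L. (9 :: real) ^ l) \<le> 2 * 14 ^ L"
  proof -
    have "(\<Sum>l\<le>L. (9 :: real) ^ l) = (9 * 9 ^ L - 1) / 8" by (subst sum_gp0) (simp add: field_simps)
    also have "... \<le> 2 * 9 ^ L" using zero_le_power[of "9 :: real" L] by (simp add: field_simps)
    also have "... \<le> 2 * 14 ^ L" by (simp add: power_mono)
    finally show ?thesis .
  qed
  have "(\<Sum>l\<le>L. (K / 14 ^ l) / Ms l) \<le> (\<Sum>l\<le>L. \<epsilon>^2 / 10 * (11 / 14) ^ l)"
  proof (rule sum_mono)
    fix l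
    have "(K / 14 ^ l) / Ms l \<le> (K / 14 ^ l) / (10 * K / \<epsilon>^2 / 11 ^ l)"
      by (rule divide_left_mono[OF Ms1]) (use mpos[of l] K Ms0[of l] in \<open>simp_all only: zero_less_mult_iff of_nat_0_less_iff, auto\<close>)
    also have "... = \<epsilon>^2 / 10 * (11 / 14) ^ l" using K by (simp add: power_divide)
    finally show "(K / 14 ^ l) / Ms l \<le> \<epsilon>^2 / 10 * (11 / 14) ^ l" .
  qed
  also have "... = \<epsilon>^2 / 10 * (\<Sum>l\<le>L. (11 / 14) ^ l)" by (rule sum_distrib_left[symmetric])
  also have "... \<le> \<epsilon>^2 / 10 * (14 / 3)" by (rule mult_left_mono[OF g1]) simp
  also have "... \<le> \<epsilon>^2 / 2" by simp
  finally have V: "(\<Sum>l\<le>L. (K / 14 ^ l) / Ms l) \<le> \<epsilon>^2 / 2" .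
  have "total_cost \<kappa> T k0 L Ms \<le> (\<Sum>l\<le>L. (10 * K / \<epsilon>^2 / 11 ^ l + 1) * (Kc * 9 ^ l))"
    unfolding total_cost_def
  proof (rule sum_mono)
    fix l
    have "real (Ms l) * level_cost \<kappa> T k0 l \<le> real (Ms l) * (Kc * 9 ^ l)" by (rule mult_left_mono[OF Kc]) simp
    also have "... \<le> (10 * K / \<epsilon>^2 / 11 ^ l + 1) * (Kc * 9 ^ l)" using Kc0 by (intro mult_right_mono Ms2) simp
    finally show "real (Ms l) * level_cost \<kappa> T k0 l \<le> (10 * K / \<epsilon>^2 / 11 ^ l + 1) * (Kc * 9 ^ l)" .
  qed
  also have "... = Kc * (10 * K / \<epsilon>^2) * (\<Sum>l\<le>L. (9 / 11) ^ l) + Kc * (\<Sum>l\<le>L. 9 ^ l)"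
    unfolding sum_distrib_left sum.distrib[symmetric] by (rule sum.cong) (auto simp: power_divide field_simps)
  also have "... \<le> Kc * (10 * K / \<epsilon>^2) * (11 / 2) + Kc * (2 * 14 ^ L)"
    using Kc0 K e2 by (intro add_mono mult_left_mono g2 g3) auto
  also have "... \<le> Kc * (10 * K / \<epsilon>^2) * (11 / 2) + Kc * (2 * ((1 + 28 * K) / \<epsilon>^2))"
    using Kc0 L2 by (intro add_left_mono mult_left_mono) auto
  also have "... = (Kc * (2 + 111 * K)) * \<epsilon> powr (-2)" unfolding pw using e2 by (simp add: field_simps)
  finally have C: "total_cost \<kappa> T k0 L Ms \<le> (Kc * (2 + 111 * K)) * \<epsilon> powr (-2)" .
  have "K / 14 ^ L \<le> \<epsilon>^2 / 2" using L1 e2 by (simp add: field_simps)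
  then show "\<exists>L Ms. (\<forall>l. 0 < Ms l) \<and> K / 14 ^ L \<le> \<epsilon>^2 / 2
     \<and> (\<Sum>l\<le>L. (K / 14 ^ l) / Ms l) \<le> \<epsilon>^2 / 2 \<and> total_cost \<kappa> T k0 L Ms \<le> (Kc * (2 + 111 * K)) * \<epsilon> powr (-2)"
    using V C Ms0 by blast
qed

text \<open>The rates 14 and 9, in place of 16 and 8, absorb polynomial factors in \<open>l\<close>.\<close>

lemma (in prob_space) mlmc_complexity:
  fixes Y :: "nat \<Rightarrow> 'a \<Rightarrow> real" and P :: "'a \<Rightarrow> real"
  assumes mY: "\<And>l. Y l \<in> borel_measurable M" and mP: "P \<in> borel_measurable M" and P2: "integrable M (\<lambda>w. (P w)^2)"
    and YP: "\<And>l. integrable M (\<lambda>w. (Y l w - P w)^2)" "\<And>l. (\<integral>w. (Y l w - P w)^2 \<partial>M) \<le> K / 14 ^ l"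
    and n0: "T / k0 = real n0" and \<kappa>: "\<kappa> > 0"
  defines "D \<equiv> \<lambda>l w. Y l w - (if l = 0 then 0 else Y (l - 1) w)"
  shows "\<exists>C \<epsilon>0. \<epsilon>0 > 0 \<and> (\<forall>\<epsilon>. 0 < \<epsilon> \<and> \<epsilon> < \<epsilon>0 \<longrightarrow>
    (\<exists>L Ms. (\<forall>l\<le>L. Ms l > 0) \<and>
       (\<forall>(\<Omega> :: 'b measure) X.
          prob_space \<Omega> \<and> prob_space.indep_vars \<Omega> (\<lambda>_. borel) (\<lambda>(l, m). X l m) (sample_indices L Ms) \<and>
          (\<forall>(l, m) \<in> sample_indices L Ms. distr \<Omega> borel (X l m) = distr M borel (D l))
          \<longrightarrow> (let EP = (\<integral>w. P w \<partial>M); err = (\<lambda>w. \<bar>mlmc_estimator L Ms X w - EP\<bar>^2)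
           in integrable \<Omega> err \<and> sqrt (\<integral>w. err w \<partial>\<Omega>) \<le> \<epsilon>)) \<and>
       total_cost \<kappa> T k0 L Ms \<le> C * \<epsilon> powr (-2)))"
proof -
  \<comment> \<open>\<open>30 = 2 + 2 * 14\<close>: a level difference is compared with
    \<open>P\<close> on its own level and on the coarser one, whose bound is larger by the factor
    14. The integral of the square of \<open>P\<close> is for level 0, where the coarser
    approximation is 0; the summand 1 makes the constant positive.\<close>
  define K1 where "K1 = 30 * K + 2 * (\<integral>w. (P w)^2 \<partial>M) + 1"
  have P0: "0 \<le> (\<integral>w. (P w)^2 \<partial>M)" by (rule Bochner_Integration.integral_nonneg) simp
  have "0 \<le> (\<integral>w. (Y 0 w - P w)^2 \<partial>M)" by (rule Bochner_Integration.integral_nonneg) simp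
  moreover have "(\<integral>w. (Y 0 w - P w)^2 \<partial>M) \<le> K" using YP(2)[of 0] by simp
  ultimately have K0: "0 \<le> K" by (rule order_trans)
  have K1: "K1 > 0" "K \<le> K1" using K0 P0 unfolding K1_def by linarith+
  have iP: "integrable M P" using square_integrable_imp_integrable[OF mP P2] .
  have Q: "integrable M (\<lambda>w. Y l w - P w)" for l
    by (rule square_integrable_imp_integrable[OF _ YP(1)]) (use mY mP in measurable)
  have iY: "integrable M (Y l)" for l using Bochner_Integration.integrable_add[OF Q[of l] iP] by simp
  have mD[measurable]: "D l \<in> borel_measurable M" for l unfolding D_def using mY by (cases l) auto
  have D2: "integrable M (\<lambda>w. (D l w)^2) \<and> (\<integral>w. (D l w)^2 \<partial>M) \<le> K1 / 14 ^ l" for l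
  proof -
    define R where "R = (\<lambda>w. if l = 0 then (P w)^2 else (Y (l - 1) w - P w)^2)"
    have iR: "integrable M R" unfolding R_def using P2 YP(1) by (cases "l = 0") auto
    have le: "(D l w)^2 \<le> 2 * (Y l w - P w)^2 + 2 * R w" for w
    proof -
      have gen: "(a + b)^2 \<le> 2 * a^2 + 2 * b^2" for a b :: real
        using sum_squares_bound[of a b] by (simp add: power2_sum)
      show ?thesis
      proof (cases "l = 0")
        case True then show ?thesis using gen[of "Y 0 w - P w" "P w"] by (simp add: D_def R_def)
      next
        case False then show ?thesis
          using gen[of "Y l w - P w" "- (Y (l - 1) w - P w)"] by (simp only: D_def R_def if_False power2_minus) simp
      qed
    qed
    have ib: "integrable M (\<lambda>w. 2 * (Y l w - P w)^2 + 2 * R w)" using YP(1) iR by auto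
    have i: "integrable M (\<lambda>w. (D l w)^2)"
      by (rule Bochner_Integration.integrable_bound[OF ib]) (measurable, use le in \<open>auto intro!: AE_I2 order_trans[OF _ abs_ge_self]\<close>)
    have "(\<integral>w. (D l w)^2 \<partial>M) \<le> (\<integral>w. 2 * (Y l w - P w)^2 + 2 * R w \<partial>M)" by (rule integral_mono[OF i ib le])
    also have "... = 2 * (\<integral>w. (Y l w - P w)^2 \<partial>M) + 2 * (\<integral>w. R w \<partial>M)" using YP(1) iR by simp
    also have "... \<le> K1 / 14 ^ l"
    proof (cases l)
      case 0
      have "(\<integral>w. R w \<partial>M) = (\<integral>w. (P w)^2 \<partial>M)" by (simp add: R_def 0)
      then show ?thesis using YP(2)[of 0] K0 by (simp add: K1_def 0)
    next
      case (Suc m)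
      have "(\<integral>w. R w \<partial>M) \<le> K / 14 ^ m" using YP(2)[of m] by (simp add: R_def Suc)
      also have "... = 14 * K / 14 ^ l" by (simp add: Suc)
      finally have "2 * (\<integral>w. (Y l w - P w)^2 \<partial>M) + 2 * (\<integral>w. R w \<partial>M) \<le> 2 * (K / 14 ^ l) + 2 * (14 * K / 14 ^ l)"
        using YP(2)[of l] by linarith
      also have "... = 30 * K / 14 ^ l" by (simp add: add_divide_distrib[symmetric])
      also have "... \<le> K1 / 14 ^ l" using P0 by (intro divide_right_mono) (auto simp: K1_def)
      finally show ?thesis .
    qed
    finally show ?thesis using i by blast
  qed
  have ED: "(\<Sum>l\<le>L. \<integral>w. D l w \<partial>M) = (\<integral>w. Y L w \<partial>M)" for L
    by (induction L) (use iY in \<open>auto simp: D_def\<close>)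
  have bias: "((\<integral>w. Y L w \<partial>M) - (\<integral>w. P w \<partial>M))^2 \<le> K1 / 14 ^ L" for L
  proof -
    \<comment> \<open>Non-negativity of the variance takes the part of Jensen's inequality: the
      squared bias is at most the mean square error.\<close>
    have "variance (\<lambda>w. Y L w - P w) = (\<integral>w. (Y L w - P w)^2 \<partial>M) - (expectation (\<lambda>w. Y L w - P w))\<^sup>2"
      by (rule variance_eq[OF Q YP(1)])
    moreover have "0 \<le> variance (\<lambda>w. Y L w - P w)" by (rule variance_positive)
    ultimately have "((\<integral>w. Y L w \<partial>M) - (\<integral>w. P w \<partial>M))^2 \<le> (\<integral>w. (Y L w - P w)^2 \<partial>M)" using iY iP by simp
    also have "... \<le> K1 / 14 ^ L" using YP(2)[of L] divide_right_mono[OF K1(2), of "14 ^ L"] by simp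
    finally show ?thesis .
  qed
  obtain C where C: "\<And>\<epsilon>. 0 < \<epsilon> \<Longrightarrow> \<epsilon> < 1 \<Longrightarrow> \<exists>L Ms. (\<forall>l. 0 < Ms l) \<and> K1 / 14 ^ L \<le> \<epsilon>^2 / 2
     \<and> (\<Sum>l\<le>L. (K1 / 14 ^ l) / real (Ms l)) \<le> \<epsilon>^2 / 2 \<and> total_cost \<kappa> T k0 L Ms \<le> C * \<epsilon> powr (-2)"
  proof (rule mlmc_parameters[OF K1(1) level_cost_le[OF n0 \<kappa>]])
    show "0 \<le> 16384 * \<kappa> * real n0" using \<kappa> by simp
  qed (rule that)
  show ?thesis
  proof (rule exI[of _ C], rule exI[of _ 1], intro conjI allI impI)
    show "(1::real) > 0" by simp
    fix \<epsilon> :: real assume e: "0 < \<epsilon> \<and> \<epsilon> < 1"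
    obtain L Ms where LM: "\<forall>l. 0 < Ms l" "K1 / 14 ^ L \<le> \<epsilon>^2 / 2"
      "(\<Sum>l\<le>L. (K1 / 14 ^ l) / real (Ms l)) \<le> \<epsilon>^2 / 2" "total_cost \<kappa> T k0 L Ms \<le> C * \<epsilon> powr (-2)" using C e by blast
    have main: "integrable \<Omega> (\<lambda>w. \<bar>mlmc_estimator L Ms X w - (\<integral>w. P w \<partial>M)\<bar>^2)
       \<and> sqrt (\<integral>w. \<bar>mlmc_estimator L Ms X w - (\<integral>w. P w \<partial>M)\<bar>^2 \<partial>\<Omega>) \<le> \<epsilon>"
      if h: "prob_space \<Omega>" "prob_space.indep_vars \<Omega> (\<lambda>_. borel) (\<lambda>(l, m). X l m) (sample_indices L Ms)"
          "\<forall>(l, m) \<in> sample_indices L Ms. distr \<Omega> borel (X l m) = distr M borel (D l)" for \<Omega> :: "'b measure" and X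
    proof -
      note R = prob_space.mlmc_mean_square_error[OF h(1) h(2) h(3) mD, where v = "\<lambda>l. K1 / 14 ^ l" and b = "\<integral>w. P w \<partial>M"]
      have i: "integrable \<Omega> (\<lambda>w. (mlmc_estimator L Ms X w - (\<integral>w. P w \<partial>M))^2)" by (rule R(1)) (use D2 LM in auto)
      have "(\<integral>w. (mlmc_estimator L Ms X w - (\<integral>w. P w \<partial>M))^2 \<partial>\<Omega>)
         \<le> (\<Sum>l\<le>L. K1 / 14 ^ l / real (Ms l)) + ((\<Sum>l\<le>L. \<integral>w. D l w \<partial>M) - (\<integral>w. P w \<partial>M))^2"
        by (rule R(2)) (use D2 LM in auto)
      also have "... \<le> \<epsilon>^2" using LM bias[of L] unfolding ED by linarith
      finally have "sqrt (\<integral>w. (mlmc_estimator L Ms X w - (\<integral>w. P w \<partial>M))^2 \<partial>\<Omega>) \<le> \<epsilon>"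
        using e by (intro real_le_lsqrt) auto
      then show ?thesis using i by simp
    qed
    show "\<exists>L Ms. (\<forall>l\<le>L. Ms l > 0) \<and>
       (\<forall>(\<Omega> :: 'b measure) X.
          prob_space \<Omega> \<and> prob_space.indep_vars \<Omega> (\<lambda>_. borel) (\<lambda>(l, m). X l m) (sample_indices L Ms) \<and>
          (\<forall>(l, m) \<in> sample_indices L Ms. distr \<Omega> borel (X l m) = distr M borel (D l))
          \<longrightarrow> (let EP = (\<integral>w. P w \<partial>M); err = (\<lambda>w. \<bar>mlmc_estimator L Ms X w - EP\<bar>^2)
           in integrable \<Omega> err \<and> sqrt (\<integral>w. err w \<partial>\<Omega>) \<le> \<epsilon>)) \<and>
       total_cost \<kappa> T k0 L Ms \<le> C * \<epsilon> powr (-2)"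
      unfolding Let_def
      by (rule exI[of _ L], rule exI[of _ Ms], rule conjI, simp add: LM(1), rule conjI,
          (intro allI impI, elim conjE, rule main; assumption), rule LM(4))
  qed
qed

section \<open>Exact functional in Fourier variables\<close>

text \<open>Completing the square on the line of height \<alpha> leaves a real Gaussian in
  \<open>s\<close> with the real frequency \<open>y - v * \<alpha>\<close> and the factor
  \<open>exp (v * \<alpha>^2 / 2 - \<alpha> * y)\<close>; after scaling by \<open>sqrt v\<close>
  this is the characteristic function of the standard normal law.\<close>

lemma has_bochner_integral_gaussian_fourier:
  fixes v \<alpha> y :: real
  assumes v: "v > 0"
  shows "has_bochner_integral lborel (\<lambda>s. exp (\<i> * Complex s \<alpha> * of_real y - of_real v * (Complex s \<alpha>)^2 / 2))
     (of_real (sqrt (2 * pi / v) * exp (- y\<^sup>2 / (2 * v))))"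
proof -
  define u where "u = (y - v * \<alpha>) / sqrt v"
  define K where "K = sqrt (2 * pi) * exp (v * \<alpha>^2 / 2 - \<alpha> * y)"
  define f where "f = (\<lambda>t. std_normal_density t *\<^sub>R iexp (u * t))"
  have [measurable]: "(\<lambda>t. iexp (u * t)) \<in> borel_measurable borel"
    by (intro borel_measurable_continuous_onI continuous_intros)
  have i: "integrable lborel f"
    by (rule Bochner_Integration.integrable_bound[OF integrable_std_normal_moment[of 0]])
      (auto simp: f_def normal_density_nonneg abs_mult)
  have "char std_normal_distribution u = (\<integral>t. f t \<partial>lborel)"
    unfolding char_def f_def by (rule integral_density) (auto simp: normal_density_nonneg)
  then have "(\<integral>t. f t \<partial>lborel) = of_real (exp (- u\<^sup>2 / 2))" using char_std_normal_distribution by (simp add: fun_eq_iff)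
  then have "has_bochner_integral lborel f (of_real (exp (- u\<^sup>2 / 2)))" using i by (simp add: has_bochner_integral_iff)
  then have "has_bochner_integral lborel (\<lambda>s. f (0 + sqrt v * s)) (of_real (exp (- u\<^sup>2 / 2)) /\<^sub>R \<bar>sqrt v\<bar>)"
    using lborel_has_bochner_integral_real_affine_iff[of "sqrt v" f _ 0] v by simp
  from has_bochner_integral_mult_right[OF this, of "of_real K"]
  have h: "has_bochner_integral lborel (\<lambda>s. of_real K * f (0 + sqrt v * s)) (of_real K * (of_real (exp (- u\<^sup>2 / 2)) /\<^sub>R \<bar>sqrt v\<bar>))" by simp
  have sv: "sqrt v > 0" "sqrt v * sqrt v = v" using v by auto
  have "of_real K * f (0 + sqrt v * s) = exp (\<i> * Complex s \<alpha> * of_real y - of_real v * (Complex s \<alpha>)^2 / 2)" for s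
  proof -
    have us: "u * (sqrt v * s) = s * (y - v * \<alpha>)" using sv by (simp add: u_def)
    have "f (0 + sqrt v * s) = of_real (exp (- (v * s^2) / 2) / sqrt (2 * pi)) * exp (\<i> * of_real (s * (y - v * \<alpha>)))"
      unfolding f_def add_0 us using v by (simp add: normal_density_def power_mult_distrib scaleR_conv_of_real)
    then have "of_real K * f (0 + sqrt v * s)
        = of_real (exp (v * \<alpha>^2 / 2 - \<alpha> * y) * exp (- (v * s^2) / 2)) * exp (\<i> * of_real (s * (y - v * \<alpha>)))"
      by (simp add: K_def)
    also have "... = exp (of_real (v * \<alpha>^2 / 2 - \<alpha> * y) + of_real (- (v * s^2) / 2) + \<i> * of_real (s * (y - v * \<alpha>)))"
      by (simp only: exp_add of_real_mult exp_of_real)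
    also have "of_real (v * \<alpha>^2 / 2 - \<alpha> * y) + of_real (- (v * s^2) / 2) + \<i> * of_real (s * (y - v * \<alpha>))
        = \<i> * Complex s \<alpha> * of_real y - of_real v * (Complex s \<alpha>)^2 / 2"
      by (simp add: complex_eq_iff power2_eq_square algebra_simps) (simp add: field_simps)
    finally show ?thesis .
  qed
  moreover have "of_real K * (of_real (exp (- u\<^sup>2 / 2)) /\<^sub>R \<bar>sqrt v\<bar>) = complex_of_real (sqrt (2 * pi / v) * exp (- y\<^sup>2 / (2 * v)))"
  proof -
    have "v * \<alpha>^2 / 2 - \<alpha> * y + - u\<^sup>2 / 2 = - y\<^sup>2 / (2 * v)"
      using v sv by (simp add: u_def power_divide) (simp add: field_simps power2_eq_square)
    then have "exp (v * \<alpha>^2 / 2 - \<alpha> * y) * exp (- u\<^sup>2 / 2) = exp (- y\<^sup>2 / (2 * v))" by (simp add: exp_add[symmetric])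
    moreover have "of_real K * (of_real (exp (- u\<^sup>2 / 2)) /\<^sub>R \<bar>sqrt v\<bar>) = complex_of_real (K * (inverse \<bar>sqrt v\<bar> * exp (- u\<^sup>2 / 2)))"
      by (simp only: scaleR_conv_of_real of_real_mult)
    moreover have "K * (inverse \<bar>sqrt v\<bar> * exp (- u\<^sup>2 / 2)) = sqrt (2 * pi) / sqrt v * (exp (v * \<alpha>^2 / 2 - \<alpha> * y) * exp (- u\<^sup>2 / 2))"
      using sv by (simp only: K_def divide_inverse abs_of_pos mult_ac)
    ultimately show ?thesis by (simp only: real_sqrt_divide)
  qed
  ultimately show ?thesis using h by simp
qed

text \<open>The integrand decays like \<open>exp (- (x * Im \<xi>))\<close>; this convergence is the
  reason for placing the contour above the real axis.\<close>

lemma has_bochner_integral_half_line_exp: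
  assumes "Im \<xi> > 0"
  shows "has_bochner_integral lborel (\<lambda>x. indicator {0..} x *\<^sub>R exp (\<i> * \<xi> * of_real x)) (\<i> / \<xi>)"
proof -
  let ?f = "\<lambda>x::real. exp (\<i> * \<xi> * of_real x)" and ?F = "\<lambda>x::real. exp (\<i> * \<xi> * of_real x) / (\<i> * \<xi>)"
  have x0: "\<xi> \<noteq> 0" using assms by auto
  have [measurable]: "?f \<in> borel_measurable borel" by (intro borel_measurable_continuous_onI continuous_intros)
  have nf: "cmod (?f x) = exp (- (x * Im \<xi>))" for x by (simp add: mult.commute)
  have si: "set_integrable lborel {0<..} ?f"
    unfolding set_integrable_def
    by (rule Bochner_Integration.integrable_bound[OF integrable_I0i_exp_mscale[OF assms, unfolded set_integrable_def]])
      (auto simp: nf indicator_def)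
  have "(LBINT x=0..\<infinity>. ?f x) = 0 - 1 / (\<i> * \<xi>)"
  proof (rule interval_integral_FTC_integrable[where F = ?F])
    show "(?F has_vector_derivative ?f x) (at x)" for x
      using x0 by (auto intro!: derivative_eq_intros has_vector_derivative_real_field)
    show "isCont ?f x" for x by (intro continuous_intros)
    show "set_integrable lborel (einterval 0 \<infinity>) ?f" using si by (simp add: zero_ereal_def)
    have "(?F \<longlongrightarrow> ?F 0) (at_right 0)" using x0 by (intro tendsto_intros) auto
    then show "((?F \<circ> real_of_ereal) \<longlongrightarrow> 1 / (\<i> * \<xi>)) (at_right 0)" unfolding zero_ereal_def ereal_tendsto_simps by simp
    have "((\<lambda>x. exp (- (x * Im \<xi>))) \<longlongrightarrow> 0) at_top" using assms by real_asymp
    then have "((\<lambda>x. cmod (?f x)) \<longlongrightarrow> 0) at_top" unfolding nf .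
    then have "(?f \<longlongrightarrow> 0) at_top" by (rule tendsto_norm_zero_cancel)
    then have "(?F \<longlongrightarrow> 0 / (\<i> * \<xi>)) at_top" by (rule tendsto_divide) (use x0 in auto)
    then show "((?F \<circ> real_of_ereal) \<longlongrightarrow> 0) (at_left \<infinity>)" unfolding ereal_tendsto_simps by simp
  qed simp
  moreover have "0 - 1 / (\<i> * \<xi>) = \<i> / \<xi>" using x0 by (simp add: field_simps)
  ultimately have "(LINT x:{0<..}|lborel. ?f x) = \<i> / \<xi>" by (simp only: interval_lebesgue_integral_0_infty)
  then have "has_bochner_integral lborel (\<lambda>x. indicator {0<..} x *\<^sub>R ?f x) (\<i> / \<xi>)"
    using si by (simp add: has_bochner_integral_iff set_integrable_def set_lebesgue_integral_def)
  \<comment> \<open>The interval integral leaves out the endpoint 0, the exact functional includes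
    it; the two differ on a null set.\<close>
  moreover have "AE x in lborel. indicator {0<..} x *\<^sub>R ?f x = indicator {0..} x *\<^sub>R ?f x"
    using AE_lborel_singleton[of "0 :: real"] by eventually_elim (auto simp: indicator_def)
  ultimately show ?thesis
    by (subst has_bochner_integral_cong_AE[where g = "\<lambda>x. indicator {0<..} x *\<^sub>R ?f x"]) auto
qed

text \<open>Half line symbol times the Fourier transform of the normal density with mean
  \<open>m\<close> and variance \<open>v\<close>. Its integral along a line above the real axis is
  \<open>2 * pi\<close> times the mass of that law on the half line.\<close>

definition normal_symbol :: "real \<Rightarrow> real \<Rightarrow> complex \<Rightarrow> complex" where
  "normal_symbol m v \<xi> = \<i> / \<xi> * exp (- \<i> * \<xi> * of_real m - of_real v * \<xi>^2 / 2)"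

lemma measurable_Complex_left [measurable (raw)]:
  assumes "f \<in> borel_measurable M" shows "(\<lambda>x. Complex (f x) \<alpha>) \<in> borel_measurable M"
  unfolding Complex_eq using assms by measurable

text \<open>One double integral in two orders: integrating first over the frequency gives the normal
  density, first over the half line \<open>normal_symbol\<close>. The modulus of the integrand
  factorises, which makes Fubini's theorem applicable.\<close>

lemma half_line_normal_fourier:
  fixes v \<alpha> m :: real
  assumes v: "v > 0" and \<alpha>: "\<alpha> > 0"
  shows "integrable lborel (\<lambda>s. normal_symbol m v (Complex s \<alpha>))"
    and "of_real (LINT x:{0..}|lborel. 1 / sqrt (2 * pi * v) * exp (- (x - m)\<^sup>2 / (2 * v)))
       = 1 / (2 * pi) * (\<integral>s. normal_symbol m v (Complex s \<alpha>) \<partial>lborel)"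
proof -
  define f where "f = (\<lambda>x s. indicator {0..} x *\<^sub>R exp (\<i> * Complex s \<alpha> * of_real (x - m) - of_real v * (Complex s \<alpha>)^2 / 2))"
  have [measurable]: "(\<lambda>(x, s). f x s) \<in> borel_measurable plane" unfolding f_def by measurable
  have f1: "has_bochner_integral lborel (\<lambda>s. f x s) (indicator {0..} x *\<^sub>R of_real (sqrt (2 * pi / v) * exp (- (x - m)\<^sup>2 / (2 * v))))" for x
    unfolding f_def by (rule has_bochner_integral_scaleR_right) (rule has_bochner_integral_gaussian_fourier[OF v])
  have f2eq: "f x s = exp (- \<i> * Complex s \<alpha> * of_real m - of_real v * (Complex s \<alpha>)^2 / 2) * (indicator {0..} x *\<^sub>R exp (\<i> * Complex s \<alpha> * of_real x))" for x s
    by (simp add: f_def exp_add[symmetric] indicator_def algebra_simps)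
  have f2: "has_bochner_integral lborel (\<lambda>x. f x s) (normal_symbol m v (Complex s \<alpha>))" for s
    unfolding f2eq normal_symbol_def mult.commute[of "\<i> / Complex s \<alpha>"]
    by (rule has_bochner_integral_mult_right) (rule has_bochner_integral_half_line_exp, use \<alpha> in simp)
  define w where "w = (\<lambda>s. exp (\<alpha> * m - v * (s^2 - \<alpha>^2) / 2))"
  have nf: "norm (f x s) = norm (indicator {0..} x *\<^sub>R exp (\<i> * Complex 0 \<alpha> * of_real x)) * w s" for x s
    by (simp add: f_def w_def exp_add[symmetric] indicator_def power2_eq_square algebra_simps)
  have ifp: "integrable plane (\<lambda>(x, s). f x s)"
  proof (rule lborel_pair.Fubini_integrable)
    have "integrable lborel (\<lambda>x. norm (indicator {0..} x *\<^sub>R exp (\<i> * Complex 0 \<alpha> * of_real x)))"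
      using has_bochner_integral_half_line_exp[of "Complex 0 \<alpha>"] \<alpha> by (intro integrable_norm) (simp add: has_bochner_integral_iff)
    then show "integrable lborel (\<lambda>x. LINT s|lborel. norm (case (x, s) of (x, s) \<Rightarrow> f x s))"
      unfolding prod.case nf by simp
    show "AE x in lborel. integrable lborel (\<lambda>s. case (x, s) of (x, s) \<Rightarrow> f x s)"
      using f1 by (auto simp: has_bochner_integral_iff)
  qed simp
  have fub: "(\<integral>s. (\<integral>x. f x s \<partial>lborel) \<partial>lborel) = (\<integral>x. (\<integral>s. f x s \<partial>lborel) \<partial>lborel)"
    by (rule lborel_pair.Fubini_integral[OF ifp])
  show "integrable lborel (\<lambda>s. normal_symbol m v (Complex s \<alpha>))"
    using lborel_pair.integrable_snd[OF ifp] by (simp add: has_bochner_integral_integral_eq[OF f2])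
  have sq: "sqrt (2 * pi / v) = 2 * pi * (1 / sqrt (2 * pi * v))"
    using v by (simp add: real_sqrt_divide real_sqrt_mult field_simps)
  have "(\<integral>s. normal_symbol m v (Complex s \<alpha>) \<partial>lborel)
      = (\<integral>x. complex_of_real (2 * pi * (indicator {0..} x *\<^sub>R (1 / sqrt (2 * pi * v) * exp (- (x - m)\<^sup>2 / (2 * v))))) \<partial>lborel)"
    using fub unfolding has_bochner_integral_integral_eq[OF f1] has_bochner_integral_integral_eq[OF f2] sq
    by (simp add: scaleR_conv_of_real mult_ac)
  also have "... = of_real (2 * pi * (LINT x:{0..}|lborel. 1 / sqrt (2 * pi * v) * exp (- (x - m)\<^sup>2 / (2 * v))))"
    unfolding integral_complex_of_real set_lebesgue_integral_def by (simp only: Bochner_Integration.integral_mult_right_zero)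
  finally show "of_real (LINT x:{0..}|lborel. 1 / sqrt (2 * pi * v) * exp (- (x - m)\<^sup>2 / (2 * v)))
       = 1 / (2 * pi) * (\<integral>s. normal_symbol m v (Complex s \<alpha>) \<partial>lborel)" by simp
qed

lemma (in pair_sigma_finite) has_bochner_integral_product:
  fixes f :: "'a \<Rightarrow> 'c :: {real_normed_field, banach, second_countable_topology}" and g :: "'b \<Rightarrow> 'c"
  assumes f: "integrable M1 f" and g: "integrable M2 g"
  shows "has_bochner_integral (M1 \<Otimes>\<^sub>M M2) (\<lambda>(x, y). f x * g y) ((\<integral>x. f x \<partial>M1) * (\<integral>y. g y \<partial>M2))"
proof -
  have [measurable]: "f \<in> borel_measurable M1" "g \<in> borel_measurable M2" using f g by auto
  have i: "integrable (M1 \<Otimes>\<^sub>M M2) (\<lambda>(x, y). f x * g y)"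
  proof (rule Fubini_integrable)
    have "integrable M1 (\<lambda>x. norm (f x) * (LINT y|M2. norm (g y)))" using f by simp
    then show "integrable M1 (\<lambda>x. LINT y|M2. norm (case (x, y) of (x, y) \<Rightarrow> f x * g y))"
      unfolding prod.case norm_mult by simp
    show "AE x in M1. integrable M2 (\<lambda>y. case (x, y) of (x, y) \<Rightarrow> f x * g y)"
      using g by (intro AE_I2) simp
  qed measurable
  then show ?thesis using integral_fst'[OF i] by (simp add: has_bochner_integral_iff)
qed

text \<open>The solution is a product of two normal densities, so the quadrant integral splits into
  two half line integrals, each with its own Fourier form.\<close>

lemma exact_functional_fourier:
  fixes T \<mu>x \<mu>y \<rho>x \<rho>y x0 y0 \<alpha> :: real
  assumes T: "T > 0" and r: "\<rho>x < 1" "\<rho>y < 1" and \<alpha>: "\<alpha> > 0"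
  defines "mx \<equiv> \<lambda>w :: path. x0 + \<mu>x * T + sqrt \<rho>x * fst (w T)" and "my \<equiv> \<lambda>w :: path. y0 + \<mu>y * T + sqrt \<rho>y * snd (w T)"
  shows "has_bochner_integral plane
     (\<lambda>(s, t). normal_symbol (mx w) ((1 - \<rho>x) * T) (Complex s \<alpha>) * normal_symbol (my w) ((1 - \<rho>y) * T) (Complex t \<alpha>))
     (of_real (4 * pi^2 * exact_functional T \<mu>x \<mu>y \<rho>x \<rho>y x0 y0 w))"
proof -
  have v: "(1 - \<rho>x) * T > 0" "(1 - \<rho>y) * T > 0" using T r by auto
  define A where "A = (\<lambda>x. 1 / sqrt (2 * pi * ((1 - \<rho>x) * T)) * exp (- (x - mx w)\<^sup>2 / (2 * ((1 - \<rho>x) * T))))"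
  define B where "B = (\<lambda>y. 1 / sqrt (2 * pi * ((1 - \<rho>y) * T)) * exp (- (y - my w)\<^sup>2 / (2 * ((1 - \<rho>y) * T))))"
  have c: "1 / (2 * pi * sqrt ((1 - \<rho>x) * (1 - \<rho>y)) * T) = 1 / sqrt (2 * pi * ((1 - \<rho>x) * T)) * (1 / sqrt (2 * pi * ((1 - \<rho>y) * T)))"
  proof -
    have "sqrt (2 * pi * ((1 - \<rho>x) * T)) * sqrt (2 * pi * ((1 - \<rho>y) * T)) = sqrt ((2 * pi * T)^2 * ((1 - \<rho>x) * (1 - \<rho>y)))"
      unfolding real_sqrt_mult[symmetric] by (rule arg_cong[of _ _ sqrt]) (simp add: power2_eq_square)
    also have "... = 2 * pi * T * sqrt ((1 - \<rho>x) * (1 - \<rho>y))" using T by (subst real_sqrt_mult) simp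
    finally show ?thesis by (simp add: mult_ac)
  qed
  have interchange: "(a * b) * (p * q) = (a * p) * (b * q)" for a b p q :: real by simp
  have "exact_solution \<mu>x \<mu>y \<rho>x \<rho>y x0 y0 w T x y = A x * B y" for x y
  proof -
    have "exact_solution \<mu>x \<mu>y \<rho>x \<rho>y x0 y0 w T x y = 1 / (2 * pi * sqrt ((1 - \<rho>x) * (1 - \<rho>y)) * T)
       * exp (- (x - mx w)\<^sup>2 / (2 * ((1 - \<rho>x) * T)) + - (y - my w)\<^sup>2 / (2 * ((1 - \<rho>y) * T)))"
      unfolding exact_solution_def mx_def my_def by (simp only: diff_diff_eq add.assoc diff_conv_add_uminus minus_divide_left mult.assoc minus_add_distrib)
    also have "... = A x * B y" unfolding c A_def B_def by (subst exp_add) (rule interchange)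
    finally show ?thesis .
  qed
  then have "exact_functional T \<mu>x \<mu>y \<rho>x \<rho>y x0 y0 w = set_lebesgue_integral lborel {0..} (\<lambda>x. set_lebesgue_integral lborel {0..} (\<lambda>y. A x * B y))"
    by (simp only: exact_functional_def)
  also have "... = set_lebesgue_integral lborel {0..} A * set_lebesgue_integral lborel {0..} B"
    by (simp only: set_integral_mult_right set_integral_mult_left)
  finally have "of_real (4 * pi^2 * exact_functional T \<mu>x \<mu>y \<rho>x \<rho>y x0 y0 w)
      = (2 * complex_of_real pi * of_real (set_lebesgue_integral lborel {0..} A)) * (2 * complex_of_real pi * of_real (set_lebesgue_integral lborel {0..} B))"
    by (simp add: power2_eq_square)
  also have "... = (\<integral>s. normal_symbol (mx w) ((1 - \<rho>x) * T) (Complex s \<alpha>) \<partial>lborel) * (\<integral>t. normal_symbol (my w) ((1 - \<rho>y) * T) (Complex t \<alpha>) \<partial>lborel)"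
  proof -
    have c: "2 * complex_of_real pi * (complex_of_real (1 / (2 * pi)) * z) = z" for z :: complex by simp
    show ?thesis unfolding A_def B_def half_line_normal_fourier(2)[OF v(1) \<alpha>] half_line_normal_fourier(2)[OF v(2) \<alpha>] c ..
  qed
  finally have eq: "of_real (4 * pi^2 * exact_functional T \<mu>x \<mu>y \<rho>x \<rho>y x0 y0 w)
    = (\<integral>s. normal_symbol (mx w) ((1 - \<rho>x) * T) (Complex s \<alpha>) \<partial>lborel) * (\<integral>t. normal_symbol (my w) ((1 - \<rho>y) * T) (Complex t \<alpha>) \<partial>lborel)" .
  show ?thesis unfolding eq
    by (rule lborel_pair.has_bochner_integral_product[OF half_line_normal_fourier(1)[OF v(1) \<alpha>] half_line_normal_fourier(1)[OF v(2) \<alpha>]])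
qed

section \<open>Mixed differences in mean square\<close>

text \<open>Indicator of the mesh band. With it the integrals for all mesh sizes run over the same
  plane, so that their differences can be taken inside one integral.\<close>

definition cutoff :: "real \<Rightarrow> real \<Rightarrow> complex" where
  "cutoff x h = (if \<bar>x\<bar> * h \<le> pi then 1 else 0)"

text \<open>For low frequencies, \<open>4 * h * r \<le> \<delta>\<close>, both cutoffs are 1 and the
  circle of radius \<open>\<delta> / r\<close> is large enough for Cauchy's formula. For the others
  the two terms are bounded separately and the missing factor is inserted as
  \<open>1 \<le> (4 * h * r)^2 / \<delta>^2\<close>; hence \<open>32 = 2 * 16\<close>.\<close>

lemma L2le_mesh_difference:
  fixes f :: "complex \<Rightarrow> 'a \<Rightarrow> complex" and x h \<delta> r :: real
  assumes M: "prob_space M" and h: "h > 0" and \<delta>: "0 < \<delta>" "\<delta> \<le> 1" and r: "0 < r" "\<bar>x\<bar> \<le> r" and B: "B > 0"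
    and even: "\<And>z w. f (- z) w = f z w"
    and meas [measurable]: "(\<lambda>(z, w). f z w) \<in> borel_measurable (borel \<Otimes>\<^sub>M M)"
    and hol: "\<And>w. 4 * h * r \<le> \<delta> \<Longrightarrow> (\<lambda>z. f z w) holomorphic_on cball 0 (\<delta> / r)"
    and b1: "\<And>z. 4 * h * r \<le> \<delta> \<Longrightarrow> cmod z = \<delta> / r \<Longrightarrow> L2le M (f z) B"
    and b2: "\<And>d. \<not> 4 * h * r \<le> \<delta> \<Longrightarrow> d = h \<or> d = 2 * h \<Longrightarrow> \<bar>x\<bar> * d \<le> pi \<Longrightarrow> L2le M (f (of_real d)) B"
  shows "L2le M (\<lambda>w. cutoff x h * f (of_real h) w - cutoff x (2 * h) * f (of_real (2 * h)) w) (32 * h^2 * r^2 / \<delta>^2 * B)"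
proof (cases "4 * h * r \<le> \<delta>")
  case True
  have xr: "\<bar>x\<bar> * (4 * h) \<le> \<delta>" 
  proof -
    have "\<bar>x\<bar> * (4 * h) \<le> r * (4 * h)" using r h by (intro mult_right_mono) auto
    also have "... \<le> \<delta>" using True by (simp add: mult_ac)
    finally show ?thesis .
  qed
  have "\<bar>x\<bar> * h \<le> \<bar>x\<bar> * (4 * h)" "\<bar>x\<bar> * (2 * h) \<le> \<bar>x\<bar> * (4 * h)" using h by (auto intro!: mult_left_mono)
  then have c: "cutoff x h = 1" "cutoff x (2 * h) = 1" using xr \<delta> pi_gt3 by (auto simp: cutoff_def)
  have "L2le M (\<lambda>w. f (of_real h) w - f (of_real (2 * h)) w) (5 * h^2 / (\<delta> / r)^2 * B)"
    by (rule L2le_even_difference[OF M hol[OF True] even h _ meas B b1[OF True]]) (use True r in \<open>auto simp: field_simps\<close>)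
  then show ?thesis unfolding c mult_1
  proof (rule L2le_mono)
    have "5 * h^2 / (\<delta> / r)^2 * B = 5 * (h^2 * r^2 / \<delta>^2 * B)" by (simp add: power_divide)
    moreover have "0 \<le> h^2 * r^2 / \<delta>^2 * B" using B by simp
    ultimately show "5 * h^2 / (\<delta> / r)^2 * B \<le> 32 * h^2 * r^2 / \<delta>^2 * B" by (simp add: mult_ac)
  qed
next
  case False
  have b: "L2le M (\<lambda>w. cutoff x d * f (of_real d) w) B" if "d = h \<or> d = 2 * h" for d
    using b2[OF False that] L2le_mono[OF L2le_0, of B M] B by (auto simp: cutoff_def)
  have "L2le M (\<lambda>w. cutoff x h * f (of_real h) w - cutoff x (2 * h) * f (of_real (2 * h)) w) (B + B)"
    by (rule L2le_diff[OF b b]) auto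
  then show ?thesis
  proof (rule L2le_mono)
    have "\<delta>^2 \<le> (4 * h * r)^2" using False \<delta> by (intro power_mono) auto
    then have "1 \<le> (4 * h * r)^2 / \<delta>^2" using \<delta> by simp
    then have "2 * B * 1 \<le> 2 * B * ((4 * h * r)^2 / \<delta>^2)" using B by (intro mult_left_mono) auto
    then show "B + B \<le> 32 * h^2 * r^2 / \<delta>^2 * B" by (simp add: power_mult_distrib mult_ac)
  qed
qed

lemma near_uminus: "near \<epsilon> (- x) S P s g \<Longrightarrow> near \<epsilon> x (- S) (- P) (- s) (- g)"
proof -
  have "cmod (- a - of_real (- b)) = cmod (a - of_real b)" for a :: complex and b :: real
    using norm_minus_commute[of a "of_real b"] by simp
  then show "near \<epsilon> (- x) S P s g \<Longrightarrow> near \<epsilon> x (- S) (- P) (- s) (- g)" unfolding near_def by simp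
qed

text \<open>\<open>x\<close> is the real part of \<open>\<xi>\<close> reduced modulo the period \<open>2 pi / h\<close>; only the square of the second symbol is periodic.\<close>

lemma near_real_mesh_strip:
  fixes h \<alpha> :: real
  assumes h: "h > 0" and \<xi>: "\<bar>Im \<xi>\<bar> \<le> \<alpha>"
  obtains x s g P where "\<bar>x\<bar> * h \<le> pi" "P^2 = (fsym \<xi> (of_real (h / 2)))^2" "near (\<alpha> * exp (\<alpha> * h)) x (fsym \<xi> (of_real h)) P s g"
proof -
  define n where "n = round (Re \<xi> * h / (2 * pi))"
  define x where "x = Re \<xi> - of_int n * (2 * pi / h)"
  define b where "b = Im \<xi>"
  have xh: "\<bar>x\<bar> * h \<le> pi"
  proof -
    have "\<bar>of_int n - Re \<xi> * h / (2 * pi)\<bar> \<le> 1 / 2" unfolding n_def by (rule of_int_round_abs_le)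
    then have "\<bar>of_int n - Re \<xi> * h / (2 * pi)\<bar> * (2 * pi) \<le> 1 / 2 * (2 * pi)" by (intro mult_right_mono) auto
    moreover have "\<bar>of_int n - Re \<xi> * h / (2 * pi)\<bar> * (2 * pi) = \<bar>(of_int n - Re \<xi> * h / (2 * pi)) * (2 * pi)\<bar>" by (simp add: abs_mult)
    moreover have "(of_int n - Re \<xi> * h / (2 * pi)) * (2 * pi) = - (x * h)" using h by (simp add: x_def field_simps)
    ultimately show ?thesis using h by (simp add: abs_mult)
  qed
  have \<xi>eq: "\<xi> = Complex x b + of_real (of_int n * (2 * pi / h))" by (simp add: complex_eq_iff x_def b_def)
  have Sh: "\<xi> * of_real h = Complex x b * of_real h + 2 * of_real pi * of_int n"
    using h unfolding \<xi>eq by (simp add: distrib_right)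
  have S: "fsym \<xi> (of_real h) = fsym (Complex x b) (of_real h)"
  proof -
    have "sin (\<xi> * of_real h) = sin (Complex x b * of_real h)"
      unfolding Sh using sin.plus_of_int[of "Complex x b * of_real h" n] by (simp add: mult_ac)
    then show ?thesis using h by (simp add: fsym_eq)
  qed
  have P: "(fsym (Complex x b) (of_real (h / 2)))^2 = (fsym \<xi> (of_real (h / 2)))^2"
  proof -
    have c2: "cos (2 * w) = 1 - 2 * (sin w)^2" for w :: complex by (rule cos_double_sin)
    have half: "2 * (w * of_real (h / 2)) = w * of_real h" for w :: complex by simp
    have "cos (2 * (\<xi> * of_real (h / 2))) = cos (2 * (Complex x b * of_real (h / 2)))"
      unfolding half Sh using cos.plus_of_int[of "Complex x b * of_real h" n] by (simp add: mult_ac)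
    then have "(sin (\<xi> * of_real (h / 2)))^2 = (sin (Complex x b * of_real (h / 2)))^2" unfolding c2 by simp
    then show ?thesis using h by (simp add: fsym_eq power_divide)
  qed
  have mono: "\<beta> * exp (\<beta> * h) \<le> \<alpha> * exp (\<alpha> * h)" if "0 \<le> \<beta>" "\<beta> \<le> \<alpha>" for \<beta>
    using that h by (intro mult_mono) auto
  show ?thesis
  proof (cases "0 \<le> b")
    case True
    have "near (b * exp (b * h)) x (fsym (Complex x b) h) (fsym (Complex x b) (h / 2)) (sin (x * h) / h) (sin (x * (h / 2)) / (h / 2))"
      by (rule near_real_mesh[OF h xh True])
    from near_mono[OF this mono[OF True]] have "near (\<alpha> * exp (\<alpha> * h)) x (fsym \<xi> (of_real h)) (fsym (Complex x b) (of_real (h / 2))) (sin (x * h) / h) (sin (x * (h / 2)) / (h / 2))"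
      unfolding S using \<xi> True by (simp add: b_def)
    then show ?thesis by (rule that[OF xh P])
  next
    \<comment> \<open>Below the real axis the frequency is reflected through the origin; the symbols
      are odd in it.\<close>
    case False
    then have b: "0 \<le> - b" "- b \<le> \<alpha>" using \<xi> by (auto simp: b_def)
    have xh': "\<bar>- x\<bar> * h \<le> pi" using xh by simp
    have m: "Complex (- x) (- b) = - Complex x b" by (simp add: complex_eq_iff)
    have fm: "fsym (- z) w = - fsym z w" for z w by (simp add: fsym_def)
    have "near (\<alpha> * exp (\<alpha> * h)) (- x) (fsym (Complex (- x) (- b)) h) (fsym (Complex (- x) (- b)) (h / 2)) (sin (- x * h) / h) (sin (- x * (h / 2)) / (h / 2))"
      by (rule near_mono[OF near_real_mesh[OF h xh' b(1)] mono[OF b]])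
    from near_uminus[OF this] have "near (\<alpha> * exp (\<alpha> * h)) x (fsym \<xi> (of_real h)) (fsym (Complex x b) (of_real (h / 2))) (- (sin (- x * h) / h)) (- (sin (- x * (h / 2)) / (h / 2)))"
      unfolding S m fm by simp
    then show ?thesis by (rule that[OF xh P])
  qed
qed

text \<open>One time level with its \<open>k\<close>. The assumption \<open>stab\<close> is the
  conclusion of \<open>step_stability\<close> for this \<open>k\<close>; the two bounds in
  \<open>small\<close> bring the complex discs and the real mesh band within the tolerance
  \<epsilon>.\<close>

locale fourier_level = prob_space M for M :: "'a measure" +
  fixes \<rho>xy T \<mu>x \<mu>y \<rho>x \<rho>y x0 y0 h0 k \<alpha> \<delta> \<epsilon> c K :: real and N :: nat and U V :: "nat \<Rightarrow> 'a \<Rightarrow> real"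
  assumes gp: "\<And>n. gauss_pair M \<rho>xy (U n) (V n)"
    and ind: "indep_vars (\<lambda>_. borel) (\<lambda>n w. (U n w, V n w)) {..<N}"
    and k: "0 < k" and T: "T = real N * k" and \<alpha>: "0 < \<alpha>" "\<alpha> \<le> 1" and \<delta>: "0 < \<delta>" "\<delta> \<le> 1"
    and small: "3 * \<alpha> + 2 * \<delta>^2 \<le> \<epsilon>" "\<alpha> * exp (\<alpha> * h0) \<le> \<epsilon>"
    and c: "0 < c" and rx: "0 \<le> \<rho>x" "\<rho>x < 1" and ry: "0 \<le> \<rho>y" "\<rho>y < 1"
    and stab: "\<And>n x y S1 P1 S2 P2 s1 g1 s2 g2.
       sqrt k * (1 + \<bar>x\<bar> + \<bar>y\<bar>) \<le> K \<Longrightarrow> near \<epsilon> x S1 P1 s1 g1 \<Longrightarrow> near \<epsilon> y S2 P2 s2 g2 \<Longrightarrow>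
       1 / 2 \<le> Re (step_den k \<mu>x \<mu>y S1 P1 S2 P2) \<and>
       integrable M (\<lambda>w. (cmod (step_factor k \<mu>x \<mu>y \<rho>x \<rho>y S1 P1 S2 P2 (U n w) (V n w)))^2) \<and>
       (\<integral>w. (cmod (step_factor k \<mu>x \<mu>y \<rho>x \<rho>y S1 P1 S2 P2 (U n w) (V n w)))^2 \<partial>M)
         \<le> exp (- c * (k * (x^2 + y^2)) + k)"
begin

lemma measurable_UV [measurable]: "U n \<in> borel_measurable M" "V n \<in> borel_measurable M"
  using gp[of n] by (auto dest: gauss_pair.measurable_U gauss_pair.measurable_V)

text \<open>The mesh band lies in the range of stability. The factor 2 lets the conditions for
  \<open>hx\<close> and \<open>hy\<close> be averaged to a bound for both frequencies
  together.\<close>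

definition "mesh h \<longleftrightarrow> 0 < h \<and> h \<le> h0 \<and> sqrt k * (1 + 2 * (pi / h)) \<le> K"
text \<open>Bound of \<open>gsym\<close> on the contour: the first summand serves real mesh sizes,
  the second complex ones.\<close>

definition "G = exp (\<alpha> * h0) / \<alpha> + 4 / \<alpha>"
definition "E0 = exp (\<alpha> * (x0 + y0))"
text \<open>Square root of the bound for the second moment of the product of all \<open>N\<close>
  factors, where \<open>N * k = T\<close>.\<close>

definition "wt x y = exp ((T - c * T * (x^2 + y^2)) / 2)"
text \<open>Common description of the two kinds of admissible mesh size: a real \<open>z\<close>
  whose mesh band contains \<open>x\<close>, and a complex \<open>z\<close> with
  \<open>\<xi> * z\<close> small. The last condition makes \<open>gsym\<close> holomorphic in
  \<open>z\<close>.\<close>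

definition "good x z \<longleftrightarrow> (\<exists>s g. near \<epsilon> x (fsym (Complex x \<alpha>) z) (fsym (Complex x \<alpha>) (z / 2)) s g)
    \<and> cmod (gsym (Complex x \<alpha>) z) \<le> G \<and> csinc (Complex x \<alpha> * z / 2) \<noteq> 0"
definition "Fct n z1 z2 x y w = step_factor k \<mu>x \<mu>y \<rho>x \<rho>y (fsym (Complex x \<alpha>) z1) (fsym (Complex x \<alpha>) (z1 / 2))
    (fsym (Complex y \<alpha>) z2) (fsym (Complex y \<alpha>) (z2 / 2)) (U n w) (V n w)"
definition "Base x y = exp (- \<i> * (Complex x \<alpha> * of_real x0 + Complex y \<alpha> * of_real y0))"
text \<open>Integrand of the discrete functional on the shifted contour as a function of both mesh
  sizes, complex ones included.\<close>

definition "\<Phi> z1 z2 x y w = gsym (Complex x \<alpha>) z1 * gsym (Complex y \<alpha>) z2 * (Base x y * (\<Prod>n<N. Fct n z1 z2 x y w))"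

lemma G_pos: "0 < G" using \<alpha> by (simp add: G_def add_pos_pos)
lemma E0_pos: "0 < E0" by (simp add: E0_def)
lemma wt_pos: "0 < wt x y" by (simp add: wt_def)
lemma cmod_Base: "cmod (Base x y) = E0" by (simp add: Base_def E0_def algebra_simps)
lemma Complex_ne_0: "Complex x \<alpha> \<noteq> 0" using \<alpha> by (simp add: complex_eq_iff)
lemma cmod_ge: "\<alpha> \<le> cmod (Complex x \<alpha>)" "\<bar>x\<bar> \<le> cmod (Complex x \<alpha>)"
  using abs_Im_le_cmod[of "Complex x \<alpha>"] abs_Re_le_cmod[of "Complex x \<alpha>"] \<alpha> by auto
lemma cmod_pos: "0 < cmod (Complex x \<alpha>)" using Complex_ne_0 by simp

lemma good_real:
  fixes h :: real
  assumes h: "0 < h" "h \<le> h0" and x: "\<bar>x\<bar> * h \<le> pi"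
  shows "good x (of_real h)"
  unfolding good_def
proof (intro conjI exI)
  have "\<alpha> * exp (\<alpha> * h) \<le> \<alpha> * exp (\<alpha> * h0)" using h \<alpha> by (intro mult_left_mono) auto
  then have e: "\<alpha> * exp (\<alpha> * h) \<le> \<epsilon>" using small by linarith
  have "near \<epsilon> x (fsym (Complex x \<alpha>) (of_real h)) (fsym (Complex x \<alpha>) (of_real (h / 2))) (sin (x * h) / h) (sin (x * (h / 2)) / (h / 2))"
    by (rule near_mono[OF near_real_mesh[OF h(1) x] e]) (use \<alpha> in simp)
  then show "near \<epsilon> x (fsym (Complex x \<alpha>) (of_real h)) (fsym (Complex x \<alpha>) (of_real h / 2)) (sin (x * h) / h) (sin (x * (h / 2)) / (h / 2))"
    by simp
  have "cmod (gsym (Complex x \<alpha>) (of_real h)) \<le> exp (\<alpha> * h) / \<alpha>" by (rule gsym_real_mesh_bound) (use h \<alpha> in auto)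
  also have "... \<le> exp (\<alpha> * h0) / \<alpha>" using h \<alpha> by (intro divide_right_mono) auto
  also have "... \<le> G" using \<alpha> by (simp add: G_def)
  finally show "cmod (gsym (Complex x \<alpha>) (of_real h)) \<le> G" .
  have eq: "Complex x \<alpha> * of_real h / 2 = Complex (x * (h / 2)) (\<alpha> * (h / 2))" by (simp add: complex_eq_iff)
  have "0 < \<alpha> * (h / 2)" using h \<alpha> by simp
  also have "... \<le> cmod (sin (Complex x \<alpha> * of_real h / 2))" unfolding eq by (rule sin_shift_bound(2)) (use h \<alpha> in simp)
  finally show "csinc (Complex x \<alpha> * of_real h / 2) \<noteq> 0" using csinc_mult[of "Complex x \<alpha> * of_real h / 2"] by force
qed

lemma good_complex:
  assumes z: "cmod (Complex x \<alpha> * z) \<le> \<delta>"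
  shows "good x z"
  unfolding good_def
proof (intro conjI exI)
  show "near \<epsilon> x (fsym (Complex x \<alpha>) z) (fsym (Complex x \<alpha>) (z / 2)) x x"
    by (rule near_mono[OF near_complex_mesh[OF z] small(1)]) (use \<alpha> \<delta> in auto)
  have "cmod (gsym (Complex x \<alpha>) z) \<le> 4 / cmod (Complex x \<alpha>)"
    by (rule gsym_complex_mesh_bound(1)) (use z \<delta> Complex_ne_0 in auto)
  also have "... \<le> 4 / \<alpha>" using cmod_ge(1)[of x] \<alpha> cmod_pos[of x] by (intro divide_left_mono mult_pos_pos) auto
  also have "... \<le> G" using \<alpha> by (simp add: G_def)
  finally show "cmod (gsym (Complex x \<alpha>) z) \<le> G" .
  have "1 / 2 \<le> cmod (csinc (Complex x \<alpha> * z / 2))" by (rule csinc_ge_half) (use z \<delta> in \<open>simp add: norm_divide\<close>)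
  then show "csinc (Complex x \<alpha> * z / 2) \<noteq> 0" by force
qed

lemma K_bound:
  assumes "mesh hx" "mesh hy" "\<bar>x\<bar> * hx \<le> pi" "\<bar>y\<bar> * hy \<le> pi"
  shows "sqrt k * (1 + \<bar>x\<bar> + \<bar>y\<bar>) \<le> K"
proof -
  have "\<bar>x\<bar> \<le> pi / hx" "\<bar>y\<bar> \<le> pi / hy" using assms by (auto simp: mesh_def field_simps)
  then have "sqrt k * (1 + \<bar>x\<bar> + \<bar>y\<bar>) \<le> sqrt k * (1 + pi / hx + pi / hy)" using k by (intro mult_left_mono) auto
  also have "... = (sqrt k * (1 + 2 * (pi / hx)) + sqrt k * (1 + 2 * (pi / hy))) / 2" by (simp add: algebra_simps)
  also have "... \<le> K" using assms by (simp add: mesh_def)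
  finally show ?thesis .
qed

lemma measurable_gsym [measurable]: "(\<lambda>(\<xi>, z). gsym \<xi> z) \<in> borel_measurable (borel \<Otimes>\<^sub>M borel)"
proof -
  have [measurable]: "(cos :: complex \<Rightarrow> complex) \<in> borel_measurable borel" by (intro borel_measurable_continuous_onI continuous_intros)
  show ?thesis unfolding gsym_def by measurable
qed

lemma measurable_fsym [measurable]: "(\<lambda>(\<xi>, z). fsym \<xi> z) \<in> borel_measurable (borel \<Otimes>\<^sub>M borel)"
  unfolding fsym_def by measurable

lemma measurable_Base [measurable]: "(\<lambda>(x, y). Base x y) \<in> borel_measurable (borel \<Otimes>\<^sub>M borel)"
  unfolding Base_def by measurable

lemma measurable_Fct [measurable]:
  assumes [measurable]: "a \<in> borel_measurable Q" "b \<in> borel_measurable Q" "x \<in> borel_measurable Q" "y \<in> borel_measurable Q" "w \<in> measurable Q M"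
  shows "(\<lambda>p. Fct n (a p) (b p) (x p) (y p) (w p)) \<in> borel_measurable Q"
  unfolding Fct_def step_factor_def step_num_def step_den_def by measurable

lemma measurable_Phi [measurable (raw)]:
  assumes [measurable]: "a \<in> borel_measurable Q" "b \<in> borel_measurable Q" "x \<in> borel_measurable Q" "y \<in> borel_measurable Q" "w \<in> measurable Q M"
  shows "(\<lambda>p. \<Phi> (a p) (b p) (x p) (y p) (w p)) \<in> borel_measurable Q"
  unfolding \<Phi>_def by measurable

lemma Phi_minus: "\<Phi> (- z1) z2 x y w = \<Phi> z1 z2 x y w" "\<Phi> z1 (- z2) x y w = \<Phi> z1 z2 x y w"
  unfolding \<Phi>_def Fct_def minus_divide_left[symmetric] by simp_all

lemma Phi_holomorphic:
  assumes a: "a holomorphic_on A" and b: "b holomorphic_on A" and K: "sqrt k * (1 + \<bar>x\<bar> + \<bar>y\<bar>) \<le> K"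
    and good: "\<And>z. z \<in> A \<Longrightarrow> good x (a z)" "\<And>z. z \<in> A \<Longrightarrow> good y (b z)"
  shows "(\<lambda>z. \<Phi> (a z) (b z) x y w) holomorphic_on A"
proof -
  have d: "step_den k \<mu>x \<mu>y (fsym (Complex x \<alpha>) (a z)) (fsym (Complex x \<alpha>) (a z / 2)) (fsym (Complex y \<alpha>) (b z)) (fsym (Complex y \<alpha>) (b z / 2)) \<noteq> 0"
    if z: "z \<in> A" for z
  proof -
    have "1 / 2 \<le> Re (step_den k \<mu>x \<mu>y (fsym (Complex x \<alpha>) (a z)) (fsym (Complex x \<alpha>) (a z / 2)) (fsym (Complex y \<alpha>) (b z)) (fsym (Complex y \<alpha>) (b z / 2)))"
      using good(1)[OF z] good(2)[OF z] stab[OF K] unfolding good_def by blast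
    then show ?thesis by force
  qed
  have F: "(\<lambda>z. Fct n (a z) (b z) x y w) holomorphic_on A" for n
    unfolding Fct_def step_factor_def
    by (intro holomorphic_on_divide d) (auto simp: step_num_def step_den_def fsym_def intro!: holomorphic_intros a b)
  have g: "(\<lambda>z. gsym (Complex x \<alpha>) (a z)) holomorphic_on A" "(\<lambda>z. gsym (Complex y \<alpha>) (b z)) holomorphic_on A"
    unfolding gsym_def using good Complex_ne_0 by (auto simp: good_def intro!: holomorphic_intros a b)
  show ?thesis unfolding \<Phi>_def by (intro holomorphic_intros F g)
qed

lemma ind_Fct: "indep_vars (\<lambda>_. borel) (\<lambda>n w. Fct n z1 z2 x y w) {..<N}"
proof -
  have [measurable]: "(\<lambda>p. step_factor k \<mu>x \<mu>y \<rho>x \<rho>y S1 P1 S2 P2 (fst p) (snd p)) \<in> borel_measurable borel" for S1 P1 S2 P2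
    unfolding step_factor_def step_num_def borel_prod[symmetric] by measurable
  show ?thesis using indep_vars_compose2[OF ind, of "\<lambda>n p. step_factor k \<mu>x \<mu>y \<rho>x \<rho>y (fsym (Complex x \<alpha>) z1) (fsym (Complex x \<alpha>) (z1 / 2))
    (fsym (Complex y \<alpha>) z2) (fsym (Complex y \<alpha>) (z2 / 2)) (fst p) (snd p)" "\<lambda>_. borel"] by (simp add: Fct_def)
qed

lemma L2le_prod_Fct:
  assumes K: "sqrt k * (1 + \<bar>x\<bar> + \<bar>y\<bar>) \<le> K" and good: "good x z1" "good y z2"
  shows "L2le M (\<lambda>w. \<Prod>n<N. Fct n z1 z2 x y w) (wt x y)"
proof (rule L2le_I_integral)
  have s: "integrable M (\<lambda>w. (cmod (Fct n z1 z2 x y w))^2) \<and> (\<integral>w. (cmod (Fct n z1 z2 x y w))^2 \<partial>M) \<le> exp (- c * (k * (x^2 + y^2)) + k)" for n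
    using good stab[OF K] unfolding good_def Fct_def by blast
  show "integrable M (\<lambda>w. (cmod (\<Prod>n<N. Fct n z1 z2 x y w))^2)"
    by (rule indep_product_norm_square(1)[OF ind_Fct]) (use s in blast)
  have "(\<integral>w. (cmod (\<Prod>n<N. Fct n z1 z2 x y w))^2 \<partial>M) = (\<Prod>n<N. \<integral>w. (cmod (Fct n z1 z2 x y w))^2 \<partial>M)"
    by (rule indep_product_norm_square(2)[OF ind_Fct]) (use s in blast)
  also have "... \<le> (\<Prod>n<N. exp (- c * (k * (x^2 + y^2)) + k))"
    by (rule prod_mono) (use s in \<open>auto intro: Bochner_Integration.integral_nonneg\<close>)
  also have "... = (wt x y)^2"
  proof -
    have "(wt x y)^2 = exp (T - c * T * (x^2 + y^2))" by (simp add: wt_def power2_eq_square[of "exp _"] exp_add[symmetric])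
    also have "T - c * T * (x^2 + y^2) = real N * (- c * (k * (x^2 + y^2)) + k)" unfolding T by (simp add: algebra_simps)
    finally show ?thesis by (simp add: exp_of_nat_mult)
  qed
  finally show "(\<integral>w. (cmod (\<Prod>n<N. Fct n z1 z2 x y w))^2 \<partial>M) \<le> (wt x y)^2" .
qed (measurable, use wt_pos[of x y] in simp)

lemma L2le_Phi:
  assumes K: "sqrt k * (1 + \<bar>x\<bar> + \<bar>y\<bar>) \<le> K" and good: "good x z1" "good y z2"
  shows "L2le M (\<Phi> z1 z2 x y) (G^2 * E0 * wt x y)"
proof (rule L2le_bound[OF L2le_prod_Fct[OF K good]])
  show "\<Phi> z1 z2 x y \<in> borel_measurable M" by measurable
  show "0 \<le> G^2 * E0" using E0_pos by simp
  have "cmod (gsym (Complex x \<alpha>) z1) * cmod (gsym (Complex y \<alpha>) z2) \<le> G * G"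
    using good G_pos by (intro mult_mono) (auto simp: good_def)
  then have "cmod (gsym (Complex x \<alpha>) z1) * cmod (gsym (Complex y \<alpha>) z2) * (E0 * cmod (\<Prod>n<N. Fct n z1 z2 x y w))
      \<le> G * G * (E0 * cmod (\<Prod>n<N. Fct n z1 z2 x y w))" for w
    using E0_pos by (intro mult_right_mono) auto
  then show "cmod (\<Phi> z1 z2 x y w) \<le> G^2 * E0 * cmod (\<Prod>n<N. Fct n z1 z2 x y w)" for w
    by (simp add: \<Phi>_def norm_mult cmod_Base power2_eq_square mult_ac)
qed

text \<open>Mixed second difference between the mesh sizes \<open>h\<close> and \<open>2 * h\<close>
  in both directions, nested so that the estimate for one direction can be applied to the outcome of
  the other.\<close>

definition "dPhi hx hy x y w =
    cutoff x hx * (cutoff y hy * \<Phi> (of_real hx) (of_real hy) x y w - cutoff y (2 * hy) * \<Phi> (of_real hx) (of_real (2 * hy)) x y w)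
  - cutoff x (2 * hx) * (cutoff y hy * \<Phi> (of_real (2 * hx)) (of_real hy) x y w - cutoff y (2 * hy) * \<Phi> (of_real (2 * hx)) (of_real (2 * hy)) x y w)"

lemma small_imp_pi:
  assumes "0 < h" "4 * h * cmod (Complex x \<alpha>) \<le> \<delta>"
  shows "\<bar>x\<bar> * h \<le> pi"
proof -
  have "\<bar>x\<bar> * h \<le> cmod (Complex x \<alpha>) * h" using cmod_ge(2)[of x] assms by (intro mult_right_mono) auto
  then have "4 * (\<bar>x\<bar> * h) \<le> 4 * h * cmod (Complex x \<alpha>)" by (simp add: mult_ac)
  then show ?thesis using assms \<delta> pi_gt3 by linarith
qed

text \<open>First the difference in the mesh size of \<open>y\<close> is estimated for every
  admissible mesh size of \<open>x\<close>, real or on the complex circle; then the outcome, as a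
  function of the mesh size of \<open>x\<close>, is treated in the same way. Each direction
  contributes its own factor of second order.\<close>

lemma L2le_dPhi:
  assumes hx: "mesh hx" "2 * hx \<le> h0" and hy: "mesh hy" "2 * hy \<le> h0"
  shows "L2le M (dPhi hx hy x y) (32 * hx^2 * (cmod (Complex x \<alpha>))^2 / \<delta>^2 * (32 * hy^2 * (cmod (Complex y \<alpha>))^2 / \<delta>^2 * (G^2 * E0 * wt x y)))"
proof -
  let ?rx = "cmod (Complex x \<alpha>)" and ?ry = "cmod (Complex y \<alpha>)"
  have hx0: "0 < hx" "0 < hy" using hx hy by (auto simp: mesh_def)
  have B: "0 < G^2 * E0 * wt x y" using G_pos E0_pos wt_pos by simp
  have real_good: "good u (of_real d)" "\<bar>u\<bar> * h \<le> pi" if "mesh h" "2 * h \<le> h0" "d = h \<or> d = 2 * h" "\<bar>u\<bar> * d \<le> pi" for u d h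
  proof -
    have h: "0 < h" "h \<le> h0" using that by (auto simp: mesh_def)
    show "good u (of_real d)" by (rule good_real) (use that h in auto)
    have "\<bar>u\<bar> * h \<le> \<bar>u\<bar> * d" using that h by (intro mult_left_mono) auto
    then show "\<bar>u\<bar> * h \<le> pi" using that by linarith
  qed
  have ball: "cmod (Complex u \<alpha> * z) \<le> \<delta>" if "cmod z \<le> \<delta> / cmod (Complex u \<alpha>)" for u z
    using that cmod_pos[of u] by (simp add: norm_mult field_simps)
  have inner: "L2le M (\<lambda>w. cutoff y hy * \<Phi> z (of_real hy) x y w - cutoff y (2 * hy) * \<Phi> z (of_real (2 * hy)) x y w)
      (32 * hy^2 * ?ry^2 / \<delta>^2 * (G^2 * E0 * wt x y))" if z: "good x z" and xp: "\<bar>x\<bar> * hx \<le> pi" for z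
  proof (rule L2le_mesh_difference[where f = "\<lambda>z2. \<Phi> z z2 x y", OF prob_space_axioms hx0(2) \<delta> cmod_pos cmod_ge(2) B])
    show "\<Phi> z (- z2) x y w = \<Phi> z z2 x y w" for z2 w by (rule Phi_minus)
    show "(\<lambda>(z2, w). \<Phi> z z2 x y w) \<in> borel_measurable (borel \<Otimes>\<^sub>M M)" by measurable
    show "(\<lambda>z2. \<Phi> z z2 x y w) holomorphic_on cball 0 (\<delta> / ?ry)" if "4 * hy * ?ry \<le> \<delta>" for w
      by (rule Phi_holomorphic[OF _ _ K_bound[OF hx(1) hy(1) xp small_imp_pi[OF hx0(2) that]]])
        (auto intro!: holomorphic_intros z good_complex ball)
    show "L2le M (\<Phi> z z2 x y) (G^2 * E0 * wt x y)" if "4 * hy * ?ry \<le> \<delta>" "cmod z2 = \<delta> / ?ry" for z2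
      by (rule L2le_Phi[OF K_bound[OF hx(1) hy(1) xp small_imp_pi[OF hx0(2) that(1)]] z])
        (rule good_complex[OF ball], use that in simp)
    show "L2le M (\<Phi> z (of_real d) x y) (G^2 * E0 * wt x y)" if "d = hy \<or> d = 2 * hy" "\<bar>y\<bar> * d \<le> pi" for d
      by (rule L2le_Phi[OF K_bound[OF hx(1) hy(1) xp real_good(2)[OF hy that]] z real_good(1)[OF hy that]])
  qed
  define f where "f = (\<lambda>z w. cutoff y hy * \<Phi> z (of_real hy) x y w - cutoff y (2 * hy) * \<Phi> z (of_real (2 * hy)) x y w)"
  have B': "0 < 32 * hy^2 * ?ry^2 / \<delta>^2 * (G^2 * E0 * wt x y)" using B hx0 cmod_pos[of y] \<delta> by simp
  have "L2le M (\<lambda>w. cutoff x hx * f (of_real hx) w - cutoff x (2 * hx) * f (of_real (2 * hx)) w)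
      (32 * hx^2 * ?rx^2 / \<delta>^2 * (32 * hy^2 * ?ry^2 / \<delta>^2 * (G^2 * E0 * wt x y)))"
  proof (rule L2le_mesh_difference[where f = f, OF prob_space_axioms hx0(1) \<delta> cmod_pos cmod_ge(2) B'])
    show "f (- z) w = f z w" for z w by (simp add: f_def Phi_minus)
    show "(\<lambda>(z, w). f z w) \<in> borel_measurable (borel \<Otimes>\<^sub>M M)" unfolding f_def by measurable
    show "(\<lambda>z. f z w) holomorphic_on cball 0 (\<delta> / ?rx)" if s: "4 * hx * ?rx \<le> \<delta>" for w
    proof -
      have "(\<lambda>z. cutoff y d * \<Phi> z (of_real d) x y w) holomorphic_on cball 0 (\<delta> / ?rx)" if d: "d = hy \<or> d = 2 * hy" for d
      proof (cases "\<bar>y\<bar> * d \<le> pi")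
        case True
        have "(\<lambda>z. \<Phi> z (of_real d) x y w) holomorphic_on cball 0 (\<delta> / ?rx)"
          by (rule Phi_holomorphic[OF _ _ K_bound[OF hx(1) hy(1) small_imp_pi[OF hx0(1) s] real_good(2)[OF hy d True]]])
            (auto intro!: holomorphic_intros good_complex ball real_good(1)[OF hy d True])
        then show ?thesis by (intro holomorphic_intros)
      qed (simp add: cutoff_def)
      from this[of hy] this[of "2 * hy"] show ?thesis unfolding f_def by (intro holomorphic_on_diff) auto
    qed
    show "L2le M (f z) (32 * hy^2 * ?ry^2 / \<delta>^2 * (G^2 * E0 * wt x y))" if "4 * hx * ?rx \<le> \<delta>" "cmod z = \<delta> / ?rx" for z
      unfolding f_def by (rule inner[OF good_complex[OF ball] small_imp_pi[OF hx0(1) that(1)]]) (use that in simp)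
    show "L2le M (f (of_real d)) (32 * hy^2 * ?ry^2 / \<delta>^2 * (G^2 * E0 * wt x y))" if "d = hx \<or> d = 2 * hx" "\<bar>x\<bar> * d \<le> pi" for d
      unfolding f_def by (rule inner[OF real_good(1)[OF hx that] real_good(2)[OF hx that]])
  qed
  then show ?thesis by (simp only: f_def dPhi_def[abs_def])
qed

end

section \<open>Gaussian weights for the frequency integrals\<close>

definition gw1 :: "nat \<Rightarrow> real \<Rightarrow> real \<Rightarrow> real" where
  "gw1 q a x = (1 + \<bar>x\<bar>) ^ q * exp (- (a * x^2))"

definition gw :: "nat \<Rightarrow> real \<Rightarrow> real \<times> real \<Rightarrow> real" where
  "gw q a p = gw1 q a (fst p) * gw1 q a (snd p)"

lemma gw1_pos: "0 < gw1 q a x" by (simp add: gw1_def add_pos_nonneg)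
lemma gw_pos: "0 < gw q a p" by (simp add: gw_def gw1_pos)

lemma integrable_gw1:
  assumes a: "a > 0" shows "integrable lborel (gw1 q a)"
proof -
  have "integrable lborel (\<lambda>s. cmod (exp (\<i> * Complex s 0 * of_real 0 - of_real a * (Complex s 0)^2 / 2)))"
    using has_bochner_integral_gaussian_fourier[of a 0 0] a by (intro integrable_norm) (simp add: has_bochner_integral_iff)
  then have i: "integrable lborel (\<lambda>x. exp ((real q)^2 / (2 * a)) * exp (- (a * x^2) / 2))"
    by (simp add: power2_eq_square)
  have "gw1 q a x \<le> exp ((real q)^2 / (2 * a)) * exp (- (a * x^2) / 2)" for x
  proof -
    have "(1 + \<bar>x\<bar>) ^ q \<le> exp \<bar>x\<bar> ^ q" by (intro power_mono exp_ge_add_one_self_aux) auto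
    then have 1: "(1 + \<bar>x\<bar>) ^ q \<le> exp (real q * \<bar>x\<bar>)" by (simp add: exp_of_nat_mult)
    have "2 * (real q) * (a * \<bar>x\<bar>) \<le> (real q)^2 + (a * \<bar>x\<bar>)^2" by (rule sum_squares_bound)
    then have "real q * \<bar>x\<bar> \<le> (real q)^2 / (2 * a) + a * x^2 / 2" using a by (simp add: field_simps power2_eq_square)
    then have 2: "real q * \<bar>x\<bar> - a * x^2 \<le> (real q)^2 / (2 * a) + - (a * x^2) / 2" by simp
    have "gw1 q a x \<le> exp (real q * \<bar>x\<bar>) * exp (- (a * x^2))" unfolding gw1_def using 1 by (rule mult_right_mono) simp
    also have "... = exp (real q * \<bar>x\<bar> - a * x^2)" by (simp add: exp_add[symmetric])
    also have "... \<le> exp ((real q)^2 / (2 * a) + - (a * x^2) / 2)" using 2 by (subst exp_le_cancel_iff)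
    finally show ?thesis by (simp only: exp_add)
  qed
  then show ?thesis
    by (intro Bochner_Integration.integrable_bound[OF i] AE_I2)
      (auto simp: gw1_def[abs_def] abs_mult add_nonneg_nonneg power_abs)
qed

lemma integrable_gw: "a > 0 \<Longrightarrow> integrable plane (gw q a)"
  using lborel_pair.has_bochner_integral_product[OF integrable_gw1 integrable_gw1, of a a q q]
  by (simp add: has_bochner_integral_iff gw_def[abs_def] case_prod_unfold)

definition "GI q a = (\<integral>p. gw q a p \<partial>plane)"

lemma GI_nonneg: "0 \<le> GI q a"
  unfolding GI_def by (rule Bochner_Integration.integral_nonneg) (simp add: gw_pos less_imp_le)

text \<open>Minkowski's inequality with the pointwise mean-square bound itself as the
  weight.\<close>

lemma (in prob_space) L2le_gw_integral:
  fixes f :: "real \<times> real \<Rightarrow> 'a \<Rightarrow> complex"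
  assumes m: "(\<lambda>(p, w). f p w) \<in> borel_measurable (plane \<Otimes>\<^sub>M M)"
    and C: "C > 0" and a: "a > 0" and b: "\<And>x y. L2le M (f (x, y)) (C * gw q a (x, y))"
  shows "L2le M (\<lambda>w. \<integral>p. f p w \<partial>plane) (C * GI q a)"
proof -
  have "L2le M (\<lambda>w. \<integral>p. f p w \<partial>plane) (\<integral>p. C * gw q a p \<partial>plane)"
  proof (rule L2le_integral[OF _ _ m])
    show "sigma_finite_measure (lborel \<Otimes>\<^sub>M (lborel :: real measure))" unfolding lborel_prod by (rule lborel.sigma_finite_measure_axioms)
    show "sigma_finite_measure M" ..
    show "integrable plane (\<lambda>p. C * gw q a p)" using integrable_gw[OF a] by simp
    show "0 < C * gw q a p" for p using C gw_pos by simp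
    show "(\<integral>\<^sup>+w. ennreal ((norm (f p w))^2) \<partial>M) \<le> ennreal ((C * gw q a p)^2)" for p
      using L2leD(3)[OF b[of "fst p" "snd p"]] by simp
  qed
  then show ?thesis by (simp add: GI_def)
qed

context fourier_level
begin

text \<open>Bridge between scheme and integrand. Non-vanishing of the denominator is required for
  all real parts of the frequency, whereas stability speaks of the mesh band; reduction modulo the
  period closes the gap.\<close>

lemma functional_fourier:
  fixes w :: path and i j :: int
  assumes hx: "mesh hx" and hy: "mesh hy" and x0: "x0 = of_int i * hx" and y0: "y0 = of_int j * hy"
    and w: "\<And>n. increment_x k w n = U n \<omega>" "\<And>n. increment_y k w n = V n \<omega>"
  defines "g \<equiv> \<lambda>(x, y). cutoff x hx * (cutoff y hy * \<Phi> (of_real hx) (of_real hy) x y \<omega>)"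
  shows "integrable plane g"
    and "trapezoidal_sum hx hy (milstein_scheme \<mu>x \<mu>y \<rho>x \<rho>y x0 y0 hx hy k w N)
      = 1 / (4 * pi^2) * Re (\<integral>p. g p \<partial>plane)"
proof -
  have h0: "0 < hx" "hx \<le> h0" "0 < hy" "hy \<le> h0" using hx hy by (auto simp: mesh_def)
  interpret fs: fourier_scheme hx hy k \<alpha> \<mu>x \<mu>y \<rho>x \<rho>y i j "\<lambda>n. U n \<omega>" "\<lambda>n. V n \<omega>"
  proof
    fix \<xi> \<eta> :: complex assume im: "\<bar>Im \<xi>\<bar> \<le> \<alpha>" "\<bar>Im \<eta>\<bar> \<le> \<alpha>"
    have e: "\<alpha> * exp (\<alpha> * h) \<le> \<epsilon>" if "h \<le> h0" for h
    proof -
      have "\<alpha> * exp (\<alpha> * h) \<le> \<alpha> * exp (\<alpha> * h0)" using that \<alpha> by (intro mult_left_mono) auto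
      then show ?thesis using small by linarith
    qed
    obtain x s1 g1 P1 where x: "\<bar>x\<bar> * hx \<le> pi" "P1^2 = (fsym \<xi> (of_real (hx / 2)))^2" "near (\<alpha> * exp (\<alpha> * hx)) x (fsym \<xi> (of_real hx)) P1 s1 g1"
      by (rule near_real_mesh_strip[OF h0(1) im(1)])
    obtain y s2 g2 P2 where y: "\<bar>y\<bar> * hy \<le> pi" "P2^2 = (fsym \<eta> (of_real (hy / 2)))^2" "near (\<alpha> * exp (\<alpha> * hy)) y (fsym \<eta> (of_real hy)) P2 s2 g2"
      by (rule near_real_mesh_strip[OF h0(3) im(2)])
    have ne: "1 / 2 \<le> Re z \<Longrightarrow> z \<noteq> 0" for z by auto
    have "1 / 2 \<le> Re (step_den k \<mu>x \<mu>y (fsym \<xi> (of_real hx)) P1 (fsym \<eta> (of_real hy)) P2)"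
      using stab[OF K_bound[OF hx hy x(1) y(1)] near_mono[OF x(3) e] near_mono[OF y(3) e]] h0 by blast
    then show "step_den k \<mu>x \<mu>y (fsym \<xi> (of_real hx)) (fsym \<xi> (of_real (hx / 2))) (fsym \<eta> (of_real hy)) (fsym \<eta> (of_real (hy / 2))) \<noteq> 0"
      unfolding step_den_def x(2) y(2) by (rule ne)
  qed (use h0 k \<alpha> rx ry in auto)
  define \<phi> where "\<phi> = (\<lambda>p :: real \<times> real. \<Phi> (of_real hx) (of_real hy) (fst p) (snd p) \<omega>)"
  have ex: "fs.Ex 0 0 (Complex x \<alpha>) (Complex y \<alpha>) = Base x y" for x y
    unfolding fs.Ex_def Base_def unfolding x0 y0 by (simp add: algebra_simps)
  have Feq: "fs.Fac n (Complex x \<alpha>) (Complex y \<alpha>) = Fct n (of_real hx) (of_real hy) x y \<omega>" for n x y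
    unfolding fs.Fac_def Fct_def by simp
  have Ieq: "gsym (Complex x \<alpha>) hx * gsym (Complex y \<alpha>) hy * (fs.Ex 0 0 (Complex x \<alpha>) (Complex y \<alpha>) * fs.Amp N (Complex x \<alpha>) (Complex y \<alpha>)) = \<phi> (x, y)" for x y
    by (simp add: \<phi>_def \<Phi>_def ex fs.Amp_def Feq)
  have fb: "(x, y) \<in> fs.fbox \<longleftrightarrow> \<bar>x\<bar> * hx \<le> pi \<and> \<bar>y\<bar> * hy \<le> pi" for x y
  proof -
    have "\<bar>u\<bar> * h \<le> pi \<longleftrightarrow> - (pi / h) \<le> u \<and> u \<le> pi / h" if "0 < h" for u h
      using that abs_le_iff[of u "pi / h"] by (simp add: pos_le_divide_eq[symmetric]) linarith
    then show ?thesis using h0 by (auto simp: fs.fbox_def cbox_Pair_eq)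
  qed
  have a: "\<bar>\<alpha>\<bar> \<le> \<alpha>" using \<alpha> by simp
  have c0: "continuous_on fs.fbox (\<lambda>(x, y). fs.Ex 0 0 (Complex x \<alpha>) (Complex y \<alpha>) * fs.Amp N (Complex x \<alpha>) (Complex y \<alpha>))"
    using fs.reg_cont[OF fs.reg_mult[OF fs.reg_Ex fs.reg_Amp] a a] by (simp add: fs.lcont_def)
  have c1: "continuous_on fs.fbox (\<lambda>p. gsym (Complex (fst p) \<alpha>) hx)" "continuous_on fs.fbox (\<lambda>p. gsym (Complex (snd p) \<alpha>) hy)"
  proof -
    have nz: "csinc (Complex (fst p) \<alpha> * hx / 2) \<noteq> 0" "csinc (Complex (snd p) \<alpha> * hy / 2) \<noteq> 0" if "p \<in> fs.fbox" for p
      using that fb[of "fst p" "snd p"] good_real[of hx "fst p"] good_real[of hy "snd p"] h0 by (auto simp: good_def)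
    show "continuous_on fs.fbox (\<lambda>p. gsym (Complex (fst p) \<alpha>) hx)" "continuous_on fs.fbox (\<lambda>p. gsym (Complex (snd p) \<alpha>) hy)"
      unfolding gsym_def using nz Complex_ne_0 unfolding Complex_eq by (auto intro!: continuous_intros)
  qed
  have "continuous_on fs.fbox (\<lambda>p. gsym (Complex (fst p) \<alpha>) hx * gsym (Complex (snd p) \<alpha>) hy
      * (fs.Ex 0 0 (Complex (fst p) \<alpha>) (Complex (snd p) \<alpha>) * fs.Amp N (Complex (fst p) \<alpha>) (Complex (snd p) \<alpha>)))"
    by (rule continuous_on_mult[OF continuous_on_mult[OF c1] c0[unfolded case_prod_unfold]])
  then have c: "continuous_on fs.fbox \<phi>" unfolding Ieq by simp
  have gi: "g p = indicator fs.fbox p *\<^sub>R \<phi> p" for p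
    using fb[of "fst p" "snd p"] by (cases p) (auto simp: g_def \<phi>_def cutoff_def indicator_def)
  have "compact fs.fbox" by (simp add: fs.fbox_def)
  from borel_integrable_compact[OF this c] have i: "set_integrable lborel fs.fbox \<phi>" by (simp add: set_integrable_def)
  then show "integrable plane g" unfolding lborel_prod gi[abs_def] set_integrable_def .
  have "fs.J \<alpha> \<alpha> (\<lambda>\<xi> \<eta>. gsym \<xi> hx * gsym \<eta> hy * (fs.Ex 0 0 \<xi> \<eta> * fs.Amp N \<xi> \<eta>)) = integral fs.fbox \<phi>"
    unfolding fs.J_def Ieq by (simp add: case_prod_unfold)
  also have "... = (\<integral>p. g p \<partial>plane)"
    using set_borel_integral_eq_integral(2)[OF i] unfolding lborel_prod gi set_lebesgue_integral_def by simp
  finally show "trapezoidal_sum hx hy (milstein_scheme \<mu>x \<mu>y \<rho>x \<rho>y x0 y0 hx hy k w N)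
      = 1 / (4 * pi^2) * Re (\<integral>p. g p \<partial>plane)"
    using fs.trapezoidal_V[of N] fs.milstein_scheme_eq_V[OF w x0 y0, of N] by simp
qed

definition "I0 hx hy w = (\<integral>(x, y). cutoff x hx * (cutoff y hy * \<Phi> (of_real hx) (of_real hy) x y w) \<partial>plane)"

lemma measurable_cutoff [measurable]: "(\<lambda>x. cutoff x h) \<in> borel_measurable borel"
  unfolding cutoff_def by measurable

lemma wt_eq: "wt x y = exp (T / 2) * (exp (- (c * T / 2 * x^2)) * exp (- (c * T / 2 * y^2)))"
  unfolding wt_def exp_add[symmetric] by (rule arg_cong[of _ _ exp]) (simp add: field_simps)

lemma cmod_Complex_le: "cmod (Complex x \<alpha>) \<le> 1 + \<bar>x\<bar>"
  using cmod_le[of "Complex x \<alpha>"] \<alpha> by simp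

lemma L2le_mixed_difference:
  assumes hx: "mesh hx" "2 * hx \<le> h0" and hy: "mesh hy" "2 * hy \<le> h0" and T0: "T > 0"
  shows "L2le M (\<lambda>w. \<integral>p. dPhi hx hy (fst p) (snd p) w \<partial>plane)
     (1024 / \<delta> ^ 4 * G^2 * E0 * exp (T / 2) * (hx^2 * hy^2) * GI 2 (c * T / 2))"
proof (rule L2le_gw_integral)
  have h: "0 < hx" "0 < hy" using hx hy by (auto simp: mesh_def)
  show "(\<lambda>(p, w). dPhi hx hy (fst p) (snd p) w) \<in> borel_measurable (plane \<Otimes>\<^sub>M M)"
    unfolding dPhi_def by measurable
  show "0 < 1024 / \<delta> ^ 4 * G^2 * E0 * exp (T / 2) * (hx^2 * hy^2)" using \<delta> G_pos E0_pos h by simp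
  show "0 < c * T / 2" using c T0 by simp
  fix x y
  have "L2le M (dPhi hx hy x y) (1024 / \<delta> ^ 4 * G^2 * E0 * exp (T / 2) * (hx^2 * hy^2) * gw 2 (c * T / 2) (x, y))"
  proof (rule L2le_mono[OF L2le_dPhi[OF hx hy]])
    let ?rx = "(cmod (Complex x \<alpha>))^2" and ?ry = "(cmod (Complex y \<alpha>))^2"
    have "32 * hx^2 * ?rx / \<delta>^2 * (32 * hy^2 * ?ry / \<delta>^2 * (G^2 * E0 * wt x y))
       = (1024 / \<delta> ^ 4 * G^2 * E0 * (hx^2 * hy^2) * wt x y) * (?rx * ?ry)"
      by (simp add: field_simps power4_eq_xxxx power2_eq_square)
    also have "... \<le> (1024 / \<delta> ^ 4 * G^2 * E0 * (hx^2 * hy^2) * wt x y) * ((1 + \<bar>x\<bar>)^2 * (1 + \<bar>y\<bar>)^2)"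
      using \<delta> E0_pos wt_pos[of x y] by (intro mult_left_mono mult_mono power_mono cmod_Complex_le mult_nonneg_nonneg) auto
    also have "... = 1024 / \<delta> ^ 4 * G^2 * E0 * exp (T / 2) * (hx^2 * hy^2) * gw 2 (c * T / 2) (x, y)"
      unfolding wt_eq gw_def gw1_def by (simp only: fst_conv snd_conv mult_ac)
    finally show "32 * hx^2 * ?rx / \<delta>^2 * (32 * hy^2 * ?ry / \<delta>^2 * (G^2 * E0 * wt x y))
       \<le> 1024 / \<delta> ^ 4 * G^2 * E0 * exp (T / 2) * (hx^2 * hy^2) * gw 2 (c * T / 2) (x, y)" .
  qed
  then show "L2le M (dPhi hx hy (fst (x, y)) (snd (x, y))) (1024 / \<delta> ^ 4 * G^2 * E0 * exp (T / 2) * (hx^2 * hy^2) * gw 2 (c * T / 2) (x, y))"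
    by simp
qed

text \<open>The weaker of the decay rates of the scheme and of the exact propagator: comparing two
  products requires one common bound for the second moments of both kinds of factor.\<close>

definition "c2 = min c (1 - max \<rho>x \<rho>y)"
definition "C2 = 10 + 2 * \<bar>\<mu>x\<bar> + 2 * \<bar>\<mu>y\<bar>"
definition "wt2 x y = exp ((C2 * T - c2 * T * (x^2 + y^2)) / 2)"
definition "Xct n x y w = exact_step k \<mu>x \<mu>y \<rho>x \<rho>y (Complex x \<alpha>) (Complex y \<alpha>) (U n w) (V n w)"
text \<open>Counterpart of \<open>\<Phi>\<close> for the exact solution: exact steps, and
  \<open>\<i> / \<xi>\<close> in place of \<open>gsym\<close>.\<close>

definition "Ext x y w = \<i> / Complex x \<alpha> * (\<i> / Complex y \<alpha>) * (Base x y * (\<Prod>n<N. Xct n x y w))"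

lemma c2: "0 < c2" "c2 \<le> c" "c2 \<le> 1 - max \<rho>x \<rho>y" using c rx ry by (auto simp: c2_def)
lemma C2: "1 \<le> C2" by (simp add: C2_def)
lemma wt2_pos: "0 < wt2 x y" by (simp add: wt2_def)
lemma T_nonneg: "0 \<le> T" using k by (simp add: T)

lemma wt_le: "wt x y \<le> wt2 x y"
proof -
  have "1 * T \<le> C2 * T" using C2 T_nonneg by (intro mult_right_mono)
  moreover have "c2 * T * (x^2 + y^2) \<le> c * T * (x^2 + y^2)" using c2 T_nonneg by (intro mult_right_mono) auto
  ultimately show ?thesis by (simp add: wt_def wt2_def)
qed

lemma measurable_Xct [measurable]:
  assumes [measurable]: "x \<in> borel_measurable Q" "y \<in> borel_measurable Q" "w \<in> measurable Q M"
  shows "(\<lambda>p. Xct n (x p) (y p) (w p)) \<in> borel_measurable Q"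
proof -
  have [measurable]: "(exp :: complex \<Rightarrow> complex) \<in> borel_measurable borel" by (intro borel_measurable_continuous_onI continuous_intros)
  show ?thesis unfolding Xct_def exact_step_def by measurable
qed

lemma measurable_Ext [measurable (raw)]:
  assumes [measurable]: "x \<in> borel_measurable Q" "y \<in> borel_measurable Q" "w \<in> measurable Q M"
  shows "(\<lambda>p. Ext (x p) (y p) (w p)) \<in> borel_measurable Q"
  unfolding Ext_def by measurable

text \<open>Common bound for the second moment of one step of either kind, the \<open>r\<close> of
  \<open>indep_product_distance\<close>.\<close>

definition "rr x y = exp (- c2 * (k * (x^2 + y^2)) + C2 * k)"

lemma rr_power: "rr x y ^ N = (wt2 x y)^2"
proof -
  have "(wt2 x y)^2 = exp (C2 * T - c2 * T * (x^2 + y^2))" by (simp add: wt2_def power2_eq_square[of "exp _"] exp_add[symmetric])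
  also have "C2 * T - c2 * T * (x^2 + y^2) = real N * (- c2 * (k * (x^2 + y^2)) + C2 * k)" unfolding T by (simp add: algebra_simps)
  finally show ?thesis by (simp add: exp_of_nat_mult rr_def)
qed

lemma Xct_bound:
  "integrable M (\<lambda>w. (cmod (Xct n x y w))^2)" "(\<integral>w. (cmod (Xct n x y w))^2 \<partial>M) \<le> rr x y"
proof -
  interpret g: gauss_pair M \<rho>xy "U n" "V n" by (rule gp)
  note E = g.exact_step_stability[of k \<alpha> \<rho>x "max \<rho>x \<rho>y" \<rho>y \<mu>x \<mu>y x y]
  show "integrable M (\<lambda>w. (cmod (Xct n x y w))^2)" unfolding Xct_def by (rule E(1)) (use k \<alpha> rx ry in auto)
  have "(\<integral>w. (cmod (Xct n x y w))^2 \<partial>M) \<le> exp (- (1 - max \<rho>x \<rho>y) * (k * (x^2 + y^2)) + (10 + 2 * \<bar>\<mu>x\<bar> + 2 * \<bar>\<mu>y\<bar>) * k)"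
    unfolding Xct_def by (rule E(2)) (use k \<alpha> rx ry in auto)
  also have "... \<le> rr x y"
  proof -
    have "c2 * (k * (x^2 + y^2)) \<le> (1 - max \<rho>x \<rho>y) * (k * (x^2 + y^2))" using c2 k by (intro mult_right_mono) auto
    then show ?thesis unfolding rr_def C2_def by (subst exp_le_cancel_iff) linarith
  qed
  finally show "(\<integral>w. (cmod (Xct n x y w))^2 \<partial>M) \<le> rr x y" .
qed

lemma Fct_bound:
  assumes K: "sqrt k * (1 + \<bar>x\<bar> + \<bar>y\<bar>) \<le> K" and good: "good x z1" "good y z2"
  shows "integrable M (\<lambda>w. (cmod (Fct n z1 z2 x y w))^2)" "(\<integral>w. (cmod (Fct n z1 z2 x y w))^2 \<partial>M) \<le> rr x y"
proof -
  have s: "integrable M (\<lambda>w. (cmod (Fct n z1 z2 x y w))^2) \<and> (\<integral>w. (cmod (Fct n z1 z2 x y w))^2 \<partial>M) \<le> exp (- c * (k * (x^2 + y^2)) + k)"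
    using good stab[OF K] unfolding good_def Fct_def by blast
  then show "integrable M (\<lambda>w. (cmod (Fct n z1 z2 x y w))^2)" by blast
  have "c2 * (k * (x^2 + y^2)) \<le> c * (k * (x^2 + y^2))" using c2 k by (intro mult_right_mono) auto
  moreover have "1 * k \<le> C2 * k" using C2 k by (intro mult_right_mono) auto
  ultimately have "exp (- c * (k * (x^2 + y^2)) + k) \<le> rr x y" unfolding rr_def by (subst exp_le_cancel_iff) linarith
  then show "(\<integral>w. (cmod (Fct n z1 z2 x y w))^2 \<partial>M) \<le> rr x y" using s by linarith
qed

lemma ind_Fct_Xct: "indep_vars (\<lambda>_. borel) (\<lambda>n w. (Fct n z1 z2 x y w, Xct n x y w)) {..<N}"
proof -
  have [measurable]: "(\<lambda>p. step_factor k \<mu>x \<mu>y \<rho>x \<rho>y S1 P1 S2 P2 (fst p) (snd p)) \<in> borel_measurable borel" for S1 P1 S2 P2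
    unfolding step_factor_def step_num_def borel_prod[symmetric] by measurable
  have [measurable]: "(\<lambda>p. exact_step k \<mu>x \<mu>y \<rho>x \<rho>y \<xi> \<eta> (fst p) (snd p)) \<in> borel_measurable borel" for \<xi> \<eta>
    unfolding exact_step_def by (intro borel_measurable_continuous_onI continuous_intros)
  have m: "(\<lambda>p. (step_factor k \<mu>x \<mu>y \<rho>x \<rho>y (fsym (Complex x \<alpha>) z1) (fsym (Complex x \<alpha>) (z1 / 2))
    (fsym (Complex y \<alpha>) z2) (fsym (Complex y \<alpha>) (z2 / 2)) (fst p) (snd p), exact_step k \<mu>x \<mu>y \<rho>x \<rho>y (Complex x \<alpha>) (Complex y \<alpha>) (fst p) (snd p)))
    \<in> borel_measurable borel" by (intro borel_measurable_Pair) measurable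
  show ?thesis using indep_vars_compose2[OF ind m] by (simp only: Fct_def Xct_def fst_conv snd_conv)
qed

lemma cmod_inv: "cmod (\<i> / Complex x \<alpha>) \<le> 1 / \<alpha>"
  unfolding norm_divide using cmod_ge(1)[of x] \<alpha> cmod_pos[of x] by (simp add: field_simps)

lemma L2le_Ext: "L2le M (Ext x y) (1 / \<alpha>^2 * E0 * wt2 x y)"
proof -
  have ind': "indep_vars (\<lambda>_. borel) (\<lambda>n w. Xct n x y w) {..<N}"
    using indep_vars_compose2[OF ind_Fct_Xct[of 0 0 x y], of "\<lambda>n. snd" "\<lambda>_. borel"] by (simp add: borel_prod[symmetric])
  have p: "L2le M (\<lambda>w. \<Prod>n<N. Xct n x y w) (wt2 x y)"
  proof (rule L2le_I_integral)
    show "integrable M (\<lambda>w. (cmod (\<Prod>n<N. Xct n x y w))^2)"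
      by (rule indep_product_norm_square(1)[OF ind']) (rule Xct_bound)
    have "(\<integral>w. (cmod (\<Prod>n<N. Xct n x y w))^2 \<partial>M) = (\<Prod>n<N. \<integral>w. (cmod (Xct n x y w))^2 \<partial>M)"
      by (rule indep_product_norm_square(2)[OF ind']) (rule Xct_bound)
    also have "... \<le> (\<Prod>n<N. rr x y)"
      by (rule prod_mono) (use Xct_bound in \<open>auto intro: Bochner_Integration.integral_nonneg\<close>)
    also have "... = (wt2 x y)^2" by (simp add: rr_power)
    finally show "(\<integral>w. (cmod (\<Prod>n<N. Xct n x y w))^2 \<partial>M) \<le> (wt2 x y)^2" .
  qed (measurable, use wt2_pos[of x y] in simp)
  show ?thesis
  proof (rule L2le_bound[OF p])
    show "Ext x y \<in> borel_measurable M" by measurable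
    show "0 \<le> 1 / \<alpha>^2 * E0" using E0_pos by simp
    have "cmod (\<i> / Complex x \<alpha>) * cmod (\<i> / Complex y \<alpha>) \<le> 1 / \<alpha> * (1 / \<alpha>)" using \<alpha> by (intro mult_mono cmod_inv) auto
    then have "cmod (\<i> / Complex x \<alpha>) * cmod (\<i> / Complex y \<alpha>) * (E0 * cmod (\<Prod>n<N. Xct n x y w))
      \<le> 1 / \<alpha> * (1 / \<alpha>) * (E0 * cmod (\<Prod>n<N. Xct n x y w))" for w using E0_pos by (intro mult_right_mono) auto
    then show "cmod (Ext x y w) \<le> 1 / \<alpha>^2 * E0 * cmod (\<Prod>n<N. Xct n x y w)" for w
      unfolding Ext_def norm_mult cmod_Base by (simp add: power2_eq_square mult_ac)
  qed
qed

end

section \<open>Diagonal error\<close>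

lemma local_constant_nonneg: "0 \<le> c \<Longrightarrow> 0 \<le> local_constant c"
  by (simp add: local_constant_def)

lemma fsym_consistency:
  assumes "cmod (\<xi> * z) \<le> 1"
  shows "cmod (fsym \<xi> z - \<xi>) \<le> 2 * (cmod \<xi>) ^ 3 * (cmod z)^2"
proof -
  have "cmod (fsym \<xi> z - \<xi>) = cmod \<xi> * cmod (csinc (\<xi> * z) - 1)" by (simp add: fsym_def norm_mult[symmetric] algebra_simps)
  also have "... \<le> cmod \<xi> * (2 * (cmod (\<xi> * z))^2)" using csinc_bound[OF assms] by (intro mult_left_mono) auto
  finally show ?thesis by (simp add: norm_mult power_mult_distrib power3_eq_cube power2_eq_square mult_ac)
qed

context fourier_level
begin

text \<open>In \<open>L2le_diagonal\<close> the resolved frequencies are those with \<open>k * R^2 \<le> s0\<close>; there the one-step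
  expansion applies, elsewhere the trivial bounds suffice because \<open>1 \<le> k * R^2 / s0\<close>.\<close>

definition "cc \<Lambda> = 2 * (2 * \<Lambda>) * (\<bar>\<mu>x\<bar> + \<bar>\<mu>y\<bar> + 2 + 2 * \<Lambda>)"
text \<open>The first bound makes frequency times mesh size at most \<delta> when
  \<open>h^2 \<le> \<Lambda> * k\<close>; the second is the smallness assumption of
  \<open>one_step_error\<close>.\<close>

definition "s0 \<Lambda> = min (\<delta>^2 / \<Lambda>) (1 / (4 * cc \<Lambda>))"
text \<open>The first summand comes from the strong errors, which add up in mean square, the second
  from the weak errors, which add up before squaring. The factors \<open>exp c2\<close> compensate
  for the division by powers of \<open>rr\<close>.\<close>

definition "C3 \<Lambda> = sqrt (exp c2 * T * local_constant (cc \<Lambda>) + 2 * exp c2 * exp c2 * (local_constant (cc \<Lambda>))^2 * T^2)"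
text \<open>Contributions of the quadrant symbols, of the time stepping and of the unresolved
  frequencies, in this order.\<close>

definition "C4 \<Lambda> = E0 * (3 * \<Lambda> * (G + 1 / \<alpha>) + C3 \<Lambda> / \<alpha>^2 + (G^2 + 1 / \<alpha>^2) / s0 \<Lambda>)"

text \<open>\<Lambda> compares \<open>h^2\<close> with \<open>k\<close>, which turns second order
  consistency in the mesh size into first order in the time step. The powers of \<open>R\<close> are
  affordable because the weight \<open>wt2\<close> decays like a Gaussian.\<close>

lemma L2le_diagonal_resolved:
  fixes h \<Lambda> x y :: real
  assumes h: "mesh h" and \<Lambda>: "1 \<le> \<Lambda>" "h^2 \<le> \<Lambda> * k"
  defines "R \<equiv> 1 + cmod (Complex x \<alpha>) + cmod (Complex y \<alpha>)"
  assumes s: "k * R^2 \<le> s0 \<Lambda>"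
  shows "\<bar>x\<bar> * h \<le> pi" "\<bar>y\<bar> * h \<le> pi"
    and "L2le M (\<lambda>w. \<Phi> (of_real h) (of_real h) x y w - Ext x y w)
      (k * R ^ 4 * wt2 x y * (E0 * (3 * \<Lambda> * (G + 1 / \<alpha>) + C3 \<Lambda> / \<alpha>^2)))"
proof -
  define \<xi> \<eta> where "\<xi> = Complex x \<alpha>" and "\<eta> = Complex y \<alpha>"
  define lc where "lc = local_constant (cc \<Lambda>)"
  define \<tau> where "\<tau> = sqrt k * R"
  have h0: "0 < h" "h \<le> h0" using h by (auto simp: mesh_def)
  have R: "1 \<le> R" "cmod \<xi> \<le> R" "cmod \<eta> \<le> R" by (auto simp: R_def \<xi>_def \<eta>_def)
  have cc0: "0 < cc \<Lambda>" "4 \<le> 4 * cc \<Lambda>"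
  proof -
    have "1 * 1 \<le> (2 * (2 * \<Lambda>)) * (\<bar>\<mu>x\<bar> + \<bar>\<mu>y\<bar> + 2 + 2 * \<Lambda>)" using \<Lambda> by (intro mult_mono) auto
    then show "0 < cc \<Lambda>" "4 \<le> 4 * cc \<Lambda>" unfolding cc_def by linarith+
  qed
  have lc0: "0 \<le> lc" unfolding lc_def using cc0 by (intro local_constant_nonneg) simp
  have \<tau>0: "0 \<le> \<tau>" and \<tau>2: "\<tau>^2 = k * R^2" using k R by (auto simp: \<tau>_def power_mult_distrib)
  have s1: "\<tau>^2 \<le> \<delta>^2 / \<Lambda>" "\<tau>^2 \<le> 1 / (4 * cc \<Lambda>)" using s by (auto simp: \<tau>2 s0_def)
  have s2: "4 * cc \<Lambda> * \<tau>^2 \<le> 1" using s1(2) cc0 by (simp add: field_simps)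
  have \<tau>1: "\<tau>^2 \<le> 1"
  proof -
    have "1 * \<tau>^2 \<le> 4 * cc \<Lambda> * \<tau>^2" using cc0 by (intro mult_right_mono) auto
    then show ?thesis using s2 by simp
  qed
  have zh: "cmod (\<zeta> * of_real h) \<le> \<delta>" if "cmod \<zeta> \<le> R" for \<zeta> :: complex
  proof -
    have "(cmod (\<zeta> * of_real h))^2 = (cmod \<zeta>)^2 * h^2" using h0 by (simp add: norm_mult power_mult_distrib)
    also have "... \<le> R^2 * (\<Lambda> * k)" using that \<Lambda> by (intro mult_mono power_mono) auto
    also have "... = \<Lambda> * \<tau>^2" by (simp add: \<tau>2 mult_ac)
    also have "... \<le> \<Lambda> * (\<delta>^2 / \<Lambda>)" using s1 \<Lambda> by (intro mult_left_mono) auto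
    also have "... = \<delta>^2" using \<Lambda> by simp
    finally show ?thesis using \<delta> by (meson less_imp_le power2_le_imp_le)
  qed
  have xp: "\<bar>u\<bar> * h \<le> pi" if "cmod (Complex u \<alpha>) \<le> R" for u
  proof -
    have "\<bar>u\<bar> * h \<le> cmod (Complex u \<alpha>) * h" using cmod_ge(2)[of u] h0 by (intro mult_right_mono) auto
    also have "... = cmod (Complex u \<alpha> * of_real h)" using h0 by (simp add: norm_mult)
    also have "... \<le> \<delta>" by (rule zh[OF that])
    finally show ?thesis using \<delta> pi_gt3 by linarith
  qed
  show xh: "\<bar>x\<bar> * h \<le> pi" and yh: "\<bar>y\<bar> * h \<le> pi" using xp R by (auto simp: \<xi>_def \<eta>_def)
  have cons: "cmod (fsym \<zeta> (of_real d) - \<zeta>) \<le> 2 * \<Lambda> * R ^ 3 * k" if "cmod \<zeta> \<le> R" "0 < d" "d \<le> h" for \<zeta> d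
  proof -
    have "cmod (\<zeta> * of_real d) \<le> cmod (\<zeta> * of_real h)" using that h0 by (simp add: norm_mult mult_left_mono)
    also have "... \<le> 1" using zh[OF that(1)] \<delta> by linarith
    finally have "cmod (fsym \<zeta> (of_real d) - \<zeta>) \<le> 2 * (cmod \<zeta>) ^ 3 * (cmod (of_real d))^2" by (rule fsym_consistency)
    also have "... \<le> 2 * R ^ 3 * (\<Lambda> * k)"
    proof -
      have "(cmod (complex_of_real d))^2 \<le> h^2" using that by (simp add: power_mono)
      then have "(cmod (complex_of_real d))^2 \<le> \<Lambda> * k" using \<Lambda> by linarith
      then show ?thesis using that R by (intro mult_mono power_mono) auto
    qed
    finally show ?thesis by (simp add: mult_ac)
  qed
  have kb: "sqrt k * (1 + \<bar>x\<bar> + \<bar>y\<bar>) \<le> K" by (rule K_bound[OF h h xh yh])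
  have gx: "good x (of_real h)" and gy: "good y (of_real h)" using good_real[OF h0 xh] good_real[OF h0 yh] by auto
  have qR: "k * (x^2 + y^2) \<le> 1"
  proof -
    have "x^2 + y^2 \<le> (\<bar>x\<bar> + \<bar>y\<bar>)^2" by (simp add: power2_sum)
    also have "... \<le> R^2" using cmod_ge(2)[of x] cmod_ge(2)[of y] by (intro power_mono) (auto simp: R_def)
    finally have "k * (x^2 + y^2) \<le> k * R^2" using k by (intro mult_left_mono) auto
    then show ?thesis using \<tau>1 \<tau>2 by linarith
  qed
  \<comment> \<open>The estimate for the products is divided by the square of \<open>rr\<close>; on
    resolved frequencies \<open>rr\<close> is bounded below, so this costs only factors
    \<open>exp c2\<close>.\<close>
  have rr1: "1 \<le> rr x y * exp c2"
  proof -
    have "c2 * (k * (x^2 + y^2)) \<le> c2 * 1" using c2 qR by (intro mult_left_mono) auto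
    moreover have "0 \<le> C2 * k" using C2 k by simp
    ultimately have "1 \<le> exp (- c2 * (k * (x^2 + y^2)) + C2 * k + c2)" by simp
    then show ?thesis unfolding rr_def by (simp only: exp_add)
  qed
  have rr0: "0 < rr x y" by (simp add: rr_def)
  have R8: "1 \<le> R ^ 4" "R ^ 6 \<le> R ^ 8" using R by (auto intro: power_increasing)
  have osg: "(\<integral>w. (cmod (Fct n (of_real h) (of_real h) x y w - Xct n x y w))^2 \<partial>M) \<le> lc * \<tau> ^ 6"
     "cmod (\<integral>w. (Fct n (of_real h) (of_real h) x y w - Xct n x y w) * cnj (Xct n x y w) \<partial>M) \<le> lc * \<tau> ^ 4" for n
  proof -
    interpret g: gauss_pair M \<rho>xy "U n" "V n" by (rule gp)
    have c': "cmod (fsym \<xi> (of_real h) - \<xi>) \<le> 2 * \<Lambda> * R ^ 3 * k" "cmod (fsym \<xi> (of_real h / 2) - \<xi>) \<le> 2 * \<Lambda> * R ^ 3 * k"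
      "cmod (fsym \<eta> (of_real h) - \<eta>) \<le> 2 * \<Lambda> * R ^ 3 * k" "cmod (fsym \<eta> (of_real h / 2) - \<eta>) \<le> 2 * \<Lambda> * R ^ 3 * k"
      using cons[OF R(2), of h] cons[OF R(2), of "h / 2"] cons[OF R(3), of h] cons[OF R(3), of "h / 2"] h0 by simp_all
    have L1: "1 \<le> 2 * \<Lambda>" using \<Lambda> by simp
    have st: "4 * (2 * (2 * \<Lambda>) * (\<bar>\<mu>x\<bar> + \<bar>\<mu>y\<bar> + 2 + 2 * \<Lambda>)) * (sqrt k * R)^2 \<le> 1" using s2 unfolding cc_def \<tau>_def .
    note E = g.one_step_error[OF less_imp_le[OF k] R(1) R(2) R(3) L1 rx(1) less_imp_le[OF rx(2)] ry(1) less_imp_le[OF ry(2)] c' st]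
    show "(\<integral>w. (cmod (Fct n (of_real h) (of_real h) x y w - Xct n x y w))^2 \<partial>M) \<le> lc * \<tau> ^ 6"
      using E(1) unfolding Fct_def Xct_def lc_def cc_def \<tau>_def \<xi>_def \<eta>_def .
    show "cmod (\<integral>w. (Fct n (of_real h) (of_real h) x y w - Xct n x y w) * cnj (Xct n x y w) \<partial>M) \<le> lc * \<tau> ^ 4"
      using E(2) unfolding Fct_def Xct_def lc_def cc_def \<tau>_def \<xi>_def \<eta>_def .
  qed
  have dist: "L2le M (\<lambda>w. (\<Prod>n<N. Fct n (of_real h) (of_real h) x y w) - (\<Prod>n<N. Xct n x y w)) (k * R ^ 4 * C3 \<Lambda> * wt2 x y)"
  proof (rule indep_product_distance[OF ind_Fct_Xct Fct_bound(1)[OF kb gx gy] Xct_bound(1) Fct_bound(2)[OF kb gx gy] Xct_bound(2) rr0 osg])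
    show "0 \<le> lc * \<tau> ^ 4" "0 \<le> lc * \<tau> ^ 6" using lc0 \<tau>0 by auto
    show "0 \<le> k * R ^ 4 * C3 \<Lambda> * wt2 x y"
      using k R wt2_pos[of x y] T_nonneg lc0 by (simp add: C3_def lc_def)
    have t6: "\<tau> ^ 6 \<le> \<tau> ^ 4" and t4: "\<tau> ^ 4 = k^2 * R ^ 4" and t6': "\<tau> ^ 6 = k * (k^2 * R ^ 6)"
    proof -
      have e: "\<tau> ^ 4 = \<tau>^2 * \<tau>^2" "\<tau> ^ 6 = \<tau>^2 * \<tau>^2 * \<tau>^2" by (simp_all add: power_add[symmetric])
      show "\<tau> ^ 6 \<le> \<tau> ^ 4" unfolding e by (rule mult_left_le[OF \<tau>1]) simp
      show "\<tau> ^ 4 = k^2 * R ^ 4" "\<tau> ^ 6 = k * (k^2 * R ^ 6)" unfolding e \<tau>2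
        by (simp_all add: power2_eq_square eval_nat_numeral mult_ac)
    qed
    define Q where "Q = k^2 * R ^ 8"
    have Q0: "0 \<le> Q" using R by (simp add: Q_def)
    have "real N * rr x y * (lc * \<tau> ^ 6) = rr x y * lc * T * (k^2 * R ^ 6)" unfolding t6' T by (simp add: mult_ac)
    also have "... \<le> rr x y * lc * T * Q"
      unfolding Q_def using rr0 lc0 T_nonneg R8 by (intro mult_left_mono mult_nonneg_nonneg) auto
    also have "... \<le> rr x y * lc * T * Q * (rr x y * exp c2)"
      using mult_left_mono[OF rr1, of "rr x y * lc * T * Q"] rr0 lc0 T_nonneg Q0 by simp
    finally have A: "real N * rr x y * (lc * \<tau> ^ 6) \<le> (rr x y)^2 * Q * (exp c2 * T * lc)" by (simp add: power2_eq_square mult_ac)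
    have "(real N)^2 * (lc * \<tau> ^ 4 + lc * \<tau> ^ 6) * (lc * \<tau> ^ 4) \<le> (real N)^2 * (lc * \<tau> ^ 4 + lc * \<tau> ^ 4) * (lc * \<tau> ^ 4)"
      using lc0 t6 \<tau>0 by (intro mult_right_mono mult_left_mono add_left_mono) auto
    also have "... = 2 * lc^2 * T^2 * Q" unfolding t4 T Q_def by (simp add: power2_eq_square eval_nat_numeral algebra_simps)
    also have "... * (1 * 1) \<le> 2 * lc^2 * T^2 * Q * ((rr x y * exp c2) * (rr x y * exp c2))"
      using rr1 rr0 Q0 lc0 by (intro mult_left_mono mult_mono) auto
    finally have B: "(real N)^2 * (lc * \<tau> ^ 4 + lc * \<tau> ^ 6) * (lc * \<tau> ^ 4) \<le> (rr x y)^2 * Q * (2 * exp c2 * exp c2 * lc^2 * T^2)"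
      by (simp add: power2_eq_square mult_ac)
    have C3sq: "(C3 \<Lambda>)^2 = exp c2 * T * lc + 2 * exp c2 * exp c2 * lc^2 * T^2"
      unfolding C3_def lc_def[symmetric] using lc0 T_nonneg by (intro real_sqrt_pow2 add_nonneg_nonneg mult_nonneg_nonneg) auto
    have "real N * rr x y * (lc * \<tau> ^ 6) + (real N)^2 * (lc * \<tau> ^ 4 + lc * \<tau> ^ 6) * (lc * \<tau> ^ 4) \<le> (rr x y)^2 * Q * (C3 \<Lambda>)^2"
      using A B unfolding C3sq distrib_left by linarith
    then have "rr x y ^ N * (real N * rr x y * (lc * \<tau> ^ 6) + (real N)^2 * (lc * \<tau> ^ 4 + lc * \<tau> ^ 6) * (lc * \<tau> ^ 4))
      \<le> (wt2 x y)^2 * ((rr x y)^2 * Q * (C3 \<Lambda>)^2)" unfolding rr_power by (intro mult_left_mono) auto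
    also have "... = (rr x y)^2 * (k * R ^ 4 * C3 \<Lambda> * wt2 x y)^2" unfolding Q_def by (simp add: power_mult_distrib power_mult[symmetric] mult_ac)
    finally show "rr x y ^ N * (real N * rr x y * (lc * \<tau> ^ 6) + (real N)^2 * (lc * \<tau> ^ 4 + lc * \<tau> ^ 6) * (lc * \<tau> ^ 4))
      \<le> (rr x y)^2 * (k * R ^ 4 * C3 \<Lambda> * wt2 x y)^2" .
  qed
  define g1 g2 i1 i2 where "g1 = gsym \<xi> (of_real h)" and "g2 = gsym \<eta> (of_real h)" and "i1 = \<i> / \<xi>" and "i2 = \<i> / \<eta>"
  have gd: "cmod (gsym \<zeta> (of_real h) - \<i> / \<zeta>) \<le> 3 * \<Lambda> * (k * R)" if "cmod \<zeta> \<le> R" "\<zeta> \<noteq> 0" for \<zeta>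
  proof -
    have "cmod (gsym \<zeta> (of_real h) - \<i> / \<zeta>) \<le> 3 * cmod \<zeta> * (cmod (of_real h))^2"
      by (rule gsym_complex_mesh_bound(2)) (use zh[OF that(1)] \<delta> that in auto)
    also have "... \<le> 3 * R * (\<Lambda> * k)" using that \<Lambda> h0 R by (intro mult_mono) auto
    finally show ?thesis by (simp add: mult_ac)
  qed
  have d1: "cmod (g1 - i1) \<le> 3 * \<Lambda> * (k * R)" "cmod (g2 - i2) \<le> 3 * \<Lambda> * (k * R)"
    unfolding g1_def g2_def i1_def i2_def using gd R Complex_ne_0 by (auto simp: \<xi>_def \<eta>_def)
  have b1: "cmod g2 \<le> G" "cmod i1 \<le> 1 / \<alpha>" "cmod i2 \<le> 1 / \<alpha>"
    using gy cmod_inv by (auto simp: g2_def i1_def i2_def \<xi>_def \<eta>_def good_def)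
  have gg: "cmod (g1 * g2 - i1 * i2) \<le> 3 * \<Lambda> * (k * R) * (G + 1 / \<alpha>)"
  proof -
    have "g1 * g2 - i1 * i2 = (g1 - i1) * g2 + i1 * (g2 - i2)" by (simp add: algebra_simps)
    then have "cmod (g1 * g2 - i1 * i2) \<le> cmod (g1 - i1) * cmod g2 + cmod i1 * cmod (g2 - i2)"
      using norm_triangle_ineq[of "(g1 - i1) * g2" "i1 * (g2 - i2)"] by (simp add: norm_mult)
    also have "... \<le> 3 * \<Lambda> * (k * R) * G + 1 / \<alpha> * (3 * \<Lambda> * (k * R))"
      using d1 b1 \<Lambda> k R \<alpha> by (intro add_mono mult_mono) auto
    finally show ?thesis by (simp add: algebra_simps)
  qed
  have ii: "cmod (i1 * i2) \<le> 1 / \<alpha>^2"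
    using mult_mono[OF b1(2) b1(3)] \<alpha> by (simp add: norm_mult power2_eq_square)
  let ?P = "\<lambda>w. \<Prod>n<N. Fct n (of_real h) (of_real h) x y w" and ?X = "\<lambda>w. \<Prod>n<N. Xct n x y w"
  \<comment> \<open>The error of the functional acts on the discrete product, and the exact
    functional on the error of the product.\<close>
  have "L2le M (\<lambda>w. (g1 * g2 - i1 * i2) * Base x y * ?P w + i1 * i2 * Base x y * (?P w - ?X w))
     (cmod ((g1 * g2 - i1 * i2) * Base x y) * wt x y + cmod (i1 * i2 * Base x y) * (k * R ^ 4 * C3 \<Lambda> * wt2 x y))"
    by (rule L2le_add[OF L2le_cmult[OF L2le_prod_Fct[OF kb gx gy]] L2le_cmult[OF dist]])
  also have "(\<lambda>w. (g1 * g2 - i1 * i2) * Base x y * ?P w + i1 * i2 * Base x y * (?P w - ?X w))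
     = (\<lambda>w. \<Phi> (of_real h) (of_real h) x y w - Ext x y w)"
    unfolding \<Phi>_def Ext_def g1_def g2_def i1_def i2_def \<xi>_def \<eta>_def by (rule ext) (simp add: algebra_simps)
  finally show "L2le M (\<lambda>w. \<Phi> (of_real h) (of_real h) x y w - Ext x y w)
      (k * R ^ 4 * wt2 x y * (E0 * (3 * \<Lambda> * (G + 1 / \<alpha>) + C3 \<Lambda> / \<alpha>^2)))"
  proof (rule L2le_mono)
    have "R \<le> R ^ 4" using R by (simp add: self_le_power)
    then have "cmod (g1 * g2 - i1 * i2) \<le> 3 * \<Lambda> * (k * R ^ 4) * (G + 1 / \<alpha>)"
      by (intro order_trans[OF gg] mult_right_mono mult_left_mono) (use \<Lambda> k G_pos \<alpha> in auto)
    then have 1: "cmod ((g1 * g2 - i1 * i2) * Base x y) * wt x y \<le> 3 * \<Lambda> * (k * R ^ 4) * (G + 1 / \<alpha>) * E0 * wt2 x y"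
      unfolding norm_mult cmod_Base using wt_le[of x y] wt_pos[of x y] E0_pos G_pos \<alpha> k \<Lambda> R by (intro mult_mono) auto
    have C30: "0 \<le> C3 \<Lambda>" unfolding C3_def lc_def[symmetric] using lc0 T_nonneg by simp
    have 2: "cmod (i1 * i2 * Base x y) * (k * R ^ 4 * C3 \<Lambda> * wt2 x y) \<le> 1 / \<alpha>^2 * E0 * (k * R ^ 4 * C3 \<Lambda> * wt2 x y)"
      unfolding norm_mult[of "i1 * i2"] cmod_Base using ii E0_pos k C30 wt2_pos[of x y] R
      by (intro mult_right_mono mult_nonneg_nonneg) auto
    show "cmod ((g1 * g2 - i1 * i2) * Base x y) * wt x y + cmod (i1 * i2 * Base x y) * (k * R ^ 4 * C3 \<Lambda> * wt2 x y)
      \<le> k * R ^ 4 * wt2 x y * (E0 * (3 * \<Lambda> * (G + 1 / \<alpha>) + C3 \<Lambda> / \<alpha>^2))"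
      using add_mono[OF 1 2] by (simp add: distrib_left distrib_right mult_ac)
  qed
qed

lemma L2le_diagonal:
  fixes h \<Lambda> x y :: real
  assumes h: "mesh h" and \<Lambda>: "1 \<le> \<Lambda>" "h^2 \<le> \<Lambda> * k"
  defines "R \<equiv> 1 + cmod (Complex x \<alpha>) + cmod (Complex y \<alpha>)"
  shows "L2le M (\<lambda>w. cutoff x h * (cutoff y h * \<Phi> (of_real h) (of_real h) x y w) - Ext x y w) (k * C4 \<Lambda> * (R ^ 4 * wt2 x y))"
proof -
  have h0: "0 < h" "h \<le> h0" using h by (auto simp: mesh_def)
  have R: "1 \<le> R" by (simp add: R_def)
  have cc0: "0 < cc \<Lambda>" unfolding cc_def using \<Lambda> by (intro mult_pos_pos add_nonneg_pos add_nonneg_nonneg) auto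
  have s00: "0 < s0 \<Lambda>" using \<delta> \<Lambda> cc0 by (simp add: s0_def)
  have C30: "0 \<le> C3 \<Lambda>" unfolding C3_def using local_constant_nonneg[of "cc \<Lambda>"] cc0 T_nonneg by simp
  have Q0: "0 \<le> k * R ^ 4 * wt2 x y" using k R wt2_pos[of x y] by simp
  show ?thesis
  proof (cases "k * R^2 \<le> s0 \<Lambda>")
    case True
    note D = L2le_diagonal_resolved[OF h \<Lambda> True[unfolded R_def]]
    have c1: "cutoff x h = 1" "cutoff y h = 1" using D(1,2) by (auto simp: cutoff_def)
    show ?thesis unfolding c1 mult_1
    proof (rule L2le_mono[OF D(3)])
      have "E0 * (3 * \<Lambda> * (G + 1 / \<alpha>) + C3 \<Lambda> / \<alpha>^2) \<le> C4 \<Lambda>"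
        unfolding C4_def using E0_pos s00 by (intro mult_left_mono) auto
      then have "k * R ^ 4 * wt2 x y * (E0 * (3 * \<Lambda> * (G + 1 / \<alpha>) + C3 \<Lambda> / \<alpha>^2)) \<le> k * R ^ 4 * wt2 x y * C4 \<Lambda>"
        using Q0 by (rule mult_left_mono)
      then show "k * (1 + cmod (Complex x \<alpha>) + cmod (Complex y \<alpha>)) ^ 4 * wt2 x y * (E0 * (3 * \<Lambda> * (G + 1 / \<alpha>) + C3 \<Lambda> / \<alpha>^2))
          \<le> k * C4 \<Lambda> * (R ^ 4 * wt2 x y)" unfolding R_def by (simp only: mult_ac)
    qed
  next
    case False
    have "L2le M (\<lambda>w. cutoff x h * (cutoff y h * \<Phi> (of_real h) (of_real h) x y w)) (G^2 * E0 * wt x y)"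
    proof (cases "\<bar>x\<bar> * h \<le> pi \<and> \<bar>y\<bar> * h \<le> pi")
      case True
      then have c1: "cutoff x h = 1" "cutoff y h = 1" by (auto simp: cutoff_def)
      show ?thesis unfolding c1 mult_1 using True
        by (intro L2le_Phi K_bound[OF h h] good_real h0) auto
    next
      case False
      then have z: "cutoff x h * (cutoff y h * u) = 0" for u by (auto simp: cutoff_def)
      show ?thesis unfolding z by (rule L2le_mono[OF L2le_0]) (use E0_pos wt_pos[of x y] in simp)
    qed
    from L2le_diff[OF this L2le_Ext[of x y]]
    show ?thesis
    proof (rule L2le_mono)
      have "s0 \<Lambda> * 1 \<le> k * R^2 * R^2" using False k R by (intro mult_mono) (auto simp: one_le_power)
      then have "1 \<le> k * R ^ 4 / s0 \<Lambda>" using s00 by (simp add: power_add[symmetric] mult.assoc)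
      moreover have "0 \<le> (G^2 + 1 / \<alpha>^2) * E0 * wt2 x y" using E0_pos wt2_pos[of x y] by simp
      ultimately have "(G^2 + 1 / \<alpha>^2) * E0 * wt2 x y * 1 \<le> (G^2 + 1 / \<alpha>^2) * E0 * wt2 x y * (k * R ^ 4 / s0 \<Lambda>)"
        by (rule mult_left_mono)
      also have "... = k * R ^ 4 * wt2 x y * (E0 * ((G^2 + 1 / \<alpha>^2) / s0 \<Lambda>))" by (simp add: mult_ac)
      also have "... \<le> k * R ^ 4 * wt2 x y * C4 \<Lambda>"
        unfolding C4_def using Q0 E0_pos C30 \<Lambda> G_pos \<alpha> by (intro mult_left_mono) auto
      finally have 1: "(G^2 + 1 / \<alpha>^2) * E0 * wt2 x y \<le> k * C4 \<Lambda> * (R ^ 4 * wt2 x y)" by (simp add: mult_ac)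
      have "G^2 * E0 * wt x y + 1 / \<alpha>^2 * E0 * wt2 x y \<le> G^2 * E0 * wt2 x y + 1 / \<alpha>^2 * E0 * wt2 x y"
        using wt_le[of x y] E0_pos by (intro add_right_mono mult_left_mono) auto
      then show "G^2 * E0 * wt x y + 1 / \<alpha>^2 * E0 * wt2 x y \<le> k * C4 \<Lambda> * (R ^ 4 * wt2 x y)"
        using 1 by (simp add: distrib_right)
    qed
  qed
qed

lemma C4_pos: "1 \<le> \<Lambda> \<Longrightarrow> 0 < C4 \<Lambda>"
proof -
  assume \<Lambda>: "1 \<le> \<Lambda>"
  have cc0: "0 < cc \<Lambda>" unfolding cc_def using \<Lambda> by (intro mult_pos_pos add_nonneg_pos add_nonneg_nonneg) auto
  have s00: "0 < s0 \<Lambda>" using \<delta> \<Lambda> cc0 by (simp add: s0_def)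
  have C30: "0 \<le> C3 \<Lambda>" unfolding C3_def using local_constant_nonneg[of "cc \<Lambda>"] cc0 T_nonneg by simp
  show ?thesis unfolding C4_def using E0_pos G_pos \<alpha> \<Lambda> C30 s00
    by (intro mult_pos_pos add_pos_nonneg add_pos_nonneg) auto
qed

lemma wt2_eq: "wt2 x y = exp (C2 * T / 2) * (exp (- (c2 * T / 2 * x^2)) * exp (- (c2 * T / 2 * y^2)))"
  unfolding wt2_def exp_add[symmetric] by (rule arg_cong[of _ _ exp]) (simp add: field_simps)

lemma weight_le_gw: "(1 + cmod (Complex x \<alpha>) + cmod (Complex y \<alpha>)) ^ 4 * wt2 x y \<le> 81 * exp (C2 * T / 2) * gw 4 (c2 * T / 2) (x, y)"
proof -
  have "1 + cmod (Complex x \<alpha>) + cmod (Complex y \<alpha>) \<le> 1 + (1 + \<bar>x\<bar>) + (1 + \<bar>y\<bar>)"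
    by (intro add_mono order_refl cmod_Complex_le)
  also have "... \<le> 3 * ((1 + \<bar>x\<bar>) * (1 + \<bar>y\<bar>))" by (simp add: algebra_simps)
  finally have "(1 + cmod (Complex x \<alpha>) + cmod (Complex y \<alpha>)) ^ 4 \<le> (3 * ((1 + \<bar>x\<bar>) * (1 + \<bar>y\<bar>))) ^ 4"
    by (intro power_mono) auto
  also have "... = 81 * ((1 + \<bar>x\<bar>) ^ 4 * (1 + \<bar>y\<bar>) ^ 4)" by (simp add: power_mult_distrib)
  finally have "(1 + cmod (Complex x \<alpha>) + cmod (Complex y \<alpha>)) ^ 4 * wt2 x y \<le> 81 * ((1 + \<bar>x\<bar>) ^ 4 * (1 + \<bar>y\<bar>) ^ 4) * wt2 x y"
    by (rule mult_right_mono) (simp add: wt2_def)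
  then show ?thesis unfolding wt2_eq gw_def gw1_def by (simp add: mult_ac)
qed

lemma L2le_Ext_integral:
  assumes T0: "0 < T"
  shows "L2le M (\<lambda>w. \<integral>p. Ext (fst p) (snd p) w \<partial>plane) (1 / \<alpha>^2 * E0 * (81 * exp (C2 * T / 2)) * GI 4 (c2 * T / 2))"
proof (rule L2le_gw_integral)
  show "(\<lambda>(p, w). Ext (fst p) (snd p) w) \<in> borel_measurable (plane \<Otimes>\<^sub>M M)" by measurable
  show "0 < 1 / \<alpha>^2 * E0 * (81 * exp (C2 * T / 2))" using \<alpha> E0_pos by simp
  show "0 < c2 * T / 2" using c2 T0 by simp
  fix x y
  have "L2le M (Ext x y) (1 / \<alpha>^2 * E0 * (81 * exp (C2 * T / 2)) * gw 4 (c2 * T / 2) (x, y))"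
  proof (rule L2le_mono[OF L2le_Ext])
    have "1 * wt2 x y \<le> (1 + cmod (Complex x \<alpha>) + cmod (Complex y \<alpha>)) ^ 4 * wt2 x y"
      by (intro mult_right_mono one_le_power) (auto simp: wt2_def)
    then have "wt2 x y \<le> 81 * exp (C2 * T / 2) * gw 4 (c2 * T / 2) (x, y)" using weight_le_gw[of x y] by linarith
    then have "1 / \<alpha>^2 * E0 * wt2 x y \<le> 1 / \<alpha>^2 * E0 * (81 * exp (C2 * T / 2) * gw 4 (c2 * T / 2) (x, y))"
      using E0_pos by (intro mult_left_mono) auto
    then show "1 / \<alpha>^2 * E0 * wt2 x y \<le> 1 / \<alpha>^2 * E0 * (81 * exp (C2 * T / 2)) * gw 4 (c2 * T / 2) (x, y)" by (simp only: mult.assoc)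
  qed
  then show "L2le M (Ext (fst (x, y)) (snd (x, y))) (1 / \<alpha>^2 * E0 * (81 * exp (C2 * T / 2)) * gw 4 (c2 * T / 2) (x, y))" by simp
qed

lemma L2le_diagonal_integral:
  assumes T0: "0 < T" and h: "mesh h" and \<Lambda>: "1 \<le> \<Lambda>" "h^2 \<le> \<Lambda> * k"
  shows "L2le M (\<lambda>w. \<integral>p. cutoff (fst p) h * (cutoff (snd p) h * \<Phi> (of_real h) (of_real h) (fst p) (snd p) w) - Ext (fst p) (snd p) w \<partial>plane)
    (k * C4 \<Lambda> * (81 * exp (C2 * T / 2)) * GI 4 (c2 * T / 2))"
proof (rule L2le_gw_integral)
  show "(\<lambda>(p, w). cutoff (fst p) h * (cutoff (snd p) h * \<Phi> (of_real h) (of_real h) (fst p) (snd p) w) - Ext (fst p) (snd p) w)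
     \<in> borel_measurable (plane \<Otimes>\<^sub>M M)" by measurable
  show "0 < k * C4 \<Lambda> * (81 * exp (C2 * T / 2))" using k C4_pos[OF \<Lambda>(1)] by simp
  show "0 < c2 * T / 2" using c2 T0 by simp
  fix x y
  have "L2le M (\<lambda>w. cutoff x h * (cutoff y h * \<Phi> (of_real h) (of_real h) x y w) - Ext x y w) (k * C4 \<Lambda> * (81 * exp (C2 * T / 2)) * gw 4 (c2 * T / 2) (x, y))"
  proof (rule L2le_mono[OF L2le_diagonal[OF h \<Lambda>]])
    have "k * C4 \<Lambda> * ((1 + cmod (Complex x \<alpha>) + cmod (Complex y \<alpha>)) ^ 4 * wt2 x y) \<le> k * C4 \<Lambda> * (81 * exp (C2 * T / 2) * gw 4 (c2 * T / 2) (x, y))"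
      using k C4_pos[OF \<Lambda>(1)] by (intro mult_left_mono weight_le_gw) auto
    then show "k * C4 \<Lambda> * ((1 + cmod (Complex x \<alpha>) + cmod (Complex y \<alpha>)) ^ 4 * wt2 x y) \<le> k * C4 \<Lambda> * (81 * exp (C2 * T / 2)) * gw 4 (c2 * T / 2) (x, y)"
      by (simp only: mult.assoc)
  qed
  then show "L2le M (\<lambda>w. cutoff (fst (x, y)) h * (cutoff (snd (x, y)) h * \<Phi> (of_real h) (of_real h) (fst (x, y)) (snd (x, y)) w) - Ext (fst (x, y)) (snd (x, y)) w)
     (k * C4 \<Lambda> * (81 * exp (C2 * T / 2)) * gw 4 (c2 * T / 2) (x, y))" by simp
qed

end

section \<open>Sparse combination\<close>

lemma (in correlated_brownian_motion) gauss_pair_increments: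
  assumes k: "k > 0" and \<rho>: "\<bar>\<rho>\<bar> \<le> 1"
  shows "gauss_pair M \<rho> (\<lambda>w. increment_x k (\<lambda>t. W t w) n) (\<lambda>w. increment_y k (\<lambda>t. W t w) n)"
proof unfold_locales
  have [measurable]: "W t \<in> borel_measurable M" if "0 \<le> t" for t using measurable_W[OF that] .
  have fs [measurable]: "(\<lambda>w. fst (W t w)) \<in> borel_measurable M" "(\<lambda>w. snd (W t w)) \<in> borel_measurable M" if "0 \<le> t" for t
    using measurable_W[OF that] unfolding borel_prod[symmetric] by measurable
  have t0: "0 \<le> real n * k" "0 \<le> real (n + 1) * k" using k by auto
  show "(\<lambda>w. increment_x k (\<lambda>t. W t w) n) \<in> borel_measurable M" "(\<lambda>w. increment_y k (\<lambda>t. W t w) n) \<in> borel_measurable M"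
    unfolding increment_x_def increment_y_def using fs[OF t0(1)] fs[OF t0(2)] by measurable
  show "\<bar>\<rho>\<bar> \<le> 1" by fact
  fix a b :: real
  have lt: "real n * k < real (n + 1) * k" using k by simp
  have d: "real (n + 1) * k - real n * k = k" by (simp add: algebra_simps)
  have "(\<lambda>w. a * increment_x k (\<lambda>t. W t w) n + b * increment_y k (\<lambda>t. W t w) n)
      = (\<lambda>w. (a / sqrt k) * fst (W (real (n + 1) * k) w - W (real n * k) w) + (b / sqrt k) * snd (W (real (n + 1) * k) w - W (real n * k) w))"
    by (simp add: increment_x_def increment_y_def)
  moreover have "k * ((a / sqrt k)^2 + 2 * \<rho> * (a / sqrt k) * (b / sqrt k) + (b / sqrt k)^2) = a^2 + 2 * \<rho> * a * b + b^2"
  proof -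
    have "sqrt k * sqrt k = k" "sqrt k \<noteq> 0" using k by auto
    then have "(a / sqrt k)^2 = a^2 / k" "(b / sqrt k)^2 = b^2 / k" "2 * \<rho> * (a / sqrt k) * (b / sqrt k) = 2 * \<rho> * a * b / k"
      by (simp_all add: power_divide power2_eq_square)
    then show ?thesis using k by (simp add: distrib_left)
  qed
  ultimately show "distr M borel (\<lambda>w. a * increment_x k (\<lambda>t. W t w) n + b * increment_y k (\<lambda>t. W t w) n)
      = centred_normal (sqrt (a^2 + 2 * \<rho> * a * b + b^2))"
    using gaussian_increments[OF t0(1) lt, of "a / sqrt k" "b / sqrt k"] unfolding d by simp
qed

lemma (in correlated_brownian_motion) indep_increments:
  assumes k: "k > 0"
  shows "indep_vars (\<lambda>_. borel) (\<lambda>n w. (increment_x k (\<lambda>t. W t w) n, increment_y k (\<lambda>t. W t w) n)) {..<N}"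
proof -
  have i: "indep_vars (\<lambda>_. borel) (\<lambda>n w. W (real (Suc n) * k) w - W (real n * k) w) {..<N}"
    by (rule independent_increments) (use k in auto)
  have m: "(\<lambda>p :: real \<times> real. (fst p / sqrt k, snd p / sqrt k)) \<in> borel_measurable borel"
    by (intro borel_measurable_continuous_onI continuous_intros) (use k in auto)
  show ?thesis using indep_vars_compose2[OF i m] by (simp add: increment_x_def increment_y_def)
qed

lemma sum_delta1: "(\<Sum>a\<le>L. delta1 F a b) = F L b"
  by (induction L) (auto simp: delta1_def)

lemma sum_delta2: "(\<Sum>b\<le>L. delta2 F a b) = F a L"
  by (induction L) (auto simp: delta2_def)

text \<open>The differences over the full box \<open>{..l + 1} \<times> {..l + 1}\<close> telescope
  to the value at its corner.\<close>

lemma sparse_telescope: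
  fixes F :: "nat \<Rightarrow> nat \<Rightarrow> real"
  shows "(\<Sum>(a, b)\<in>sparse_indices l. delta1 (delta2 F) a b)
    = F (l + 1) (l + 1) - (\<Sum>(a, b)\<in>{..l + 1} \<times> {..l + 1} - sparse_indices l. delta1 (delta2 F) a b)"
proof -
  have sub: "sparse_indices l \<subseteq> {..l + 1} \<times> {..l + 1}" by (auto simp: sparse_indices_def)
  have "(\<Sum>(a, b)\<in>{..l + 1} \<times> {..l + 1}. delta1 (delta2 F) a b) = (\<Sum>b\<le>l + 1. \<Sum>a\<le>l + 1. delta1 (delta2 F) a b)"
    by (subst sum.swap) (rule sum.cartesian_product[symmetric])
  also have "... = F (l + 1) (l + 1)" unfolding sum_delta1 sum_delta2 ..
  finally show ?thesis using sum.subset_diff[OF sub, of "\<lambda>(a, b). delta1 (delta2 F) a b"] by simp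
qed

lemma L2le_integrable_square:
  fixes f :: "'a \<Rightarrow> real"
  assumes "L2le M f B"
  shows "integrable M (\<lambda>w. (f w)^2)" "(\<integral>w. (f w)^2 \<partial>M) \<le> B^2"
proof -
  note D = L2leD[OF assms]
  have [measurable]: "f \<in> borel_measurable M" by (rule D(1))
  have n: "(\<integral>\<^sup>+w. ennreal ((f w)^2) \<partial>M) \<le> ennreal (B^2)" using D(3) by simp
  show i: "integrable M (\<lambda>w. (f w)^2)"
    by (rule integrableI_nonneg) (auto intro: le_less_trans[OF n])
  have "ennreal (\<integral>w. (f w)^2 \<partial>M) \<le> ennreal (B^2)" using n nn_integral_eq_integral[OF i] by simp
  then show "(\<integral>w. (f w)^2 \<partial>M) \<le> B^2" by simp
qed

lemma L2le_cong_AE: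
  fixes f :: "'a \<Rightarrow> real"
  assumes "L2le M f B" "g \<in> borel_measurable M" "AE w in M. f w = g w"
  shows "L2le M g B"
proof -
  have "(\<integral>\<^sup>+w. ennreal ((norm (g w))^2) \<partial>M) = (\<integral>\<^sup>+w. ennreal ((norm (f w))^2) \<partial>M)"
    by (rule nn_integral_cong_AE) (use assms(3) in \<open>eventually_elim, simp\<close>)
  then show ?thesis using assms by (simp add: L2le_def)
qed

lemma L2le_scaled_Re:
  fixes f :: "'a \<Rightarrow> complex"
  assumes f: "L2le M f B"
  shows "L2le M (\<lambda>w. 1 / (4 * pi^2) * Re (f w)) B"
proof -
  have "1 * 1 \<le> pi * pi" using pi_gt3 by (intro mult_mono) auto
  then have p: "1 / (4 * pi^2) \<le> 1" by (simp add: power2_eq_square)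
  have "L2le M (\<lambda>w. 1 / (4 * pi^2) * Re (f w)) (1 * B)"
  proof (rule L2le_bound[OF f])
    fix w
    have "1 / (4 * pi^2) * \<bar>Re (f w)\<bar> \<le> 1 * cmod (f w)" using p by (intro mult_mono abs_Re_le_cmod) auto
    then show "norm (1 / (4 * pi^2) * Re (f w)) \<le> 1 * norm (f w)" by (simp add: abs_mult)
    show "(\<lambda>w. 1 / (4 * pi^2) * Re (f w)) \<in> borel_measurable M"
      by (intro borel_measurable_times borel_measurable_const measurable_compose[OF L2leD(1)[OF f] borel_measurable_Re])
  qed simp
  then show ?thesis by simp
qed

text \<open>The squared sparse error carries \<open>(real l + 2) ^ 4\<close>, which is absorbed by
  lowering the rate from 16 to 14, since \<open>(33 / 32) ^ 4\<close> is below
  \<open>16 / 14\<close>.\<close>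

lemma quartic_le_geometric: "(real l + 2) ^ 4 / 16 ^ l \<le> 64 ^ 4 / 14 ^ l"
proof -
  have "(real l + 2) / 64 \<le> 1 + real l * (1 / 32)" by simp
  also have "... \<le> (1 + 1 / 32) ^ l" by (rule Bernoulli_inequality) simp
  finally have "((real l + 2) / 64) ^ 4 \<le> ((33 / 32) ^ l) ^ 4" by (intro power_mono) auto
  also have "... = ((33 / 32) ^ 4) ^ l" by (simp only: power_mult[symmetric] mult.commute)
  also have "... \<le> (16 / 14) ^ l" by (intro power_mono) (auto simp: power4_eq_xxxx)
  finally have "(real l + 2) ^ 4 \<le> 64 ^ 4 * (16 / 14) ^ l" by (simp add: power_divide mult_ac)
  then have "(real l + 2) ^ 4 / 16 ^ l \<le> 64 ^ 4 * (16 / 14) ^ l / 16 ^ l" by (intro divide_right_mono) auto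
  also have "... = 64 ^ 4 * ((16 / 14) ^ l / 16 ^ l)" by simp
  also have "((16 / 14) ^ l / 16 ^ l :: real) = 1 / 14 ^ l" unfolding power_divide[symmetric] by (simp add: power_divide)
  finally show ?thesis by simp
qed

text \<open>A time level together with the Brownian path and the meshes \<open>h0 / 2 ^ m\<close> up
  to \<open>m = L\<close>. Since the starting point is a multiple of \<open>h0\<close> in each
  coordinate, it is a grid point of all of them.\<close>

locale sparse_level = correlated_brownian_motion M \<rho>xy W + fourier_level M \<rho>xy T \<mu>x \<mu>y \<rho>x \<rho>y x0 y0 h0 k \<alpha> \<delta> \<epsilon> c K N
    "\<lambda>n w. increment_x k (\<lambda>t. W t w) n" "\<lambda>n w. increment_y k (\<lambda>t. W t w) n"
  for M :: "'a measure" and \<rho>xy W T \<mu>x \<mu>y \<rho>x \<rho>y x0 y0 h0 k \<alpha> \<delta> \<epsilon> c K N +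
  fixes L :: nat and i j :: int and \<Lambda> :: real
  assumes T0: "T > 0" and h0: "h0 > 0" and x0: "x0 = of_int i * h0" and y0: "y0 = of_int j * h0"
    and meshes: "\<And>m. m \<le> L \<Longrightarrow> mesh (h0 / 2 ^ m)" and \<Lambda>: "1 \<le> \<Lambda>" "(h0 / 2 ^ L)^2 \<le> \<Lambda> * k"
begin

abbreviation path_of :: "'a \<Rightarrow> path" where "path_of w \<equiv> (\<lambda>t. W t w)"
definition "F w = grid_functional T \<mu>x \<mu>y \<rho>x \<rho>y x0 y0 h0 (path_of w) N"
definition "P w = exact_functional T \<mu>x \<mu>y \<rho>x \<rho>y x0 y0 (path_of w)"
definition "gI a b w = (\<lambda>p. cutoff (fst p) (h0 / 2 ^ a) * (cutoff (snd p) (h0 / 2 ^ b)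
    * \<Phi> (of_real (h0 / 2 ^ a)) (of_real (h0 / 2 ^ b)) (fst p) (snd p) w))"

lemma N0: "T / real N = k"
proof -
  have "N \<noteq> 0" using T T0 by (intro notI) simp
  then show ?thesis using T by simp
qed

lemma F_eq:
  assumes "a \<le> L" "b \<le> L"
  shows "integrable plane (gI a b w)"
    and "F w a b = 1 / (4 * pi^2) * Re (\<integral>p. gI a b w p \<partial>plane)"
proof -
  have x: "x0 = of_int (i * 2 ^ a) * (h0 / 2 ^ a)" "y0 = of_int (j * 2 ^ b) * (h0 / 2 ^ b)" by (simp_all add: x0 y0)
  note R = functional_fourier[OF meshes[OF assms(1)] meshes[OF assms(2)] x, of "path_of w" w, OF refl refl]
  show "integrable plane (gI a b w)" using R(1) by (simp add: gI_def case_prod_unfold)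
  show "F w a b = 1 / (4 * pi^2) * Re (\<integral>p. gI a b w p \<partial>plane)"
    using R(2) by (simp add: F_def grid_functional_def Let_def N0 gI_def case_prod_unfold)
qed

text \<open>Doubling the mesh size \<open>h0 / 2 ^ a\<close> gives that of index
  \<open>a - 1\<close>, so the four functionals combine to a single integral of
  \<open>dPhi\<close>.\<close>

lemma L2le_delta:
  assumes a: "0 < a" "a \<le> L" and b: "0 < b" "b \<le> L"
  shows "L2le M (\<lambda>w. delta1 (delta2 (F w)) a b)
    (1024 / \<delta> ^ 4 * G^2 * E0 * exp (T / 2) * ((h0 / 2 ^ a)^2 * (h0 / 2 ^ b)^2) * GI 2 (c * T / 2))"
proof -
  have half: "2 * (h0 / 2 ^ m) = h0 / 2 ^ (m - 1)" "2 * (h0 / 2 ^ m) \<le> h0" if m0: "0 < m" for m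
  proof -
    obtain m' where m: "m = Suc m'" using m0 gr0_conv_Suc by auto
    show "2 * (h0 / 2 ^ m) = h0 / 2 ^ (m - 1)" by (simp add: m)
    have "h0 / 2 ^ m' \<le> h0 / 1" using h0 by (intro divide_left_mono) auto
    then show "2 * (h0 / 2 ^ m) \<le> h0" by (simp add: m)
  qed
  have le: "a - 1 \<le> L" "b - 1 \<le> L" using a b by auto
  have "(\<integral>p. dPhi (h0 / 2 ^ a) (h0 / 2 ^ b) (fst p) (snd p) w \<partial>plane)
     = (\<integral>p. gI a b w p \<partial>plane) - (\<integral>p. gI a (b - 1) w p \<partial>plane)
      - ((\<integral>p. gI (a - 1) b w p \<partial>plane) - (\<integral>p. gI (a - 1) (b - 1) w p \<partial>plane))" for w
  proof -
    have "dPhi (h0 / 2 ^ a) (h0 / 2 ^ b) (fst p) (snd p) w = gI a b w p - gI a (b - 1) w p - (gI (a - 1) b w p - gI (a - 1) (b - 1) w p)" for p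
      unfolding dPhi_def gI_def half[OF a(1)] half[OF b(1)] by (simp add: right_diff_distrib)
    then show ?thesis using F_eq(1) a b le by simp
  qed
  then have eq: "delta1 (delta2 (F w)) a b = 1 / (4 * pi^2) * Re (\<integral>p. dPhi (h0 / 2 ^ a) (h0 / 2 ^ b) (fst p) (snd p) w \<partial>plane)" for w
    using a b le by (simp add: delta1_def delta2_def F_eq(2) diff_divide_distrib)
  show ?thesis unfolding eq
    by (rule L2le_scaled_Re[OF L2le_mixed_difference[OF meshes[OF a(2)] half(2)[OF a(1)] meshes[OF b(2)] half(2)[OF b(1)] T0]])
qed

text \<open>The exponents are linear in the increments, which sum up to \<open>W T w\<close> when
  the path starts at 0. Together with the drift and heat parts the product of the steps is therefore
  the exact symbol, without discretisation error.\<close>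

lemma Ext_eq_normal_symbol:
  assumes "W 0 w = (0, 0)"
  shows "Ext x y w = normal_symbol (x0 + \<mu>x * T + sqrt \<rho>x * fst (W T w)) ((1 - \<rho>x) * T) (Complex x \<alpha>)
    * normal_symbol (y0 + \<mu>y * T + sqrt \<rho>y * snd (W T w)) ((1 - \<rho>y) * T) (Complex y \<alpha>)"
proof -
  define \<xi> \<eta> where "\<xi> = Complex x \<alpha>" and "\<eta> = Complex y \<alpha>"
  have sk: "sqrt k \<noteq> 0" using k by simp
  have su: "(\<Sum>n<m. sqrt k * increment_x k (path_of w) n) = fst (W (real m * k) w)" for m
    by (induction m) (use assms sk in \<open>auto simp: increment_x_def add.commute\<close>)
  have sv: "(\<Sum>n<m. sqrt k * increment_y k (path_of w) n) = snd (W (real m * k) w)" for m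
    by (induction m) (use assms sk in \<open>auto simp: increment_y_def add.commute\<close>)
  define e where "e = (\<lambda>n. - \<i> * (of_real (sqrt (k * \<rho>x)) * \<xi> * of_real (increment_x k (path_of w) n) + of_real (sqrt (k * \<rho>y)) * \<eta> * of_real (increment_y k (path_of w) n))
     - of_real k * (\<i> * (\<mu>x * \<xi> + \<mu>y * \<eta>) + ((1 - \<rho>x) * \<xi>^2 + (1 - \<rho>y) * \<eta>^2) / 2))"
  have e_eq: "e n = - \<i> * (of_real (sqrt \<rho>x) * \<xi> * of_real (sqrt k * increment_x k (path_of w) n) + of_real (sqrt \<rho>y) * \<eta> * of_real (sqrt k * increment_y k (path_of w) n))
     - of_real k * (\<i> * (\<mu>x * \<xi> + \<mu>y * \<eta>) + ((1 - \<rho>x) * \<xi>^2 + (1 - \<rho>y) * \<eta>^2) / 2)" for n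
    by (simp add: e_def real_sqrt_mult mult_ac)
  have sums: "(\<Sum>n<m. - \<i> * (p * of_real (a n) + q * of_real (b n)) - d) = - \<i> * (p * of_real (\<Sum>n<m. a n) + q * of_real (\<Sum>n<m. b n)) - of_nat m * d"
    for p q d :: complex and a b :: "nat \<Rightarrow> real" and m
  proof (induction m)
    case (Suc m)
    then show ?case by (simp only: sum.lessThan_Suc of_real_add of_nat_Suc) (simp add: distrib_left distrib_right)
  qed simp
  have "(\<Prod>n<N. Xct n x y w) = exp (\<Sum>n<N. e n)"
    by (simp add: exp_sum Xct_def exact_step_def e_def \<xi>_def \<eta>_def)
  also have "(\<Sum>n<N. e n) = - \<i> * (of_real (sqrt \<rho>x) * \<xi> * of_real (\<Sum>n<N. sqrt k * increment_x k (path_of w) n) + of_real (sqrt \<rho>y) * \<eta> * of_real (\<Sum>n<N. sqrt k * increment_y k (path_of w) n))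
     - of_nat N * (of_real k * (\<i> * (\<mu>x * \<xi> + \<mu>y * \<eta>) + ((1 - \<rho>x) * \<xi>^2 + (1 - \<rho>y) * \<eta>^2) / 2))"
    unfolding e_eq by (rule sums)
  also have "... = - \<i> * (of_real (sqrt \<rho>x) * \<xi> * of_real (fst (W T w)) + of_real (sqrt \<rho>y) * \<eta> * of_real (snd (W T w)))
     - of_real T * (\<i> * (\<mu>x * \<xi> + \<mu>y * \<eta>) + ((1 - \<rho>x) * \<xi>^2 + (1 - \<rho>y) * \<eta>^2) / 2)"
  proof -
    have T': "real N * k = T" by (simp add: T)
    have "complex_of_real T = of_nat N * of_real k" by (simp add: T)
    then show ?thesis unfolding su sv T' by simp
  qed
  finally have P: "(\<Prod>n<N. Xct n x y w) = exp (- \<i> * (of_real (sqrt \<rho>x) * \<xi> * of_real (fst (W T w)) + of_real (sqrt \<rho>y) * \<eta> * of_real (snd (W T w)))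
     - of_real T * (\<i> * (\<mu>x * \<xi> + \<mu>y * \<eta>) + ((1 - \<rho>x) * \<xi>^2 + (1 - \<rho>y) * \<eta>^2) / 2))" .
  have "Base x y * (\<Prod>n<N. Xct n x y w) = exp (- \<i> * \<xi> * of_real (x0 + \<mu>x * T + sqrt \<rho>x * fst (W T w)) - of_real ((1 - \<rho>x) * T) * \<xi>^2 / 2)
      * exp (- \<i> * \<eta> * of_real (y0 + \<mu>y * T + sqrt \<rho>y * snd (W T w)) - of_real ((1 - \<rho>y) * T) * \<eta>^2 / 2)"
    unfolding P Base_def \<xi>_def[symmetric] \<eta>_def[symmetric] exp_add[symmetric]
    by (rule arg_cong[of _ _ exp]) (simp add: algebra_simps add_divide_distrib diff_divide_distrib)
  then show ?thesis unfolding Ext_def normal_symbol_def \<xi>_def[symmetric] \<eta>_def[symmetric] by (simp only: mult_ac)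
qed

lemma measurable_WT [measurable]: "(\<lambda>w. fst (W T w)) \<in> borel_measurable M" "(\<lambda>w. snd (W T w)) \<in> borel_measurable M"
  using measurable_W[OF less_imp_le[OF T0]] unfolding borel_prod[symmetric] by measurable

text \<open>Valid for every path, whether or not it starts at 0, and therefore suited to prove
  \<open>P\<close> measurable.\<close>

lemma P_eq: "P \<omega> = 1 / (4 * pi^2) * Re (\<integral>p. normal_symbol (x0 + \<mu>x * T + sqrt \<rho>x * fst (W T \<omega>)) ((1 - \<rho>x) * T) (Complex (fst p) \<alpha>)
    * normal_symbol (y0 + \<mu>y * T + sqrt \<rho>y * snd (W T \<omega>)) ((1 - \<rho>y) * T) (Complex (snd p) \<alpha>) \<partial>plane)"
  using has_bochner_integral_integral_eq[OF exact_functional_fourier[OF T0 rx(2) ry(2) \<alpha>(1), where w = "path_of \<omega>" and ?x0.0 = x0 and \<mu>x = \<mu>x and ?y0.0 = y0 and \<mu>y = \<mu>y]]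
  unfolding P_def by (simp add: case_prod_unfold)

lemma measurable_P [measurable]: "P \<in> borel_measurable M"
proof -
  have [measurable]: "(exp :: complex \<Rightarrow> complex) \<in> borel_measurable borel" by (intro borel_measurable_continuous_onI continuous_intros)
  show ?thesis unfolding P_eq[abs_def] normal_symbol_def unfolding lborel_prod
    by (intro borel_measurable_times borel_measurable_const borel_measurable_Re lborel.borel_measurable_lebesgue_integral)
      (unfold lborel_prod[symmetric], measurable)
qed

lemma integrable_Ext: "AE \<omega> in M. integrable plane (\<lambda>p. Ext (fst p) (snd p) \<omega>)
    \<and> P \<omega> = 1 / (4 * pi^2) * Re (\<integral>p. Ext (fst p) (snd p) \<omega> \<partial>plane)"
  using start
proof eventually_elim
  fix \<omega> assume W0: "W 0 \<omega> = (0, 0)"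
  show "integrable plane (\<lambda>p. Ext (fst p) (snd p) \<omega>)
    \<and> P \<omega> = 1 / (4 * pi^2) * Re (\<integral>p. Ext (fst p) (snd p) \<omega> \<partial>plane)"
    using exact_functional_fourier[OF T0 rx(2) ry(2) \<alpha>(1), where w = "path_of \<omega>" and ?x0.0 = x0 and \<mu>x = \<mu>x and ?y0.0 = y0 and \<mu>y = \<mu>y]
    unfolding Ext_eq_normal_symbol[OF W0] P_eq[of \<omega>] has_bochner_integral_iff case_prod_unfold by simp
qed

lemma L2le_P: "L2le M P (1 / \<alpha>^2 * E0 * (81 * exp (C2 * T / 2)) * GI 4 (c2 * T / 2))"
  by (rule L2le_cong_AE[OF L2le_scaled_Re[OF L2le_Ext_integral[OF T0]] measurable_P])
    (use integrable_Ext in \<open>eventually_elim, simp\<close>)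

lemma L2le_diagonal_error: "L2le M (\<lambda>w. F w L L - P w) (k * C4 \<Lambda> * (81 * exp (C2 * T / 2)) * GI 4 (c2 * T / 2))"
proof (rule L2le_cong_AE[OF L2le_scaled_Re[OF L2le_diagonal_integral[OF T0 meshes[OF order_refl] \<Lambda>]]])
  show "(\<lambda>w. F w L L - P w) \<in> borel_measurable M"
    unfolding F_eq(2)[OF order_refl order_refl] gI_def unfolding lborel_prod
    by (intro borel_measurable_diff borel_measurable_times borel_measurable_const borel_measurable_Re lborel.borel_measurable_lebesgue_integral measurable_P)
      (unfold lborel_prod[symmetric], measurable)
  show "AE w in M. 1 / (4 * pi^2) * Re (\<integral>p. cutoff (fst p) (h0 / 2 ^ L) * (cutoff (snd p) (h0 / 2 ^ L) * \<Phi> (of_real (h0 / 2 ^ L)) (of_real (h0 / 2 ^ L)) (fst p) (snd p) w)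
      - Ext (fst p) (snd p) w \<partial>plane) = F w L L - P w"
    using integrable_Ext
  proof eventually_elim
    case (elim w)
    have "(\<integral>p. gI L L w p - Ext (fst p) (snd p) w \<partial>plane)
      = (\<integral>p. gI L L w p \<partial>plane) - (\<integral>p. Ext (fst p) (snd p) w \<partial>plane)"
      by (rule Bochner_Integration.integral_diff[OF F_eq(1)[OF order_refl order_refl] conjunct1[OF elim]])
    then show ?case using elim unfolding F_eq(2)[OF order_refl order_refl] gI_def by (simp add: diff_divide_distrib)
  qed
qed

text \<open>Each of the at most \<open>(l + 2)^2\<close> omitted mixed differences is of order
  \<open>1 / 4 ^ (a + b)\<close>, hence at most of order \<open>1 / 4 ^ l\<close>. In the
  application \<open>k\<close> is of the same order, so the time error and the sparse error are in
  balance up to the number of terms.\<close>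

lemma L2le_sparse_error:
  assumes L: "L = l + 1"
  shows "L2le M (\<lambda>w. sparse_functional T \<mu>x \<mu>y \<rho>x \<rho>y x0 y0 h0 (path_of w) N l - P w)
    (k * C4 \<Lambda> * (81 * exp (C2 * T / 2)) * GI 4 (c2 * T / 2)
     + (real l + 2)^2 * (1024 / \<delta> ^ 4 * G^2 * E0 * exp (T / 2) * h0 ^ 4 * GI 2 (c * T / 2)) / 4 ^ l)"
proof -
  define Cm where "Cm = 1024 / \<delta> ^ 4 * G^2 * E0 * exp (T / 2) * h0 ^ 4 * GI 2 (c * T / 2)"
  have Cm0: "0 \<le> Cm" using \<delta> E0_pos GI_nonneg h0 by (simp add: Cm_def)
  let ?S = "{..l + 1} \<times> {..l + 1} - sparse_indices l"
  have fin: "finite ?S" by simp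
  have "L2le M (\<lambda>w. \<Sum>p\<in>?S. delta1 (delta2 (F w)) (fst p) (snd p)) (\<Sum>p\<in>?S. Cm / 4 ^ l)"
  proof (rule L2le_sum[OF fin])
    fix p assume p: "p \<in> ?S"
    obtain a b where ab: "p = (a, b)" by (cases p)
    \<comment> \<open>Outside the sparse index set \<open>a + b\<close> is at least
      \<open>l + 2\<close> while both are at most \<open>l + 1\<close>; so both are positive and the
      differences are genuine ones.\<close>
    have h: "0 < a" "a \<le> L" "0 < b" "b \<le> L" "l + 2 \<le> a + b" using p by (auto simp: ab L sparse_indices_def)
    have "1024 / \<delta> ^ 4 * G^2 * E0 * exp (T / 2) * ((h0 / 2 ^ a)^2 * (h0 / 2 ^ b)^2) * GI 2 (c * T / 2) = Cm / 4 ^ (a + b)"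
    proof -
      have "(h0 / 2 ^ a)^2 * (h0 / 2 ^ b)^2 = h0 ^ 4 / 4 ^ (a + b)"
      proof -
        have four: "((2 :: real) ^ m)^2 = 4 ^ m" for m by (simp add: power2_eq_square power_mult_distrib[symmetric])
        show ?thesis unfolding power_divide four power_add by (simp add: power4_eq_xxxx power2_eq_square)
      qed
      then show ?thesis by (simp add: Cm_def)
    qed
    also have "... \<le> Cm / 4 ^ l" using Cm0 h by (intro divide_left_mono power_increasing) auto
    finally show "L2le M (\<lambda>w. delta1 (delta2 (F w)) (fst p) (snd p)) (Cm / 4 ^ l)"
      using L2le_mono[OF L2le_delta[OF h(1-4)]] by (simp add: ab)
  qed
  then have S: "L2le M (\<lambda>w. \<Sum>p\<in>?S. delta1 (delta2 (F w)) (fst p) (snd p)) ((real l + 2)^2 * Cm / 4 ^ l)"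
  proof (rule L2le_mono)
    have "card ?S \<le> card ({..l + 1} \<times> {..l + 1})" by (intro card_mono) auto
    also have "... = (l + 2) * (l + 2)" by simp
    finally have "real (card ?S) \<le> real ((l + 2) * (l + 2))" by (rule of_nat_mono)
    then have "real (card ?S) \<le> (real l + 2)^2" by (simp add: power2_eq_square algebra_simps)
    then have "real (card ?S) * (Cm / 4 ^ l) \<le> (real l + 2)^2 * (Cm / 4 ^ l)" using Cm0 by (intro mult_right_mono) auto
    then show "(\<Sum>p\<in>?S. Cm / 4 ^ l) \<le> (real l + 2)^2 * Cm / 4 ^ l" by simp
  qed
  have eq: "sparse_functional T \<mu>x \<mu>y \<rho>x \<rho>y x0 y0 h0 (path_of w) N l - P w
     = (F w L L - P w) - (\<Sum>p\<in>?S. delta1 (delta2 (F w)) (fst p) (snd p))" for w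
    using sparse_telescope[of "F w" l] by (simp add: sparse_functional_def F_def L case_prod_unfold)
  show ?thesis unfolding eq using L2le_diff[OF L2le_diagonal_error S] by (simp add: Cm_def)
qed

end

theorem mainTheorem3:
  fixes T \<mu>x \<mu>y \<rho>x \<rho>y \<rho>xy h0 k0 x0 y0 \<kappa> :: real
    and M :: "'a measure" and W :: "real \<Rightarrow> 'a \<Rightarrow> real \<times> real"
  assumes "T > 0"
    and "0 \<le> \<rho>x" "\<rho>x < 1" and "0 \<le> \<rho>y" "\<rho>y < 1" and "-1 \<le> \<rho>xy" "\<rho>xy \<le> 1"
    and "2 * \<rho>x\<^sup>2 * (1 + 2 * \<bar>\<rho>xy\<bar>) \<le> 1"
    and "2 * \<rho>y\<^sup>2 * (1 + 2 * \<bar>\<rho>xy\<bar>) \<le> 1"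
    and "2 * \<rho>x * \<rho>y * (3 * \<rho>xy\<^sup>2 + 2 * \<bar>\<rho>xy\<bar> + 1) \<le> 1"
    and "h0 > 0" and "k0 > 0"
    and "\<exists>n::nat. n > 0 \<and> T / k0 = real n"
    and "x0 / h0 \<in> \<int>" and "y0 / h0 \<in> \<int>"
    and "correlated_brownian_motion M \<rho>xy W"
    and "\<kappa> > 0"
  shows "\<exists>C \<epsilon>0. \<epsilon>0 > 0 \<and> (\<forall>\<epsilon>. 0 < \<epsilon> \<and> \<epsilon> < \<epsilon>0 \<longrightarrow>
    (\<exists>L Ms. (\<forall>l\<le>L. Ms l > 0) \<and>
       (\<forall>(\<Omega> :: 'b measure) X.
          prob_space \<Omega> \<and>
          prob_space.indep_vars \<Omega> (\<lambda>_. borel) (\<lambda>(l, m). X l m) (sample_indices L Ms) \<and>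
          (\<forall>(l, m) \<in> sample_indices L Ms.
             distr \<Omega> borel (X l m) =
             distr M borel (\<lambda>\<omega>. level_difference T \<mu>x \<mu>y \<rho>x \<rho>y x0 y0 h0 k0 l (\<lambda>t. W t \<omega>)))
          \<longrightarrow>
          (let EP = (\<integral>\<omega>. exact_functional T \<mu>x \<mu>y \<rho>x \<rho>y x0 y0 (\<lambda>t. W t \<omega>) \<partial>M);
               err = (\<lambda>\<omega>. \<bar>mlmc_estimator L Ms X \<omega> - EP\<bar>\<^sup>2)
           in integrable \<Omega> err \<and> sqrt (\<integral>\<omega>. err \<omega> \<partial>\<Omega>) \<le> \<epsilon>)) \<and>
       total_cost \<kappa> T k0 L Ms \<le> C * \<epsilon> powr (-2)))"
proof -
  note T0 = assms(1) and rx = assms(2,3) and ry = assms(4,5) and h0 = \<open>h0 > 0\<close> and k0 = \<open>k0 > 0\<close>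
  interpret bm: correlated_brownian_motion M \<rho>xy W by fact
  obtain n0 where n0: "n0 > 0" "T / k0 = real n0" using assms(13) by blast
  have Tn: "T = real n0 * k0" using n0 k0 by (simp add: field_simps)
  obtain i j where ij: "x0 / h0 = of_int i" "y0 / h0 = of_int j" using \<open>x0 / h0 \<in> \<int>\<close> \<open>y0 / h0 \<in> \<int>\<close> by (auto elim!: Ints_cases)
  then have xy: "x0 = of_int i * h0" "y0 = of_int j * h0" using h0 by (simp_all add: field_simps)
  have \<rho>: "\<bar>\<rho>xy\<bar> \<le> 1" using assms(6,7) by simp
  \<comment> \<open>The finest mesh size on level \<open>l\<close> is
    \<open>h0 / 2 ^ (l + 1)\<close>; there \<open>sqrt k\<close> times \<open>2 * (pi / h)\<close>
    equals \<open>sqrt k0 * (4 * (pi / h0))\<close>, independently of \<open>l\<close>.\<close>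
  define K where "K = sqrt k0 * (1 + 4 * (pi / h0))"
  have K0: "0 \<le> K" using k0 h0 by (simp add: K_def)
  obtain \<epsilon> c where e: "0 < \<epsilon>" "\<epsilon> \<le> 1" and c: "0 < c"
    and st: "\<And>(M :: 'a measure) U V k x y S1 P1 S2 P2 s1 g1 s2 g2.
       gauss_pair M \<rho>xy U V \<Longrightarrow> 0 \<le> k \<Longrightarrow> sqrt k * (1 + \<bar>x\<bar> + \<bar>y\<bar>) \<le> K \<Longrightarrow>
       near \<epsilon> x S1 P1 s1 g1 \<Longrightarrow> near \<epsilon> y S2 P2 s2 g2 \<Longrightarrow>
       1 / 2 \<le> Re (step_den k \<mu>x \<mu>y S1 P1 S2 P2) \<and>
       integrable M (\<lambda>\<omega>. (cmod (step_factor k \<mu>x \<mu>y \<rho>x \<rho>y S1 P1 S2 P2 (U \<omega>) (V \<omega>)))\<^sup>2) \<and>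
       (\<integral>\<omega>. (cmod (step_factor k \<mu>x \<mu>y \<rho>x \<rho>y S1 P1 S2 P2 (U \<omega>) (V \<omega>)))\<^sup>2 \<partial>M)
         \<le> exp (- c * (k * (x\<^sup>2 + y\<^sup>2)) + k)"
    by (rule step_stability[OF rx ry assms(8,9,10) K0, where 'a = 'a]) (rule that)
  \<comment> \<open>With this \<alpha> and the \<delta> below, \<open>3 * \<alpha>\<close> and
    \<open>2 * \<delta>^2\<close> are each at most \<open>\<epsilon> / 2\<close>; the factor
    \<open>exp (- h0)\<close> offsets \<open>exp (\<alpha> * h0)\<close>, since \<alpha> is at most
    1.\<close>
  define \<alpha> where "\<alpha> = \<epsilon> / 6 * exp (- h0)"
  define \<delta> where "\<delta> = sqrt (\<epsilon> / 4)"
  have eh: "exp (- h0) \<le> 1" using h0 by simp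
  have \<alpha>6: "\<alpha> \<le> \<epsilon> / 6" using e eh unfolding \<alpha>_def by (intro mult_left_le) auto
  have "0 < \<alpha>" using e by (simp add: \<alpha>_def)
  moreover have "\<alpha> \<le> 1" using e \<alpha>6 by linarith
  ultimately have \<alpha>: "0 < \<alpha>" "\<alpha> \<le> 1" by auto
  have \<delta>: "0 < \<delta>" "\<delta> \<le> 1" "2 * \<delta>\<^sup>2 = \<epsilon> / 2" using e by (auto simp: \<delta>_def)
  have small: "3 * \<alpha> + 2 * \<delta>\<^sup>2 \<le> \<epsilon>" using \<alpha>6 \<delta>(3) by linarith
  have small2: "\<alpha> * exp (\<alpha> * h0) \<le> \<epsilon>"
  proof -
    have "\<alpha> * exp (\<alpha> * h0) \<le> \<alpha> * exp h0" using \<alpha> h0 by (intro mult_left_mono) auto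
    also have "\<dots> = \<epsilon> / 6" by (simp add: \<alpha>_def exp_minus)
    finally show ?thesis using e by linarith
  qed
  \<comment> \<open>On each level the squared finest mesh size is \<open>h0^2 / (4 * k0)\<close>
    times the time step.\<close>
  define \<Lambda> where "\<Lambda> = max 1 (h0\<^sup>2 / (4 * k0))"
  have fl: "sparse_level M \<rho>xy W T \<mu>x \<mu>y \<rho>x \<rho>y x0 y0 h0 (k0 / 4 ^ l) \<alpha> \<delta> \<epsilon> c K (n0 * 4 ^ l) (l + 1) i j \<Lambda>" for l
  proof -
    have k: "0 < k0 / 4 ^ l" using k0 by simp
    have FL: "fourier_level M \<rho>xy T \<mu>x \<mu>y \<rho>x \<rho>y h0 (k0 / 4 ^ l) \<alpha> \<delta> \<epsilon> c K (n0 * 4 ^ l)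
      (\<lambda>n \<omega>. increment_x (k0 / 4 ^ l) (\<lambda>t. W t \<omega>) n) (\<lambda>n \<omega>. increment_y (k0 / 4 ^ l) (\<lambda>t. W t \<omega>) n)"
    proof (intro fourier_level.intro fourier_level_axioms.intro)
      show "prob_space M" by (rule bm.prob_space_axioms)
      show "gauss_pair M \<rho>xy (\<lambda>\<omega>. increment_x (k0 / 4 ^ l) (\<lambda>t. W t \<omega>) n) (\<lambda>\<omega>. increment_y (k0 / 4 ^ l) (\<lambda>t. W t \<omega>) n)" for n
        by (rule bm.gauss_pair_increments[OF k \<rho>])
      show "bm.indep_vars (\<lambda>_. borel) (\<lambda>n \<omega>. (increment_x (k0 / 4 ^ l) (\<lambda>t. W t \<omega>) n, increment_y (k0 / 4 ^ l) (\<lambda>t. W t \<omega>) n)) {..<n0 * 4 ^ l}"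
        by (rule bm.indep_increments[OF k])
      show "T = real (n0 * 4 ^ l) * (k0 / 4 ^ l)" by (simp add: Tn)
    qed ((rule k \<alpha> \<delta>(1,2) small small2 c rx ry | (rule st[OF bm.gauss_pair_increments[OF k \<rho>] less_imp_le[OF k]]; assumption))+)
    interpret f: fourier_level M \<rho>xy T \<mu>x \<mu>y \<rho>x \<rho>y x0 y0 h0 "k0 / 4 ^ l" \<alpha> \<delta> \<epsilon> c K "n0 * 4 ^ l"
      "\<lambda>n \<omega>. increment_x (k0 / 4 ^ l) (\<lambda>t. W t \<omega>) n" "\<lambda>n \<omega>. increment_y (k0 / 4 ^ l) (\<lambda>t. W t \<omega>) n" by (rule FL)
    have sk: "sqrt (k0 / 4 ^ l) = sqrt k0 / 2 ^ l"
    proof -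
      have "sqrt (4 ^ l) = 2 ^ l" by (rule real_sqrt_unique) (simp_all add: power2_eq_square power_mult_distrib[symmetric])
      then show ?thesis by (simp add: real_sqrt_divide)
    qed
    show ?thesis
    proof (intro sparse_level.intro sparse_level_axioms.intro)
      show "correlated_brownian_motion M \<rho>xy W" by fact
      show "fourier_level M \<rho>xy T \<mu>x \<mu>y \<rho>x \<rho>y h0 (k0 / 4 ^ l) \<alpha> \<delta> \<epsilon> c K (n0 * 4 ^ l)
        (\<lambda>n \<omega>. increment_x (k0 / 4 ^ l) (\<lambda>t. W t \<omega>) n) (\<lambda>n \<omega>. increment_y (k0 / 4 ^ l) (\<lambda>t. W t \<omega>) n)" by (rule FL)
      show "f.mesh (h0 / 2 ^ m)" if m: "m \<le> l + 1" for m
      proof -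
        have "h0 / 2 ^ m \<le> h0 / 1" using h0 by (intro divide_left_mono) auto
        moreover have "sqrt (k0 / 4 ^ l) * (1 + 2 * (pi / (h0 / 2 ^ m))) \<le> K"
        proof -
          have "(2 :: real) ^ m \<le> 2 ^ (l + 1)" using m by (intro power_increasing) auto
          then have p: "(2 :: real) ^ m / 2 ^ l \<le> 2" by (simp add: field_simps)
          have "sqrt (k0 / 4 ^ l) * (1 + 2 * (pi / (h0 / 2 ^ m))) = sqrt k0 * (1 / 2 ^ l + 2 * (pi / h0) * (2 ^ m / 2 ^ l))"
            unfolding sk using h0 by (simp add: field_simps)
          also have "\<dots> \<le> sqrt k0 * (1 + 2 * (pi / h0) * 2)"
            using p h0 k0 by (intro mult_left_mono add_mono) (auto simp: field_simps)
          finally show ?thesis by (simp add: K_def)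
        qed
        ultimately show ?thesis using h0 by (simp add: f.mesh_def)
      qed
      show "1 \<le> \<Lambda>" by (simp add: \<Lambda>_def)
      have "(h0 / 2 ^ (l + 1))\<^sup>2 = h0\<^sup>2 / (4 * k0) * (k0 / 4 ^ l)"
      proof -
        have four: "((2 :: real) ^ (l + 1))\<^sup>2 = 4 * 4 ^ l" by (simp add: power2_eq_square power_mult_distrib[symmetric])
        show ?thesis unfolding power_divide four using k0 by simp
      qed
      also have "\<dots> \<le> \<Lambda> * (k0 / 4 ^ l)" using k by (intro mult_right_mono) (auto simp: \<Lambda>_def)
      finally show "(h0 / 2 ^ (l + 1))\<^sup>2 \<le> \<Lambda> * (k0 / 4 ^ l)" .
    qed (rule T0 h0 xy)+
  qed
  \<comment> \<open>Level 0 serves to name the constants; they do not involve the time step and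
    hence agree on all levels.\<close>
  interpret s0: sparse_level M \<rho>xy W T \<mu>x \<mu>y \<rho>x \<rho>y x0 y0 h0 "k0 / 4 ^ 0" \<alpha> \<delta> \<epsilon> c K "n0 * 4 ^ 0" "0 + 1" i j \<Lambda> by (rule fl)
  define P where "P = (\<lambda>\<omega>. exact_functional T \<mu>x \<mu>y \<rho>x \<rho>y x0 y0 (\<lambda>t. W t \<omega>))"
  define Y where "Y = (\<lambda>l \<omega>. level_functional T \<mu>x \<mu>y \<rho>x \<rho>y x0 y0 h0 k0 l (\<lambda>t. W t \<omega>))"
  have Peq: "s0.P = P" by (simp add: P_def s0.P_def fun_eq_iff)
  have mP: "P \<in> borel_measurable M" using s0.measurable_P unfolding Peq .
  have P2: "integrable M (\<lambda>\<omega>. (P \<omega>)\<^sup>2)" using L2le_integrable_square(1)[OF s0.L2le_P] unfolding Peq .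
  define A where "A = s0.C4 \<Lambda> * (81 * exp (s0.C2 * T / 2)) * GI 4 (s0.c2 * T / 2)"
  define B where "B = 1024 / \<delta> ^ 4 * (s0.G)\<^sup>2 * s0.E0 * exp (T / 2) * h0 ^ 4 * GI 2 (c * T / 2)"
  define Q where "Q = k0 * A + B"
  have A0: "0 \<le> A" using s0.C4_pos[OF s0.\<Lambda>(1)] GI_nonneg by (simp add: A_def)
  have err: "L2le M (\<lambda>\<omega>. Y l \<omega> - P \<omega>) ((real l + 2)\<^sup>2 * Q / 4 ^ l)" for l
  proof -
    interpret s: sparse_level M \<rho>xy W T \<mu>x \<mu>y \<rho>x \<rho>y x0 y0 h0 "k0 / 4 ^ l" \<alpha> \<delta> \<epsilon> c K "n0 * 4 ^ l" "l + 1" i j \<Lambda> by (rule fl)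
    have "L2le M (\<lambda>\<omega>. Y l \<omega> - P \<omega>) (k0 / 4 ^ l * s0.C4 \<Lambda> * (81 * exp (s0.C2 * T / 2)) * GI 4 (s0.c2 * T / 2) + (real l + 2)\<^sup>2 * B / 4 ^ l)"
      using s.L2le_sparse_error[OF refl] unfolding s.P_def P_def Y_def B_def level_functional_def num_steps_eq[OF n0(2)] .
    then show ?thesis
    proof (rule L2le_mono)
      have "1 * (k0 / 4 ^ l * A) \<le> (real l + 2)\<^sup>2 * (k0 / 4 ^ l * A)" using A0 k0 by (intro mult_right_mono) (auto simp: one_le_power)
      then show "k0 / 4 ^ l * s0.C4 \<Lambda> * (81 * exp (s0.C2 * T / 2)) * GI 4 (s0.c2 * T / 2) + (real l + 2)\<^sup>2 * B / 4 ^ l \<le> (real l + 2)\<^sup>2 * Q / 4 ^ l"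
        by (simp add: Q_def A_def distrib_left add_divide_distrib mult_ac)
    qed
  qed
  have mY: "Y l \<in> borel_measurable M" for l
    using borel_measurable_add[OF L2leD(1)[OF err[of l]] mP] by simp
  have YP: "(\<integral>\<omega>. (Y l \<omega> - P \<omega>)\<^sup>2 \<partial>M) \<le> (64 ^ 4 * Q\<^sup>2) / 14 ^ l" for l
  proof -
    have "(\<integral>\<omega>. (Y l \<omega> - P \<omega>)\<^sup>2 \<partial>M) \<le> ((real l + 2)\<^sup>2 * Q / 4 ^ l)\<^sup>2" by (rule L2le_integrable_square(2)[OF err])
    also have "\<dots> = Q\<^sup>2 * ((real l + 2) ^ 4 / 16 ^ l)"
    proof -
      have "((4 :: real) ^ l)\<^sup>2 = 16 ^ l" by (simp add: power2_eq_square power_mult_distrib[symmetric])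
      then show ?thesis by (simp add: power_divide power_mult_distrib)
    qed
    also have "\<dots> \<le> Q\<^sup>2 * (64 ^ 4 / 14 ^ l)" by (rule mult_left_mono[OF quartic_le_geometric]) simp
    finally show ?thesis by (simp add: mult_ac)
  qed
  have D: "level_difference T \<mu>x \<mu>y \<rho>x \<rho>y x0 y0 h0 k0 l (\<lambda>t. W t \<omega>) = Y l \<omega> - (if l = 0 then 0 else Y (l - 1) \<omega>)" for l \<omega>
    by (simp add: level_difference_def Y_def)
  show ?thesis unfolding D P_def[symmetric] fun_cong[OF P_def, symmetric]
    by (rule bm.mlmc_complexity[OF mY mP P2 L2le_integrable_square(1)[OF err] YP n0(2) \<open>\<kappa> > 0\<close>])
qed

end
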